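(* Consider a locally Lipschitz spray on a $C^{2,1}$ manifold $M$, and let $\varphi\colon W\to TM$, $W\subset [0,+\infty)\times TM$, $\varphi(t,v):=\gamma_v'(t)$, be the geodesic flow map, defined at those $(t,v)\in [0,+\infty)\times TM$ for which $\gamma_v$ extends up to time $t$. Then: (1) $W$ is an open subset of $[0,+\infty)\times TM$ such that $[0,1]\times \Omega\subset W$, and for every $s\in[0,1]$, if $(t,v)\in W$ then $(st,v)\in W$ and $(t,sv)\in W$. Analogously, $\Omega\subset TM$ is open and star-shaped in the sense that for every $s\in[0,1]$, if $v\in\Omega$ then $sv\in \Omega$. (2) $\varphi(\cdot,v)$ is $C^{1,1}$ and $\varphi$ is locally Lipschitz. Moreover, there is a star-shaped subset $\tilde\Omega\subset\Omega$ such that $\Omega\backslash\tilde\Omega$ has zero Lebesgue measure and, for every $v\in\tilde\Omega$ and every $t\in[0,1]$, $\varphi(t,\cdot)$ is differentiable at $v$, and the differential (Jacobian) $\partial_2\varphi(\cdot,v)$ is locally Lipschitz in $t$, locally uniformly with respect to those $v$ belonging to $\tilde\Omega$ (that is, the local Lipschitz constant can be chosen so that it does not vary in a small neighborhood of $v$ as long as the independent variable stays in $\tilde\Omega$). (3) For any $v\in\tilde\Omega$, for almost every $t\in[0,1]$ the following mixed differentials exist, are locally bounded and coincide: $$\partial_1\partial_2\varphi=\partial_2\partial_1\varphi .$$ These conclusions do not change if $\varphi$ is restricted to some Lipschitz $m$-dimensional submanifold $N$ of $TM$ (that is, $v$ is restricted to $N$). In this case the differential $\partial_2$ refers to the variables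 of the Lipschitz chart on $N$, and the almost everywhere existence of $\partial_2\varphi$ must be understood in the $m$-dimensional Lebesgue measure of $N$.
   Context: $C^{k,1}$ means $C^{k,1}_{loc}$ ($k$ times continuously differentiable with locally Lipschitz $k$-th derivatives). $M$ is an $n$-dimensional paracompact connected $C^{2,1}$ manifold, $\pi\colon TM\to M$ its tangent bundle. Each chart $x^\mu$ on $U\subset M$ induces a chart $(x^\mu,v^\mu)$ on $\pi^{-1}(U)$; Lipschitz conditions, zero-measure sets and differentials on $TM$ are understood in such charts. A locally Lipschitz spray on $M$ assigns to each chart locally Lipschitz functions $H^\mu(x,v)$ on $\pi^{-1}(U)$ with $H^\mu(x,sv)=s^2H^\mu(x,v)$ for every $s>0$, transforming under a change of chart $\tilde x(x)$ (with $\tilde v^\mu=\frac{\partial\tilde x^\mu}{\partial x^\nu}v^\nu$) as $\tilde H^\mu(\tilde x,\tilde v)=\frac{\partial^2\tilde x^\mu}{\partial x^\alpha\partial x^\beta}v^\alpha v^\beta+\frac{\partial\tilde x^\mu}{\partial x^\nu}H^\nu(x,v)$, so that the system $\dot x^\mu=v^\mu$, $\dot v^\mu=H^\mu(x,v)$ is chart independent. Non-stationary solutions are called geodesics. For $v\in TM$, $\gamma_v$ denotes the unique solution with $\gamma_v(0)=\pi(v)$, $\gamma_v'(0)=v$ (constant if $v=0$). $\Omega\subset TM$ is the set of those $v$ for which $\gamma_v(t)$ exists at least for $t\in[0,1]$. $\partial_1$ and $\partial_2$ denote differentiation with respect to the first argument $t$ and the second argument $v$. A subset $A\subset TM$ is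 star-shaped if $v\in A$ implies $sv\in A$ for every $s\in[0,1]$.
   Formalization: In (3) the values of φ are read in a fixed countable family of charts, on which Ω̃ may depend; N carries a fixed countable atlas; for N, sv must lie in N, and Ω̃ is star-shaped only for star-shaped N and at those sv where the inclusion of N is differentiable. *)

theory Defs
  imports "HOL-Analysis.Analysis"
begin

section \<open>Local Lipschitz regularity\<close>

definition locally_lipschitz_on :: "'a::metric_space set \<Rightarrow> ('a \<Rightarrow> 'b::metric_space) \<Rightarrow> bool" where
  "locally_lipschitz_on S f \<longleftrightarrow> (\<forall>x\<in>S. \<exists>e>0. \<exists>L. L-lipschitz_on (S \<inter> ball x e) f)"

text \<open>\<open>C11_on\<close> is used for open subsets of a normed space and for relatively open subsets of
  \<open>{0..}\<close> in \<^typ>\<open>real\<close> (curves); \<open>C21_on\<close> is used for open sets only.\<close>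

definition C11_on :: "'a::real_normed_vector set \<Rightarrow> ('a \<Rightarrow> 'b::real_normed_vector) \<Rightarrow> bool" where
  "C11_on S f \<longleftrightarrow> (\<exists>f' :: 'a \<Rightarrow> 'a \<Rightarrow>\<^sub>L 'b.
     (\<forall>x\<in>S. (f has_derivative blinfun_apply (f' x)) (at x within S)) \<and>
     locally_lipschitz_on S f')"

definition C21_on :: "'a::real_normed_vector set \<Rightarrow> ('a \<Rightarrow> 'b::real_normed_vector) \<Rightarrow> bool" where
  "C21_on S f \<longleftrightarrow> (\<exists>f' :: 'a \<Rightarrow> 'a \<Rightarrow>\<^sub>L 'b.
     (\<forall>x\<in>S. (f has_derivative blinfun_apply (f' x)) (at x within S)) \<and>
     C11_on S f')"

text \<open>In coordinates: \<open>(\<partial>\<^sup>2f / \<partial>x\<^sup>\<alpha> \<partial>x\<^sup>\<beta>) u\<^sup>\<alpha> w\<^sup>\<beta>\<close>.\<close>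

definition second_derivative ::
    "('a::real_normed_vector \<Rightarrow> 'b::real_normed_vector) \<Rightarrow> 'a \<Rightarrow> 'a \<Rightarrow> 'a \<Rightarrow> 'b" where
  "second_derivative f x u w =
     frechet_derivative (\<lambda>y. frechet_derivative f (at y) u) (at x) w"

section \<open>Charts and manifolds\<close>

text \<open>A chart is a pair of its domain and its coordinate map; the values of the coordinate map
  outside the domain are irrelevant. The dimension is that of the coordinate type \<open>'a\<close>.\<close>

type_synonym ('p, 'a) chart = "'p set \<times> ('p \<Rightarrow> 'a)"

definition is_chart :: "'p topology \<Rightarrow> ('p, 'a::euclidean_space) chart \<Rightarrow> bool" where
  "is_chart X c \<longleftrightarrow> openin X (fst c) \<and> open (snd c ` fst c) \<and>
     homeomorphic_map (subtopology X (fst c)) (top_of_set (snd c ` fst c)) (snd c)"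

abbreviation chart_inv :: "('p, 'a) chart \<Rightarrow> 'a \<Rightarrow> 'p" where
  "chart_inv c \<equiv> inv_into (fst c) (snd c)"

definition transition :: "('p, 'a) chart \<Rightarrow> ('p, 'b) chart \<Rightarrow> 'a \<Rightarrow> 'b" where
  "transition c d = snd d \<circ> chart_inv c"

definition overlap :: "('p, 'a) chart \<Rightarrow> ('p, 'b) chart \<Rightarrow> 'a set" where
  "overlap c d = snd c ` (fst c \<inter> fst d)"

definition paracompact_space :: "'p topology \<Rightarrow> bool" where
  "paracompact_space X \<longleftrightarrow>
     (\<forall>\<U>. (\<forall>U\<in>\<U>. openin X U) \<and> \<Union>\<U> = topspace X \<longrightarrow>
        (\<exists>\<V>. (\<forall>V\<in>\<V>. openin X V) \<and> \<Union>\<V> = topspace X \<and>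
             (\<forall>V\<in>\<V>. \<exists>U\<in>\<U>. V \<subseteq> U) \<and> locally_finite_in X \<V>))"

text \<open>\<open>A\<close> is an arbitrary \<open>C\<^sup>2\<^sup>,\<^sup>1\<close> atlas of \<open>M\<close>; it may be, but need not be, the maximal one.\<close>

definition C21_manifold :: "'p topology \<Rightarrow> ('p, 'a::euclidean_space) chart set \<Rightarrow> bool" where
  "C21_manifold M A \<longleftrightarrow>
     Hausdorff_space M \<and> paracompact_space M \<and> connected_space M \<and>
     (\<forall>c\<in>A. is_chart M c) \<and> (\<Union>c\<in>A. fst c) = topspace M \<and>
     (\<forall>c\<in>A. \<forall>d\<in>A. C21_on (overlap c d) (transition c d))"

section \<open>The tangent bundle\<close>

text \<open>A tangent vector at \<open>p\<close> is a pair \<open>(p, \<xi>)\<close> where \<open>\<xi>\<close> assigns to each chart \<open>c\<close> around \<open>p\<close> the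
  components \<open>\<xi> c\<close> of the vector in that chart, subject to the transformation law
  \<open>\<xi> d = (\<partial>x\<^sub>d / \<partial>x\<^sub>c) (\<xi> c)\<close>. For all other \<open>c\<close> the value is \<open>0\<close>, so that the
  representation is unique.\<close>

type_synonym ('p, 'a) tvec = "'p \<times> (('p, 'a) chart \<Rightarrow> 'a)"

definition tangent_bundle :: "('p, 'a::euclidean_space) chart set \<Rightarrow> ('p, 'a) tvec set" where
  "tangent_bundle A = {(p, \<xi>). p \<in> (\<Union>c\<in>A. fst c) \<and>
     (\<forall>c. \<not> (c \<in> A \<and> p \<in> fst c) \<longrightarrow> \<xi> c = 0) \<and>
     (\<forall>c\<in>A. \<forall>d\<in>A. p \<in> fst c \<inter> fst d \<longrightarrow>
        \<xi> d = frechet_derivative (transition c d) (at (snd c p)) (\<xi> c))}"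

definition tchart ::
    "('p, 'a::euclidean_space) chart set \<Rightarrow> ('p, 'a) chart \<Rightarrow> (('p, 'a) tvec, 'a \<times> 'a) chart" where
  "tchart A c = ({w \<in> tangent_bundle A. fst w \<in> fst c}, \<lambda>(p, \<xi>). (snd c p, \<xi> c))"

definition tangent_topology ::
    "('p, 'a::euclidean_space) chart set \<Rightarrow> ('p, 'a) tvec topology" where
  "tangent_topology A = topology_generated_by
     {{w \<in> fst (tchart A c). snd (tchart A c) w \<in> Q} | c Q. c \<in> A \<and> open Q}"

definition tscale :: "real \<Rightarrow> ('p, 'a::real_vector) tvec \<Rightarrow> ('p, 'a) tvec" where
  "tscale s w = (fst w, \<lambda>c. s *\<^sub>R snd w c)"

definition star_shaped :: "('p, 'a::real_vector) tvec set \<Rightarrow> bool" where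
  "star_shaped S \<longleftrightarrow> (\<forall>w\<in>S. \<forall>s\<in>{0..1}. tscale s w \<in> S)"

definition chart_null :: "('q, 'b::euclidean_space) chart set \<Rightarrow> 'q set \<Rightarrow> bool" where
  "chart_null B S \<longleftrightarrow> (\<forall>b\<in>B. snd b ` (S \<inter> fst b) \<in> null_sets lebesgue)"

text \<open>A subset \<open>N\<close> of the tangent bundle with an atlas \<open>B\<close> of charts which are, in the charts of the
  tangent bundle, locally bi-Lipschitz; the dimension of \<open>N\<close> is that of the type \<open>'b\<close>.\<close>

definition lipschitz_submanifold :: "('p, 'a::euclidean_space) chart set \<Rightarrow>
    ('p, 'a) tvec set \<Rightarrow> (('p, 'a) tvec, 'b::euclidean_space) chart set \<Rightarrow> bool" where
  "lipschitz_submanifold A N B \<longleftrightarrow> N \<subseteq> tangent_bundle A \<and>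
     (\<forall>b\<in>B. is_chart (subtopology (tangent_topology A) N) b) \<and> (\<Union>b\<in>B. fst b) = N \<and>
     (\<forall>b\<in>B. \<forall>c\<in>A.
        locally_lipschitz_on (overlap b (tchart A c)) (transition b (tchart A c)) \<and>
        locally_lipschitz_on (overlap (tchart A c) b) (transition (tchart A c) b))"

text \<open>Differentiability at \<open>w\<close> of the inclusion of the submanifold into the tangent bundle.
  Since \<open>\<phi>(0, v) = v\<close>, the flow restricted to the submanifold cannot be differentiable at the
  vectors where this fails.\<close>

definition inclusion_differentiable_at :: "('p, 'a::euclidean_space) chart set \<Rightarrow>
    (('p, 'a) tvec, 'b::euclidean_space) chart set \<Rightarrow> ('p, 'a) tvec \<Rightarrow> bool" where
  "inclusion_differentiable_at A B w \<longleftrightarrow>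
     (\<forall>b\<in>B. \<forall>c\<in>A. w \<in> fst b \<and> w \<in> fst (tchart A c) \<longrightarrow>
        transition b (tchart A c) differentiable (at (snd b w)))"

section \<open>Sprays and the geodesic flow\<close>

definition lipschitz_spray :: "('p, 'a::euclidean_space) chart set \<Rightarrow>
    (('p, 'a) chart \<Rightarrow> 'a \<Rightarrow> 'a \<Rightarrow> 'a) \<Rightarrow> bool" where
  "lipschitz_spray A H \<longleftrightarrow>
     (\<forall>c\<in>A. locally_lipschitz_on ((snd c ` fst c) \<times> UNIV) (\<lambda>(x, v). H c x v)) \<and>
     (\<forall>c\<in>A. \<forall>x\<in>snd c ` fst c. \<forall>v. \<forall>s>0. H c x (s *\<^sub>R v) = s\<^sup>2 *\<^sub>R H c x v) \<and>
     (\<forall>c\<in>A. \<forall>d\<in>A. \<forall>x\<in>overlap c d. \<forall>v.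
        H d (transition c d x) (frechet_derivative (transition c d) (at x) v) =
          second_derivative (transition c d) x v v +
          frechet_derivative (transition c d) (at x) (H c x v))"

definition velocity :: "('p, 'a::euclidean_space) chart set \<Rightarrow>
    (real \<Rightarrow> 'p) \<Rightarrow> real \<Rightarrow> ('p, 'a) tvec" where
  "velocity A \<gamma> t = (\<gamma> t, \<lambda>c. if c \<in> A \<and> \<gamma> t \<in> fst c
     then vector_derivative (\<lambda>s. snd c (\<gamma> s)) (at t) else 0)"

text \<open>Solutions, on an open interval \<open>J\<close>, of \<open>x' = v\<close>, \<open>v' = H(x, v)\<close>.\<close>

definition spray_solution :: "'p topology \<Rightarrow> ('p, 'a::euclidean_space) chart set \<Rightarrow>
    (('p, 'a) chart \<Rightarrow> 'a \<Rightarrow> 'a \<Rightarrow> 'a) \<Rightarrow> real set \<Rightarrow> (real \<Rightarrow> 'p) \<Rightarrow> bool" where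
  "spray_solution M A H J \<gamma> \<longleftrightarrow> open J \<and> is_interval J \<and>
     continuous_map (top_of_set J) M \<gamma> \<and>
     (\<forall>t\<in>J. \<forall>c\<in>A. \<gamma> t \<in> fst c \<longrightarrow>
        ((\<lambda>s. snd c (\<gamma> s)) has_vector_derivative snd (velocity A \<gamma> t) c) (at t) \<and>
        ((\<lambda>s. snd (velocity A \<gamma> s) c) has_vector_derivative
           H c (snd c (\<gamma> t)) (snd (velocity A \<gamma> t) c)) (at t))"

definition solution_from :: "'p topology \<Rightarrow> ('p, 'a::euclidean_space) chart set \<Rightarrow>
    (('p, 'a) chart \<Rightarrow> 'a \<Rightarrow> 'a \<Rightarrow> 'a) \<Rightarrow> ('p, 'a) tvec \<Rightarrow> real set \<Rightarrow> (real \<Rightarrow> 'p) \<Rightarrow> bool" where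
  "solution_from M A H v J \<gamma> \<longleftrightarrow> spray_solution M A H J \<gamma> \<and> 0 \<in> J \<and> velocity A \<gamma> 0 = v"

text \<open>The maximal solution with initial velocity \<open>v\<close>, on its maximal domain.\<close>

definition geodesic_dom :: "'p topology \<Rightarrow> ('p, 'a::euclidean_space) chart set \<Rightarrow>
    (('p, 'a) chart \<Rightarrow> 'a \<Rightarrow> 'a \<Rightarrow> 'a) \<Rightarrow> ('p, 'a) tvec \<Rightarrow> real set" where
  "geodesic_dom M A H v = \<Union>{J. \<exists>\<gamma>. solution_from M A H v J \<gamma>}"

definition geodesic :: "'p topology \<Rightarrow> ('p, 'a::euclidean_space) chart set \<Rightarrow>
    (('p, 'a) chart \<Rightarrow> 'a \<Rightarrow> 'a \<Rightarrow> 'a) \<Rightarrow> ('p, 'a) tvec \<Rightarrow> real \<Rightarrow> 'p" where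
  "geodesic M A H v t = (THE p. \<exists>J \<gamma>. solution_from M A H v J \<gamma> \<and> t \<in> J \<and> \<gamma> t = p)"

definition flow :: "'p topology \<Rightarrow> ('p, 'a::euclidean_space) chart set \<Rightarrow>
    (('p, 'a) chart \<Rightarrow> 'a \<Rightarrow> 'a \<Rightarrow> 'a) \<Rightarrow> real \<Rightarrow> ('p, 'a) tvec \<Rightarrow> ('p, 'a) tvec" where
  "flow M A H t v = velocity A (geodesic M A H v) t"

definition flow_dom :: "'p topology \<Rightarrow> ('p, 'a::euclidean_space) chart set \<Rightarrow>
    (('p, 'a) chart \<Rightarrow> 'a \<Rightarrow> 'a \<Rightarrow> 'a) \<Rightarrow> (real \<times> ('p, 'a) tvec) set" where
  "flow_dom M A H = {(t, v). 0 \<le> t \<and> v \<in> tangent_bundle A \<and> t \<in> geodesic_dom M A H v}"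

definition exp_dom :: "'p topology \<Rightarrow> ('p, 'a::euclidean_space) chart set \<Rightarrow>
    (('p, 'a) chart \<Rightarrow> 'a \<Rightarrow> 'a \<Rightarrow> 'a) \<Rightarrow> ('p, 'a) tvec set" where
  "exp_dom M A H = {v \<in> tangent_bundle A. {0..1} \<subseteq> geodesic_dom M A H v}"

section \<open>Regularity of the flow in charts\<close>

text \<open>In what follows \<open>b\<close> is a chart for the initial vector, either one of the charts
  \<open>tchart A c\<close> of the tangent bundle or a chart of a submanifold, while the value of the
  flow is always expressed in a chart \<open>tchart A c\<close>.\<close>

definition flow_rep :: "'p topology \<Rightarrow> ('p, 'a::euclidean_space) chart set \<Rightarrow>
    (('p, 'a) chart \<Rightarrow> 'a \<Rightarrow> 'a \<Rightarrow> 'a) \<Rightarrow> (('p, 'a) tvec, 'b::euclidean_space) chart \<Rightarrow>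
    ('p, 'a) chart \<Rightarrow> real \<Rightarrow> 'b \<Rightarrow> 'a \<times> 'a" where
  "flow_rep M A H b c t y = snd (tchart A c) (flow M A H t (chart_inv b y))"

definition flow_rep_dom :: "'p topology \<Rightarrow> ('p, 'a::euclidean_space) chart set \<Rightarrow>
    (('p, 'a) chart \<Rightarrow> 'a \<Rightarrow> 'a \<Rightarrow> 'a) \<Rightarrow> (('p, 'a) tvec, 'b::euclidean_space) chart \<Rightarrow>
    ('p, 'a) chart \<Rightarrow> (real \<times> 'b) set" where
  "flow_rep_dom M A H b c = {(t, y). y \<in> snd b ` fst b \<and>
     (t, chart_inv b y) \<in> flow_dom M A H \<and> flow M A H t (chart_inv b y) \<in> fst (tchart A c)}"

definition flow_curves_C11 :: "'p topology \<Rightarrow> ('p, 'a::euclidean_space) chart set \<Rightarrow>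
    (('p, 'a) chart \<Rightarrow> 'a \<Rightarrow> 'a \<Rightarrow> 'a) \<Rightarrow> ('p, 'a) tvec set \<Rightarrow> bool" where
  "flow_curves_C11 M A H N \<longleftrightarrow> (\<forall>v\<in>N.
     continuous_map (top_of_set {t. (t, v) \<in> flow_dom M A H}) (tangent_topology A)
       (\<lambda>t. flow M A H t v) \<and>
     (\<forall>c\<in>A. C11_on {t. (t, v) \<in> flow_dom M A H \<and> flow M A H t v \<in> fst (tchart A c)}
       (\<lambda>t. snd (tchart A c) (flow M A H t v))))"

definition flow_locally_lipschitz :: "'p topology \<Rightarrow> ('p, 'a::euclidean_space) chart set \<Rightarrow>
    (('p, 'a) chart \<Rightarrow> 'a \<Rightarrow> 'a \<Rightarrow> 'a) \<Rightarrow> ('p, 'a) tvec set \<Rightarrow>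
    (('p, 'a) tvec, 'b::euclidean_space) chart set \<Rightarrow> bool" where
  "flow_locally_lipschitz M A H N B \<longleftrightarrow>
     continuous_map
       (subtopology (prod_topology (top_of_set {0..}) (tangent_topology A))
          (flow_dom M A H \<inter> UNIV \<times> N))
       (tangent_topology A) (\<lambda>(t, v). flow M A H t v) \<and>
     (\<forall>b\<in>B. \<forall>c\<in>A.
        locally_lipschitz_on (flow_rep_dom M A H b c) (\<lambda>(t, y). flow_rep M A H b c t y))"

definition partial1 :: "(real \<Rightarrow> 'b \<Rightarrow> 'c::real_normed_vector) \<Rightarrow> real \<Rightarrow> 'b \<Rightarrow> 'c" where
  "partial1 f t y = vector_derivative (\<lambda>s. f s y) (at t)"

definition partial2 :: "(real \<Rightarrow> 'b::real_normed_vector \<Rightarrow> 'c::real_normed_vector) \<Rightarrow>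
    real \<Rightarrow> 'b \<Rightarrow> 'b \<Rightarrow>\<^sub>L 'c" where
  "partial2 f t y = Blinfun (frechet_derivative (f t) (at y))"

text \<open>Existence at \<open>(t, y)\<close> of \<open>\<partial>\<^sub>1\<partial>\<^sub>2f\<close> and of \<open>\<partial>\<^sub>2\<partial>\<^sub>1f\<close>; their values are then
  \<open>partial1 (partial2 f) t y\<close> and \<open>partial2 (partial1 f) t y\<close>.\<close>

definition has_partial12 :: "(real \<Rightarrow> 'b::real_normed_vector \<Rightarrow> 'c::real_normed_vector) \<Rightarrow>
    real \<Rightarrow> 'b \<Rightarrow> bool" where
  "has_partial12 f t y \<longleftrightarrow> (\<forall>\<^sub>F s in nhds t. f s differentiable (at y)) \<and>
     (\<lambda>s. partial2 f s y) differentiable (at t)"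

definition has_partial21 :: "(real \<Rightarrow> 'b::real_normed_vector \<Rightarrow> 'c::real_normed_vector) \<Rightarrow>
    real \<Rightarrow> 'b \<Rightarrow> bool" where
  "has_partial21 f t y \<longleftrightarrow> (\<forall>\<^sub>F z in nhds y. (\<lambda>s. f s z) differentiable (at t)) \<and>
     partial1 f t differentiable (at y)"

text \<open>From here on \<open>R\<close> is the set of those initial vectors at which the flow is asserted to be
  differentiable.\<close>

definition flow_differentiable_on :: "'p topology \<Rightarrow> ('p, 'a::euclidean_space) chart set \<Rightarrow>
    (('p, 'a) chart \<Rightarrow> 'a \<Rightarrow> 'a \<Rightarrow> 'a) \<Rightarrow> (('p, 'a) tvec, 'b::euclidean_space) chart set \<Rightarrow>
    ('p, 'a) tvec set \<Rightarrow> bool" where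
  "flow_differentiable_on M A H B R \<longleftrightarrow>
     (\<forall>v\<in>R. \<forall>t\<in>{0..1}. \<forall>b\<in>B. \<forall>c\<in>A. v \<in> fst b \<and> flow M A H t v \<in> fst (tchart A c) \<longrightarrow>
        flow_rep M A H b c t differentiable (at (snd b v)))"

definition jacobian_locally_lipschitz :: "'p topology \<Rightarrow> ('p, 'a::euclidean_space) chart set \<Rightarrow>
    (('p, 'a) chart \<Rightarrow> 'a \<Rightarrow> 'a \<Rightarrow> 'a) \<Rightarrow> (('p, 'a) tvec, 'b::euclidean_space) chart set \<Rightarrow>
    ('p, 'a) tvec set \<Rightarrow> bool" where
  "jacobian_locally_lipschitz M A H B R \<longleftrightarrow>
     (\<forall>v\<in>R. \<forall>t\<in>{0..1}. \<forall>b\<in>B. \<forall>c\<in>A. v \<in> fst b \<and> flow M A H t v \<in> fst (tchart A c) \<longrightarrow>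
        (\<exists>V e L. openin (tangent_topology A) V \<and> v \<in> V \<and> 0 < e \<and>
           (\<forall>w \<in> V \<inter> R \<inter> fst b.
              L-lipschitz_on ({0..1} \<inter> ball t e)
                (\<lambda>s. partial2 (flow_rep M A H b c) s (snd b w)))))"

text \<open>The set \<open>C\<close> of target charts is a parameter: \<open>\<partial>\<^sub>1\<phi>\<close> takes its values in the second
  tangent bundle, whose transition maps are merely Lipschitz, so the existence of
  \<open>\<partial>\<^sub>2\<partial>\<^sub>1\<phi>\<close> depends on the chart in which the value of the flow is expressed.\<close>

definition mixed_partials_coincide :: "'p topology \<Rightarrow> ('p, 'a::euclidean_space) chart set \<Rightarrow>
    (('p, 'a) chart \<Rightarrow> 'a \<Rightarrow> 'a \<Rightarrow> 'a) \<Rightarrow> ('p, 'a) chart set \<Rightarrow>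
    (('p, 'a) tvec, 'b::euclidean_space) chart set \<Rightarrow> ('p, 'a) tvec set \<Rightarrow> bool" where
  "mixed_partials_coincide M A H C B R \<longleftrightarrow>
     (\<forall>v\<in>R. AE t in lebesgue_on {0..1}.
        \<forall>b\<in>B. \<forall>c\<in>C. v \<in> fst b \<and> flow M A H t v \<in> fst (tchart A c) \<longrightarrow>
          has_partial12 (flow_rep M A H b c) t (snd b v) \<and>
          has_partial21 (flow_rep M A H b c) t (snd b v) \<and>
          partial1 (partial2 (flow_rep M A H b c)) t (snd b v) =
            partial2 (partial1 (flow_rep M A H b c)) t (snd b v))"

definition mixed_partials_locally_bounded :: "'p topology \<Rightarrow>
    ('p, 'a::euclidean_space) chart set \<Rightarrow> (('p, 'a) chart \<Rightarrow> 'a \<Rightarrow> 'a \<Rightarrow> 'a) \<Rightarrow>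
    (('p, 'a) tvec, 'b::euclidean_space) chart set \<Rightarrow> ('p, 'a) tvec set \<Rightarrow> bool" where
  "mixed_partials_locally_bounded M A H B R \<longleftrightarrow>
     (\<forall>v\<in>R. \<forall>t\<in>{0..1}. \<forall>b\<in>B. \<forall>c\<in>A. v \<in> fst b \<and> flow M A H t v \<in> fst (tchart A c) \<longrightarrow>
        (\<exists>V e K. openin (tangent_topology A) V \<and> v \<in> V \<and> 0 < e \<and>
           (\<forall>w \<in> V \<inter> R \<inter> fst b. \<forall>s \<in> {0..1} \<inter> ball t e.
              (has_partial12 (flow_rep M A H b c) s (snd b w) \<longrightarrow>
                 norm (partial1 (partial2 (flow_rep M A H b c)) s (snd b w)) \<le> K) \<and>
              (has_partial21 (flow_rep M A H b c) s (snd b w) \<longrightarrow>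
                 norm (partial2 (partial1 (flow_rep M A H b c)) s (snd b w)) \<le> K))))"

end

theory Submission
  imports Defs
begin

text \<open>In the charts \<open>tchart A c\<close> of the tangent bundle the spray is the vector field
\<open>(x, v) \<mapsto> (v, H(x, v))\<close>, which is locally Lipschitz, and geodesics are the base curves of its
integral curves. By uniqueness of integral curves and homogeneity of \<open>H\<close>,
\<open>\<phi>(t, s v) = s \<phi>(s t, v)\<close> for \<open>s \<ge> 0\<close> (\<open>tscale_flow\<close>); all scaling statements about the domains of
the flow follow from this.

Openness of the domains and the local Lipschitz property come from Picard's theorem
(\<open>local_flow\<close>), which gives a Lipschitz flow near every point for a short time. For a fixed initial
vector \<open>v\<close>, the times around which the flow is defined and Lipschitz on a box of times and initial
vectors form an open and closed subset of the domain of \<open>\<gamma>\<^sub>v\<close>, because near a limit time such a box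
can be continued by a local flow whose reach does not depend on the time at which it is attached
(\<open>flow_box_reaches_limit\<close>, \<open>flow_box_exists\<close>).

For the differentials let \<open>g(t, y)\<close> be the flow in charts on such a box and \<open>G = \<partial>\<^sub>1 g\<close> the field
along it; both are Lipschitz in \<open>(t, y)\<close>. Rademacher's theorem on the box, followed by Fubini's
theorem, shows that for almost every \<open>y\<close> the maps \<open>g(t, \<cdot>)\<close> and \<open>G(t, \<cdot>)\<close> are differentiable at \<open>y\<close>
for almost every \<open>t\<close>. Two observations turn this into the theorem.

\<^item> Since \<open>G\<close> is Lipschitz in \<open>y\<close>, the difference quotients of \<open>g(t, \<cdot>)\<close> at \<open>y\<close> are Lipschitz in \<open>t\<close>
  with one common constant (\<open>increment_le\<close>). Hence differentiability passes from a dense set of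
  times to every time, and \<open>\<partial>\<^sub>2 g(\<cdot>, y)\<close> is Lipschitz (\<open>differentiable_if_dense\<close>,
  \<open>jacobian_lipschitz\<close>).

\<^item> The time derivatives of these quotients are the difference quotients of \<open>G(t, \<cdot>)\<close>, which are
  bounded and converge for almost every \<open>t\<close>. By dominated convergence their limit is the derivative
  of \<open>\<partial>\<^sub>2 g(\<cdot>, y)\<close> almost everywhere, that is \<open>\<partial>\<^sub>1 \<partial>\<^sub>2 g = \<partial>\<^sub>2 \<partial>\<^sub>1 g\<close>
  (\<open>ae_derivative_of_pointwise_limit\<close>, \<open>jacobian_derivative_ae\<close>).

The coordinates \<open>y\<close> may come from any Lipschitz parametrization of initial vectors, so the argument
covers Lipschitz submanifolds \<open>N\<close> of the tangent bundle; the tangent bundle itself is the case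
\<open>N = TM\<close>. The set of the theorem consists of the initial vectors that are \<open>good\<close> in every chart of
\<open>N\<close> around them. Null sets are added up over the countable set \<open>C\<close> of target charts and over the
charts of \<open>N\<close>; the latter are countable or, for \<open>TM\<close>, related by differentiable transition maps.

It remains to see that good vectors are stable under scaling. For \<open>0 < s \<le> 1\<close> the identity
\<open>\<phi>(t, s v) = s \<phi>(s t, v)\<close> transports differentiability at \<open>v\<close> to differentiability at \<open>s v\<close>, provided
that the inverse of the scaling, read in the charts of \<open>N\<close>, is differentiable at \<open>s v\<close>. On a
submanifold, scaling is a continuous injective map between open sets of the same Euclidean space,
hence open by invariance of domain; its inverse is Lipschitz and becomes differentiable after
composition with the inclusion of \<open>N\<close>, whose differential at \<open>v\<close> is injective
(\<open>inverse_scaling\<close>, \<open>differentiable_if_composite\<close>). For \<open>s = 0\<close> homogeneity gives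
\<open>\<phi>(t, (x, v)) = (x + t v, v) + O(|v|^2)\<close> in a chart, so the flow is differentiable at every zero
vector (\<open>zero_vector_expansion\<close>).

Rademacher's theorem is proved from the one-dimensional case, where Vitali's covering theorem bounds
how much a monotone Lipschitz function contracts or expands the set of points with two different
limiting slopes (\<open>lipschitz_real_differentiable_ae\<close>). In higher dimension directional derivatives
exist almost everywhere by Fubini's theorem along parallel lines, and they are additive in the
direction because translating a box by \<open>h u\<close> changes integrals over it by little
(\<open>dir_deriv_add_ae\<close>).\<close>

section \<open>Rademacher's theorem\<close>

text \<open>A bounded function without a limit must oscillate across an interval with rational end points.
There are only countably many of these, so null sets can be collected over them.\<close>

lemma limit_exists_of_no_rational_gap:
  fixes q :: "'x \<Rightarrow> real"
  assumes "F \<noteq> bot" and lo: "\<forall>\<^sub>F x in F. c \<le> q x" and hi: "\<forall>\<^sub>F x in F. q x \<le> B"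
    and gap: "\<And>a b :: rat. a < b \<Longrightarrow> \<not> ((\<exists>\<^sub>F x in F. q x < of_rat a) \<and> (\<exists>\<^sub>F x in F. of_rat b < q x))"
  shows "\<exists>l. (q \<longlongrightarrow> l) F"
proof -
  define R where "R = {r. \<forall>\<^sub>F x in F. r \<le> q x}"
  define l where "l = Sup R"
  have ne: "c \<in> R" using lo by (simp add: R_def)
  have ub: "r \<le> B" if "r \<in> R" for r
  proof -
    have "\<forall>\<^sub>F x in F. r \<le> B"
      using that hi unfolding R_def by (auto elim: eventually_elim2)
    then show ?thesis using \<open>F \<noteq> bot\<close> by (simp add: eventually_const)
  qed
  have bdd: "bdd_above R" using ub by (auto simp: bdd_above_def)
  have "(q \<longlongrightarrow> l) F"
  proof (rule order_tendstoI)
    fix a assume "a < l"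
    then obtain r where r: "r \<in> R" "a < r"
      unfolding l_def using ne bdd less_cSup_iff by blast
    then show "\<forall>\<^sub>F x in F. a < q x"
      unfolding R_def by (auto elim: eventually_mono)
  next
    fix a assume "l < a"
    obtain m where m: "l < of_rat m" "of_rat m < a" using \<open>l < a\<close> of_rat_dense by blast
    obtain k where k: "of_rat m < (of_rat k :: real)" "of_rat k < a" using m(2) of_rat_dense by blast
    have "of_rat m \<notin> R" using m(1) cSup_upper[OF _ bdd] l_def by fastforce
    then have "\<exists>\<^sub>F x in F. q x < of_rat m"
      unfolding R_def by (simp add: frequently_def not_less)
    then have "\<not> (\<exists>\<^sub>F x in F. of_rat k < q x)"
      using gap[of m k] k(1) by (simp add: of_rat_less)
    then have "\<forall>\<^sub>F x in F. q x \<le> of_rat k" by (simp add: frequently_def not_less)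
    then show "\<forall>\<^sub>F x in F. q x < a" by (rule eventually_mono) (use k in linarith)
  qed
  then show ?thesis by blast
qed

text \<open>The intervals of mean slope at most \<open>p\<close> form a Vitali cover of \<open>S\<close>. Disjoint ones among them exhaust \<open>S\<close>
up to a null set while staying inside an open set \<open>T\<close> barely larger than \<open>S\<close>, and each has an image
of length at most \<open>p\<close> times its own; the null set that is left over has a null image because \<open>g\<close> is
Lipschitz.\<close>

lemma emeasure_image_le_of_small_quotients:
  fixes g :: "real \<Rightarrow> real"
  assumes mono: "strict_mono g" and lip: "L-lipschitz_on UNIV g"
    and S: "S \<in> sets lebesgue" and "p > 0"
    and small: "\<And>x d. x \<in> S \<Longrightarrow> d > 0 \<Longrightarrow>
      \<exists>u v. u < v \<and> u \<le> x \<and> x \<le> v \<and> v - u < d \<and> g v - g u \<le> p * (v - u)"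
  shows "emeasure lebesgue (g ` S) \<le> ennreal p * emeasure lebesgue S"
proof -
  have cont: "continuous_on A g" for A
    using lip lipschitz_on_continuous_on continuous_on_subset by blast
  have "emeasure lebesgue (g ` S) \<le> ennreal p * emeasure lebesgue S + ennreal e" if "e > 0" for e
  proof -
    have "e / p > 0" using that \<open>p > 0\<close> by simp
    then obtain T where T: "open T" "S \<subseteq> T" "T - S \<in> lmeasurable"
        "emeasure lebesgue (T - S) < ennreal (e / p)"
      using sets_lebesgue_outer_open[OF S] by metis
    define K where "K = {(u, v). u < v \<and> {u..v} \<subseteq> T \<and> g v - g u \<le> p * (v - u)}"
    define ce where "ce = (\<lambda>(u, v). (u + v) / 2 :: real)"
    define ra where "ra = (\<lambda>(u, v). (v - u) / 2 :: real)"
    have cb: "cball (ce i) (ra i) = {fst i..snd i}" for i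
      by (auto simp: ce_def ra_def cball_eq_atLeastAtMost field_simps split: prod.splits)
    have rpos: "0 < ra i" if "i \<in> K" for i using that by (auto simp: K_def ra_def)
    have cov: "\<exists>i. i \<in> K \<and> x \<in> cball (ce i) (ra i) \<and> ra i < d" if x: "x \<in> S" and d: "0 < d" for x d
    proof -
      obtain r where r: "r > 0" "ball x r \<subseteq> T" using T x open_contains_ball by blast
      obtain u v where uv: "u < v" "u \<le> x" "x \<le> v" "v - u < min d r" "g v - g u \<le> p * (v - u)"
        using small[OF x, of "min d r"] d r by auto
      have "{u..v} \<subseteq> T"
        using r uv by (force simp: dist_real_def)
      then have "(u, v) \<in> K" using uv by (simp add: K_def)
      moreover have "x \<in> cball (ce (u, v)) (ra (u, v))" unfolding cb using uv by simp
      moreover have "ra (u, v) < d" using uv by (simp add: ra_def)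
      ultimately show ?thesis by blast
    qed
    obtain C where C: "countable C" "C \<subseteq> K"
        "pairwise (\<lambda>i j. disjnt (cball (ce i) (ra i)) (cball (ce j) (ra j))) C"
        "negligible (S - (\<Union>i\<in>C. cball (ce i) (ra i)))"
      using Vitali_covering_theorem_cballs[of K ra S ce, OF rpos cov] by blast
    have dj: "disjoint_family_on (\<lambda>i. {fst i..snd i}) C"
      using C(3) unfolding cb by (auto simp: pairwise_def disjoint_family_on_def disjnt_def)
    have img: "g ` {a..b} = {g a..g b}" if "a \<le> b" for a b
    proof
      show "g ` {a..b} \<subseteq> {g a..g b}" using mono by (auto simp: strict_mono_less_eq)
      show "{g a..g b} \<subseteq> g ` {a..b}"
        using IVT'[of g a _ b] that cont by fastforce
    qed
    have lt: "fst i < snd i" if "i \<in> C" for i using C(2) that by (auto simp: K_def)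
    have "{g (fst i)..g (snd i)} = g ` {fst i..snd i}" if "i \<in> C" for i
      using img lt[OF that] by simp
    then have dj': "disjoint_family_on (\<lambda>i. {g (fst i)..g (snd i)}) C"
      using dj strict_mono_imp_inj_on[OF mono]
      unfolding disjoint_family_on_def by (metis (no_types, lifting) image_Int image_empty)
    let ?N = "g ` (S - (\<Union>i\<in>C. {fst i..snd i}))"
    have negN: "negligible ?N"
    proof (rule negligible_locally_Lipschitz_image)
      show "negligible (S - (\<Union>i\<in>C. {fst i..snd i}))" using C(4) by (simp add: cb)
      show "\<exists>T B. open T \<and> x \<in> T \<and> (\<forall>y\<in>(S - (\<Union>i\<in>C. {fst i..snd i})) \<inter> T. norm (g y - g x) \<le> B * norm (y - x))" for x
        using lipschitz_onD[OF lip] by (intro exI[of _ UNIV] exI[of _ L]) (auto simp: dist_norm)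
    qed simp
    have sub: "g ` S \<subseteq> (\<Union>i\<in>C. {g (fst i)..g (snd i)}) \<union> ?N"
      using mono by (fastforce simp: strict_mono_less_eq)
    have mC: "(\<Union>i\<in>C. {g (fst i)..g (snd i)}) \<in> sets lebesgue" "(\<Union>i\<in>C. {fst i..snd i}) \<in> sets lebesgue"
      using C(1) by (auto intro!: sets.countable_UN'')
    have "emeasure lebesgue (g ` S) \<le> emeasure lebesgue ((\<Union>i\<in>C. {g (fst i)..g (snd i)}) \<union> ?N)"
      using sub mC negN by (intro emeasure_mono) (auto simp: negligible_iff_null_sets null_setsD2)
    also have "\<dots> \<le> emeasure lebesgue (\<Union>i\<in>C. {g (fst i)..g (snd i)}) + emeasure lebesgue ?N"
      using mC negN by (intro emeasure_subadditive) (auto simp: negligible_iff_null_sets null_setsD2)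
    also have "\<dots> = emeasure lebesgue (\<Union>i\<in>C. {g (fst i)..g (snd i)})"
      using negN by (simp add: negligible_iff_null_sets null_setsD1)
    also have "\<dots> = (\<integral>\<^sup>+i. emeasure lebesgue {g (fst i)..g (snd i)} \<partial>count_space C)"
      by (rule emeasure_UN_countable[OF _ C(1) dj']) auto
    also have "\<dots> \<le> (\<integral>\<^sup>+i. ennreal p * emeasure lebesgue {fst i..snd i} \<partial>count_space C)"
    proof (intro nn_integral_mono)
      fix i assume "i \<in> space (count_space C)"
      then have i: "i \<in> C" "i \<in> K" using C by auto
      then have "g (fst i) \<le> g (snd i)" using mono lt[of i] by (simp add: strict_mono_less_eq less_imp_le)
      then show "emeasure lebesgue {g (fst i)..g (snd i)} \<le> ennreal p * emeasure lebesgue {fst i..snd i}"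
        using i \<open>p > 0\<close> by (auto simp: K_def ennreal_mult[symmetric] intro!: ennreal_leI)
    qed
    also have "\<dots> = ennreal p * (\<integral>\<^sup>+i. emeasure lebesgue {fst i..snd i} \<partial>count_space C)"
      by (rule nn_integral_cmult) auto
    also have "(\<integral>\<^sup>+i. emeasure lebesgue {fst i..snd i} \<partial>count_space C) = emeasure lebesgue (\<Union>i\<in>C. {fst i..snd i})"
      by (rule emeasure_UN_countable[OF _ C(1) dj, symmetric]) auto
    also have "ennreal p * emeasure lebesgue (\<Union>i\<in>C. {fst i..snd i}) \<le> ennreal p * emeasure lebesgue T"
    proof (intro mult_left_mono emeasure_mono)
      show "(\<Union>i\<in>C. {fst i..snd i}) \<subseteq> T" using C(2) by (fastforce simp: K_def)
    qed (use T in auto)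
    also have "emeasure lebesgue T \<le> emeasure lebesgue S + emeasure lebesgue (T - S)"
      using T S by (metis Un_Diff_cancel emeasure_subadditive fmeasurableD sup.absorb2)
    also have "ennreal p * (emeasure lebesgue S + emeasure lebesgue (T - S))
        \<le> ennreal p * (emeasure lebesgue S + ennreal (e / p))"
      using T by (intro mult_left_mono add_left_mono) auto
    also have "\<dots> = ennreal p * emeasure lebesgue S + ennreal e"
      using \<open>p > 0\<close> that by (simp add: distrib_left ennreal_mult[symmetric])
    finally show ?thesis by (simp add: mult_left_mono)
  qed
  then show ?thesis by (rule ennreal_le_epsilon)
qed

lemma rational_in_open:
  fixes S :: "real set"
  assumes "open S" "x \<in> S"
  obtains r :: rat where "of_rat r \<in> S"
proof -
  obtain e where e: "e > 0" "ball x e \<subseteq> S" using assms open_contains_ball by blast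
  obtain r :: rat where "x < of_rat r" "of_rat r < x + e" using of_rat_dense[of x "x+e"] e by auto
  then have "of_rat r \<in> ball x e" by (auto simp: dist_real_def)
  then show ?thesis using e that by blast
qed

text \<open>Restricting increments to the rationals is what makes the sets of points with prescribed limiting
slopes Borel.\<close>

lemma frequently_at_0_rational:
  fixes q :: "real \<Rightarrow> real"
  assumes q: "continuous_on (- {0}) q" and U: "open U" and fr: "\<exists>\<^sub>F h in at 0. q h \<in> U" and "d > 0"
  shows "\<exists>r::rat. r \<noteq> 0 \<and> \<bar>of_rat r\<bar> < (d::real) \<and> q (of_rat r) \<in> U"
proof -
  have "\<forall>\<^sub>F h in at (0::real). \<bar>h\<bar> < d \<and> h \<noteq> 0"
    unfolding eventually_at using \<open>d > 0\<close> by (intro exI[of _ d]) auto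
  then obtain h where h: "q h \<in> U" "\<bar>h\<bar> < d" "h \<noteq> 0"
    using frequently_ex[OF frequently_eventually_frequently[OF fr]] by blast
  let ?T = "((q -` U) \<inter> - {0}) \<inter> ball 0 d"
  have "open ?T" using q U by (metis continuous_on_open_vimage open_Compl closed_singleton open_Int open_ball)
  moreover have "h \<in> ?T" using h by auto
  ultimately obtain r :: rat where "of_rat r \<in> ?T" using rational_in_open by blast
  then show ?thesis by (intro exI[of _ r]) auto
qed

text \<open>If the derivative fails to exist, difference quotients below \<open>p\<close> and above \<open>q\<close> both occur arbitrarily
near, for some rationals \<open>p < q\<close>. The previous estimate, applied to an increasing modification \<open>F\<close> of
the function and to its inverse, bounds the measure of the image of a bounded set \<open>S\<close> of such points by
\<open>p |S|\<close> from above and by \<open>q |S|\<close> from below, so that \<open>S\<close> is null.\<close>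

theorem lipschitz_real_differentiable_ae:
  fixes f :: "real \<Rightarrow> real"
  assumes "L-lipschitz_on UNIV f"
  shows "negligible {x. \<not> (\<exists>l. ((\<lambda>h. (f (x + h) - f x) / h) \<longlongrightarrow> l) (at 0))}"
proof -
  have L: "L \<ge> 0" using assms lipschitz_on_nonneg by blast
  \<comment> \<open>The slopes of \<open>F\<close> lie between \<open>1\<close> and \<open>2 L + 1\<close>, so \<open>F\<close> and its inverse are increasing and Lipschitz.\<close>
  define F where "F x = f x + (L + 1) * x" for x
  have flip: "\<bar>f y - f x\<bar> \<le> L * \<bar>y - x\<bar>" for x y
    using lipschitz_onD[OF assms, of y x] by (simp add: dist_real_def)
  have up: "F y - F x \<le> (2 * L + 1) * (y - x)" and low: "y - x \<le> F y - F x" if "x \<le> y" for x y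
    using flip[of y x] that by (auto simp: F_def algebra_simps abs_if split: if_splits)
  have smono: "strict_mono F"
    by (rule strict_monoI) (use low in \<open>smt (verit)\<close>)
  have Flip: "(2 * L + 1)-lipschitz_on UNIV F"
  proof (rule lipschitz_onI)
    fix x y show "dist (F x) (F y) \<le> (2 * L + 1) * dist x y"
      using up[of x y] up[of y x] low[of x y] low[of y x]
      by (cases "x \<le> y") (auto simp: dist_real_def abs_if algebra_simps)
  qed (use L in simp)
  have cont: "continuous_on A F" for A
    using Flip lipschitz_on_continuous_on continuous_on_subset by blast
  have surj: "surj F"
  proof -
    have "\<exists>x. F x = y" for y
    proof -
      have "F (- \<bar>y - F 0\<bar>) \<le> y" "y \<le> F \<bar>y - F 0\<bar>"
        using low[of "- \<bar>y - F 0\<bar>" 0] low[of 0 "\<bar>y - F 0\<bar>"] by auto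
      then show ?thesis using IVT'[of F "- \<bar>y - F 0\<bar>" y "\<bar>y - F 0\<bar>"] cont by auto
    qed
    then show ?thesis by (metis surjI)
  qed
  define G where "G = inv F"
  have FG: "F (G y) = y" for y unfolding G_def using surj by (simp add: surj_f_inv_f)
  have GF: "G (F x) = x" for x unfolding G_def using strict_mono_imp_inj_on[OF smono] by simp
  have gmono: "strict_mono G"
    by (rule strict_monoI) (metis FG smono strict_mono_less)
  have Glip: "1-lipschitz_on UNIV G"
  proof (rule lipschitz_onI)
    fix x y show "dist (G x) (G y) \<le> 1 * dist x y"
      using low[of "G x" "G y"] low[of "G y" "G x"] FG[of x] FG[of y]
      by (cases "G x \<le> G y") (auto simp: dist_real_def)
  qed simp
  have Gcont: "continuous_on UNIV G"
    using Glip lipschitz_on_continuous_on by blast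
  have Fm [measurable]: "F \<in> borel_measurable borel" using cont by (simp add: borel_measurable_continuous_onI)
  have Gm [measurable]: "G \<in> borel_measurable borel" using Gcont by (simp add: borel_measurable_continuous_onI)
  define Q where "Q x h = (F (x + h) - F x) / h" for x h
  \<comment> \<open>Points with arbitrarily small rational increments of slope below \<open>p\<close>, respectively above \<open>p\<close>.\<close>
  define Lo where "Lo p = {x. \<forall>n::nat. \<exists>r::rat. r \<noteq> 0 \<and> \<bar>of_rat r\<bar> < 1 / (real n + 1) \<and> Q x (of_rat r) < of_rat p}" for p :: rat
  define Hi where "Hi p = {x. \<forall>n::nat. \<exists>r::rat. r \<noteq> 0 \<and> \<bar>of_rat r\<bar> < 1 / (real n + 1) \<and> Q x (of_rat r) > of_rat p}" for p :: rat
  have Lom: "Lo p \<in> sets borel" and Him: "Hi p \<in> sets borel" for p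
    unfolding Lo_def Hi_def Q_def by measurable
  have Q1: "1 \<le> Q x h" and Q2: "Q x h \<le> 2 * L + 1" if "h \<noteq> 0" for x h
    using low[of x "x+h"] low[of "x+h" x] up[of x "x+h"] up[of "x+h" x] that
    by (cases "h > 0"; auto simp: Q_def field_simps)+
  have interval: "\<exists>u v. u < v \<and> u \<le> x \<and> x \<le> v \<and> v - u < d \<and> R ((F v - F u) / (v - u))"
    if H: "\<forall>n::nat. \<exists>r::rat. r \<noteq> 0 \<and> \<bar>of_rat r\<bar> < 1 / (real n + 1) \<and> R (Q x (of_rat r))" "d > 0" for x d R
  proof -
    obtain n :: nat where "1 / (real n + 1) < d"
      using reals_Archimedean[OF H(2)] by (auto simp: inverse_eq_divide add.commute)
    then obtain r :: rat where r: "r \<noteq> 0" "\<bar>of_rat r :: real\<bar> < d" "R (Q x (of_rat r))"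
      using H(1)[rule_format, of n] by (meson less_trans)
    let ?h = "of_rat r :: real"
    show ?thesis
    proof (cases "r > 0")
      case True
      then show ?thesis using r by (intro exI[of _ x] exI[of _ "x + ?h"]) (auto simp: Q_def)
    next
      case False
      then have "?h < 0" using r by (simp add: of_rat_less_0_iff)
      moreover have "(F x - F (x + ?h)) / (x - (x + ?h)) = Q x ?h"
        using \<open>?h < 0\<close> by (simp add: Q_def field_simps)
      moreover have "x - (x + ?h) < d" "x + ?h < x" "x + ?h \<le> x" using \<open>?h < 0\<close> r(2) by linarith+
      ultimately show ?thesis using r(3) by (metis order_refl)
    qed
  qed
  have null: "negligible (Lo p \<inter> Hi q \<inter> {-real n..real n})" if pq: "0 < p" "p < q" for p q :: rat and n
  proof -
    let ?S = "Lo p \<inter> Hi q \<inter> {-real n..real n}"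
    have Sb: "?S \<in> sets borel" using Lom Him by auto
    have FS: "F ` T = G -` T" for T using FG GF by (auto simp: image_iff) (metis FG)
    have "G -` ?S \<in> sets borel"
      using measurable_sets[OF Gm Sb] by simp
    then have FSm: "F ` ?S \<in> sets lebesgue" using FS by simp
    have a: "emeasure lebesgue (F ` ?S) \<le> ennreal (of_rat p) * emeasure lebesgue ?S"
    proof (rule emeasure_image_le_of_small_quotients[OF smono Flip])
      fix x d assume x: "x \<in> ?S" and "(0::real) < d"
      then obtain u v where "u < v \<and> u \<le> x \<and> x \<le> v \<and> v - u < d \<and> (F v - F u) / (v - u) < of_rat p"
        using interval[of "\<lambda>z. z < of_rat p" x d] by (auto simp: Lo_def)
      then show "\<exists>u v. u < v \<and> u \<le> x \<and> x \<le> v \<and> v - u < d \<and> F v - F u \<le> of_rat p * (v - u)"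
        by (intro exI[of _ u] exI[of _ v]) (auto simp: field_simps)
    qed (use Sb pq in auto)
    have b: "emeasure lebesgue (G ` F ` ?S) \<le> ennreal (1 / of_rat q) * emeasure lebesgue (F ` ?S)"
    proof (rule emeasure_image_le_of_small_quotients[OF gmono Glip FSm])
      show "0 < 1 / (of_rat q :: real)" using pq by simp
      fix y d assume y: "y \<in> F ` ?S" and "(0::real) < d"
      then obtain x where x: "x \<in> ?S" "y = F x" by blast
      have "d / (2 * L + 1) > 0" using \<open>0 < d\<close> L by simp
      then obtain u v where uv: "u < v" "u \<le> x" "x \<le> v" "v - u < d / (2 * L + 1)" "(F v - F u) / (v - u) > of_rat q"
        using interval[of "\<lambda>z. z > of_rat q" x "d / (2 * L + 1)"] x by (auto simp: Hi_def)
      have "(2 * L + 1) * (v - u) < d" using uv(4) L by (simp add: field_simps)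
      moreover have "v - u \<le> 1 / of_rat q * (F v - F u)" using uv pq by (simp add: field_simps)
      ultimately show "\<exists>u v. u < v \<and> u \<le> y \<and> y \<le> v \<and> v - u < d \<and> G v - G u \<le> 1 / of_rat q * (v - u)"
        using uv x up[of u v] smono
        by (intro exI[of _ "F u"] exI[of _ "F v"]) (auto simp: GF strict_mono_less strict_mono_less_eq)
    qed
    have GFS: "G ` F ` ?S = ?S" by (auto simp: image_iff GF)
    have fin: "emeasure lebesgue ?S < \<infinity>"
    proof -
      have "emeasure lebesgue ?S \<le> emeasure lebesgue {-real n..real n}" by (intro emeasure_mono) auto
      also have "\<dots> < \<infinity>" by simp
      finally show ?thesis .
    qed
    define s where "s = measure lebesgue ?S"
    have s: "emeasure lebesgue ?S = ennreal s" unfolding s_def using fin by (simp add: emeasure_eq_ennreal_measure)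
    have "s \<ge> 0" by (simp add: s_def)
    \<comment> \<open>Chaining both estimates gives \<open>s \<le> (p / q) s\<close> with \<open>s\<close> finite and \<open>p < q\<close>.\<close>
    have "ennreal s \<le> ennreal (1 / of_rat q) * (ennreal (of_rat p) * ennreal s)"
      using b a GFS s by (metis (no_types, lifting) mult_left_mono order_trans zero_le)
    also have "\<dots> = ennreal (1 / of_rat q * (of_rat p * s))"
      using pq \<open>s \<ge> 0\<close> by (simp add: ennreal_mult[symmetric])
    finally have "s \<le> 1 / of_rat q * (of_rat p * s)" using pq \<open>s \<ge> 0\<close> by (simp add: ennreal_le_iff)
    then have "of_rat q * s \<le> of_rat p * s" using pq by (simp add: field_simps)
    then have "s \<le> 0"
      using pq by (metis linorder_not_le mult_le_cancel_right not_less_iff_gr_or_eq of_rat_less)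
    then have "emeasure lebesgue ?S = 0" using s by (simp add: ennreal_neg)
    then show ?thesis using Sb by (subst negligible_iff_emeasure0) auto
  qed
  have "negligible (\<Union>(p, q, n) \<in> {(p :: rat, q :: rat, n :: nat). 0 < p \<and> p < q}. Lo p \<inter> Hi q \<inter> {-real n..real n})"
    using null by (intro negligible_countable_Union) (auto intro!: countable_image)
  moreover have "{x. \<not> (\<exists>l. ((\<lambda>h. (f (x + h) - f x) / h) \<longlongrightarrow> l) (at 0))} \<subseteq>
      (\<Union>(p, q, n) \<in> {(p :: rat, q :: rat, n :: nat). 0 < p \<and> p < q}. Lo p \<inter> Hi q \<inter> {-real n..real n})"
  proof
    fix x assume "x \<in> {x. \<not> (\<exists>l. ((\<lambda>h. (f (x + h) - f x) / h) \<longlongrightarrow> l) (at 0))}"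
    then have no: "\<not> (\<exists>l. ((\<lambda>h. (f (x + h) - f x) / h) \<longlongrightarrow> l) (at 0))" by simp
    have ne: "(at (0::real)) \<noteq> bot" by simp
    have nq: "\<not> (\<exists>l. (Q x \<longlongrightarrow> l) (at 0))"
    proof
      assume "\<exists>l. (Q x \<longlongrightarrow> l) (at 0)"
      then obtain l where "(Q x \<longlongrightarrow> l) (at 0)" by blast
      then have "((\<lambda>h. Q x h - (L + 1)) \<longlongrightarrow> l - (L + 1)) (at 0)" by (intro tendsto_intros)
      moreover have "\<forall>\<^sub>F h in at 0. Q x h - (L + 1) = (f (x + h) - f x) / h"
        unfolding eventually_at_filter by (rule always_eventually) (auto simp: Q_def F_def field_simps)
      ultimately have "((\<lambda>h. (f (x + h) - f x) / h) \<longlongrightarrow> l - (L + 1)) (at 0)"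
        by (rule Lim_transform_eventually)
      then show False using no by blast
    qed
    have ev1: "\<forall>\<^sub>F h in at 0. 1 \<le> Q x h" and ev2: "\<forall>\<^sub>F h in at 0. Q x h \<le> 2 * L + 1"
      unfolding eventually_at_filter using Q1 Q2 by auto
    obtain a b :: rat where ab: "a < b" "\<exists>\<^sub>F h in at 0. Q x h < of_rat a" "\<exists>\<^sub>F h in at 0. of_rat b < Q x h"
      using limit_exists_of_no_rational_gap[OF ne ev1 ev2] nq by blast
    have apos: "0 < a"
    proof (rule ccontr)
      assume "\<not> 0 < a"
      then have "of_rat a \<le> (0::real)" by (simp add: of_rat_le_0_iff)
      moreover obtain h where "Q x h < of_rat a" "1 \<le> Q x h"
        using frequently_ex[OF frequently_eventually_frequently[OF ab(2) ev1]] by blast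
      ultimately show False by linarith
    qed
    have Qc: "continuous_on (- {0}) (Q x)"
      unfolding Q_def by (intro continuous_intros continuous_on_compose2[OF cont[of UNIV]]) auto
    have rat: "\<forall>n::nat. \<exists>r::rat. r \<noteq> 0 \<and> \<bar>of_rat r\<bar> < 1 / (real n + 1) \<and> Q x (of_rat r) \<in> U"
      if H: "open U" "\<exists>\<^sub>F h in at 0. Q x h \<in> U" for U
      using frequently_at_0_rational[OF Qc H] by simp
    have "x \<in> Lo a" using rat[of "{..<of_rat a}"] ab(2) by (auto simp: Lo_def)
    moreover have "x \<in> Hi b" using rat[of "{of_rat b<..}"] ab(3) by (auto simp: Hi_def)
    moreover obtain n where "\<bar>x\<bar> \<le> real n" using real_arch_simple by blast
    ultimately have "x \<in> Lo a \<inter> Hi b \<inter> {-real n..real n}" by (simp add: abs_le_iff)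
    then show "x \<in> (\<Union>(p, q, n) \<in> {(p :: rat, q :: rat, n :: nat). 0 < p \<and> p < q}. Lo p \<inter> Hi q \<inter> {-real n..real n})"
      using apos ab(1) by (intro UN_I[of "(a, b, n)"]) auto
  qed
  ultimately show ?thesis using negligible_subset by blast
qed

definition diff_quot :: "('a::real_vector \<Rightarrow> real) \<Rightarrow> 'a \<Rightarrow> 'a \<Rightarrow> real \<Rightarrow> real" where
  "diff_quot f u x h = (f (x + h *\<^sub>R u) - f x) / h"

text \<open>The limit along the fixed sequence \<open>1 / (n + 1)\<close> makes this a measurable function of \<open>x\<close> that is defined
everywhere; where the directional derivative exists the two agree.\<close>

definition dir_deriv :: "('a::real_vector \<Rightarrow> real) \<Rightarrow> 'a \<Rightarrow> 'a \<Rightarrow> real" where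
  "dir_deriv f u x = lim (\<lambda>n. diff_quot f u x (inverse (real (Suc n))))"

lemma dir_deriv_eqI:
  assumes "(diff_quot f u x \<longlongrightarrow> l) (at 0)"
  shows "dir_deriv f u x = l" and "(\<lambda>n. diff_quot f u x (inverse (real (Suc n)))) \<longlonglongrightarrow> l"
proof -
  have "filterlim (\<lambda>n. inverse (real (Suc n))) (at 0) sequentially"
    unfolding filterlim_at using LIMSEQ_inverse_real_of_nat by auto
  from filterlim_compose[OF assms this]
  show "(\<lambda>n. diff_quot f u x (inverse (real (Suc n)))) \<longlonglongrightarrow> l" .
  then show "dir_deriv f u x = l" unfolding dir_deriv_def by (rule limI)
qed

lemma norm_diff_quot_le:
  fixes f :: "'a::real_normed_vector \<Rightarrow> real"
  assumes "L-lipschitz_on UNIV f"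
  shows "\<bar>diff_quot f u x h\<bar> \<le> L * norm u"
proof (cases "h = 0")
  case True
  then show ?thesis using lipschitz_on_nonneg[OF assms] by (simp add: diff_quot_def)
next
  case False
  have "\<bar>f (x + h *\<^sub>R u) - f x\<bar> \<le> L * (\<bar>h\<bar> * norm u)"
    using lipschitz_onD[OF assms, of "x + h *\<^sub>R u" x] by (simp add: dist_norm)
  then show ?thesis using False by (simp add: diff_quot_def divide_simps mult_ac)
qed

lemma negligible_if_ae:
  assumes "AE x in lborel. P x"
  shows "negligible {x. \<not> P x}"
proof -
  obtain N where N: "{x. \<not> P x} \<subseteq> N" "N \<in> null_sets lborel"
    using assms by (auto simp: eventually_ae_filter)
  then have "negligible N" by (auto simp: negligible_iff_null_sets null_sets_completionI)
  then show ?thesis using N(1) negligible_subset by blast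
qed

lemma ae_if_negligible:
  assumes "negligible {x. \<not> P x}"
  shows "AE x in lborel. P x"
proof -
  have "{x. \<not> P x} \<in> null_sets lebesgue" using assms by (simp add: negligible_iff_null_sets)
  then have "AE x in lebesgue. x \<notin> {x. \<not> P x}" by (rule AE_not_in)
  then show ?thesis by (simp add: AE_completion_iff)
qed

text \<open>On every line in direction \<open>u\<close> the exceptional set \<open>N\<close> is null by the one-dimensional theorem.
Averaging the translates of \<open>N\<close> along \<open>u\<close> over a unit time and exchanging the integrals shows that \<open>N\<close> is
null.\<close>

lemma dir_deriv_exists_ae:
  fixes f :: "'a::euclidean_space \<Rightarrow> real"
  assumes lip: "L-lipschitz_on UNIV f"
  shows "AE x in lborel. (diff_quot f u x \<longlongrightarrow> dir_deriv f u x) (at 0)"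
proof -
  have [measurable]: "f \<in> borel_measurable borel"
    using lipschitz_on_continuous_on[OF lip] by (rule borel_measurable_continuous_onI)
  \<comment> \<open>The Cauchy criterion for the difference quotients along rational increments, a Borel condition on \<open>x\<close>.\<close>
  define P where "P x \<longleftrightarrow> (\<forall>n::nat. \<exists>m::nat. \<forall>r s::rat. r \<noteq> 0 \<and> s \<noteq> 0 \<and> \<bar>of_rat r\<bar> < 1 / (real m + 1) \<and>
      \<bar>of_rat s\<bar> < 1 / (real m + 1) \<longrightarrow>
      \<bar>diff_quot f u x (of_rat r) - diff_quot f u x (of_rat s)\<bar> \<le> 1 / (real n + 1))" for x
  define N where "N = {x. \<not> P x}"
  have N [measurable]: "N \<in> sets borel"
    unfolding N_def P_def diff_quot_def by measurable
  have PD: "P x" if l: "(diff_quot f u x \<longlongrightarrow> l) (at 0)" for x l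
    unfolding P_def
  proof
    fix n :: nat
    have "\<forall>\<^sub>F h in at 0. dist (diff_quot f u x h) l < 1 / (2 * (real n + 1))"
      using l by (rule tendstoD) auto
    then obtain d where d: "d > 0" "\<And>h. h \<noteq> 0 \<Longrightarrow> \<bar>h\<bar> < d \<Longrightarrow> \<bar>diff_quot f u x h - l\<bar> < 1 / (2 * (real n + 1))"
      unfolding eventually_at by (auto simp: dist_real_def)
    obtain m :: nat where m: "1 / (real m + 1) < d"
      using reals_Archimedean[OF \<open>d > 0\<close>] by (auto simp: inverse_eq_divide add.commute)
    have "\<bar>diff_quot f u x (of_rat r) - diff_quot f u x (of_rat s)\<bar> \<le> 1 / (real n + 1)"
      if "r \<noteq> 0" "s \<noteq> 0" "\<bar>of_rat r\<bar> < 1 / (real m + 1)" "\<bar>of_rat s\<bar> < 1 / (real m + 1)" for r s :: rat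
    proof -
      define e where "e = 1 / (2 * (real n + 1))"
      have "\<bar>diff_quot f u x (of_rat r) - l\<bar> < e" "\<bar>diff_quot f u x (of_rat s) - l\<bar> < e"
        unfolding e_def using d(2) that m by (meson less_trans of_rat_eq_0_iff)+
      moreover have "1 / (real n + 1) = e + e"
        by (simp add: e_def field_simps)
      ultimately show ?thesis by (smt (verit))
    qed
    then show "\<exists>m::nat. \<forall>r s::rat. r \<noteq> 0 \<and> s \<noteq> 0 \<and> \<bar>of_rat r\<bar> < 1 / (real m + 1) \<and>
      \<bar>of_rat s\<bar> < 1 / (real m + 1) \<longrightarrow>
      \<bar>diff_quot f u x (of_rat r) - diff_quot f u x (of_rat s)\<bar> \<le> 1 / (real n + 1)" by blast
  qed
  have PI: "\<exists>l. (diff_quot f u x \<longlongrightarrow> l) (at 0)" if P: "P x" for x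
  proof (rule limit_exists_of_no_rational_gap)
    show "\<forall>\<^sub>F h in at 0. - (L * norm u) \<le> diff_quot f u x h" "\<forall>\<^sub>F h in at 0. diff_quot f u x h \<le> L * norm u"
      using norm_diff_quot_le[OF lip, of u x] by (auto intro!: always_eventually simp: abs_le_iff minus_le_iff)
    show "(at (0::real)) \<noteq> bot" by simp
    fix a b :: rat assume ab: "a < b"
    show "\<not> ((\<exists>\<^sub>F h in at 0. diff_quot f u x h < of_rat a) \<and> (\<exists>\<^sub>F h in at 0. of_rat b < diff_quot f u x h))"
    proof
      assume fr: "(\<exists>\<^sub>F h in at 0. diff_quot f u x h < of_rat a) \<and> (\<exists>\<^sub>F h in at 0. of_rat b < diff_quot f u x h)"
      have c: "continuous_on (- {0}) (diff_quot f u x)"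
        unfolding diff_quot_def
        by (intro continuous_intros continuous_on_compose2[OF lipschitz_on_continuous_on[OF lip]]) auto
      have "of_rat b - of_rat a > (0::real)" using ab by (simp add: of_rat_less)
      then obtain n :: nat where n: "1 / (real n + 1) < of_rat b - of_rat a"
        using reals_Archimedean[of "of_rat b - of_rat a :: real"] by (auto simp: inverse_eq_divide add.commute)
      obtain m :: nat where m: "\<And>r s::rat. r \<noteq> 0 \<and> s \<noteq> 0 \<and> \<bar>of_rat r\<bar> < 1 / (real m + 1) \<and>
          \<bar>of_rat s\<bar> < 1 / (real m + 1) \<Longrightarrow>
          \<bar>diff_quot f u x (of_rat r) - diff_quot f u x (of_rat s)\<bar> \<le> 1 / (real n + 1)"
        using P unfolding P_def by blast
      have mp: "1 / (real m + 1) > 0" by simp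
      obtain r :: rat where r: "r \<noteq> 0" "\<bar>of_rat r\<bar> < 1 / (real m + 1)" "diff_quot f u x (of_rat r) < of_rat a"
        using frequently_at_0_rational[OF c, of "{..<of_rat a}", OF _ _ mp] fr by auto
      obtain s :: rat where s: "s \<noteq> 0" "\<bar>of_rat s\<bar> < 1 / (real m + 1)" "diff_quot f u x (of_rat s) > of_rat b"
        using frequently_at_0_rational[OF c, of "{of_rat b<..}", OF _ _ mp] fr by auto
      have "\<bar>diff_quot f u x (of_rat r) - diff_quot f u x (of_rat s)\<bar> \<le> 1 / (real n + 1)"
        using m r s by blast
      then show False using r(3) s(3) n by linarith
    qed
  qed
  have line: "AE t in lborel. x + t *\<^sub>R u \<notin> N" for x
  proof -
    define g where "g t = f (x + t *\<^sub>R u)" for t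
    have "(L * norm u)-lipschitz_on UNIV g"
    proof (rule lipschitz_onI)
      fix s t show "dist (g s) (g t) \<le> L * norm u * dist s t"
        using lipschitz_onD[OF lip, of "x + s *\<^sub>R u" "x + t *\<^sub>R u"]
        by (simp add: g_def dist_norm mult_ac scaleR_left_diff_distrib[symmetric])
    qed (use lipschitz_on_nonneg[OF lip] in simp)
    then have "negligible {t. \<not> (\<exists>l. ((\<lambda>h. (g (t + h) - g t) / h) \<longlongrightarrow> l) (at 0))}"
      by (rule lipschitz_real_differentiable_ae)
    moreover have "{t. x + t *\<^sub>R u \<in> N} \<subseteq> {t. \<not> (\<exists>l. ((\<lambda>h. (g (t + h) - g t) / h) \<longlongrightarrow> l) (at 0))}"
    proof -
      have "(\<lambda>h. (g (t + h) - g t) / h) = diff_quot f u (x + t *\<^sub>R u)" for t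
        by (simp add: g_def diff_quot_def fun_eq_iff scaleR_add_left add.assoc)
      then show ?thesis using PD by (auto simp: N_def)
    qed
    ultimately have "negligible {t. x + t *\<^sub>R u \<in> N}" using negligible_subset by blast
    moreover have "{t. x + t *\<^sub>R u \<in> N} \<in> sets borel" by measurable
    ultimately have "{t. x + t *\<^sub>R u \<in> N} \<in> null_sets lborel"
      by (auto simp: negligible_iff_null_sets null_sets_def)
    then have "AE t in lborel. t \<notin> {t. x + t *\<^sub>R u \<in> N}" by (rule AE_not_in)
    then show ?thesis by simp
  qed
  let ?I = "\<lambda>x t. indicator {0..1::real} t * indicator N (x + t *\<^sub>R u) :: ennreal"
  have "emeasure lborel N = (\<integral>\<^sup>+t. indicator {0..1::real} t * emeasure lborel N \<partial>lborel)"
    by (simp add: nn_integral_multc)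
  also have "\<dots> = (\<integral>\<^sup>+t. (\<integral>\<^sup>+x. ?I x t \<partial>lborel) \<partial>lborel)"
  proof (intro nn_integral_cong)
    fix t :: real
    have "(\<integral>\<^sup>+x. indicator N (x + t *\<^sub>R u) \<partial>lborel) = (\<integral>\<^sup>+x. indicator N x \<partial>(distr lborel borel ((+) (t *\<^sub>R u))))"
      by (subst nn_integral_distr) (auto simp: add.commute[of "t *\<^sub>R u"])
    also have "\<dots> = emeasure lborel N" by (simp add: lborel_distr_plus)
    finally show "indicator {0..1::real} t * emeasure lborel N = (\<integral>\<^sup>+x. ?I x t \<partial>lborel)"
      by (simp add: nn_integral_cmult)
  qed
  also have "\<dots> = (\<integral>\<^sup>+x. (\<integral>\<^sup>+t. ?I x t \<partial>lborel) \<partial>lborel)"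
    by (rule lborel_pair.Fubini'[symmetric]) measurable
  also have "\<dots> = (\<integral>\<^sup>+x. 0 \<partial>(lborel :: 'a measure))"
  proof (intro nn_integral_cong)
    fix x :: 'a
    have "(\<integral>\<^sup>+t. ?I x t \<partial>lborel) = (\<integral>\<^sup>+t. 0 \<partial>(lborel :: real measure))"
      using line[of x] by (intro nn_integral_cong_AE) (auto elim!: eventually_mono)
    then show "(\<integral>\<^sup>+t. ?I x t \<partial>lborel) = 0" by simp
  qed
  finally have "N \<in> null_sets lborel" using N by (simp add: null_sets_def)
  then have "AE x in lborel. x \<notin> N" by (rule AE_not_in)
  then show ?thesis
  proof (rule eventually_mono)
    fix x assume "x \<notin> N"
    then obtain l where "(diff_quot f u x \<longlongrightarrow> l) (at 0)" using PI by (auto simp: N_def)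
    then show "(diff_quot f u x \<longlongrightarrow> dir_deriv f u x) (at 0)" using dir_deriv_eqI(1) by metis
  qed
qed

lemma dir_deriv_measurable:
  fixes f :: "'a::euclidean_space \<Rightarrow> real"
  assumes "continuous_on UNIV f"
  shows "dir_deriv f u \<in> borel_measurable borel"
proof -
  have [measurable]: "f \<in> borel_measurable borel"
    using assms by (rule borel_measurable_continuous_onI)
  show ?thesis unfolding dir_deriv_def diff_quot_def by measurable
qed

lemma dir_deriv_bounded_ae:
  fixes f :: "'a::euclidean_space \<Rightarrow> real"
  assumes lip: "L-lipschitz_on UNIV f"
  shows "AE x in lborel. \<bar>dir_deriv f u x\<bar> \<le> L * norm u"
  using dir_deriv_exists_ae[OF lip, of u]
proof eventually_elim
  case (elim x)
  have "((\<lambda>h. \<bar>diff_quot f u x h\<bar>) \<longlongrightarrow> \<bar>dir_deriv f u x\<bar>) (at 0)"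
    using elim by (rule tendsto_rabs)
  then show ?case
    by (rule tendsto_upperbound) (auto intro!: always_eventually norm_diff_quot_le[OF lip])
qed

text \<open>The density \<open>(g + C) / C\<close> gives every box its Lebesgue measure. Since Lebesgue measure is
determined by boxes and densities are unique, it equals \<open>1\<close> almost everywhere.\<close>

lemma ae_zero_if_box_integrals_zero:
  fixes g :: "'a::euclidean_space \<Rightarrow> real"
  assumes [measurable]: "g \<in> borel_measurable borel" and B: "AE x in lborel. \<bar>g x\<bar> \<le> B"
    and z: "\<And>l u. (\<integral>x. indicator (box l u) x * g x \<partial>lborel) = 0"
  shows "AE x in lborel. g x = 0"
proof -
  define C where "C = max B 1"
  have C: "C \<ge> 1" "C > 0" "B \<le> C" by (auto simp: C_def)
  define f where "f x = (g x + C) / C" for x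
  have [measurable]: "f \<in> borel_measurable borel" unfolding f_def by measurable
  have f0: "AE x in lborel. 0 \<le> f x"
    using B by eventually_elim (use C in \<open>auto simp: f_def\<close>)
  have "lborel = density lborel (\<lambda>x. ennreal (f x))"
  proof (rule lborel_eqI)
    fix l u :: 'a assume le: "\<And>b. b \<in> Basis \<Longrightarrow> l \<bullet> b \<le> u \<bullet> b"
    have ib: "integrable lborel (\<lambda>x. indicator (box l u) x :: real)"
      by (rule integrable_real_indicator) (auto simp: emeasure_lborel_box_eq)
    have ig: "integrable lborel (\<lambda>x. indicator (box l u) x * g x)"
      using B C
      by (intro Bochner_Integration.integrable_bound[OF integrable_mult_left[OF ib, of C]])
        (auto elim!: eventually_mono simp: indicator_def)
    have eq: "indicator (box l u) x * f x = indicator (box l u) x * g x / C + indicator (box l u) x" for x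
      using C by (simp add: f_def field_simps)
    have int: "integrable lborel (\<lambda>x. indicator (box l u) x * f x)"
      unfolding eq using ib ig by (intro Bochner_Integration.integrable_add integrable_divide_zero) auto
    have "emeasure (density lborel (\<lambda>x. ennreal (f x))) (box l u) = (\<integral>\<^sup>+x. ennreal (f x) * indicator (box l u) x \<partial>lborel)"
      by (simp add: emeasure_density)
    also have "\<dots> = (\<integral>\<^sup>+x. ennreal (indicator (box l u) x * f x) \<partial>lborel)"
      by (intro nn_integral_cong) (auto simp: indicator_def)
    also have "\<dots> = ennreal (\<integral>x. indicator (box l u) x * f x \<partial>lborel)"
      using int f0 by (intro nn_integral_eq_integral) (auto elim!: eventually_mono)
    also have "(\<integral>x. indicator (box l u) x * f x \<partial>lborel) = (\<integral>x. indicator (box l u) x * g x \<partial>lborel) / C + (\<integral>x. indicator (box l u) x \<partial>lborel)"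
      unfolding eq using ib ig by (subst Bochner_Integration.integral_add) auto
    also have "\<dots> = (\<Prod>b\<in>Basis. (u - l) \<bullet> b)"
      using le z by (simp add: measure_lborel_box_eq)
    finally show "emeasure (density lborel (\<lambda>x. ennreal (f x))) (box l u) = (\<Prod>b\<in>Basis. (u - l) \<bullet> b)" .
  qed simp
  then have "density lborel (\<lambda>_. 1) = density lborel (\<lambda>x. ennreal (f x))"
    by (simp add: density_1)
  then have "AE x in lborel. 1 = ennreal (f x)"
    by (intro sigma_finite_measure.density_unique[OF sigma_finite_lborel]) auto
  with f0 show ?thesis
  proof eventually_elim
    case (elim x)
    then have "f x = 1" by (metis ennreal_1 ennreal_inj zero_le_one)
    then show ?case using C by (simp add: f_def field_simps)
  qed
qed

text \<open>The small shift \<open>c n\<close> of the box is what the proof of additivity needs; in the limit it only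
matters on the frontier of the box, which is null.\<close>

lemma dir_deriv_integral_limit:
  fixes f :: "'a::euclidean_space \<Rightarrow> real"
  assumes lip: "L-lipschitz_on UNIV f" and c: "c \<longlonglongrightarrow> 0"
  shows "(\<lambda>n. \<integral>x. indicator (box l r) (x - c n) * diff_quot f u x (inverse (real (Suc n))) \<partial>lborel)
    \<longlonglongrightarrow> (\<integral>x. indicator (box l r) x * dir_deriv f u x \<partial>lborel)"
    and "integrable lborel (\<lambda>x. indicator (box l r) x * dir_deriv f u x)"
proof -
  have cf: "continuous_on UNIV f" using lip lipschitz_on_continuous_on by blast
  have [measurable]: "f \<in> borel_measurable borel"
    using cf by (rule borel_measurable_continuous_onI)
  note dir_deriv_measurable[OF cf, measurable]
  obtain K where K: "\<And>n. norm (c n) \<le> K"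
    using convergent_imp_Bseq[of c] c by (auto simp: convergent_def Bseq_def)
  obtain R where R: "\<And>x. x \<in> box l r \<Longrightarrow> norm x \<le> R"
    using bounded_box[of l r] by (auto simp: bounded_iff)
  let ?w = "\<lambda>x::'a. L * norm u * indicator (cball 0 (R + K)) x :: real"
  have w: "integrable lborel ?w"
    by (intro integrable_mult_right integrable_real_indicator) (auto intro: emeasure_bounded_finite[unfolded infinity_ennreal_def])
  have fr: "AE x in lborel. x \<notin> frontier (box l r)"
  proof -
    have "frontier (box l r) \<in> null_sets lborel"
      using negligible_convex_frontier[OF convex_box(2)[of l r]] frontier_closed[of "box l r"]
      by (auto simp: negligible_iff_null_sets null_sets_def)
    then show ?thesis by (rule AE_not_in)
  qed
  have L0: "L * norm u \<ge> 0" using lipschitz_on_nonneg[OF lip] by simp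
  have lim: "AE x in lborel. (\<lambda>n. indicator (box l r) (x - c n) * diff_quot f u x (inverse (real (Suc n))))
      \<longlonglongrightarrow> indicator (box l r) x * dir_deriv f u x"
    using dir_deriv_exists_ae[OF lip, of u] fr
  proof eventually_elim
    case (elim x)
    have xc: "(\<lambda>n. x - c n) \<longlonglongrightarrow> x" using tendsto_diff[OF tendsto_const[of x] c] by simp
    have "(\<lambda>n. indicator (box l r) (x - c n) :: real) \<longlonglongrightarrow> indicator (box l r) x"
    proof (cases "x \<in> box l r")
      case True
      then have "\<forall>\<^sub>F n in sequentially. x - c n \<in> box l r"
        using xc open_box topological_tendstoD by blast
      then have "\<forall>\<^sub>F n in sequentially. indicator (box l r) (x - c n) = (indicator (box l r) x :: real)"
        by eventually_elim (use True in simp)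
      then show ?thesis by (rule tendsto_eventually)
    next
      case False
      then have "x \<in> - closure (box l r)" using elim(2) by (simp add: frontier_def interior_open[OF open_box])
      then have "\<forall>\<^sub>F n in sequentially. x - c n \<in> - closure (box l r)"
        using topological_tendstoD[OF xc open_Compl[OF closed_closure]] by blast
      then have "\<forall>\<^sub>F n in sequentially. indicator (box l r) (x - c n) = (indicator (box l r) x :: real)"
        by eventually_elim (use False closure_subset[of "box l r"] in \<open>auto simp: indicator_def\<close>)
      then show ?thesis by (rule tendsto_eventually)
    qed
    then show ?case using dir_deriv_eqI(2)[OF elim(1)] by (rule tendsto_mult)
  qed
  have bd: "AE x in lborel. norm (indicator (box l r) (x - c n) * diff_quot f u x (inverse (real (Suc n)))) \<le> ?w x" for n
  proof (intro AE_I2)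
    fix x
    show "norm (indicator (box l r) (x - c n) * diff_quot f u x (inverse (real (Suc n)))) \<le> ?w x"
    proof (cases "x - c n \<in> box l r")
      case True
      have "norm x \<le> norm (x - c n) + norm (c n)" by (metis diff_add_cancel norm_triangle_ineq)
      then have "norm x \<le> R + K" using R[OF True] K[of n] by simp
      then show ?thesis using True norm_diff_quot_le[OF lip] by simp
    qed (use L0 in \<open>simp add: indicator_def\<close>)
  qed
  have m1: "(\<lambda>x. indicator (box l r) x * dir_deriv f u x) \<in> borel_measurable lborel" by measurable
  have m2: "(\<lambda>x. indicator (box l r) (x - c n) * diff_quot f u x (inverse (real (Suc n)))) \<in> borel_measurable lborel" for n
    unfolding diff_quot_def by measurable
  show "(\<lambda>n. \<integral>x. indicator (box l r) (x - c n) * diff_quot f u x (inverse (real (Suc n))) \<partial>lborel)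
    \<longlonglongrightarrow> (\<integral>x. indicator (box l r) x * dir_deriv f u x \<partial>lborel)"
    by (rule integral_dominated_convergence[OF m1 m2 w lim bd])
  show "integrable lborel (\<lambda>x. indicator (box l r) x * dir_deriv f u x)"
    by (rule integrable_dominated_convergence[OF m1 m2 w lim bd])
qed

text \<open>The quotient in direction \<open>u + w\<close> at \<open>x\<close> is the one in direction \<open>u\<close> at \<open>x\<close> plus the one in direction
\<open>w\<close> at \<open>x + h u\<close>. Under an integral over a box the second base point can be moved back to \<open>x\<close> by
translating the box, so both sides have the same integrals over all boxes.\<close>

lemma dir_deriv_add_ae:
  fixes f :: "'a::euclidean_space \<Rightarrow> real"
  assumes lip: "L-lipschitz_on UNIV f"
  shows "AE x in lborel. dir_deriv f (u + w) x = dir_deriv f u x + dir_deriv f w x"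
proof -
  have cf: "continuous_on UNIV f" using lip lipschitz_on_continuous_on by blast
  have [measurable]: "f \<in> borel_measurable borel"
    using cf by (rule borel_measurable_continuous_onI)
  note dir_deriv_measurable[OF cf, measurable]
  let ?g = "\<lambda>x. dir_deriv f (u + w) x - (dir_deriv f u x + dir_deriv f w x)"
  have "AE x in lborel. ?g x = 0"
  proof (rule ae_zero_if_box_integrals_zero)
    show "?g \<in> borel_measurable borel" by measurable
    show "AE x in lborel. \<bar>?g x\<bar> \<le> L * norm (u + w) + (L * norm u + L * norm w)"
      using dir_deriv_bounded_ae[OF lip, of u] dir_deriv_bounded_ae[OF lip, of w] dir_deriv_bounded_ae[OF lip, of "u+w"]
      by eventually_elim linarith
    fix l r :: 'a
    let ?h = "\<lambda>n. inverse (real (Suc n))"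
    have h0: "(\<lambda>n. ?h n *\<^sub>R u) \<longlonglongrightarrow> 0"
      using tendsto_scaleR[OF LIMSEQ_inverse_real_of_nat tendsto_const[of u]] by simp
    let ?J = "\<lambda>c v n. \<integral>x. indicator (box l r) (x - c n) * diff_quot f v x (?h n) \<partial>lborel"
    have fin: "integrable lborel (\<lambda>x. indicator (box l r) x * diff_quot f v (x + c) (?h n))" for v c n
    proof (rule Bochner_Integration.integrable_bound[where f = "\<lambda>x. L * norm v * indicator (box l r) x"])
      show "integrable lborel (\<lambda>x. L * norm v * indicator (box l r) x)"
        by (intro integrable_mult_right integrable_real_indicator) (auto simp: emeasure_lborel_box_eq)
      show "(\<lambda>x. indicator (box l r) x * diff_quot f v (x + c) (?h n)) \<in> borel_measurable lborel"
        unfolding diff_quot_def by measurable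
      show "AE x in lborel. norm (indicator (box l r) x * diff_quot f v (x + c) (?h n)) \<le> norm (L * norm v * indicator (box l r) x)"
        using norm_diff_quot_le[OF lip, of v] lipschitz_on_nonneg[OF lip]
        by (intro AE_I2) (auto simp: indicator_def)
    qed
    have eq: "?J (\<lambda>_. 0) (u + w) n = ?J (\<lambda>n. ?h n *\<^sub>R u) w n + ?J (\<lambda>_. 0) u n" for n
    proof -
      have "diff_quot f (u + w) x (?h n) = diff_quot f w (x + ?h n *\<^sub>R u) (?h n) + diff_quot f u x (?h n)" for x
        by (simp add: diff_quot_def scaleR_add_right add.assoc add_divide_distrib[symmetric] diff_divide_distrib[symmetric])
      then have "?J (\<lambda>_. 0) (u + w) n =
          (\<integral>x. indicator (box l r) x * diff_quot f w (x + ?h n *\<^sub>R u) (?h n) + indicator (box l r) x * diff_quot f u x (?h n) \<partial>lborel)"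
        by (simp add: distrib_left)
      also have "\<dots> = (\<integral>x. indicator (box l r) x * diff_quot f w (x + ?h n *\<^sub>R u) (?h n) \<partial>lborel) + ?J (\<lambda>_. 0) u n"
        using fin[of w "?h n *\<^sub>R u" n] fin[of u 0 n] by (subst Bochner_Integration.integral_add) auto
      also have "(\<integral>x. indicator (box l r) x * diff_quot f w (x + ?h n *\<^sub>R u) (?h n) \<partial>lborel) =
          (\<integral>y. indicator (box l r) (y - ?h n *\<^sub>R u) * diff_quot f w y (?h n) \<partial>(distr lborel borel ((+) (?h n *\<^sub>R u))))"
        by (subst integral_distr) (auto simp: diff_quot_def ac_simps)
      also have "\<dots> = ?J (\<lambda>n. ?h n *\<^sub>R u) w n" by (simp only: lborel_distr_plus)
      finally show ?thesis .
    qed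
    have lims: "(\<lambda>n. ?J (\<lambda>_. 0) (u + w) n) \<longlonglongrightarrow> (\<integral>x. indicator (box l r) x * dir_deriv f (u + w) x \<partial>lborel)"
      "(\<lambda>n. ?J (\<lambda>n. ?h n *\<^sub>R u) w n) \<longlonglongrightarrow> (\<integral>x. indicator (box l r) x * dir_deriv f w x \<partial>lborel)"
      "(\<lambda>n. ?J (\<lambda>_. 0) u n) \<longlonglongrightarrow> (\<integral>x. indicator (box l r) x * dir_deriv f u x \<partial>lborel)"
      by (intro dir_deriv_integral_limit(1)[OF lip] tendsto_const h0)+
    note int = dir_deriv_integral_limit(2)[OF lip tendsto_const]
    have "(\<integral>x. indicator (box l r) x * dir_deriv f (u + w) x \<partial>lborel) =
       (\<integral>x. indicator (box l r) x * dir_deriv f w x \<partial>lborel) + (\<integral>x. indicator (box l r) x * dir_deriv f u x \<partial>lborel)"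
      using LIMSEQ_unique[OF lims(1)] tendsto_add[OF lims(2,3)] unfolding eq by blast
    then show "(\<integral>x. indicator (box l r) x * ?g x \<partial>lborel) = 0"
      using int by (simp add: right_diff_distrib distrib_left)
  qed
  then show ?thesis by eventually_elim simp
qed

lemma diff_quot_scaleR:
  assumes "(diff_quot f u x \<longlongrightarrow> l) (at 0)"
  shows "(diff_quot f (c *\<^sub>R u) x \<longlongrightarrow> c * l) (at 0)"
proof (cases "c = 0")
  case True
  then show ?thesis by (simp add: diff_quot_def[abs_def])
next
  case False
  have "filterlim (\<lambda>h. h * c) (at 0) (at (0::real))"
    unfolding filterlim_at using False by (auto intro!: tendsto_eq_intros simp: eventually_at_filter)
  from filterlim_compose[OF assms this]
  have "((\<lambda>h. c * diff_quot f u x (h * c)) \<longlongrightarrow> c * l) (at 0)" by (intro tendsto_intros)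
  moreover have "c * diff_quot f u x (h * c) = diff_quot f (c *\<^sub>R u) x h" for h
    using False by (simp add: diff_quot_def)
  ultimately show ?thesis by simp
qed

lemma dir_deriv_linear_ae:
  fixes f :: "'a::euclidean_space \<Rightarrow> real"
  assumes lip: "L-lipschitz_on UNIV f"
  shows "AE x in lborel. dir_deriv f u x = (\<Sum>i\<in>Basis. (u \<bullet> i) * dir_deriv f i x)"
proof -
  have "AE x in lborel. dir_deriv f (\<Sum>i\<in>S. (u \<bullet> i) *\<^sub>R i) x = (\<Sum>i\<in>S. (u \<bullet> i) * dir_deriv f i x)"
    if "finite S" for S :: "'a set"
    using that
  proof induction
    case empty
    have "dir_deriv f 0 x = 0" for x by (simp add: dir_deriv_def diff_quot_def)
    then show ?case by simp
  next
    case (insert j S)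
    show ?case
      using insert.IH dir_deriv_add_ae[OF lip, of "(u \<bullet> j) *\<^sub>R j" "\<Sum>i\<in>S. (u \<bullet> i) *\<^sub>R i"]
        dir_deriv_exists_ae[OF lip, of j]
    proof eventually_elim
      case (elim x)
      have "dir_deriv f ((u \<bullet> j) *\<^sub>R j) x = (u \<bullet> j) * dir_deriv f j x"
        using diff_quot_scaleR[OF elim(3)] by (rule dir_deriv_eqI(1))
      then show ?case using elim insert.hyps by simp
    qed
  qed
  from this[OF finite_Basis] show ?thesis by (simp add: euclidean_representation)
qed

text \<open>Linearity of the candidate is assumed, so what is missing is uniformity over directions. The
Lipschitz bound and compactness of the unit sphere reduce it to finitely many directions of \<open>Q\<close>.\<close>

lemma has_derivative_if_dense_directions:
  fixes f :: "'a::euclidean_space \<Rightarrow> real"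
  assumes lip: "L-lipschitz_on UNIV f" and "linear l"
    and dense: "\<And>X. open X \<Longrightarrow> X \<noteq> {} \<Longrightarrow> \<exists>u\<in>Q. u \<in> X"
    and l: "\<And>u. u \<in> Q \<Longrightarrow> (diff_quot f u x \<longlongrightarrow> l u) (at 0)"
  shows "(f has_derivative l) (at x)"
  unfolding has_derivative_at_alt
proof (intro conjI allI impI)
  show bl: "bounded_linear l" using \<open>linear l\<close> by (simp add: linear_linear)
  fix e :: real assume "e > 0"
  obtain K where K: "K > 0" "\<And>h. \<bar>l h\<bar> \<le> K * norm h"
    using bounded_linear.pos_bounded[OF bl] by (auto simp: mult.commute)
  have L0: "L \<ge> 0" using lipschitz_on_nonneg[OF lip] .
  define \<eta> where "\<eta> = e / (L + K + 1)"
  have \<eta>: "\<eta> > 0" "(L + K + 1) * \<eta> = e" using \<open>e > 0\<close> L0 K by (auto simp: \<eta>_def field_simps)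
  have "sphere (0::'a) 1 \<subseteq> (\<Union>u\<in>Q. ball u \<eta>)"
  proof
    fix x :: 'a
    obtain u where "u \<in> Q" "u \<in> ball x \<eta>" using dense[of "ball x \<eta>"] \<eta> by auto
    then show "x \<in> (\<Union>u\<in>Q. ball u \<eta>)" by (auto simp: dist_commute)
  qed
  then obtain T where T: "T \<subseteq> Q" "finite T" "sphere (0::'a) 1 \<subseteq> (\<Union>u\<in>T. ball u \<eta>)"
    using compactE_image[OF compact_sphere, of Q "\<lambda>u. ball u \<eta>"] by (metis open_ball)
  have "\<forall>\<^sub>F h in at 0. \<forall>u\<in>T. dist (diff_quot f u x h) (l u) < \<eta>"
    using T l \<eta> by (intro eventually_ball_finite ballI tendstoD) auto
  then obtain d where d: "d > 0" "\<And>h u. h \<noteq> 0 \<Longrightarrow> \<bar>h\<bar> < d \<Longrightarrow> u \<in> T \<Longrightarrow> \<bar>diff_quot f u x h - l u\<bar> < \<eta>"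
    unfolding eventually_at by (auto simp: dist_real_def)
  show "\<exists>d>0. \<forall>y. norm (y - x) < d \<longrightarrow> norm (f y - f x - l (y - x)) \<le> e * norm (y - x)"
  proof (intro exI[of _ d] conjI allI impI \<open>d > 0\<close>)
    fix y assume y: "norm (y - x) < d"
    show "norm (f y - f x - l (y - x)) \<le> e * norm (y - x)"
    proof (cases "y = x")
      case True
      then show ?thesis using linear_0[OF \<open>linear l\<close>] by simp
    next
      case False
      define h where "h = norm (y - x)"
      define w where "w = (y - x) /\<^sub>R h"
      have h: "h > 0" "h < d" using False y by (auto simp: h_def)
      have yx: "y = x + h *\<^sub>R w" using h by (simp add: w_def)
      have "norm w = 1" using h by (simp add: w_def h_def)
      then have "w \<in> sphere 0 1" by simp
      then obtain u where u: "u \<in> T" "dist u w < \<eta>" using T(3) by fastforce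
      have a: "\<bar>f (x + h *\<^sub>R w) - f (x + h *\<^sub>R u)\<bar> \<le> h * (L * \<eta>)"
      proof -
        have "\<bar>f (x + h *\<^sub>R w) - f (x + h *\<^sub>R u)\<bar> \<le> L * (h * dist u w)"
          using lipschitz_onD[OF lip, of "x + h *\<^sub>R w" "x + h *\<^sub>R u"] h
          by (simp add: dist_norm scaleR_right_diff_distrib[symmetric] norm_minus_commute)
        also have "\<dots> \<le> L * (h * \<eta>)" using u h L0 by (intro mult_left_mono) auto
        finally show ?thesis by (simp add: mult_ac)
      qed
      have "\<bar>diff_quot f u x h - l u\<bar> < \<eta>" using d(2) h u by auto
      then have "h * \<bar>diff_quot f u x h - l u\<bar> \<le> h * \<eta>" using h by simp
      moreover have "h * \<bar>diff_quot f u x h - l u\<bar> = \<bar>f (x + h *\<^sub>R u) - f x - h * l u\<bar>"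
      proof -
        have "h * (diff_quot f u x h - l u) = f (x + h *\<^sub>R u) - f x - h * l u"
          using h by (simp add: diff_quot_def field_simps)
        then show ?thesis using h by (metis abs_mult abs_of_pos)
      qed
      ultimately have b: "\<bar>f (x + h *\<^sub>R u) - f x - h * l u\<bar> \<le> h * \<eta>" by simp
      have "\<bar>l (u - w)\<bar> \<le> K * \<eta>"
        using K(2)[of "u - w"] u K(1) by (smt (verit, best) dist_norm mult_left_mono)
      then have "h * \<bar>l (u - w)\<bar> \<le> h * (K * \<eta>)" using h by simp
      moreover have "h * l u - l (y - x) = h * l (u - w)"
        using linear_diff[OF \<open>linear l\<close>] linear_scale[OF \<open>linear l\<close>] by (simp add: yx right_diff_distrib)
      ultimately have c: "\<bar>h * l u - l (y - x)\<bar> \<le> h * (K * \<eta>)" using h by (simp add: abs_mult)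
      have "\<bar>f y - f x - l (y - x)\<bar> \<le> h * (L * \<eta>) + h * \<eta> + h * (K * \<eta>)"
        using a b c unfolding yx by linarith
      also have "\<dots> = e * h" by (simp add: \<eta>(2)[symmetric] algebra_simps)
      finally show ?thesis by (simp add: h_def)
    qed
  qed
qed

lemma rademacher_real:
  fixes f :: "'a::euclidean_space \<Rightarrow> real"
  assumes lip: "L-lipschitz_on UNIV f"
  shows "negligible {x. \<not> f differentiable (at x)}"
proof -
  obtain Q :: "'a set" where Q: "countable Q" "\<And>X. open X \<Longrightarrow> X \<noteq> {} \<Longrightarrow> \<exists>u\<in>Q. u \<in> X"
    using countable_dense_exists by blast
  have "AE x in lborel. \<forall>u\<in>Q. (diff_quot f u x \<longlongrightarrow> dir_deriv f u x) (at 0) \<and>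
      dir_deriv f u x = (\<Sum>i\<in>Basis. (u \<bullet> i) * dir_deriv f i x)"
    unfolding AE_ball_countable[OF Q(1)]
    using dir_deriv_exists_ae[OF lip] dir_deriv_linear_ae[OF lip] by (auto intro: AE_conjI)
  then have "AE x in lborel. f differentiable (at x)"
  proof eventually_elim
    case (elim x)
    have "(f has_derivative (\<lambda>u. \<Sum>i\<in>Basis. (u \<bullet> i) * dir_deriv f i x)) (at x)"
    proof (rule has_derivative_if_dense_directions[OF lip _ Q(2)])
      show "linear (\<lambda>u. \<Sum>i\<in>Basis. (u \<bullet> i) * dir_deriv f i x)"
        by (intro linearI) (simp_all add: inner_add_left algebra_simps sum.distrib sum_distrib_left)
    qed (use elim in auto)
    then show ?case unfolding differentiable_def by blast
  qed
  then show ?thesis by (rule negligible_if_ae)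
qed

theorem rademacher:
  fixes f :: "'a::euclidean_space \<Rightarrow> 'b::euclidean_space"
  assumes lip: "L-lipschitz_on UNIV f"
  shows "negligible {x. \<not> f differentiable (at x)}"
proof -
  have "negligible {x. \<not> (\<lambda>x. f x \<bullet> i) differentiable (at x)}" if "i \<in> Basis" for i
  proof (rule rademacher_real)
    show "L-lipschitz_on UNIV (\<lambda>x. f x \<bullet> i)"
    proof (rule lipschitz_onI)
      fix x y
      have "\<bar>(f x - f y) \<bullet> i\<bar> \<le> norm (f x - f y)" using that by (rule Basis_le_norm)
      then show "dist (f x \<bullet> i) (f y \<bullet> i) \<le> L * dist x y"
        using lipschitz_onD[OF lip, of x y] by (simp add: dist_norm inner_diff_left)
    qed (use lipschitz_on_nonneg[OF lip] in simp)
  qed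
  then have "negligible (\<Union>i\<in>Basis. {x. \<not> (\<lambda>x. f x \<bullet> i) differentiable (at x)})"
    by (intro negligible_Union) auto
  moreover have "{x. \<not> f differentiable (at x)} \<subseteq> (\<Union>i\<in>Basis. {x. \<not> (\<lambda>x. f x \<bullet> i) differentiable (at x)})"
    using differentiable_componentwise_within[of f _ UNIV] by auto
  ultimately show ?thesis using negligible_subset by blast
qed

lemma differentiable_transform_open:
  assumes "f differentiable (at x)" "open S" "x \<in> S" "\<And>y. y \<in> S \<Longrightarrow> f y = g y"
  shows "g differentiable (at x)"
  using assms has_derivative_transform_within_open unfolding differentiable_def by blast

text \<open>The nearest-point projection extends a Lipschitz function from the ball to the whole space.\<close>

lemma rademacher_ball:
  fixes f :: "'a::euclidean_space \<Rightarrow> 'b::euclidean_space"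
  assumes lip: "L-lipschitz_on (ball a r) f"
  shows "negligible {x \<in> ball a r. \<not> f differentiable (at x)}"
proof (cases "r > 0")
  case False
  then show ?thesis by (simp add: ball_empty)
next
  case True
  obtain g where g: "L-lipschitz_on (closure (ball a r)) g" "\<And>x. x \<in> ball a r \<Longrightarrow> g x = f x"
    using lipschitz_extend_closure[OF lip] by blast
  let ?p = "closest_point (cball a r)"
  have ne: "cball a r \<noteq> {}" using True by auto
  have p: "?p x \<in> cball a r" for x by (rule closest_point_in_set[OF closed_cball ne])
  have "L-lipschitz_on UNIV (\<lambda>x. g (?p x))"
  proof (rule lipschitz_onI)
    show L: "0 \<le> L" by (rule lipschitz_on_nonneg[OF lip])
    fix x y
    have "dist (g (?p x)) (g (?p y)) \<le> L * dist (?p x) (?p y)"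
      using lipschitz_onD[OF g(1)] p True by (simp add: closure_ball)
    also have "\<dots> \<le> L * dist x y"
      by (intro mult_left_mono closest_point_lipschitz) (use L ne in auto)
    finally show "dist (g (?p x)) (g (?p y)) \<le> L * dist x y" .
  qed
  then have "negligible {x. \<not> (\<lambda>x. g (?p x)) differentiable (at x)}" by (rule rademacher)
  moreover have "{x \<in> ball a r. \<not> f differentiable (at x)} \<subseteq> {x. \<not> (\<lambda>x. g (?p x)) differentiable (at x)}"
  proof clarify
    fix x assume x: "x \<in> ball a r" and nd: "\<not> f differentiable (at x)" and d: "(\<lambda>x. g (?p x)) differentiable (at x)"
    have "g (?p y) = f y" if "y \<in> ball a r" for y
      using that g(2) closest_point_self[of y "cball a r"] by auto
    then show False using differentiable_transform_open[OF d open_ball x] nd by blast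
  qed
  ultimately show ?thesis using negligible_subset by blast
qed

section \<open>Slices of null sets and derivatives of pointwise limits\<close>

text \<open>The null set is first enclosed in a Borel null set, to which Fubini's theorem on the product of the
Borel measures applies.\<close>

lemma negligible_prod_slices:
  fixes Z :: "(real \<times> 'b::euclidean_space) set"
  assumes "negligible Z"
  shows "negligible {y. \<not> negligible {t. (t, y) \<in> Z}}"
proof -
  have "AE z in lborel. z \<notin> Z" using assms by (intro ae_if_negligible) simp
  then obtain N where N: "Z \<subseteq> N" "N \<in> null_sets lborel"
    by (auto simp: eventually_ae_filter)
  have eq: "(lborel :: real measure) \<Otimes>\<^sub>M (lborel :: 'b measure) = lborel" by (rule lborel_prod)
  have Nm: "N \<in> sets ((lborel :: real measure) \<Otimes>\<^sub>M (lborel :: 'b measure))"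
    unfolding eq using N(2) by blast
  have "AE z in lborel. z \<notin> N" using N(2) by (rule AE_not_in)
  then have "AE z in (lborel :: real measure) \<Otimes>\<^sub>M (lborel :: 'b measure). z \<notin> N"
    unfolding eq .
  then have "AE t in lborel. AE y in lborel. (t, y) \<notin> N" by (rule lborel_pair.AE_pair)
  then have "AE y in lborel. AE t in lborel. (t, y) \<notin> N"
    using lborel_pair.AE_commute[of "\<lambda>t y. (t, y) \<notin> N"] sets.Diff[OF sets.top Nm] by (simp add: set_diff_eq)
  then have "AE y in lborel. negligible {t. (t, y) \<in> Z}"
  proof (rule eventually_mono)
    fix y assume "AE t in lborel. (t, y) \<notin> N"
    then have "negligible {t. \<not> (t, y) \<notin> N}" by (rule negligible_if_ae)
    then show "negligible {t. (t, y) \<in> Z}" by (rule negligible_subset) (use N in auto)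
  qed
  then show ?thesis by (rule negligible_if_ae)
qed

text \<open>The fundamental theorem of calculus for a Lipschitz function: the integral of a difference quotient is
a difference of two mean values of \<open>P\<close>, which tend to the values at the end points.\<close>

lemma integral_dir_deriv_lipschitz:
  fixes P :: "real \<Rightarrow> real"
  assumes lip: "L-lipschitz_on UNIV P" and "l \<le> u"
  shows "(\<integral>t. indicator (box l u) t * dir_deriv P 1 t \<partial>lborel) = P u - P l"
proof -
  have cP: "continuous_on UNIV P" using lip lipschitz_on_continuous_on by blast
  then have cP': "continuous_on A P" for A using continuous_on_subset by blast
  let ?h = "\<lambda>n. inverse (real (Suc n))"
  define A where "A t = integral {l..t} P" for t
  have dA: "(A has_vector_derivative P t) (at t within {l..u + 1})" if "t \<in> {l..u+1}" for t
    unfolding A_def using integral_has_vector_derivative[OF cP' that] .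
  have DA: "((\<lambda>t. A (t + h)) has_vector_derivative P (t + h)) (at t within {l..u})"
    if "t \<in> {l..u}" "0 \<le> h" "h \<le> 1" for t h
  proof -
    have "(A has_vector_derivative P (t + h)) (at (t + h) within (\<lambda>t. t + h) ` {l..u})"
      by (rule has_vector_derivative_within_subset[OF dA]) (use that in auto)
    from vector_diff_chain_within[OF _ this, of 1]
    moreover have "((\<lambda>t. t + h) has_vector_derivative 1) (at t within {l..u})"
      by (simp flip: has_real_derivative_iff_has_vector_derivative) (auto intro!: derivative_eq_intros)
    ultimately show ?thesis by (auto simp: o_def)
  qed
  have eq: "(\<integral>t. indicator (box l u) (t - 0) * diff_quot P 1 t (?h n) \<partial>lborel) =
      (A (u + ?h n) - A u) / ?h n - (A (l + ?h n) - A l) / ?h n" for n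
  proof -
    have h: "0 < ?h n" "?h n \<le> 1" by (auto simp: field_simps)
    have "(\<integral>t. indicator (box l u) (t - 0) * diff_quot P 1 t (?h n) \<partial>lborel) =
        (\<integral>t. indicator {l..u} t *\<^sub>R diff_quot P 1 t (?h n) \<partial>lborel)"
    proof (rule integral_cong_AE)
      have [measurable]: "P \<in> borel_measurable borel" using cP by (rule borel_measurable_continuous_onI)
      show "(\<lambda>t. indicator (box l u) (t - 0) * diff_quot P 1 t (?h n)) \<in> borel_measurable lborel"
        "(\<lambda>t. indicator {l..u} t *\<^sub>R diff_quot P 1 t (?h n)) \<in> borel_measurable lborel"
        unfolding diff_quot_def by measurable
      have "AE t in lborel. t \<noteq> l \<and> t \<noteq> u" using AE_lborel_singleton[of l] AE_lborel_singleton[of u] by eventually_elim simp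
      then show "AE t in lborel. indicator (box l u) (t - 0) * diff_quot P 1 t (?h n) = indicator {l..u} t *\<^sub>R diff_quot P 1 t (?h n)"
        by eventually_elim (auto simp: indicator_def)
    qed
    also have "\<dots> = (A (u + ?h n) - A u) / ?h n - (A (l + ?h n) - A l) / ?h n"
    proof (rule integral_FTC_atLeastAtMost[OF \<open>l \<le> u\<close>, where F = "\<lambda>t. (A (t + ?h n) - A t) / ?h n"])
      fix t assume t: "l \<le> t" "t \<le> u"
      have "((\<lambda>t. (A (t + ?h n) - A (t + 0)) / ?h n) has_vector_derivative (P (t + ?h n) - P (t + 0)) / ?h n) (at t within {l..u})"
        by (intro derivative_intros has_vector_derivative_divide DA) (use t h in auto)
      then show "((\<lambda>t. (A (t + ?h n) - A t) / ?h n) has_vector_derivative diff_quot P 1 t (?h n)) (at t within {l..u})"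
        by (simp add: diff_quot_def)
    next
      show "continuous_on {l..u} (\<lambda>t. diff_quot P 1 t (?h n))"
        unfolding diff_quot_def by (intro continuous_intros continuous_on_compose2[OF cP]) auto
    qed
    finally show ?thesis .
  qed
  have lim: "(\<lambda>n. (A (t + ?h n) - A t) / ?h n) \<longlonglongrightarrow> P t" if "t \<in> {l..u}" for t
  proof -
    have "(A has_real_derivative P t) (at t within {t..u+1})"
      using has_vector_derivative_within_subset[OF dA, of t "{t..u+1}"] that
      by (auto simp: has_real_derivative_iff_has_vector_derivative)
    then have "((\<lambda>s. (A s - A t) / (s - t)) \<longlongrightarrow> P t) (at t within {t..u+1})"
      by (simp add: has_field_derivative_iff)
    moreover have "filterlim (\<lambda>n. t + ?h n) (at t within {t..u+1}) sequentially"
      unfolding filterlim_at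
    proof (intro conjI)
      show "\<forall>\<^sub>F n in sequentially. t + ?h n \<in> {t..u+1} \<and> t + ?h n \<noteq> t"
      proof (intro always_eventually allI)
        fix n
        have "0 < ?h n" "?h n \<le> 1" by (auto simp: field_simps)
        then show "t + ?h n \<in> {t..u+1} \<and> t + ?h n \<noteq> t" using that by auto
      qed
      show "(\<lambda>n. t + ?h n) \<longlonglongrightarrow> t"
        using tendsto_add[OF tendsto_const[of t] LIMSEQ_inverse_real_of_nat] by simp
    qed
    ultimately show ?thesis by (auto dest: filterlim_compose)
  qed
  have "(\<lambda>n. \<integral>t. indicator (box l u) (t - 0) * diff_quot P 1 t (?h n) \<partial>lborel) \<longlonglongrightarrow> P u - P l"
    unfolding eq using assms(2) by (intro tendsto_diff lim) auto
  then show ?thesis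
    using dir_deriv_integral_limit(1)[OF lip tendsto_const, of l u 1] LIMSEQ_unique by blast
qed

lemma has_real_derivative_iff_diff_quot:
  "(f has_real_derivative l) (at x) \<longleftrightarrow> (diff_quot f 1 x \<longlongrightarrow> l) (at 0)"
  by (simp add: DERIV_def diff_quot_def[abs_def])

text \<open>Integrating \<open>q n\<close> and passing to the limit by dominated convergence, the increments of \<open>P\<close> are the
integrals of \<open>k\<close>; being Lipschitz, \<open>P\<close> is also the integral of its own derivative. The two
integrands agree almost everywhere because their integrals over all intervals do. This is the tool
that exchanges the time derivative with the differential in the initial value.\<close>

lemma ae_derivative_of_pointwise_limit:
  fixes Q q :: "nat \<Rightarrow> real \<Rightarrow> real"
  assumes dQ: "\<And>n t. t \<in> {a..b} \<Longrightarrow> (Q n has_real_derivative q n t) (at t)"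
    and cq: "\<And>n. continuous_on {a..b} (q n)"
    and bd: "\<And>n t. t \<in> {a..b} \<Longrightarrow> \<bar>q n t\<bar> \<le> B"
    and lQ: "\<And>t. t \<in> {a..b} \<Longrightarrow> (\<lambda>n. Q n t) \<longlonglongrightarrow> P t"
    and lq: "negligible {t \<in> {a..b}. \<not> (\<lambda>n. q n t) \<longlonglongrightarrow> k t}"
  shows "negligible {t \<in> {a<..<b}. \<not> (P has_real_derivative k t) (at t)}"
proof (cases "a < b")
  case False
  then show ?thesis by auto
next
  case True
  have B0: "B \<ge> 0" using bd[of a 0] True by auto
  \<comment> \<open>Clamping extends \<open>P\<close> from \<open>[a, b]\<close> to a Lipschitz function \<open>R\<close> on the line.\<close>
  define r where "r t = max a (min b t)" for t
  have r: "r t \<in> {a..b}" for t using True by (auto simp: r_def)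
  define R where "R t = P (r t)" for t
  have Plip: "\<bar>P s - P t\<bar> \<le> B * \<bar>s - t\<bar>" if "s \<in> {a..b}" "t \<in> {a..b}" for s t
  proof (rule tendsto_upperbound)
    show "(\<lambda>n. \<bar>Q n s - Q n t\<bar>) \<longlonglongrightarrow> \<bar>P s - P t\<bar>" using that by (intro tendsto_intros lQ)
    show "\<forall>\<^sub>F n in sequentially. \<bar>Q n s - Q n t\<bar> \<le> B * \<bar>s - t\<bar>"
    proof (intro always_eventually allI)
      fix n
      have "norm (Q n s - Q n t) \<le> B * norm (s - t)"
        by (rule field_differentiable_bound[of "{a..b}" _ "q n"])
          (use that dQ bd in \<open>auto intro: has_field_derivative_at_within\<close>)
      then show "\<bar>Q n s - Q n t\<bar> \<le> B * \<bar>s - t\<bar>" by simp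
    qed
  qed simp
  have Rlip: "B-lipschitz_on UNIV R"
  proof (rule lipschitz_onI)
    fix s t
    have "\<bar>R s - R t\<bar> \<le> B * \<bar>r s - r t\<bar>" unfolding R_def by (rule Plip[OF r r])
    also have "\<dots> \<le> B * \<bar>s - t\<bar>" by (rule mult_left_mono[OF _ B0]) (auto simp: r_def)
    finally show "dist (R s) (R t) \<le> B * dist s t" by (simp add: dist_real_def)
  qed (rule B0)
  note dir_deriv_measurable[OF lipschitz_on_continuous_on[OF Rlip], measurable]
  define q' where "q' n t = (if t \<in> {a..b} then q n t else 0)" for n t
  have [measurable]: "q' n \<in> borel_measurable borel" for n
  proof -
    have "(\<lambda>t. indicator {a..b} t *\<^sub>R q n t) \<in> borel_measurable borel"
      using borel_measurable_continuous_on_indicator[OF _ cq[of n]] by simp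
    moreover have "(\<lambda>t. indicator {a..b} t *\<^sub>R q n t) = q' n" by (auto simp: q'_def indicator_def)
    ultimately show ?thesis by simp
  qed
  define k' where "k' t = lim (\<lambda>n. q' n t)" for t
  have [measurable]: "k' \<in> borel_measurable borel" unfolding k'_def[abs_def] by measurable
  have ael: "AE t in lborel. t \<in> {a..b} \<longrightarrow> (\<lambda>n. q n t) \<longlonglongrightarrow> k t"
    using lq by (intro ae_if_negligible) (simp add: Collect_conj_eq)
  have aek: "AE t in lborel. (\<lambda>n. q' n t) \<longlonglongrightarrow> k' t" "AE t in lborel. t \<in> {a..b} \<longrightarrow> k' t = k t"
  proof -
    have 1: "AE t in lborel. (\<lambda>n. q' n t) \<longlonglongrightarrow> (if t \<in> {a..b} then k t else 0)"
      using ael by eventually_elim (auto simp: q'_def)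
    then show "AE t in lborel. (\<lambda>n. q' n t) \<longlonglongrightarrow> k' t" "AE t in lborel. t \<in> {a..b} \<longrightarrow> k' t = k t"
      by (eventually_elim, auto simp: k'_def limI)+
  qed
  have bq': "\<bar>q' n t\<bar> \<le> B" for n t using bd B0 by (auto simp: q'_def)
  let ?g = "\<lambda>t. indicator {a..b} t * (dir_deriv R 1 t - k' t)"
  have "AE t in lborel. ?g t = 0"
  proof (rule ae_zero_if_box_integrals_zero)
    show "?g \<in> borel_measurable borel" by measurable
    have "AE t in lborel. \<bar>k' t\<bar> \<le> B"
      using aek(1)
    proof eventually_elim
      case (elim t)
      have "(\<lambda>n. \<bar>q' n t\<bar>) \<longlonglongrightarrow> \<bar>k' t\<bar>" using elim by (rule tendsto_rabs)
      then show ?case by (rule tendsto_upperbound) (use bq' in auto)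
    qed
    then show "AE t in lborel. \<bar>?g t\<bar> \<le> B + B"
      using dir_deriv_bounded_ae[OF Rlip, of 1]
      by eventually_elim (use B0 in \<open>auto simp: indicator_def\<close>)
    fix l u :: real
    define l' where "l' = max a l"
    define u' where "u' = min b u"
    have ae: "AE t in lborel. indicator (box l u) t * ?g t = indicator (box l' u') t * dir_deriv R 1 t - indicator (box l' u') t * k' t"
    proof -
      have "AE t in lborel. t \<noteq> a \<and> t \<noteq> b" using AE_lborel_singleton[of a] AE_lborel_singleton[of b] by eventually_elim simp
      then show ?thesis by eventually_elim (auto simp: indicator_def l'_def u'_def)
    qed
    show "(\<integral>t. indicator (box l u) t * ?g t \<partial>lborel) = 0"
    proof (cases "l' \<le> u'")
      case False
      then have "box l' u' = {}" by auto
      then have "AE t in lborel. indicator (box l u) t * ?g t = 0" using ae by simp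
      then show ?thesis by (subst integral_cong_AE[where g = "\<lambda>_. 0"]) auto
    next
      case True
      have lu: "{l'..u'} \<subseteq> {a..b}" by (auto simp: l'_def u'_def)
      have w: "integrable lborel (\<lambda>t. B * indicator (box l' u') t)"
        using True by (intro integrable_mult_right integrable_real_indicator) auto
      have m1: "(\<lambda>t. indicator (box l' u') t * k' t) \<in> borel_measurable lborel" by measurable
      have m2: "(\<lambda>t. indicator (box l' u') t * q' n t) \<in> borel_measurable lborel" for n by measurable
      have cv: "AE t in lborel. (\<lambda>n. indicator (box l' u') t * q' n t) \<longlonglongrightarrow> indicator (box l' u') t * k' t"
        using aek(1) by eventually_elim (intro tendsto_intros)
      have dm: "AE t in lborel. norm (indicator (box l' u') t * q' n t) \<le> B * indicator (box l' u') t" for n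
        using bq' by (intro AE_I2) (auto simp: indicator_def)
      have "(\<lambda>n. \<integral>t. indicator (box l' u') t * q' n t \<partial>lborel) \<longlonglongrightarrow> (\<integral>t. indicator (box l' u') t * k' t \<partial>lborel)"
        by (rule integral_dominated_convergence[OF m1 m2 w cv dm])
      moreover have "(\<integral>t. indicator (box l' u') t * q' n t \<partial>lborel) = Q n u' - Q n l'" for n
      proof -
        have "(\<integral>t. indicator (box l' u') t * q' n t \<partial>lborel) = (\<integral>t. indicator {l'..u'} t *\<^sub>R q n t \<partial>lborel)"
        proof (rule integral_cong_AE)
          show "(\<lambda>t. indicator (box l' u') t * q' n t) \<in> borel_measurable lborel" by measurable
          have "(\<lambda>t. indicator {l'..u'} t *\<^sub>R q n t) = (\<lambda>t. indicator {l'..u'} t *\<^sub>R q' n t)"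
            using lu by (auto simp: q'_def indicator_def)
          then show "(\<lambda>t. indicator {l'..u'} t *\<^sub>R q n t) \<in> borel_measurable lborel" by simp
          have "AE t in lborel. t \<noteq> l' \<and> t \<noteq> u'" using AE_lborel_singleton[of l'] AE_lborel_singleton[of u'] by eventually_elim simp
          then show "AE t in lborel. indicator (box l' u') t * q' n t = indicator {l'..u'} t *\<^sub>R q n t"
            by eventually_elim (use lu in \<open>auto simp: indicator_def q'_def\<close>)
        qed
        also have "\<dots> = Q n u' - Q n l'"
        proof (rule integral_FTC_atLeastAtMost[OF True])
          fix t assume "l' \<le> t" "t \<le> u'"
          then have "t \<in> {a..b}" using lu by auto
          then show "(Q n has_vector_derivative q n t) (at t within {l'..u'})"
            using dQ has_real_derivative_iff_has_vector_derivative has_vector_derivative_at_within by blast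
        qed (rule continuous_on_subset[OF cq lu])
        finally show ?thesis .
      qed
      moreover have "(\<lambda>n. Q n u' - Q n l') \<longlonglongrightarrow> P u' - P l'"
        using True lu by (intro tendsto_diff lQ) auto
      ultimately have I2: "(\<integral>t. indicator (box l' u') t * k' t \<partial>lborel) = P u' - P l'"
        using LIMSEQ_unique by simp
      have "r u' = u'" "r l' = l'" using True \<open>a < b\<close> by (auto simp: r_def l'_def u'_def)
      then have I1: "(\<integral>t. indicator (box l' u') t * dir_deriv R 1 t \<partial>lborel) = P u' - P l'"
        using integral_dir_deriv_lipschitz[OF Rlip True] by (simp add: R_def)
      have "(\<integral>t. indicator (box l u) t * ?g t \<partial>lborel) =
          (\<integral>t. indicator (box l' u') t * dir_deriv R 1 t - indicator (box l' u') t * k' t \<partial>lborel)"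
        by (rule integral_cong_AE[OF _ _ ae]) measurable
      also have "\<dots> = (\<integral>t. indicator (box l' u') t * dir_deriv R 1 t \<partial>lborel) - (\<integral>t. indicator (box l' u') t * k' t \<partial>lborel)"
        by (intro Bochner_Integration.integral_diff dir_deriv_integral_limit(2)[OF Rlip tendsto_const]
            integrable_dominated_convergence[OF m1 m2 w cv dm])
      finally show ?thesis using I1 I2 by simp
    qed
  qed
  then have "AE t in lborel. \<not> (t \<in> {a<..<b} \<and> \<not> (P has_real_derivative k t) (at t))"
    using dir_deriv_exists_ae[OF Rlip, of 1] aek(2)
  proof eventually_elim
    case (elim t)
    show ?case
    proof
      assume t: "t \<in> {a<..<b} \<and> \<not> (P has_real_derivative k t) (at t)"
      then have "dir_deriv R 1 t = k t" using elim by (auto simp: indicator_def)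
      then have "(R has_real_derivative k t) (at t)"
        using elim(2) by (simp add: has_real_derivative_iff_diff_quot)
      then have "(P has_real_derivative k t) (at t)"
        by (rule has_field_derivative_transform_within_open[of _ _ _ "{a<..<b}"])
          (use t in \<open>auto simp: R_def r_def\<close>)
      then show False using t by blast
    qed
  qed
  from negligible_if_ae[OF this] show ?thesis by (rule negligible_subset) auto
qed

section \<open>Local flows of Lipschitz vector fields\<close>

lemma vector_derivative_bound:
  fixes f :: "real \<Rightarrow> 'e::real_normed_vector"
  assumes "convex S" and d: "\<And>x. x \<in> S \<Longrightarrow> (f has_vector_derivative f' x) (at x within S)"
    and B: "\<And>x. x \<in> S \<Longrightarrow> norm (f' x) \<le> B" and "x \<in> S" "y \<in> S"
  shows "norm (f x - f y) \<le> B * \<bar>x - y\<bar>"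
proof -
  have "norm (f x - f y) \<le> B * norm (x - y)"
  proof (rule differentiable_bound[OF \<open>convex S\<close> _ _ \<open>x \<in> S\<close> \<open>y \<in> S\<close>])
    show "(f has_derivative (\<lambda>h. h *\<^sub>R f' x)) (at x within S)" if "x \<in> S" for x
      using d[OF that] by (simp add: has_vector_derivative_def)
    show "onorm (\<lambda>h. h *\<^sub>R f' x) \<le> B" if "x \<in> S" for x
      by (rule onorm_le) (use mult_left_mono[OF B[OF that] abs_ge_zero] in \<open>simp add: mult.commute\<close>)
  qed
  then show ?thesis by simp
qed

text \<open>Let \<open>m\<close> be the largest distance of the solutions on an interval on which \<open>\<eta> K \<le> 1 / 2\<close>. The derivative of
the difference is at most \<open>K m\<close>, so \<open>m\<close> is at most the initial distance plus \<open>m / 2\<close>.\<close>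

lemma ode_solutions_close:
  fixes u w :: "real \<Rightarrow> 'e::real_normed_vector"
  assumes u: "\<And>t. t \<in> ball t0 \<eta> \<Longrightarrow> (u has_vector_derivative F (u t)) (at t)" "\<And>t. t \<in> ball t0 \<eta> \<Longrightarrow> u t \<in> S"
    and w: "\<And>t. t \<in> ball t0 \<eta> \<Longrightarrow> (w has_vector_derivative F (w t)) (at t)" "\<And>t. t \<in> ball t0 \<eta> \<Longrightarrow> w t \<in> S"
    and lip: "K-lipschitz_on S F" and \<eta>: "\<eta> * K \<le> 1 / 2" and t: "t \<in> ball t0 \<eta>"
  shows "norm (u t - w t) \<le> 2 * norm (u t0 - w t0)"
proof -
  define \<tau> where "\<tau> = \<bar>t - t0\<bar>"
  define J where "J = {t0 - \<tau>..t0 + \<tau>}"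
  have J: "J \<subseteq> ball t0 \<eta>" "t \<in> J" "t0 \<in> J" "convex J" "compact J" "J \<noteq> {}"
    using t by (auto simp: J_def \<tau>_def dist_real_def)
  have K: "K \<ge> 0" using lipschitz_on_nonneg[OF lip] .
  have d: "((\<lambda>t. u t - w t) has_vector_derivative (F (u s) - F (w s))) (at s within J)" if "s \<in> J" for s
  proof -
    have s: "s \<in> ball t0 \<eta>" using J(1) that by blast
    show ?thesis
      by (rule has_vector_derivative_at_within[OF has_vector_derivative_diff[OF u(1)[OF s] w(1)[OF s]]])
  qed
  then have "continuous_on J (\<lambda>t. u t - w t)"
    by (meson continuous_on_eq_continuous_within has_vector_derivative_continuous)
  then have "continuous_on J (\<lambda>t. norm (u t - w t))" by (rule continuous_on_norm)
  then obtain s where s: "s \<in> J" "\<And>r. r \<in> J \<Longrightarrow> norm (u r - w r) \<le> norm (u s - w s)"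
    using continuous_attains_sup[OF J(5,6), of "\<lambda>t. norm (u t - w t)"] by blast
  let ?m = "norm (u s - w s)"
  have "norm ((u s - w s) - (u t0 - w t0)) \<le> (K * ?m) * \<bar>s - t0\<bar>"
  proof (rule vector_derivative_bound[OF J(4) d _ s(1) J(3)])
    fix r assume r: "r \<in> J"
    then have "norm (F (u r) - F (w r)) \<le> K * norm (u r - w r)"
      using lipschitz_onD[OF lip, of "u r" "w r"] u(2) w(2) J(1) by (auto simp: dist_norm)
    also have "\<dots> \<le> K * ?m" using s(2)[OF r] K by (rule mult_left_mono)
    finally show "norm (F (u r) - F (w r)) \<le> K * ?m" .
  qed
  also have "\<dots> \<le> (K * ?m) * \<eta>"
    using s(1) J(1) K by (intro mult_left_mono) (auto simp: dist_real_def abs_minus_commute subset_eq intro: less_imp_le)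
  also have "\<dots> = (\<eta> * K) * ?m" by simp
  also have "\<dots> \<le> 1 / 2 * ?m" using \<eta> by (rule mult_right_mono) simp
  finally have "?m \<le> 2 * norm (u t0 - w t0)"
    using norm_triangle_ineq2[of "u s - w s" "u t0 - w t0"] by linarith
  then show ?thesis using s(2)[OF J(2)] by linarith
qed

text \<open>Picard iteration on the space of bounded continuous functions on the whole line. Clamping time to
\<open>[-\<delta>, \<delta>]\<close> makes the iteration a self-map of this space and, with \<open>\<delta> K \<le> 1 / 2\<close>, a contraction.\<close>

lemma lipschitz_ode_solution:
  fixes G :: "'e::euclidean_space \<Rightarrow> 'e"
  assumes lip: "K-lipschitz_on UNIV G" and B: "\<And>x. norm (G x) \<le> B" and "\<delta> > 0" and \<delta>: "\<delta> * K \<le> 1 / 2"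
  shows "\<exists>u. u 0 = z \<and> (\<forall>t. t \<in> {-\<delta><..<\<delta>} \<longrightarrow> (u has_vector_derivative G (u t)) (at t))"
proof -
  have K: "K \<ge> 0" using lipschitz_on_nonneg[OF lip] .
  have B0: "B \<ge> 0" using B[of 0] norm_ge_zero order_trans by blast
  have cG: "continuous_on UNIV G" using lip lipschitz_on_continuous_on by blast
  define cl where "cl t = max (-\<delta>) (min \<delta> t)" for t
  have cl: "cl t \<in> {-\<delta>..\<delta>}" for t using \<open>\<delta> > 0\<close> by (auto simp: cl_def)
  have ccl: "continuous_on UNIV cl" unfolding cl_def by (intro continuous_intros)
  define A where "A u x = integral {-\<delta>..x} (\<lambda>s. G (apply_bcontfun u s))" for u :: "real \<Rightarrow>\<^sub>C 'e" and x
  have cGu: "continuous_on S (\<lambda>s. G (apply_bcontfun u s))" for u S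
    using continuous_on_compose2[OF cG continuous_on_apply_bcontfun] by simp
  have dA: "(A u has_vector_derivative G (apply_bcontfun u t)) (at t within {-\<delta>..\<delta>})" if "t \<in> {-\<delta>..\<delta>}" for u t
    unfolding A_def using integral_has_vector_derivative[OF cGu that] .
  have cA: "continuous_on {-\<delta>..\<delta>} (A u)" for u
    using dA by (meson continuous_on_eq_continuous_within has_vector_derivative_continuous)
  define T where "T u = Bcontfun (\<lambda>t. z + (A u (cl t) - A u 0))" for u
  have Tb: "(\<lambda>t. z + (A u (cl t) - A u 0)) \<in> bcontfun" for u
  proof (rule bcontfun_normI)
    show "continuous_on UNIV (\<lambda>t. z + (A u (cl t) - A u 0))"
      by (intro continuous_intros continuous_on_compose2[OF cA ccl]) (use cl in auto)
    fix t
    have "norm (A u (cl t) - A u 0) \<le> B * \<bar>cl t - 0\<bar>"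
      by (rule vector_derivative_bound[OF _ dA B cl]) (use \<open>\<delta> > 0\<close> in auto)
    also have "\<dots> \<le> B * \<delta>" by (rule mult_left_mono[OF _ B0]) (use cl[of t] in auto)
    finally show "norm (z + (A u (cl t) - A u 0)) \<le> norm z + B * \<delta>"
      using norm_triangle_ineq[of z "A u (cl t) - A u 0"] by linarith
  qed
  have T: "apply_bcontfun (T u) t = z + (A u (cl t) - A u 0)" for u t
    unfolding T_def using Tb by (simp add: Bcontfun_inverse)
  have "dist (T u) (T w) \<le> 1 / 2 * dist u w" for u w
  proof (rule dist_bound)
    fix t
    have "norm ((A u (cl t) - A w (cl t)) - (A u 0 - A w 0)) \<le> (K * dist u w) * \<bar>cl t - 0\<bar>"
    proof (rule vector_derivative_bound[OF _ has_vector_derivative_diff[OF dA dA] _ cl])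
      fix s
      have "norm (G (apply_bcontfun u s) - G (apply_bcontfun w s)) \<le> K * dist (apply_bcontfun u s) (apply_bcontfun w s)"
        using lipschitz_onD[OF lip] by (simp add: dist_norm)
      also have "\<dots> \<le> K * dist u w" using dist_bounded K by (rule mult_left_mono)
      finally show "norm (G (apply_bcontfun u s) - G (apply_bcontfun w s)) \<le> K * dist u w" .
    qed (use \<open>\<delta> > 0\<close> in auto)
    also have "\<dots> \<le> (K * dist u w) * \<delta>" by (rule mult_left_mono) (use cl[of t] K in auto)
    also have "\<dots> = (\<delta> * K) * dist u w" by simp
    also have "\<dots> \<le> 1 / 2 * dist u w" using \<delta> by (rule mult_right_mono) simp
    finally show "dist (apply_bcontfun (T u) t) (apply_bcontfun (T w) t) \<le> 1 / 2 * dist u w"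
      by (simp add: T dist_norm algebra_simps)
  qed
  then obtain u where u: "T u = u"
    using banach_fix_type[of "1/2" T] by auto
  have ut: "apply_bcontfun u t = z + (A u (cl t) - A u 0)" for t using T[of u t] u by simp
  show ?thesis
  proof (intro exI[of _ "apply_bcontfun u"] conjI allI impI)
    show "apply_bcontfun u 0 = z" using ut[of 0] \<open>\<delta> > 0\<close> by (simp add: cl_def)
    fix t assume t: "t \<in> {-\<delta><..<\<delta>}"
    have "(A u has_vector_derivative G (apply_bcontfun u t)) (at t)"
      using dA[of t u] t at_within_interior[of t "{-\<delta>..\<delta>}"] by simp
    then have "((\<lambda>t. z + (A u t - A u 0)) has_vector_derivative G (apply_bcontfun u t)) (at t)"
      by (auto intro!: derivative_eq_intros)
    then show "(apply_bcontfun u has_vector_derivative G (apply_bcontfun u t)) (at t)"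
      by (rule has_vector_derivative_transform_within_open[of _ _ _ "{-\<delta><..<\<delta>}"]) (use t in \<open>auto simp: ut cl_def\<close>)
  qed
qed

lemma locally_lipschitz_onE:
  assumes "locally_lipschitz_on S f" "x \<in> S"
  obtains e L where "e > 0" "L-lipschitz_on (S \<inter> ball x e) f"
  using assms unfolding locally_lipschitz_on_def by blast

lemma locally_lipschitz_on_openE:
  assumes "locally_lipschitz_on S f" "open S" "x \<in> S"
  obtains e L where "e > 0" "ball x e \<subseteq> S" "L-lipschitz_on (ball x e) f"
proof -
  obtain e L where e: "e > 0" "L-lipschitz_on (S \<inter> ball x e) f"
    using assms(1,3) by (rule locally_lipschitz_onE)
  obtain d where d: "d > 0" "ball x d \<subseteq> S" using assms(2,3) open_contains_ball by blast
  have "ball x (min d e) \<subseteq> S \<inter> ball x e" using d by (auto simp: subset_eq)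
  then have "L-lipschitz_on (ball x (min d e)) f" using e(2) lipschitz_on_subset by blast
  then show ?thesis using that[of "min d e"] d e by (auto simp: subset_eq)
qed

lemma locally_lipschitz_imp_continuous_on:
  assumes "locally_lipschitz_on S f"
  shows "continuous_on S f"
  unfolding continuous_on_eq_continuous_within
proof
  fix x assume x: "x \<in> S"
  obtain e L where e: "e > 0" "L-lipschitz_on (S \<inter> ball x e) f"
    using locally_lipschitz_onE[OF assms x] .
  have "continuous_on (S \<inter> ball x e) f" by (rule lipschitz_on_continuous_on[OF e(2)])
  then have "continuous (at x within S \<inter> ball x e) f" using x e(1) by (simp add: continuous_on_eq_continuous_within)
  moreover have "at x within S \<inter> ball x e = at x within S"
    by (rule at_within_nhd[of _ "ball x e"]) (use e(1) in auto)
  ultimately show "continuous (at x within S) f" by simp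
qed

lemma lipschitz_on_fst [lipschitz_intros]: "1-lipschitz_on S fst"
  and lipschitz_on_snd [lipschitz_intros]: "1-lipschitz_on S snd"
  by (simp_all add: lipschitz_on_def dist_fst_le dist_snd_le)

text \<open>Composing \<open>F\<close> with the nearest-point projection onto a small ball makes it globally Lipschitz and
bounded. Solutions that start in the half ball do not leave the ball before time \<open>\<delta>\<close>, so they solve
the original equation.\<close>

lemma local_flow:
  fixes F :: "'e::euclidean_space \<Rightarrow> 'e"
  assumes lF: "locally_lipschitz_on U F" and U: "open U" "z0 \<in> U"
  obtains \<delta> r L \<Phi> where "\<delta> > 0" "r > 0" "ball z0 r \<subseteq> U"
    "\<And>z. z \<in> ball z0 r \<Longrightarrow> \<Phi> 0 z = z"
    "\<And>z t. z \<in> ball z0 r \<Longrightarrow> t \<in> ball 0 \<delta> \<Longrightarrow> \<Phi> t z \<in> U"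
    "\<And>z t. z \<in> ball z0 r \<Longrightarrow> t \<in> ball 0 \<delta> \<Longrightarrow> ((\<lambda>t. \<Phi> t z) has_vector_derivative F (\<Phi> t z)) (at t)"
    "L-lipschitz_on (ball 0 \<delta> \<times> ball z0 r) (\<lambda>p. \<Phi> (fst p) (snd p))"
proof -
  obtain \<rho>' K where \<rho>': "\<rho>' > 0" "ball z0 \<rho>' \<subseteq> U" "K-lipschitz_on (ball z0 \<rho>') F"
    using locally_lipschitz_on_openE[OF lF U] by blast
  define \<rho> where "\<rho> = \<rho>' / 2"
  have \<rho>: "\<rho> > 0" "cball z0 \<rho> \<subseteq> ball z0 \<rho>'" using \<rho>'(1) by (auto simp: \<rho>_def)
  have FK: "K-lipschitz_on (cball z0 \<rho>) F" using \<rho>'(3) \<rho>(2) lipschitz_on_subset by blast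
  have K: "K \<ge> 0" using lipschitz_on_nonneg[OF FK] .
  let ?p = "closest_point (cball z0 \<rho>)"
  have ne: "cball z0 \<rho> \<noteq> {}" using \<rho> by auto
  have p: "?p x \<in> cball z0 \<rho>" for x by (rule closest_point_in_set[OF closed_cball ne])
  define G where "G x = F (?p x)" for x
  have GF: "G x = F x" if "x \<in> cball z0 \<rho>" for x using that by (simp add: G_def closest_point_self)
  have Glip: "K-lipschitz_on UNIV G"
  proof (rule lipschitz_onI[OF _ K])
    fix x y
    have "dist (G x) (G y) \<le> K * dist (?p x) (?p y)" unfolding G_def by (rule lipschitz_onD[OF FK p p])
    also have "\<dots> \<le> K * dist x y"
      by (intro mult_left_mono closest_point_lipschitz K ne) auto
    finally show "dist (G x) (G y) \<le> K * dist x y" .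
  qed
  define B where "B = norm (F z0) + K * \<rho>"
  have GB: "norm (G x) \<le> B" for x
  proof -
    have "dist (F (?p x)) (F z0) \<le> K * dist (?p x) z0" by (rule lipschitz_onD[OF FK p]) (use \<rho> in simp)
    also have "\<dots> \<le> K * \<rho>" using p[of x] K by (intro mult_left_mono) (auto simp: dist_commute)
    finally show ?thesis unfolding G_def B_def
      using norm_triangle_ineq2[of "F (?p x)" "F z0"] by (simp add: dist_norm)
  qed
  have B: "B \<ge> 0" using GB[of 0] norm_ge_zero order_trans by blast
  \<comment> \<open>The first bound makes Picard iteration a contraction, the second keeps solutions from the half ball
    inside the ball, since they move with speed at most \<open>B\<close>.\<close>
  define \<delta> where "\<delta> = min (1 / (2 * (K + 1))) (\<rho> / (2 * (B + 1)))"
  have \<delta>: "\<delta> > 0" using K B \<rho> by (simp add: \<delta>_def)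
  have \<delta>K: "\<delta> * K \<le> 1 / 2"
  proof -
    have "\<delta> * K \<le> 1 / (2 * (K + 1)) * K" by (rule mult_right_mono) (auto simp: \<delta>_def K)
    also have "\<dots> \<le> 1 / 2" using K by (simp add: field_simps)
    finally show ?thesis .
  qed
  have \<delta>B: "B * \<delta> \<le> \<rho> / 2"
  proof -
    have "B * \<delta> \<le> B * (\<rho> / (2 * (B + 1)))" by (rule mult_left_mono) (auto simp: \<delta>_def B)
    also have "\<dots> \<le> \<rho> / 2" using B \<rho> by (simp add: field_simps)
    finally show ?thesis .
  qed
  have bt: "t \<in> ball 0 \<delta> \<longleftrightarrow> t \<in> {-\<delta><..<\<delta>}" for t by (auto simp: dist_real_def)
  define \<Phi> where "\<Phi> t z = (SOME u. u 0 = z \<and> (\<forall>t. t \<in> {-\<delta><..<\<delta>} \<longrightarrow> (u has_vector_derivative G (u t)) (at t))) t" for t z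
  have sol: "\<Phi> 0 z = z" "t \<in> ball 0 \<delta> \<Longrightarrow> ((\<lambda>t. \<Phi> t z) has_vector_derivative G (\<Phi> t z)) (at t)" for z t
    using someI_ex[OF lipschitz_ode_solution[OF Glip GB \<delta> \<delta>K, of z]] unfolding \<Phi>_def bt by blast+
  have move: "norm (\<Phi> s z - \<Phi> t z) \<le> B * \<bar>s - t\<bar>" if "s \<in> ball 0 \<delta>" "t \<in> ball 0 \<delta>" for s t z
    by (rule vector_derivative_bound[OF convex_ball _ GB that])
      (use sol(2) in \<open>auto intro: has_vector_derivative_at_within\<close>)
  have stay: "\<Phi> t z \<in> cball z0 \<rho>" if z: "z \<in> ball z0 (\<rho> / 2)" and t: "t \<in> ball 0 \<delta>" for t z
  proof -
    have "norm (\<Phi> t z - \<Phi> 0 z) \<le> B * \<bar>t - 0\<bar>" by (rule move) (use t \<delta> in auto)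
    also have "\<dots> \<le> B * \<delta>" using t by (intro mult_left_mono B) auto
    also have "\<dots> \<le> \<rho> / 2" by (rule \<delta>B)
    finally have "dist (\<Phi> t z) z \<le> \<rho> / 2" by (simp add: sol dist_norm)
    moreover have "dist z0 (\<Phi> t z) \<le> dist z0 z + dist (\<Phi> t z) z" by (metis dist_commute dist_triangle)
    ultimately show ?thesis using z by simp
  qed
  have lipz: "norm (\<Phi> t z - \<Phi> t z') \<le> 2 * norm (z - z')" if "t \<in> ball 0 \<delta>" for t z z'
    using ode_solutions_close[OF sol(2) UNIV_I sol(2) UNIV_I Glip \<delta>K that] by (simp add: sol(1))
  show ?thesis
  proof (rule that[OF \<delta>, of "\<rho> / 2" \<Phi> "B + 2"])
    show "\<rho> / 2 > 0" using \<rho> by simp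
    show "ball z0 (\<rho> / 2) \<subseteq> U" using \<rho> \<rho>' by (auto simp: subset_eq)
    fix z and t :: real assume z: "z \<in> ball z0 (\<rho> / 2)" and t: "t \<in> ball 0 \<delta>"
    show "\<Phi> t z \<in> U" using stay[OF z t] \<rho> \<rho>' by blast
    show "((\<lambda>t. \<Phi> t z) has_vector_derivative F (\<Phi> t z)) (at t)"
      using sol(2)[OF t, of z] GF[OF stay[OF z t]] by simp
  next
    show "(B + 2)-lipschitz_on (ball 0 \<delta> \<times> ball z0 (\<rho> / 2)) (\<lambda>p. \<Phi> (fst p) (snd p))"
    proof (rule lipschitz_onI)
      fix p q :: "real \<times> 'e" assume "p \<in> ball 0 \<delta> \<times> ball z0 (\<rho> / 2)" "q \<in> ball 0 \<delta> \<times> ball z0 (\<rho> / 2)"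
      then have pq: "fst p \<in> ball 0 \<delta>" "fst q \<in> ball 0 \<delta>" by auto
      have "dist (\<Phi> (fst p) (snd p)) (\<Phi> (fst q) (snd q)) \<le> dist (\<Phi> (fst p) (snd p)) (\<Phi> (fst q) (snd p)) + dist (\<Phi> (fst q) (snd p)) (\<Phi> (fst q) (snd q))"
        by (rule dist_triangle)
      also have "\<dots> \<le> B * dist (fst p) (fst q) + 2 * dist (snd p) (snd q)"
        using move[OF pq] lipz[OF pq(2)] by (intro add_mono) (simp_all add: dist_norm)
      also have "\<dots> \<le> B * dist p q + 2 * dist p q"
        using B by (intro add_mono mult_left_mono dist_fst_le dist_snd_le) auto
      finally show "dist (\<Phi> (fst p) (snd p)) (\<Phi> (fst q) (snd q)) \<le> (B + 2) * dist p q"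
        by (simp add: algebra_simps)
    qed (use B in simp)
  qed (use sol in auto)
qed

section \<open>Integral curves on spaces with charts\<close>

lemma is_chartD:
  assumes "is_chart X c"
  shows "openin X (fst c)" "open (snd c ` fst c)" "inj_on (snd c) (fst c)"
    "p \<in> fst c \<Longrightarrow> chart_inv c (snd c p) = p"
    "y \<in> snd c ` fst c \<Longrightarrow> chart_inv c y \<in> fst c"
    "y \<in> snd c ` fst c \<Longrightarrow> snd c (chart_inv c y) = y"
    "fst c \<subseteq> topspace X"
proof -
  show o: "openin X (fst c)" and "open (snd c ` fst c)" using assms by (auto simp: is_chart_def)
  then show sub: "fst c \<subseteq> topspace X" using openin_subset by blast
  show inj: "inj_on (snd c) (fst c)"
    using assms sub unfolding is_chart_def homeomorphic_eq_everything_map by (simp add: inf.absorb2)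
  show "p \<in> fst c \<Longrightarrow> chart_inv c (snd c p) = p" using inj by simp
  show "y \<in> snd c ` fst c \<Longrightarrow> chart_inv c y \<in> fst c" by (rule inv_into_into)
  show "y \<in> snd c ` fst c \<Longrightarrow> snd c (chart_inv c y) = y" by (rule f_inv_into_f)
qed

lemma chart_openin_preimage:
  assumes c: "is_chart X c" and "open Q"
  shows "openin X {p \<in> fst c. snd c p \<in> Q}"
proof -
  have "continuous_map (subtopology X (fst c)) (top_of_set (snd c ` fst c)) (snd c)"
    using c by (auto simp: is_chart_def homeomorphic_eq_everything_map)
  moreover have "openin (top_of_set (snd c ` fst c)) (snd c ` fst c \<inter> Q)"
    using \<open>open Q\<close> by (rule openin_open_Int)
  ultimately have "openin (subtopology X (fst c)) {p \<in> topspace (subtopology X (fst c)). snd c p \<in> snd c ` fst c \<inter> Q}"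
    by (rule openin_continuous_map_preimage)
  moreover have "{p \<in> topspace (subtopology X (fst c)). snd c p \<in> snd c ` fst c \<inter> Q} = {p \<in> fst c. snd c p \<in> Q}"
    using is_chartD(7)[OF c] by auto
  ultimately show ?thesis using openin_open_subtopology[OF is_chartD(1)[OF c]] by simp
qed

lemma chart_open_image:
  assumes c: "is_chart X c" and "openin X V"
  shows "open (snd c ` (fst c \<inter> V))"
proof -
  have "open_map (subtopology X (fst c)) (top_of_set (snd c ` fst c)) (snd c)"
    using c by (auto simp: is_chart_def homeomorphic_eq_everything_map)
  moreover have "openin (subtopology X (fst c)) (fst c \<inter> V)"
    using \<open>openin X V\<close> by (simp add: openin_subtopology_Int2)
  ultimately have "openin (top_of_set (snd c ` fst c)) (snd c ` (fst c \<inter> V))"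
    by (simp add: open_map_def)
  then show ?thesis using is_chartD(2)[OF c] openin_open_trans by blast
qed

lemma chart_inv_nhd:
  assumes c: "is_chart X c" and "openin X V" "y \<in> snd c ` fst c" "chart_inv c y \<in> V"
  obtains e where "e > 0" "\<And>y'. y' \<in> ball y e \<Longrightarrow> y' \<in> snd c ` fst c \<and> chart_inv c y' \<in> V"
proof -
  have "y \<in> snd c ` (fst c \<inter> V)" using assms is_chartD(5,6)[OF c] by (metis IntI image_eqI)
  then obtain e where e: "e > 0" "ball y e \<subseteq> snd c ` (fst c \<inter> V)"
    using chart_open_image[OF c \<open>openin X V\<close>] open_contains_ball by blast
  show ?thesis
  proof (rule that[OF e(1)])
    fix y' assume "y' \<in> ball y e"
    then obtain p where "p \<in> fst c" "p \<in> V" "y' = snd c p" using e(2) by blast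
    then show "y' \<in> snd c ` fst c \<and> chart_inv c y' \<in> V" using is_chartD(4)[OF c] by auto
  qed
qed

lemma overlap_open: "is_chart X c \<Longrightarrow> is_chart X d \<Longrightarrow> open (overlap c d)"
  unfolding overlap_def using chart_open_image is_chartD(1) by blast

lemma continuous_curve_iff:
  assumes "open J"
  shows "continuous_map (top_of_set J) X u \<longleftrightarrow> (\<forall>t\<in>J. u t \<in> topspace X \<and>
    (\<forall>V. openin X V \<and> u t \<in> V \<longrightarrow> (\<exists>e>0. ball t e \<subseteq> J \<and> (\<forall>s\<in>ball t e. u s \<in> V))))"
proof
  assume c: "continuous_map (top_of_set J) X u"
  show "\<forall>t\<in>J. u t \<in> topspace X \<and> (\<forall>V. openin X V \<and> u t \<in> V \<longrightarrow> (\<exists>e>0. ball t e \<subseteq> J \<and> (\<forall>s\<in>ball t e. u s \<in> V)))"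
  proof (intro ballI conjI allI impI)
    fix t assume "t \<in> J"
    then show "u t \<in> topspace X" using c by (auto simp: continuous_map_def)
    fix V assume V: "openin X V \<and> u t \<in> V"
    then have "openin (top_of_set J) {s \<in> J. u s \<in> V}"
      using openin_continuous_map_preimage[OF c, of V] by simp
    then have "open {s \<in> J. u s \<in> V}" using assms openin_open_trans by blast
    then obtain e where "e > 0" "ball t e \<subseteq> {s \<in> J. u s \<in> V}" using V \<open>t \<in> J\<close> open_contains_ball by blast
    then show "\<exists>e>0. ball t e \<subseteq> J \<and> (\<forall>s\<in>ball t e. u s \<in> V)" by blast
  qed
next
  assume H: "\<forall>t\<in>J. u t \<in> topspace X \<and> (\<forall>V. openin X V \<and> u t \<in> V \<longrightarrow> (\<exists>e>0. ball t e \<subseteq> J \<and> (\<forall>s\<in>ball t e. u s \<in> V)))"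
  show "continuous_map (top_of_set J) X u"
    unfolding continuous_map_def
  proof (intro conjI allI impI)
    show "u \<in> topspace (top_of_set J) \<rightarrow> topspace X" using H by auto
    fix V assume "openin X V"
    have "open {s \<in> J. u s \<in> V}"
      unfolding open_contains_ball
    proof
      fix t assume t: "t \<in> {s \<in> J. u s \<in> V}"
      then obtain e where "e > 0" "ball t e \<subseteq> J" "\<forall>s\<in>ball t e. u s \<in> V"
        using H \<open>openin X V\<close> by (metis (no_types, lifting) mem_Collect_eq)
      then show "\<exists>e>0. ball t e \<subseteq> {s \<in> J. u s \<in> V}" by blast
    qed
    then show "openin (top_of_set J) {s \<in> topspace (top_of_set J). u s \<in> V}"
      by (auto intro!: open_subset)
  qed
qed

text \<open>Differentiability of the transition maps makes a vector field a chart independent notion, and their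
local Lipschitz property carries Lipschitz estimates of the flow from one chart to another. The index
\<open>i\<close> lets the field be attached to a chart of the base while \<open>ch i\<close> is the induced chart of the bundle.\<close>

locale charted_vector_field =
  fixes X :: "'q topology" and I :: "'i set" and ch :: "'i \<Rightarrow> ('q, 'e::euclidean_space) chart"
    and F :: "'i \<Rightarrow> 'e \<Rightarrow> 'e"
  assumes hausdorff: "Hausdorff_space X"
    and charts: "i \<in> I \<Longrightarrow> is_chart X (ch i)"
    and cover: "(\<Union>i\<in>I. fst (ch i)) = topspace X"
    and field_lipschitz: "i \<in> I \<Longrightarrow> locally_lipschitz_on (snd (ch i) ` fst (ch i)) (F i)"
    and field_transforms: "i \<in> I \<Longrightarrow> j \<in> I \<Longrightarrow> x \<in> overlap (ch i) (ch j) \<Longrightarrow>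
      \<exists>D. (transition (ch i) (ch j) has_derivative D) (at x) \<and> D (F i x) = F j (transition (ch i) (ch j) x)"
    and transition_lipschitz: "i \<in> I \<Longrightarrow> j \<in> I \<Longrightarrow>
      locally_lipschitz_on (overlap (ch i) (ch j)) (transition (ch i) (ch j))"
begin

abbreviation dm :: "'i \<Rightarrow> 'q set" where "dm i \<equiv> fst (ch i)"
abbreviation co :: "'i \<Rightarrow> 'q \<Rightarrow> 'e" where "co i \<equiv> snd (ch i)"

definition icurve :: "real set \<Rightarrow> (real \<Rightarrow> 'q) \<Rightarrow> bool" where
  "icurve J u \<longleftrightarrow> open J \<and> is_interval J \<and> continuous_map (top_of_set J) X u \<and>
     (\<forall>t\<in>J. \<forall>i\<in>I. u t \<in> dm i \<longrightarrow> ((\<lambda>s. co i (u s)) has_vector_derivative F i (co i (u t))) (at t))"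

lemma icurveD:
  assumes "icurve J u"
  shows "open J" "is_interval J" "t \<in> J \<Longrightarrow> u t \<in> topspace X"
    "t \<in> J \<Longrightarrow> i \<in> I \<Longrightarrow> u t \<in> dm i \<Longrightarrow> ((\<lambda>s. co i (u s)) has_vector_derivative F i (co i (u t))) (at t)"
    "t \<in> J \<Longrightarrow> openin X V \<Longrightarrow> u t \<in> V \<Longrightarrow> \<exists>e>0. ball t e \<subseteq> J \<and> (\<forall>s\<in>ball t e. u s \<in> V)"
  using assms continuous_curve_iff[of J X u] unfolding icurve_def by blast+

lemma chart_around:
  assumes "p \<in> topspace X" obtains i where "i \<in> I" "p \<in> dm i"
  using assms cover by blast

lemma icurve_if_locally:
  assumes "open J" "is_interval J"
    and loc: "\<And>t. t \<in> J \<Longrightarrow> \<exists>e>0. \<exists>J' w. icurve J' w \<and> ball t e \<subseteq> J' \<and> (\<forall>s\<in>ball t e. u s = w s)"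
  shows "icurve J u"
  unfolding icurve_def continuous_curve_iff[OF \<open>open J\<close>]
proof (intro conjI ballI allI impI assms(1,2))
  fix t assume t: "t \<in> J"
  obtain e J' w where w: "e > 0" "icurve J' w" "ball t e \<subseteq> J'" "\<And>s. s \<in> ball t e \<Longrightarrow> u s = w s"
    using loc[OF t] by blast
  have tJ': "t \<in> J'" and ut: "u t = w t" using w by auto
  show "u t \<in> topspace X" using icurveD(3)[OF w(2) tJ'] ut by simp
  show "\<exists>e>0. ball t e \<subseteq> J \<and> (\<forall>s\<in>ball t e. u s \<in> V)" if V: "openin X V \<and> u t \<in> V" for V
  proof -
    obtain d where d: "d > 0" "\<And>s. s \<in> ball t d \<Longrightarrow> w s \<in> V" using icurveD(5)[OF w(2) tJ', of V] V ut by auto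
    obtain c where c: "c > 0" "ball t c \<subseteq> J" using \<open>open J\<close> t open_contains_ball by blast
    show ?thesis
      by (rule exI[of _ "min c (min d e)"]) (use c d w in \<open>auto simp: subset_eq\<close>)
  qed
  fix i assume i: "i \<in> I" "u t \<in> dm i"
  have "((\<lambda>s. co i (w s)) has_vector_derivative F i (co i (w t))) (at t)"
    using icurveD(4)[OF w(2) tJ' i(1)] i ut by simp
  then have "((\<lambda>s. co i (u s)) has_vector_derivative F i (co i (w t))) (at t)"
    by (rule has_vector_derivative_transform_within_open[of _ _ _ "ball t e"]) (use w in auto)
  then show "((\<lambda>s. co i (u s)) has_vector_derivative F i (co i (u t))) (at t)" using ut by simp
qed

lemma icurve_shift:
  assumes u: "icurve J u"
  shows "icurve ((\<lambda>t. t + a) -` J) (\<lambda>t. u (t + a))"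
proof -
  have o: "open ((\<lambda>t. t + a) -` J)"
    using icurveD(1)[OF u] by (intro open_vimage continuous_intros)
  have iv: "is_interval ((\<lambda>t. t + a) -` J)"
    unfolding is_interval_1
  proof (intro ballI allI impI)
    fix b c x assume "b \<in> (\<lambda>t. t + a) -` J" "c \<in> (\<lambda>t. t + a) -` J" "b \<le> x \<and> x \<le> c"
    then show "x \<in> (\<lambda>t. t + a) -` J"
      using mem_is_interval_1_I[OF icurveD(2)[OF u], of "b + a" "c + a" "x + a"] by simp
  qed
  show ?thesis
    unfolding icurve_def continuous_curve_iff[OF o]
  proof (intro conjI ballI allI impI o iv)
    fix t assume t: "t \<in> (\<lambda>t. t + a) -` J"
    show "u (t + a) \<in> topspace X" using icurveD(3)[OF u] t by simp
    show "\<exists>e>0. ball t e \<subseteq> (\<lambda>t. t + a) -` J \<and> (\<forall>s\<in>ball t e. u (s + a) \<in> V)" if "openin X V \<and> u (t + a) \<in> V" for V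
    proof -
      obtain e where e: "e > 0" "ball (t + a) e \<subseteq> J" "\<And>s. s \<in> ball (t + a) e \<Longrightarrow> u s \<in> V"
        using icurveD(5)[OF u, of "t + a" V] t \<open>openin X V \<and> u (t + a) \<in> V\<close> by auto
      have "s + a \<in> ball (t + a) e" if "s \<in> ball t e" for s using that by (simp add: dist_real_def)
      then show ?thesis using e by blast
    qed
    fix i assume i: "i \<in> I" "u (t + a) \<in> dm i"
    have "((\<lambda>s. s + a) has_vector_derivative 1) (at t)"
      by (simp flip: has_real_derivative_iff_has_vector_derivative) (auto intro!: derivative_eq_intros)
    from vector_diff_chain_at[OF this icurveD(4)[OF u _ i]] t
    show "((\<lambda>s. co i (u (s + a))) has_vector_derivative F i (co i (u (t + a)))) (at t)"
      by (simp add: o_def)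
  qed
qed

lemma icurve_of_chart:
  assumes i: "i \<in> I" and J: "open J" "is_interval J"
    and z: "\<And>t. t \<in> J \<Longrightarrow> z t \<in> co i ` dm i"
    and dz: "\<And>t. t \<in> J \<Longrightarrow> (z has_vector_derivative F i (z t)) (at t)"
  shows "icurve J (\<lambda>t. chart_inv (ch i) (z t))"
  unfolding icurve_def continuous_curve_iff[OF J(1)]
proof (intro conjI ballI allI impI J)
  note c = charts[OF i]
  fix t assume t: "t \<in> J"
  show "chart_inv (ch i) (z t) \<in> topspace X" using is_chartD(5,7)[OF c] z[OF t] by blast
  show "\<exists>e>0. ball t e \<subseteq> J \<and> (\<forall>s\<in>ball t e. chart_inv (ch i) (z s) \<in> V)" if V: "openin X V \<and> chart_inv (ch i) (z t) \<in> V" for V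
  proof -
    obtain d where d: "d > 0" "\<And>y. y \<in> ball (z t) d \<Longrightarrow> chart_inv (ch i) y \<in> V"
      using chart_inv_nhd[OF c conjunct1[OF V] z[OF t] conjunct2[OF V]] by metis
    have "continuous (at t) z" using dz[OF t] has_vector_derivative_continuous by blast
    then obtain e where e: "e > 0" "\<And>s. dist s t < e \<Longrightarrow> dist (z s) (z t) < d"
      using d(1) unfolding continuous_at_eps_delta by blast
    obtain e' where e': "e' > 0" "ball t e' \<subseteq> J" using J(1) t open_contains_ball by blast
    show ?thesis
      by (rule exI[of _ "min e e'"]) (use e e' d in \<open>auto simp: subset_eq dist_commute\<close>)
  qed
  fix j assume j: "j \<in> I" "chart_inv (ch i) (z t) \<in> dm j"
  have "z t \<in> overlap (ch i) (ch j)"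
    unfolding overlap_def using is_chartD(5,6)[OF c z[OF t]] j(2) by (metis IntI image_eqI)
  then obtain D where D: "(transition (ch i) (ch j) has_derivative D) (at (z t))"
      "D (F i (z t)) = F j (transition (ch i) (ch j) (z t))"
    using field_transforms[OF i j(1)] by blast
  have "((transition (ch i) (ch j) \<circ> z) has_derivative (D \<circ> (\<lambda>h. h *\<^sub>R F i (z t)))) (at t)"
    using dz[OF t] D(1) unfolding has_vector_derivative_def by (rule diff_chain_at)
  then have "((transition (ch i) (ch j) \<circ> z) has_vector_derivative D (F i (z t))) (at t)"
    using linear_scale[OF has_derivative_linear[OF D(1)]] by (simp add: has_vector_derivative_def o_def)
  then show "((\<lambda>s. co j (chart_inv (ch i) (z s))) has_vector_derivative F j (co j (chart_inv (ch i) (z t)))) (at t)"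
    using D(2) by (simp add: transition_def o_def)
qed

lemma icurve_unique_locally:
  assumes u: "icurve J u" "t0 \<in> J" and w: "icurve J' w" "t0 \<in> J'" and eq: "u t0 = w t0"
  shows "\<exists>e>0. \<forall>t\<in>ball t0 e. t \<in> J \<and> t \<in> J' \<and> u t = w t"
proof -
  obtain i where i: "i \<in> I" "u t0 \<in> dm i" using chart_around icurveD(3)[OF u] by blast
  note c = charts[OF i(1)]
  obtain \<rho> K where \<rho>: "\<rho> > 0" "ball (co i (u t0)) \<rho> \<subseteq> co i ` dm i" "K-lipschitz_on (ball (co i (u t0)) \<rho>) (F i)"
    using locally_lipschitz_on_openE[OF field_lipschitz[OF i(1)] is_chartD(2)[OF c], of "co i (u t0)"] i(2) by blast
  let ?V = "{p \<in> dm i. co i p \<in> ball (co i (u t0)) \<rho>}"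
  have V: "openin X ?V" by (rule chart_openin_preimage[OF c open_ball])
  obtain e1 where e1: "e1 > 0" "ball t0 e1 \<subseteq> J" "\<forall>s\<in>ball t0 e1. u s \<in> ?V"
    using icurveD(5)[OF u V] i \<rho> by auto
  obtain e2 where e2: "e2 > 0" "ball t0 e2 \<subseteq> J'" "\<forall>s\<in>ball t0 e2. w s \<in> ?V"
    using icurveD(5)[OF w V] i \<rho> eq by auto
  have K: "K \<ge> 0" using lipschitz_on_nonneg[OF \<rho>(3)] .
  define \<eta> where "\<eta> = min (min e1 e2) (1 / (2 * (K + 1)))"
  have \<eta>: "\<eta> > 0" using e1 e2 K by (simp add: \<eta>_def)
  have \<eta>K: "\<eta> * K \<le> 1 / 2"
  proof -
    have "\<eta> * K \<le> 1 / (2 * (K + 1)) * K" by (rule mult_right_mono) (auto simp: \<eta>_def K)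
    also have "\<dots> \<le> 1 / 2" using K by (simp add: field_simps)
    finally show ?thesis .
  qed
  have sub: "ball t0 \<eta> \<subseteq> ball t0 e1" "ball t0 \<eta> \<subseteq> ball t0 e2" by (auto simp: \<eta>_def)
  have "u t = w t" if t: "t \<in> ball t0 \<eta>" for t
  proof -
    have "norm (co i (u t) - co i (w t)) \<le> 2 * norm (co i (u t0) - co i (w t0))"
    proof (rule ode_solutions_close[OF _ _ _ _ \<rho>(3) \<eta>K t])
      fix s assume "s \<in> ball t0 \<eta>"
      then have s: "s \<in> ball t0 e1" "s \<in> ball t0 e2" using sub by auto
      then show "co i (u s) \<in> ball (co i (u t0)) \<rho>" "co i (w s) \<in> ball (co i (u t0)) \<rho>" using e1 e2 by auto
      show "((\<lambda>s. co i (u s)) has_vector_derivative F i (co i (u s))) (at s)"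
        by (rule icurveD(4)[OF u(1) _ i(1)]) (use s e1 in auto)
      show "((\<lambda>s. co i (w s)) has_vector_derivative F i (co i (w s))) (at s)"
        by (rule icurveD(4)[OF w(1) _ i(1)]) (use s e2 in auto)
    qed
    then have "co i (u t) = co i (w t)" using eq by simp
    moreover have "u t \<in> dm i" "w t \<in> dm i" using t sub e1 e2 by auto
    ultimately show ?thesis using is_chartD(3)[OF c] by (simp add: inj_on_eq_iff)
  qed
  then show ?thesis using \<eta> sub e1(2) e2(2) by blast
qed

text \<open>The set of times at which two integral curves agree is open by local uniqueness and closed because
\<open>X\<close> is Hausdorff.\<close>

lemma icurve_unique:
  assumes u: "icurve J u" "t0 \<in> J" and w: "icurve J' w" "t0 \<in> J'" and eq: "u t0 = w t0"
    and t: "t \<in> J" "t \<in> J'"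
  shows "u t = w t"
proof (rule ccontr)
  assume ne: "u t \<noteq> w t"
  let ?A = "{s \<in> J \<inter> J'. u s = w s}" and ?B = "{s \<in> J \<inter> J'. u s \<noteq> w s}"
  have "open ?A"
    unfolding open_contains_ball
  proof
    fix s assume "s \<in> ?A"
    then obtain e where "e > 0" "\<forall>r\<in>ball s e. r \<in> J \<and> r \<in> J' \<and> u r = w r"
      using icurve_unique_locally[OF u(1) _ w(1), of s] by auto
    then show "\<exists>e>0. ball s e \<subseteq> ?A" by blast
  qed
  moreover have "open ?B"
    unfolding open_contains_ball
  proof
    fix s assume s: "s \<in> ?B"
    then have "u s \<in> topspace X" "w s \<in> topspace X" using icurveD(3)[OF u(1)] icurveD(3)[OF w(1)] by auto
    then obtain V V' where V: "openin X V" "openin X V'" "u s \<in> V" "w s \<in> V'" "disjnt V V'"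
      using hausdorff[unfolded Hausdorff_space_def, rule_format, of "u s" "w s"] s by blast
    have sJ: "s \<in> J" "s \<in> J'" using s by auto
    obtain e where e: "e > 0" "ball s e \<subseteq> J" "\<forall>r\<in>ball s e. u r \<in> V"
      using icurveD(5)[OF u(1) sJ(1) V(1,3)] by blast
    obtain e' where e': "e' > 0" "ball s e' \<subseteq> J'" "\<forall>r\<in>ball s e'. w r \<in> V'"
      using icurveD(5)[OF w(1) sJ(2) V(2,4)] by blast
    have "ball s (min e e') \<subseteq> ?B"
    proof
      fix r assume "r \<in> ball s (min e e')"
      then have r: "r \<in> ball s e" "r \<in> ball s e'" by auto
      then have "u r \<in> V" "w r \<in> V'" using e(3) e'(3) by blast+
      then have "u r \<noteq> w r" using V(5) by (auto simp: disjnt_iff)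
      then show "r \<in> ?B" using r e(2) e'(2) by blast
    qed
    then show "\<exists>e>0. ball s e \<subseteq> ?B" using e(1) e'(1) by (intro exI[of _ "min e e'"]) auto
  qed
  moreover have "connected (J \<inter> J')"
    using icurveD(2)[OF u(1)] icurveD(2)[OF w(1)] is_interval_Int is_interval_connected by blast
  moreover have "J \<inter> J' \<subseteq> ?A \<union> ?B" "?A \<inter> ?B \<inter> (J \<inter> J') = {}" by auto
  moreover have "?A \<inter> (J \<inter> J') \<noteq> {}" "?B \<inter> (J \<inter> J') \<noteq> {}" using u w eq t ne by auto
  ultimately show False unfolding connected_def by blast
qed

lemma icurve_glue:
  assumes u: "icurve J u" "t0 \<in> J" and w: "icurve J' w" "t0 \<in> J'" and eq: "u t0 = w t0"
  shows "icurve (J \<union> J') (\<lambda>t. if t \<in> J then u t else w t)"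
proof (rule icurve_if_locally)
  show "open (J \<union> J')" using icurveD(1)[OF u(1)] icurveD(1)[OF w(1)] by blast
  have "connected (J \<union> J')"
    using icurveD(2)[OF u(1)] icurveD(2)[OF w(1)] u(2) w(2) by (intro connected_Un) (auto simp: is_interval_connected)
  then show "is_interval (J \<union> J')" by (simp add: is_interval_connected_1)
  fix t assume "t \<in> J \<union> J'"
  then consider "t \<in> J" | "t \<in> J'" by blast
  then show "\<exists>e>0. \<exists>J'' v. icurve J'' v \<and> ball t e \<subseteq> J'' \<and> (\<forall>s\<in>ball t e. (if s \<in> J then u s else w s) = v s)"
  proof cases
    case 1
    then obtain e where "e > 0" "ball t e \<subseteq> J" using icurveD(1)[OF u(1)] open_contains_ball by blast
    then show ?thesis using u(1) by (intro exI[of _ e] conjI exI[of _ J] exI[of _ u]) auto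
  next
    case 2
    then obtain e where e: "e > 0" "ball t e \<subseteq> J'" using icurveD(1)[OF w(1)] open_contains_ball by blast
    have "(if s \<in> J then u s else w s) = w s" if "s \<in> ball t e" for s
      using icurve_unique[OF u w eq] e(2) that by auto
    then show ?thesis using w(1) e by (intro exI[of _ e] conjI exI[of _ J'] exI[of _ w]) auto
  qed
qed

definition dom :: "'q \<Rightarrow> real set" where
  "dom v = \<Union>{J. \<exists>u. icurve J u \<and> 0 \<in> J \<and> u 0 = v}"

definition Fl :: "real \<Rightarrow> 'q \<Rightarrow> 'q" where
  "Fl t v = (THE p. \<exists>J u. icurve J u \<and> 0 \<in> J \<and> u 0 = v \<and> t \<in> J \<and> u t = p)"

lemma Fl_eqI:
  assumes "icurve J u" "0 \<in> J" "u 0 = v" "t \<in> J"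
  shows "t \<in> dom v" "Fl t v = u t"
proof -
  show "t \<in> dom v" unfolding dom_def using assms by blast
  show "Fl t v = u t" unfolding Fl_def
  proof (rule the_equality)
    fix p assume "\<exists>J u. icurve J u \<and> 0 \<in> J \<and> u 0 = v \<and> t \<in> J \<and> u t = p"
    then obtain J' w where "icurve J' w" "0 \<in> J'" "w 0 = v" "t \<in> J'" "w t = p" by blast
    then show "p = u t" using icurve_unique[of J u 0 J' w t] assms by metis
  qed (use assms in blast)
qed

lemma domE:
  assumes "t \<in> dom v"
  obtains J u where "icurve J u" "0 \<in> J" "u 0 = v" "t \<in> J"
  using assms unfolding dom_def by blast

lemma zero_in_dom:
  assumes "v \<in> topspace X" shows "0 \<in> dom v"
proof -
  obtain i where i: "i \<in> I" "v \<in> dm i" using chart_around assms by blast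
  note c = charts[OF i(1)]
  obtain \<delta> r L \<Phi> where f: "\<delta> > 0" "r > 0" "ball (co i v) r \<subseteq> co i ` dm i"
    "\<And>z. z \<in> ball (co i v) r \<Longrightarrow> \<Phi> 0 z = z"
    "\<And>z t. z \<in> ball (co i v) r \<Longrightarrow> t \<in> ball 0 \<delta> \<Longrightarrow> \<Phi> t z \<in> co i ` dm i"
    "\<And>z t. z \<in> ball (co i v) r \<Longrightarrow> t \<in> ball 0 \<delta> \<Longrightarrow> ((\<lambda>t. \<Phi> t z) has_vector_derivative F i (\<Phi> t z)) (at t)"
    "L-lipschitz_on (ball 0 \<delta> \<times> ball (co i v) r) (\<lambda>p. \<Phi> (fst p) (snd p))"
    by (rule local_flow[OF field_lipschitz[OF i(1)] is_chartD(2)[OF c] imageI[OF i(2)]]) (rule that; assumption)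
  have vb: "co i v \<in> ball (co i v) r" using f(2) by simp
  have "icurve (ball 0 \<delta>) (\<lambda>t. chart_inv (ch i) (\<Phi> t (co i v)))"
    by (rule icurve_of_chart[OF i(1) open_ball is_interval_ball_real]) (use f(5,6) vb in auto)
  then show ?thesis
    by (rule Fl_eqI(1)) (use f(1,4) vb is_chartD(4)[OF c i(2)] in auto)
qed

lemma icurve_Fl: "icurve (dom v) (\<lambda>t. Fl t v)"
proof (rule icurve_if_locally)
  show "open (dom v)" unfolding dom_def using icurveD(1) by blast
  have "connected (dom v)" unfolding dom_def
    by (rule connected_Union) (use icurveD(2) in \<open>auto simp: is_interval_connected\<close>)
  then show "is_interval (dom v)" by (simp add: is_interval_connected_1)
  fix t assume "t \<in> dom v"
  then obtain J u where u: "icurve J u" "0 \<in> J" "u 0 = v" "t \<in> J" by (rule domE)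
  obtain e where "e > 0" "ball t e \<subseteq> J" using icurveD(1)[OF u(1)] u(4) open_contains_ball by blast
  then show "\<exists>e>0. \<exists>J' w. icurve J' w \<and> ball t e \<subseteq> J' \<and> (\<forall>s\<in>ball t e. Fl s v = w s)"
    using u Fl_eqI(2)[OF u(1-3)] by (intro exI[of _ e] conjI exI[of _ J] exI[of _ u]) auto
qed

lemma Fl_0: "v \<in> topspace X \<Longrightarrow> Fl 0 v = v"
  using zero_in_dom domE Fl_eqI(2) by metis

lemma Fl_in_space: "t \<in> dom v \<Longrightarrow> Fl t v \<in> topspace X"
  using icurveD(3)[OF icurve_Fl] by blast

lemma Fl_add:
  assumes t: "t \<in> dom v" and s: "s \<in> dom (Fl t v)"
  shows "t + s \<in> dom v" "Fl (t + s) v = Fl s (Fl t v)"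
proof -
  obtain J u where u: "icurve J u" "0 \<in> J" "u 0 = v" "t \<in> J" using t by (rule domE)
  have ut: "u t = Fl t v" using Fl_eqI(2)[OF u] by simp
  let ?J' = "(\<lambda>a. a + - t) -` dom (Fl t v)"
  let ?w = "\<lambda>a. Fl (a + - t) (Fl t v)"
  have w: "icurve ?J' ?w" by (rule icurve_shift[OF icurve_Fl])
  have sp: "Fl t v \<in> topspace X" by (rule Fl_in_space[OF t])
  have tJ': "t \<in> ?J'" using zero_in_dom[OF sp] by simp
  have eq: "u t = ?w t" using ut Fl_0[OF sp] by simp
  have g: "icurve (J \<union> ?J') (\<lambda>a. if a \<in> J then u a else ?w a)"
    by (rule icurve_glue[OF u(1,4) w tJ' eq])
  have in': "t + s \<in> J \<union> ?J'" "0 \<in> J \<union> ?J'" using s u by auto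
  note F = Fl_eqI[OF g in'(2) _ in'(1), of v]
  show "t + s \<in> dom v" using F(1) u by simp
  have "Fl (t + s) v = (if t + s \<in> J then u (t + s) else ?w (t + s))" using F(2) u by simp
  also have "\<dots> = ?w (t + s)"
    using icurve_unique[OF u(1,4) w tJ' eq, of "t + s"] s by simp
  finally show "Fl (t + s) v = Fl s (Fl t v)" by simp
qed

end

section \<open>Continuation of flow boxes\<close>

lemma lipschitz_box_shrink:
  assumes lip: "L-lipschitz_on (ball t0 e \<times> ball y0 e) g" and "e > 0" "\<rho> > 0"
  shows "\<exists>e'>0. e' \<le> e \<and> (\<forall>p\<in>ball t0 e' \<times> ball y0 e'. g p \<in> ball (g (t0, y0)) \<rho>)"
proof -
  have "continuous_on (ball t0 e \<times> ball y0 e) g" by (rule lipschitz_on_continuous_on[OF lip])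
  moreover have "(t0, y0) \<in> ball t0 e \<times> ball y0 e" using \<open>e > 0\<close> by simp
  ultimately obtain d where d: "d > 0" "\<And>p. p \<in> ball t0 e \<times> ball y0 e \<Longrightarrow> dist p (t0, y0) < d \<Longrightarrow> dist (g p) (g (t0, y0)) < \<rho>"
    using \<open>\<rho> > 0\<close> unfolding continuous_on_iff by metis
  show ?thesis
  proof (intro exI[of _ "min e (d / 2)"] conjI ballI)
    fix p assume "p \<in> ball t0 (min e (d / 2)) \<times> ball y0 (min e (d / 2))"
    then have p: "p \<in> ball t0 e \<times> ball y0 e" "dist t0 (fst p) < d / 2" "dist y0 (snd p) < d / 2" by auto
    have "dist p (t0, y0) \<le> dist (fst p) t0 + dist (snd p) y0"
      using sqrt_sum_squares_le_sum[OF zero_le_dist zero_le_dist] by (simp add: dist_prod_def)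
    also have "\<dots> < d" using p(2,3) by (simp add: dist_commute)
    finally show "g p \<in> ball (g (t0, y0)) \<rho>" using d(2)[OF p(1)] by (simp add: dist_commute)
  qed (use \<open>e > 0\<close> d in auto)
qed

context charted_vector_field
begin

text \<open>The initial point is written in a parametrization \<open>b\<close> of any dimension, later a chart of a submanifold,
and its position at time \<open>t\<close> in the chart \<open>i\<close>.\<close>

definition flow_box :: "('q, 'b::euclidean_space) chart \<Rightarrow> 'i \<Rightarrow> real \<Rightarrow> 'b \<Rightarrow> real \<Rightarrow> real \<Rightarrow> bool" where
  "flow_box b i t0 y0 e L \<longleftrightarrow> e > 0 \<and> ball y0 e \<subseteq> snd b ` fst b \<and>
     (\<forall>t\<in>ball t0 e. \<forall>y\<in>ball y0 e. t \<in> dom (chart_inv b y) \<and> Fl t (chart_inv b y) \<in> dm i) \<and>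
     L-lipschitz_on (ball t0 e \<times> ball y0 e) (\<lambda>p. co i (Fl (fst p) (chart_inv b (snd p))))"

lemma flow_boxD:
  assumes "flow_box b i t0 y0 e L"
  shows "e > 0" "ball y0 e \<subseteq> snd b ` fst b"
    "t \<in> ball t0 e \<Longrightarrow> y \<in> ball y0 e \<Longrightarrow> t \<in> dom (chart_inv b y)"
    "t \<in> ball t0 e \<Longrightarrow> y \<in> ball y0 e \<Longrightarrow> Fl t (chart_inv b y) \<in> dm i"
    "L-lipschitz_on (ball t0 e \<times> ball y0 e) (\<lambda>p. co i (Fl (fst p) (chart_inv b (snd p))))"
  using assms unfolding flow_box_def by blast+

lemma flow_box_shrink:
  assumes b: "flow_box b i t0 y0 e L" and "e' > 0" and t: "ball t1 e' \<subseteq> ball t0 e" and y: "ball y1 e' \<subseteq> ball y0 e"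
  shows "flow_box b i t1 y1 e' L"
proof -
  have "ball t1 e' \<times> ball y1 e' \<subseteq> ball t0 e \<times> ball y0 e" using t y by (rule Sigma_mono)
  then have "L-lipschitz_on (ball t1 e' \<times> ball y1 e') (\<lambda>p. co i (Fl (fst p) (chart_inv b (snd p))))"
    using lipschitz_on_subset[OF flow_boxD(5)[OF b]] by blast
  then show ?thesis using b t y \<open>e' > 0\<close> unfolding flow_box_def by blast
qed

lemma chart_flow_box:
  assumes i: "i \<in> I" "p \<in> dm i"
  shows "\<exists>e L. flow_box (ch i) i 0 (co i p) e L"
proof -
  note c = charts[OF i(1)]
  obtain \<delta> r L \<Phi> where f: "\<delta> > 0" "r > 0" "ball (co i p) r \<subseteq> co i ` dm i"
    "\<And>z. z \<in> ball (co i p) r \<Longrightarrow> \<Phi> 0 z = z"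
    "\<And>z t. z \<in> ball (co i p) r \<Longrightarrow> t \<in> ball 0 \<delta> \<Longrightarrow> \<Phi> t z \<in> co i ` dm i"
    "\<And>z t. z \<in> ball (co i p) r \<Longrightarrow> t \<in> ball 0 \<delta> \<Longrightarrow> ((\<lambda>t. \<Phi> t z) has_vector_derivative F i (\<Phi> t z)) (at t)"
    "L-lipschitz_on (ball 0 \<delta> \<times> ball (co i p) r) (\<lambda>p. \<Phi> (fst p) (snd p))"
    by (rule local_flow[OF field_lipschitz[OF i(1)] is_chartD(2)[OF c] imageI[OF i(2)]]) (rule that; assumption)
  have F: "t \<in> dom (chart_inv (ch i) z)" "Fl t (chart_inv (ch i) z) = chart_inv (ch i) (\<Phi> t z)"
    if z: "z \<in> ball (co i p) r" and t: "t \<in> ball 0 \<delta>" for z t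
  proof -
    have "icurve (ball 0 \<delta>) (\<lambda>t. chart_inv (ch i) (\<Phi> t z))"
      by (rule icurve_of_chart[OF i(1) open_ball is_interval_ball_real f(5)[OF z] f(6)[OF z]])
    from Fl_eqI[OF this _ _ t, of "chart_inv (ch i) z"]
    show "t \<in> dom (chart_inv (ch i) z)" "Fl t (chart_inv (ch i) z) = chart_inv (ch i) (\<Phi> t z)"
      using f(1) f(4)[OF z] by simp_all
  qed
  define e where "e = min \<delta> r"
  have e: "e > 0" "ball 0 e \<subseteq> ball 0 \<delta>" "ball (co i p) e \<subseteq> ball (co i p) r"
    using f(1,2) by (auto simp: e_def)
  have FF: "Fl t (chart_inv (ch i) z) \<in> dm i" "co i (Fl t (chart_inv (ch i) z)) = \<Phi> t z"
    if "z \<in> ball (co i p) e" "t \<in> ball 0 e" for z t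
  proof -
    have zt: "z \<in> ball (co i p) r" "t \<in> ball 0 \<delta>" using that e by blast+
    show "Fl t (chart_inv (ch i) z) \<in> dm i" "co i (Fl t (chart_inv (ch i) z)) = \<Phi> t z"
      unfolding F(2)[OF zt] using is_chartD(5,6)[OF c f(5)[OF zt]] by auto
  qed
  have "L-lipschitz_on (ball 0 e \<times> ball (co i p) e) (\<lambda>p. \<Phi> (fst p) (snd p))"
    by (rule lipschitz_on_subset[OF f(7) Sigma_mono]) (use e in auto)
  then have "L-lipschitz_on (ball 0 e \<times> ball (co i p) e) (\<lambda>q. co i (Fl (fst q) (chart_inv (ch i) (snd q))))"
    by (rule lipschitz_on_transform) (use FF in auto)
  then have "flow_box (ch i) i 0 (co i p) e L"
    unfolding flow_box_def using e f(3) F(1) FF(1) by (meson subset_iff)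
  then show ?thesis by blast
qed

text \<open>By the semigroup law a box at time \<open>t\<close> whose image lies in the range of a local flow around \<open>z0\<close> extends
to every time \<open>t1\<close> within the reach \<open>r\<close> of that local flow. That \<open>r\<close> does not depend on \<open>t\<close> is what makes the
continuation below possible.\<close>

lemma flow_box_compose:
  assumes j: "j \<in> I" and loc: "flow_box (ch j) j 0 z0 r L0"
    and "e > 0" and yb: "ball y0 e \<subseteq> snd b ` fst b"
    and td: "\<And>y. y \<in> ball y0 e \<Longrightarrow> t \<in> dom (chart_inv b y) \<and> Fl t (chart_inv b y) \<in> dm j"
    and tz: "\<And>y. y \<in> ball y0 e \<Longrightarrow> co j (Fl t (chart_inv b y)) \<in> ball z0 r"
    and lip: "K-lipschitz_on (ball y0 e) (\<lambda>y. co j (Fl t (chart_inv b y)))"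
    and t1: "\<bar>t1 - t\<bar> < r"
  shows "\<exists>e' L'. flow_box b j t1 y0 e' L'"
proof -
  \<comment> \<open>Times within \<open>e'\<close> of \<open>t1\<close> differ from \<open>t\<close> by less than the reach \<open>r\<close>.\<close>
  define e' where "e' = min e (r - \<bar>t1 - t\<bar>)"
  have e': "e' > 0" "ball y0 e' \<subseteq> ball y0 e" using \<open>e > 0\<close> t1 by (auto simp: e'_def)
  have st: "s - t \<in> ball 0 r" if "s \<in> ball t1 e'" for s
    using that by (auto simp: e'_def dist_real_def)
  note c = charts[OF j]
  have F: "s \<in> dom (chart_inv b y) \<and> Fl s (chart_inv b y) = Fl (s - t) (chart_inv (ch j) (co j (Fl t (chart_inv b y))))"
    if s: "s \<in> ball t1 e'" and y: "y \<in> ball y0 e'" for s y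
  proof -
    have y': "y \<in> ball y0 e" using e' y by blast
    have eq: "chart_inv (ch j) (co j (Fl t (chart_inv b y))) = Fl t (chart_inv b y)"
      using td[OF y'] is_chartD(4)[OF c] by blast
    have "s - t \<in> dom (chart_inv (ch j) (co j (Fl t (chart_inv b y))))"
      by (rule flow_boxD(3)[OF loc st[OF s] tz[OF y']])
    then show ?thesis using Fl_add[of t "chart_inv b y" "s - t"] td[OF y'] eq by simp
  qed
  let ?\<psi> = "\<lambda>p. (fst p - t, co j (Fl t (chart_inv b (snd p))))"
  have "1-lipschitz_on (ball t1 e' \<times> ball y0 e') (\<lambda>p. fst p - t)"
    using lipschitz_on_diff[OF lipschitz_on_fst lipschitz_on_constant[of _ t]] by simp
  moreover have "(K * 1)-lipschitz_on (ball t1 e' \<times> ball y0 e') (\<lambda>p. co j (Fl t (chart_inv b (snd p))))"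
  proof (rule lipschitz_on_compose2[OF lipschitz_on_snd])
    show "K-lipschitz_on (snd ` (ball t1 e' \<times> ball y0 e')) (\<lambda>y. co j (Fl t (chart_inv b y)))"
      by (rule lipschitz_on_subset[OF lip]) (use e' in auto)
  qed
  ultimately have \<psi>: "(sqrt (1\<^sup>2 + (K * 1)\<^sup>2))-lipschitz_on (ball t1 e' \<times> ball y0 e') ?\<psi>"
    by (rule lipschitz_on_Pair)
  have "L0-lipschitz_on (?\<psi> ` (ball t1 e' \<times> ball y0 e')) (\<lambda>p. co j (Fl (fst p) (chart_inv (ch j) (snd p))))"
  proof (rule lipschitz_on_subset[OF flow_boxD(5)[OF loc]])
    show "?\<psi> ` (ball t1 e' \<times> ball y0 e') \<subseteq> ball 0 r \<times> ball z0 r"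
    proof
      fix q assume "q \<in> ?\<psi> ` (ball t1 e' \<times> ball y0 e')"
      then obtain s y where q: "q = ?\<psi> (s, y)" "s \<in> ball t1 e'" "y \<in> ball y0 e'" by auto
      then show "q \<in> ball 0 r \<times> ball z0 r" using st[OF q(2)] tz[of y] e'(2) by auto
    qed
  qed
  from lipschitz_on_compose2[OF \<psi> this]
  have "(L0 * sqrt (1\<^sup>2 + (K * 1)\<^sup>2))-lipschitz_on (ball t1 e' \<times> ball y0 e') (\<lambda>p. co j (Fl (fst p) (chart_inv b (snd p))))"
    by (rule lipschitz_on_transform) (use F in auto)
  moreover have "Fl s (chart_inv b y) \<in> dm j" if s: "s \<in> ball t1 e'" and y: "y \<in> ball y0 e'" for s y
    using flow_boxD(4)[OF loc st[OF s] tz[of y]] F[OF s y] e'(2) y by auto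
  ultimately have "flow_box b j t1 y0 e' (L0 * sqrt (1\<^sup>2 + (K * 1)\<^sup>2))"
    unfolding flow_box_def using e' yb F by blast
  then show ?thesis by blast
qed

lemma flow_box_change_chart:
  assumes b: "flow_box b i t0 y0 e L" and i: "i \<in> I" and j: "j \<in> I" "Fl t0 (chart_inv b y0) \<in> dm j"
  shows "\<exists>e' L'. flow_box b j t0 y0 e' L'"
proof -
  let ?g = "\<lambda>p. co i (Fl (fst p) (chart_inv b (snd p)))"
  have e: "e > 0" by (rule flow_boxD(1)[OF b])
  have "Fl t0 (chart_inv b y0) \<in> dm i" by (rule flow_boxD(4)[OF b]) (use e in auto)
  then have "?g (t0, y0) \<in> overlap (ch i) (ch j)" using j(2) by (auto simp: overlap_def)
  then obtain \<rho> K where \<rho>: "\<rho> > 0" "ball (?g (t0, y0)) \<rho> \<subseteq> overlap (ch i) (ch j)"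
      "K-lipschitz_on (ball (?g (t0, y0)) \<rho>) (transition (ch i) (ch j))"
    using locally_lipschitz_on_openE[OF transition_lipschitz[OF i j(1)] overlap_open[OF charts[OF i] charts[OF j(1)]]] by blast
  obtain e' where e': "e' > 0" "e' \<le> e" "\<And>p. p \<in> ball t0 e' \<times> ball y0 e' \<Longrightarrow> ?g p \<in> ball (?g (t0, y0)) \<rho>"
    using lipschitz_box_shrink[OF flow_boxD(5)[OF b] e \<rho>(1)] by blast
  have sub: "ball t0 e' \<subseteq> ball t0 e" "ball y0 e' \<subseteq> ball y0 e" using e'(2) by auto
  note b' = flow_box_shrink[OF b e'(1) sub]
  have dmj: "Fl s (chart_inv b y) \<in> dm j" and tr: "transition (ch i) (ch j) (?g (s, y)) = co j (Fl s (chart_inv b y))"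
    if s: "s \<in> ball t0 e'" and y: "y \<in> ball y0 e'" for s y
  proof -
    have di: "Fl s (chart_inv b y) \<in> dm i" by (rule flow_boxD(4)[OF b' s y])
    have "?g (s, y) \<in> overlap (ch i) (ch j)" using e'(3)[of "(s, y)"] \<rho>(2) s y by blast
    then obtain q where "q \<in> dm i" "q \<in> dm j" "co i (Fl s (chart_inv b y)) = co i q"
      by (auto simp: overlap_def)
    then show "Fl s (chart_inv b y) \<in> dm j"
      using di is_chartD(3)[OF charts[OF i]] by (metis inj_on_eq_iff)
    show "transition (ch i) (ch j) (?g (s, y)) = co j (Fl s (chart_inv b y))"
      using is_chartD(4)[OF charts[OF i] di] by (simp add: transition_def)
  qed
  have "K-lipschitz_on (?g ` (ball t0 e' \<times> ball y0 e')) (transition (ch i) (ch j))"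
    by (rule lipschitz_on_subset[OF \<rho>(3)]) (use e'(3) in blast)
  from lipschitz_on_compose2[OF flow_boxD(5)[OF b'] this]
  have "(K * L)-lipschitz_on (ball t0 e' \<times> ball y0 e') (\<lambda>p. co j (Fl (fst p) (chart_inv b (snd p))))"
    by (rule lipschitz_on_transform) (use tr in auto)
  then have "flow_box b j t0 y0 e' (K * L)"
    using b' dmj unfolding flow_box_def by blast
  then show ?thesis by blast
qed

text \<open>A parametrization of a subset of \<open>X\<close> by an open set of a Euclidean space, possibly of smaller dimension.\<close>

definition lipschitz_param :: "('q, 'b::euclidean_space) chart \<Rightarrow> bool" where
  "lipschitz_param b \<longleftrightarrow> (\<exists>N\<subseteq>topspace X. is_chart (subtopology X N) b) \<and>
     (\<forall>i\<in>I. locally_lipschitz_on (overlap b (ch i)) (transition b (ch i)))"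

lemma overlap_open_param:
  assumes "lipschitz_param b" "i \<in> I"
  shows "open (overlap b (ch i))"
proof -
  obtain N where N: "is_chart (subtopology X N) b" using assms(1) by (auto simp: lipschitz_param_def)
  have "openin (subtopology X N) (N \<inter> dm i)"
    using is_chartD(1)[OF charts[OF assms(2)]] by (rule openin_subtopology_Int2)
  from chart_open_image[OF N this] have "open (snd b ` (fst b \<inter> (N \<inter> dm i)))" .
  moreover have "fst b \<inter> (N \<inter> dm i) = fst b \<inter> dm i" using is_chartD(7)[OF N] by auto
  ultimately show ?thesis by (simp add: overlap_def)
qed

lemma param_chartD:
  assumes "lipschitz_param b"
  shows "inj_on (snd b) (fst b)" "open (snd b ` fst b)" "fst b \<subseteq> topspace X"
    "p \<in> fst b \<Longrightarrow> chart_inv b (snd b p) = p"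
    "y \<in> snd b ` fst b \<Longrightarrow> chart_inv b y \<in> fst b" "y \<in> snd b ` fst b \<Longrightarrow> snd b (chart_inv b y) = y"
proof -
  obtain N where N: "is_chart (subtopology X N) b" using assms(1) by (auto simp: lipschitz_param_def)
  show "inj_on (snd b) (fst b)" "open (snd b ` fst b)" "fst b \<subseteq> topspace X"
    "p \<in> fst b \<Longrightarrow> chart_inv b (snd b p) = p"
    "y \<in> snd b ` fst b \<Longrightarrow> chart_inv b y \<in> fst b" "y \<in> snd b ` fst b \<Longrightarrow> snd b (chart_inv b y) = y"
    using is_chartD[OF N] by auto
qed

lemma flow_box_start:
  assumes b: "lipschitz_param b" "v \<in> fst b" and i: "i \<in> I" "v \<in> dm i"
  shows "\<exists>e L. flow_box b i 0 (snd b v) e L"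
proof -
  obtain r L0 where loc: "flow_box (ch i) i 0 (co i v) r L0" using chart_flow_box[OF i] by blast
  have r: "r > 0" by (rule flow_boxD(1)[OF loc])
  let ?T = "transition b (ch i)"
  have vo: "snd b v \<in> overlap b (ch i)" using b(2) i(2) by (auto simp: overlap_def)
  have tv: "?T (snd b v) = co i v" using param_chartD(4)[OF b] by (simp add: transition_def)
  have "locally_lipschitz_on (overlap b (ch i)) ?T" using b(1) i(1) by (auto simp: lipschitz_param_def)
  then obtain \<rho> K where \<rho>: "\<rho> > 0" "ball (snd b v) \<rho> \<subseteq> overlap b (ch i)" "K-lipschitz_on (ball (snd b v) \<rho>) ?T"
    using locally_lipschitz_on_openE[OF _ overlap_open_param[OF b(1) i(1)] vo] by blast
  have "continuous_on (ball (snd b v) \<rho>) ?T" by (rule lipschitz_on_continuous_on[OF \<rho>(3)])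
  then obtain d where d: "d > 0" "\<And>y. y \<in> ball (snd b v) \<rho> \<Longrightarrow> dist y (snd b v) < d \<Longrightarrow> dist (?T y) (co i v) < r"
    using r \<rho>(1) tv unfolding continuous_on_iff by (metis centre_in_ball)
  define e where "e = min \<rho> d"
  have e: "e > 0" "ball (snd b v) e \<subseteq> ball (snd b v) \<rho>" using \<rho> d by (auto simp: e_def)
  have y: "chart_inv b y \<in> fst b \<and> chart_inv b y \<in> dm i \<and> y \<in> snd b ` fst b" if "y \<in> ball (snd b v) e" for y
  proof -
    have "y \<in> overlap b (ch i)" using that e \<rho> by blast
    then obtain p where p: "p \<in> fst b" "p \<in> dm i" "y = snd b p" by (auto simp: overlap_def)
    then show ?thesis using param_chartD(4)[OF b(1) p(1)] by simp
  qed
  have F0: "0 \<in> dom (chart_inv b y) \<and> Fl 0 (chart_inv b y) = chart_inv b y" if "y \<in> ball (snd b v) e" for y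
    using y[OF that] param_chartD(3)[OF b(1)] zero_in_dom Fl_0 by blast
  have eq: "co i (Fl 0 (chart_inv b y)) = ?T y" if "y \<in> ball (snd b v) e" for y
    using F0[OF that] by (simp add: transition_def)
  show ?thesis
  proof (rule flow_box_compose[OF i(1) loc e(1), where t = 0])
    show "ball (snd b v) e \<subseteq> snd b ` fst b" using y by blast
    show "0 \<in> dom (chart_inv b y) \<and> Fl 0 (chart_inv b y) \<in> dm i" if "y \<in> ball (snd b v) e" for y
      using F0[OF that] y[OF that] by simp
    show "co i (Fl 0 (chart_inv b y)) \<in> ball (co i v) r" if "y \<in> ball (snd b v) e" for y
      using d(2)[of y] that e(2) eq[OF that] by (auto simp: e_def dist_commute)
    show "K-lipschitz_on (ball (snd b v) e) (\<lambda>y. co i (Fl 0 (chart_inv b y)))"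
      using lipschitz_on_subset[OF \<rho>(3) e(2)] by (rule lipschitz_on_transform) (rule eq)
  qed (use r in auto)
qed

text \<open>The local flow around the position at time \<open>t1\<close> has a fixed reach, and boxes at times close enough to
\<open>t1\<close> can be continued by it up to \<open>t1\<close>. This says that the set of times with a flow box is relatively
closed.\<close>

lemma flow_box_reaches_limit:
  assumes b: "lipschitz_param b" "v \<in> fst b" and t1: "t1 \<in> dom v"
  shows "\<exists>\<eta>>0. ball t1 \<eta> \<subseteq> dom v \<and> (\<forall>t\<in>ball t1 \<eta>. (\<exists>i\<in>I. \<exists>e L. flow_box b i t (snd b v) e L) \<longrightarrow>
    (\<exists>i\<in>I. \<exists>e L. flow_box b i t1 (snd b v) e L))"
proof -
  obtain j where j: "j \<in> I" "Fl t1 v \<in> dm j" using chart_around Fl_in_space[OF t1] by blast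
  obtain r L0 where loc: "flow_box (ch j) j 0 (co j (Fl t1 v)) r L0" using chart_flow_box[OF j] by blast
  have r: "r > 0" by (rule flow_boxD(1)[OF loc])
  let ?V = "{p \<in> dm j. co j p \<in> ball (co j (Fl t1 v)) r}"
  have "openin X ?V" by (rule chart_openin_preimage[OF charts[OF j(1)] open_ball])
  then obtain \<eta>' where \<eta>': "\<eta>' > 0" "ball t1 \<eta>' \<subseteq> dom v" "\<forall>s\<in>ball t1 \<eta>'. Fl s v \<in> ?V"
    using icurveD(5)[OF icurve_Fl t1, of ?V] j r by auto
  define \<eta> where "\<eta> = min \<eta>' r"
  have iv: "chart_inv b (snd b v) = v" using param_chartD(4)[OF b] .
  show ?thesis
  proof (intro exI[of _ \<eta>] conjI ballI impI)
    show "0 < \<eta>" using \<eta>' r by (simp add: \<eta>_def)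
    show "ball t1 \<eta> \<subseteq> dom v" using \<eta>' by (auto simp: \<eta>_def)
    fix t assume t: "t \<in> ball t1 \<eta>" and "\<exists>i\<in>I. \<exists>e L. flow_box b i t (snd b v) e L"
    then obtain i e L where i: "i \<in> I" "flow_box b i t (snd b v) e L" by blast
    have tV: "Fl t v \<in> ?V" using t \<eta>'(3) by (auto simp: \<eta>_def)
    obtain e1 L1 where b1: "flow_box b j t (snd b v) e1 L1"
      using flow_box_change_chart[OF i(2,1) j(1)] tV iv by auto
    have e1: "e1 > 0" by (rule flow_boxD(1)[OF b1])
    let ?g = "\<lambda>p. co j (Fl (fst p) (chart_inv b (snd p)))"
    define \<rho> where "\<rho> = r - dist (co j (Fl t1 v)) (co j (Fl t v))"
    have \<rho>: "\<rho> > 0" "ball (co j (Fl t v)) \<rho> \<subseteq> ball (co j (Fl t1 v)) r"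
    proof -
      show "\<rho> > 0" using tV by (simp add: \<rho>_def)
      show "ball (co j (Fl t v)) \<rho> \<subseteq> ball (co j (Fl t1 v)) r"
      proof
        fix z assume "z \<in> ball (co j (Fl t v)) \<rho>"
        then show "z \<in> ball (co j (Fl t1 v)) r"
          using dist_triangle[of "co j (Fl t1 v)" z "co j (Fl t v)"] by (simp add: \<rho>_def)
      qed
    qed
    obtain e2 where e2: "e2 > 0" "e2 \<le> e1" "\<And>p. p \<in> ball t e2 \<times> ball (snd b v) e2 \<Longrightarrow> ?g p \<in> ball (?g (t, snd b v)) \<rho>"
      using lipschitz_box_shrink[OF flow_boxD(5)[OF b1] e1 \<rho>(1)] by blast
    have b2: "flow_box b j t (snd b v) e2 L1"
      by (rule flow_box_shrink[OF b1 e2(1)]) (use e2(2) in auto)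
    have "\<exists>e' L'. flow_box b j t1 (snd b v) e' L'"
    proof (rule flow_box_compose[OF j(1) loc e2(1) flow_boxD(2)[OF b2], where t = t])
      fix y assume y: "y \<in> ball (snd b v) e2"
      show "t \<in> dom (chart_inv b y) \<and> Fl t (chart_inv b y) \<in> dm j"
        using flow_boxD(3,4)[OF b2 _ y, of t] e2(1) by simp
      show "co j (Fl t (chart_inv b y)) \<in> ball (co j (Fl t1 v)) r"
        using e2(3)[of "(t, y)"] y e2(1) \<rho>(2) iv by auto
    next
      show "L1-lipschitz_on (ball (snd b v) e2) (\<lambda>y. co j (Fl t (chart_inv b y)))"
      proof (rule lipschitz_onI)
        fix y y' assume "y \<in> ball (snd b v) e2" "y' \<in> ball (snd b v) e2"
        then show "dist (co j (Fl t (chart_inv b y))) (co j (Fl t (chart_inv b y'))) \<le> L1 * dist y y'"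
          using lipschitz_onD[OF flow_boxD(5)[OF b2], of "(t, y)" "(t, y')"] e2(1) by (simp add: dist_Pair_Pair)
      qed (rule lipschitz_on_nonneg[OF flow_boxD(5)[OF b2]])
      show "\<bar>t1 - t\<bar> < r" using t by (simp add: \<eta>_def dist_real_def)
    qed
    then show "\<exists>i\<in>I. \<exists>e L. flow_box b i t1 (snd b v) e L" using j(1) by blast
  qed
qed

text \<open>The times with a flow box form an open and closed subset, containing \<open>0\<close>, of the connected domain of
the integral curve.\<close>

theorem flow_box_exists:
  assumes b: "lipschitz_param b" "v \<in> fst b" and t: "t \<in> dom v" and i: "i \<in> I" "Fl t v \<in> dm i"
  shows "\<exists>e L. flow_box b i t (snd b v) e L"
proof -
  define P where "P s \<longleftrightarrow> (\<exists>i\<in>I. \<exists>e L. flow_box b i s (snd b v) e L)" for s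
  let ?A = "{s \<in> dom v. P s}" and ?B = "{s \<in> dom v. \<not> P s}"
  have od: "open (dom v)" by (rule icurveD(1)[OF icurve_Fl])
  have vX: "v \<in> topspace X" using b param_chartD(3) by blast
  have "open ?A"
    unfolding open_contains_ball
  proof
    fix s assume s: "s \<in> ?A"
    then obtain i e L where f: "i \<in> I" "flow_box b i s (snd b v) e L" unfolding P_def by blast
    obtain d where d: "d > 0" "ball s d \<subseteq> dom v" using od s open_contains_ball by blast
    have "P r" if r: "r \<in> ball s e" for r
    proof -
      have "e - dist s r > 0" using r by simp
      moreover have "ball r (e - dist s r) \<subseteq> ball s e"
        using dist_triangle[of s _ r] by (auto simp: subset_eq) (metis add_less_cancel_left diff_add_cancel dist_triangle add.commute less_diff_eq order_le_less_trans)
      moreover have "ball (snd b v) (e - dist s r) \<subseteq> ball (snd b v) e" by (rule subset_ball) simp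
      ultimately have "flow_box b i r (snd b v) (e - dist s r) L" by (rule flow_box_shrink[OF f(2)])
      then show ?thesis unfolding P_def using f(1) by blast
    qed
    then have "ball s (min d e) \<subseteq> ?A" using d(2) by auto
    then show "\<exists>e>0. ball s e \<subseteq> ?A" using d(1) flow_boxD(1)[OF f(2)] by (intro exI[of _ "min d e"]) auto
  qed
  moreover have "open ?B"
    unfolding open_contains_ball
  proof
    fix s assume s: "s \<in> ?B"
    then obtain \<eta> where "\<eta> > 0" "ball s \<eta> \<subseteq> dom v" "\<forall>r\<in>ball s \<eta>. P r \<longrightarrow> P s"
      using flow_box_reaches_limit[OF b, of s] unfolding P_def by blast
    then show "\<exists>e>0. ball s e \<subseteq> ?B" using s by blast
  qed
  moreover have "connected (dom v)" using icurveD(2)[OF icurve_Fl] is_interval_connected by blast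
  moreover have "0 \<in> ?A"
  proof -
    obtain i where "i \<in> I" "v \<in> dm i" using chart_around[OF vX] .
    then show ?thesis using flow_box_start[OF b] zero_in_dom[OF vX] unfolding P_def by blast
  qed
  moreover have "dom v \<subseteq> ?A \<union> ?B" "?A \<inter> ?B \<inter> dom v = {}" by auto
  ultimately have "?B \<inter> dom v = {}" unfolding connected_def by blast
  then obtain j e L where "j \<in> I" "flow_box b j t (snd b v) e L" using t unfolding P_def by blast
  moreover have "Fl t (chart_inv b (snd b v)) \<in> dm i" using i(2) param_chartD(4)[OF b] by simp
  ultimately show ?thesis using flow_box_change_chart[OF _ _ i(1)] by blast
qed

lemma flow_box_derivative:
  assumes f: "flow_box b i t0 y0 e L" and i: "i \<in> I" and ty: "t \<in> ball t0 e" "y \<in> ball y0 e"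
  shows "((\<lambda>s. co i (Fl s (chart_inv b y))) has_vector_derivative F i (co i (Fl t (chart_inv b y)))) (at t)"
  by (rule icurveD(4)[OF icurve_Fl flow_boxD(3)[OF f ty] i flow_boxD(4)[OF f ty]])

lemma flow_box_with_field:
  assumes f: "flow_box b i t0 y0 e L" and i: "i \<in> I"
  shows "\<exists>e L. flow_box b i t0 y0 e L \<and>
    L-lipschitz_on (ball t0 e \<times> ball y0 e) (\<lambda>p. F i (co i (Fl (fst p) (chart_inv b (snd p)))))"
proof -
  let ?g = "\<lambda>p. co i (Fl (fst p) (chart_inv b (snd p)))"
  have e: "e > 0" by (rule flow_boxD(1)[OF f])
  have "Fl t0 (chart_inv b y0) \<in> dm i" by (rule flow_boxD(4)[OF f]) (use e in auto)
  then have "?g (t0, y0) \<in> co i ` dm i" by simp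
  then obtain \<rho> K where \<rho>: "\<rho> > 0" "K-lipschitz_on (ball (?g (t0, y0)) \<rho>) (F i)"
    using locally_lipschitz_on_openE[OF field_lipschitz[OF i] is_chartD(2)[OF charts[OF i]]] by metis
  obtain e' where e': "e' > 0" "e' \<le> e" "\<And>p. p \<in> ball t0 e' \<times> ball y0 e' \<Longrightarrow> ?g p \<in> ball (?g (t0, y0)) \<rho>"
    using lipschitz_box_shrink[OF flow_boxD(5)[OF f] e \<rho>(1)] by blast
  have f': "flow_box b i t0 y0 e' L" by (rule flow_box_shrink[OF f e'(1)]) (use e'(2) in auto)
  have "K-lipschitz_on (?g ` (ball t0 e' \<times> ball y0 e')) (F i)"
    by (rule lipschitz_on_subset[OF \<rho>(2)]) (use e'(3) in blast)
  from lipschitz_on_compose2[OF flow_boxD(5)[OF f'] this]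
  have KL: "(K * L)-lipschitz_on (ball t0 e' \<times> ball y0 e') (\<lambda>p. F i (?g p))" .
  have "flow_box b i t0 y0 e' (max L (K * L))"
    using f' lipschitz_on_mono[OF flow_boxD(5)[OF f'] order_refl, of "max L (K * L)"] unfolding flow_box_def by auto
  moreover have "(max L (K * L))-lipschitz_on (ball t0 e' \<times> ball y0 e') (\<lambda>p. F i (?g p))"
    by (rule lipschitz_on_mono[OF KL]) auto
  ultimately show ?thesis by blast
qed

end

section \<open>Differentiability of an evolution in its initial value\<close>

lemma rademacher_open:
  fixes f :: "'a::euclidean_space \<Rightarrow> 'b::euclidean_space"
  assumes "open S" and lip: "L-lipschitz_on S f"
  shows "negligible {x \<in> S. \<not> f differentiable (at x)}"
  unfolding locally_negligible_alt[of "{x \<in> S. \<not> f differentiable (at x)}"]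
proof
  let ?N = "{x \<in> S. \<not> f differentiable (at x)}"
  fix x assume x: "x \<in> ?N"
  then obtain r where r: "r > 0" "ball x r \<subseteq> S" using \<open>open S\<close> open_contains_ball by blast
  have "negligible {y \<in> ball x r. \<not> f differentiable (at y)}"
    by (rule rademacher_ball[OF lipschitz_on_subset[OF lip r(2)]])
  then have "negligible (?N \<inter> ball x r)" by (rule negligible_subset) auto
  moreover have "openin (top_of_set ?N) (?N \<inter> ball x r)" by (simp add: openin_open_Int)
  ultimately show "\<exists>U. openin (top_of_set ?N) U \<and> x \<in> U \<and> negligible U" using x r by auto
qed

lemma derivative_norm_le:
  fixes f :: "'a::real_normed_vector \<Rightarrow> 'b::real_normed_vector"
  assumes D: "(f has_derivative D) (at y)" and C: "\<forall>\<^sub>F z in nhds y. norm (f z - f y) \<le> C * norm (z - y)"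
  shows "norm (D h) \<le> C * norm h"
proof (cases "h = 0")
  case True
  then show ?thesis using linear_0[OF has_derivative_linear[OF D]] by simp
next
  case False
  obtain r where r: "r > 0" "\<And>z. dist z y < r \<Longrightarrow> norm (f z - f y) \<le> C * norm (z - y)"
    using C unfolding eventually_nhds_metric by blast
  show ?thesis
  proof (rule field_le_epsilon)
    fix \<epsilon> :: real assume "\<epsilon> > 0"
    then have "\<epsilon> / norm h > 0" using False by simp
    then obtain d where d: "d > 0" "\<And>z. norm (z - y) < d \<Longrightarrow> norm (f z - f y - D (z - y)) \<le> \<epsilon> / norm h * norm (z - y)"
      using D unfolding has_derivative_at_alt by blast
    define \<tau> where "\<tau> = min d r / (2 * norm h)"
    have \<tau>: "\<tau> > 0" "\<tau> * norm h < d" "\<tau> * norm h < r" using False d r by (auto simp: \<tau>_def)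
    let ?z = "y + \<tau> *\<^sub>R h"
    have n: "norm (?z - y) = \<tau> * norm h" using \<tau> by simp
    have Dz: "D (?z - y) = \<tau> *\<^sub>R D h" using linear_scale[OF has_derivative_linear[OF D]] by simp
    have "norm (f ?z - f y - D (?z - y)) \<le> \<epsilon> / norm h * (\<tau> * norm h)" using d(2)[of ?z] n \<tau> by simp
    moreover have "norm (f ?z - f y) \<le> C * (\<tau> * norm h)" using r(2)[of ?z] n \<tau> by (simp add: dist_norm)
    moreover have "norm (D (?z - y)) \<le> norm (f ?z - f y) + norm (f ?z - f y - D (?z - y))"
      using norm_triangle_ineq4[of "f ?z - f y" "f ?z - f y - D (?z - y)"] by simp
    moreover have "norm (D (?z - y)) = \<tau> * norm (D h)" unfolding Dz using \<tau> by simp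
    ultimately have "\<tau> * norm (D h) \<le> \<tau> * (C * norm h + \<epsilon>)" using False by (simp add: algebra_simps)
    then show "norm (D h) \<le> C * norm h + \<epsilon>" using \<tau>(1) by simp
  qed
qed

lemma has_derivative_partial2:
  assumes "f t differentiable (at y)"
  shows "(f t has_derivative blinfun_apply (partial2 f t y)) (at y)"
proof -
  have d: "(f t has_derivative frechet_derivative (f t) (at y)) (at y)"
    using assms by (simp add: frechet_derivative_works)
  then have "bounded_linear (frechet_derivative (f t) (at y))" by (rule has_derivative_bounded_linear)
  then show ?thesis using d by (simp add: partial2_def bounded_linear_Blinfun_apply)
qed

lemma partial2_eqI:
  assumes "(f t has_derivative blinfun_apply D) (at y)"
  shows "partial2 f t y = D"
proof -
  have "frechet_derivative (f t) (at y) = blinfun_apply D"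
    using frechet_derivative_at[OF assms] by simp
  then show ?thesis by (simp add: partial2_def blinfun_apply_inverse)
qed

lemma blinfun_has_vector_derivative_componentwise:
  fixes J :: "real \<Rightarrow> 'b::euclidean_space \<Rightarrow>\<^sub>L 'e::euclidean_space"
  assumes "\<And>h k. h \<in> Basis \<Longrightarrow> k \<in> Basis \<Longrightarrow> ((\<lambda>s. blinfun_apply (J s) h \<bullet> k) has_real_derivative (blinfun_apply K h \<bullet> k)) (at t)"
  shows "(J has_vector_derivative K) (at t)"
proof -
  \<comment> \<open>The matrix units; every operator is the combination of them by its entries.\<close>
  define E where "E k h = Blinfun (\<lambda>x. (x \<bullet> h) *\<^sub>R k)" for k :: 'e and h :: 'b
  have rep: "A = (\<Sum>k\<in>Basis. \<Sum>h\<in>Basis. (blinfun_apply A h \<bullet> k) *\<^sub>R E k h)" for A :: "'b \<Rightarrow>\<^sub>L 'e"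
  proof (rule blinfun_euclidean_eqI)
    fix j :: 'b assume j: "j \<in> Basis"
    have E: "blinfun_apply (E k h) j = (if h = j then k else 0)" if "k \<in> Basis" "h \<in> Basis" for k h
    proof -
      have "bounded_linear (\<lambda>x. (x \<bullet> h) *\<^sub>R k)" by (intro bounded_linear_intros)
      then show ?thesis unfolding E_def using j that by (simp add: bounded_linear_Blinfun_apply inner_Basis)
    qed
    have "blinfun_apply (\<Sum>k\<in>Basis. \<Sum>h\<in>Basis. (blinfun_apply A h \<bullet> k) *\<^sub>R E k h) j =
        (\<Sum>k\<in>Basis. \<Sum>h\<in>Basis. (blinfun_apply A h \<bullet> k) *\<^sub>R blinfun_apply (E k h) j)"
      by (simp add: blinfun.sum_left blinfun.scaleR_left)
    also have "\<dots> = (\<Sum>k\<in>Basis. \<Sum>h\<in>Basis. if h = j then (blinfun_apply A h \<bullet> k) *\<^sub>R k else 0)"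
      by (intro sum.cong refl) (simp add: E)
    also have "\<dots> = (\<Sum>k\<in>Basis. (blinfun_apply A j \<bullet> k) *\<^sub>R k)" using j by simp
    also have "\<dots> = blinfun_apply A j" by (rule euclidean_representation)
    finally show "blinfun_apply A j = blinfun_apply (\<Sum>k\<in>Basis. \<Sum>h\<in>Basis. (blinfun_apply A h \<bullet> k) *\<^sub>R E k h) j" ..
  qed
  have D: "((\<lambda>s. \<Sum>k\<in>Basis. \<Sum>h\<in>Basis. (blinfun_apply (J s) h \<bullet> k) *\<^sub>R E k h) has_vector_derivative
      (\<Sum>k\<in>Basis. \<Sum>h\<in>Basis. (blinfun_apply K h \<bullet> k) *\<^sub>R E k h)) (at t)"
  proof (intro has_vector_derivative_sum)
    fix k :: 'e and h :: 'b assume kh: "k \<in> Basis" "h \<in> Basis"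
    show "((\<lambda>s. (blinfun_apply (J s) h \<bullet> k) *\<^sub>R E k h) has_vector_derivative (blinfun_apply K h \<bullet> k) *\<^sub>R E k h) (at t)"
      by (rule bounded_linear.has_vector_derivative[OF bounded_linear_scaleR_left])
        (use assms[OF kh(2,1)] in \<open>simp add: has_real_derivative_iff_has_vector_derivative\<close>)
  qed
  have eJ: "(\<lambda>s. \<Sum>k\<in>Basis. \<Sum>h\<in>Basis. (blinfun_apply (J s) h \<bullet> k) *\<^sub>R E k h) = J"
    by (rule ext) (rule rep[symmetric])
  have eK: "(\<Sum>k\<in>Basis. \<Sum>h\<in>Basis. (blinfun_apply K h \<bullet> k) *\<^sub>R E k h) = K"
    by (rule rep[symmetric])
  from D show ?thesis unfolding eJ eK .
qed

definition mixed_at :: "(real \<Rightarrow> 'b::real_normed_vector \<Rightarrow> 'c::real_normed_vector) \<Rightarrow> real \<Rightarrow> 'b \<Rightarrow> bool" where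
  "mixed_at f t y \<longleftrightarrow> has_partial12 f t y \<and> has_partial21 f t y \<and>
     partial1 (partial2 f) t y = partial2 (partial1 f) t y"

text \<open>In applications \<open>g\<close> is a flow expressed in charts and \<open>G\<close> the vector field along it. Everything about
differentials is derived from the fact that both are Lipschitz jointly in time and initial value.\<close>

locale evolution_box =
  fixes g G :: "real \<Rightarrow> 'b::euclidean_space \<Rightarrow> 'e::euclidean_space" and t0 y0 e L
  assumes e: "e > 0"
    and lip_g: "L-lipschitz_on (ball t0 e \<times> ball y0 e) (\<lambda>p. g (fst p) (snd p))"
    and lip_G: "L-lipschitz_on (ball t0 e \<times> ball y0 e) (\<lambda>p. G (fst p) (snd p))"
    and evolve: "t \<in> ball t0 e \<Longrightarrow> y \<in> ball y0 e \<Longrightarrow> ((\<lambda>s. g s y) has_vector_derivative G t y) (at t)"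
begin

lemma L_nonneg: "L \<ge> 0" by (rule lipschitz_on_nonneg[OF lip_g])

lemma G_lipschitz: "t \<in> ball t0 e \<Longrightarrow> y \<in> ball y0 e \<Longrightarrow> y' \<in> ball y0 e \<Longrightarrow> norm (G t y - G t y') \<le> L * norm (y - y')"
  using lipschitz_onD[OF lip_G, of "(t, y)" "(t, y')"] by (simp add: dist_Pair_Pair dist_norm)

text \<open>The time derivative \<open>G r y' - G r y\<close> is at most \<open>L |y' - y|\<close>: the difference quotients in \<open>y\<close> are
Lipschitz in time with the constant \<open>L\<close>, whatever the direction and the size of the increment.\<close>

lemma increment_le:
  assumes "s \<in> ball t0 e" "t \<in> ball t0 e" and y: "y \<in> ball y0 e" "y' \<in> ball y0 e"
  shows "norm ((g t y' - g t y) - (g s y' - g s y)) \<le> L * norm (y' - y) * \<bar>t - s\<bar>"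
proof (rule vector_derivative_bound[OF convex_ball _ _ assms(2,1)])
  fix r assume r: "r \<in> ball t0 e"
  show "((\<lambda>r. g r y' - g r y) has_vector_derivative G r y' - G r y) (at r within ball t0 e)"
    by (rule has_vector_derivative_at_within[OF has_vector_derivative_diff[OF evolve[OF r y(2)] evolve[OF r y(1)]]])
  show "norm (G r y' - G r y) \<le> L * norm (y' - y)" by (rule G_lipschitz[OF r y(2,1)])
qed

lemma eventually_in_ball: "y \<in> ball y0 e \<Longrightarrow> \<forall>\<^sub>F z in nhds y. z \<in> ball y0 e"
  and eventually_in_ball_time: "t \<in> ball t0 e \<Longrightarrow> \<forall>\<^sub>F z in nhds t. z \<in> ball t0 e"
  using eventually_nhds_in_open[OF open_ball] by blast+

lemma jacobian_lipschitz:
  assumes s: "s \<in> ball t0 e" and t: "t \<in> ball t0 e" and y: "y \<in> ball y0 e"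
    and d: "g s differentiable (at y)" "g t differentiable (at y)"
  shows "dist (partial2 g s y) (partial2 g t y) \<le> L * dist s t"
proof -
  have "norm (partial2 g t y - partial2 g s y) \<le> L * \<bar>t - s\<bar>"
  proof (rule norm_blinfun_bound)
    show "0 \<le> L * \<bar>t - s\<bar>" using L_nonneg by simp
    fix h
    have D: "((\<lambda>z. g t z - g s z) has_derivative blinfun_apply (partial2 g t y - partial2 g s y)) (at y)"
      using has_derivative_diff[OF has_derivative_partial2[of g t y, OF d(2)] has_derivative_partial2[of g s y, OF d(1)]]
      by (simp add: minus_blinfun.rep_eq)
    show "norm (blinfun_apply (partial2 g t y - partial2 g s y) h) \<le> L * \<bar>t - s\<bar> * norm h"
    proof (rule derivative_norm_le[OF D])
      show "\<forall>\<^sub>F z in nhds y. norm ((g t z - g s z) - (g t y - g s y)) \<le> L * \<bar>t - s\<bar> * norm (z - y)"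
        using eventually_in_ball[OF y]
      proof (rule eventually_mono)
        fix z assume z: "z \<in> ball y0 e"
        have "(g t z - g s z) - (g t y - g s y) = (g t z - g t y) - (g s z - g s y)" by simp
        then show "norm ((g t z - g s z) - (g t y - g s y)) \<le> L * \<bar>t - s\<bar> * norm (z - y)"
          unfolding \<open>(g t z - g s z) - (g t y - g s y) = _\<close> using increment_le[OF s t y z] by (simp add: mult_ac)
      qed
    qed
  qed
  then show ?thesis by (simp add: dist_norm norm_minus_commute abs_minus_commute)
qed

text \<open>Along a sequence of good times tending to \<open>t\<close> the Jacobians form a Cauchy sequence. Its limit is the
Jacobian at \<open>t\<close>, because \<open>increment_le\<close> bounds the error made by replacing one time by another
uniformly in the increment.\<close>

lemma differentiable_if_dense:
  assumes t: "t \<in> ball t0 e" and y: "y \<in> ball y0 e"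
    and dense: "\<And>d. d > 0 \<Longrightarrow> \<exists>s\<in>ball t0 e. \<bar>s - t\<bar> < d \<and> g s differentiable (at y)"
  shows "g t differentiable (at y)"
proof -
  have "\<forall>n. \<exists>s. s \<in> ball t0 e \<and> \<bar>s - t\<bar> < inverse (real (Suc n)) \<and> g s differentiable (at y)"
    using dense by (metis inverse_positive_iff_positive of_nat_0_less_iff zero_less_Suc)
  then obtain s where s: "\<And>n. s n \<in> ball t0 e" "\<And>n. \<bar>s n - t\<bar> < inverse (real (Suc n))" "\<And>n. g (s n) differentiable (at y)"
    by metis
  have "(\<lambda>n. s n - t) \<longlonglongrightarrow> 0"
    by (rule tendsto_rabs_zero_cancel, rule tendsto_sandwich[OF _ _ tendsto_const LIMSEQ_inverse_real_of_nat])
      (use s(2) in \<open>auto intro!: always_eventually less_imp_le\<close>)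
  then have st: "s \<longlonglongrightarrow> t" by (rule LIM_zero_cancel)
  define J where "J n = partial2 g (s n) y" for n
  have "Cauchy J"
    unfolding Cauchy_def
  proof (intro allI impI)
    fix \<epsilon> :: real assume "\<epsilon> > 0"
    then have "\<epsilon> / (L + 1) > 0" using L_nonneg by simp
    then obtain M where M: "\<And>m n. m \<ge> M \<Longrightarrow> n \<ge> M \<Longrightarrow> dist (s m) (s n) < \<epsilon> / (L + 1)"
      using LIMSEQ_imp_Cauchy[OF st] unfolding Cauchy_def by blast
    show "\<exists>M. \<forall>m\<ge>M. \<forall>n\<ge>M. dist (J m) (J n) < \<epsilon>"
    proof (intro exI[of _ M] allI impI)
      fix m n assume "m \<ge> M" "n \<ge> M"
      then have "L * dist (s m) (s n) \<le> L * (\<epsilon> / (L + 1))" using M L_nonneg by (intro mult_left_mono) (auto intro: less_imp_le)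
      also have "\<dots> < \<epsilon>" using L_nonneg \<open>\<epsilon> > 0\<close> by (simp add: field_simps)
      finally show "dist (J m) (J n) < \<epsilon>"
        using jacobian_lipschitz[OF s(1) s(1) y s(3) s(3), of m n] unfolding J_def by linarith
    qed
  qed
  then obtain K where K: "J \<longlonglongrightarrow> K" using Cauchy_convergent convergentD by blast
  have "(g t has_derivative blinfun_apply K) (at y)"
    unfolding has_derivative_at_alt
  proof (intro conjI allI impI)
    show "bounded_linear (blinfun_apply K)" by (rule blinfun.bounded_linear_right)
    fix \<epsilon> :: real assume "\<epsilon> > 0"
    then have e3: "\<epsilon> / 3 / (L + 1) > 0" "\<epsilon> / 3 > 0" using L_nonneg by auto
    have "\<forall>\<^sub>F n in sequentially. dist (s n) t < \<epsilon> / 3 / (L + 1) \<and> dist (J n) K < \<epsilon> / 3"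
      using tendstoD[OF st e3(1)] tendstoD[OF K e3(2)] by (rule eventually_conj)
    then obtain n where n: "dist (s n) t < \<epsilon> / 3 / (L + 1)" "dist (J n) K < \<epsilon> / 3"
      using eventually_happens' sequentially_bot by blast
    obtain d where d: "d > 0" "\<And>z. norm (z - y) < d \<Longrightarrow> norm (g (s n) z - g (s n) y - blinfun_apply (J n) (z - y)) \<le> \<epsilon> / 3 * norm (z - y)"
      using has_derivative_partial2[of g "s n" y, OF s(3)] e3(2) unfolding has_derivative_at_alt J_def by blast
    obtain d' where d': "d' > 0" "ball y d' \<subseteq> ball y0 e" using y open_contains_ball[of "ball y0 e"] by blast
    show "\<exists>d>0. \<forall>z. norm (z - y) < d \<longrightarrow> norm (g t z - g t y - blinfun_apply K (z - y)) \<le> \<epsilon> * norm (z - y)"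
    proof (intro exI[of _ "min d d'"] conjI allI impI)
      fix z assume z: "norm (z - y) < min d d'"
      then have zb: "z \<in> ball y0 e" using d' by (auto simp: dist_norm norm_minus_commute)
      have a: "norm ((g t z - g t y) - (g (s n) z - g (s n) y)) \<le> \<epsilon> / 3 * norm (z - y)"
      proof -
        have "L * \<bar>t - s n\<bar> \<le> (L + 1) * (\<epsilon> / 3 / (L + 1))"
          using n(1) L_nonneg by (intro mult_mono) (auto simp: dist_real_def)
        also have "\<dots> = (L + 1) * (\<epsilon> / 3) / (L + 1)" by (rule times_divide_eq_right)
        also have "\<dots> = \<epsilon> / 3" by (rule nonzero_mult_div_cancel_left) (use L_nonneg in simp)
        finally have "L * \<bar>t - s n\<bar> * norm (z - y) \<le> \<epsilon> / 3 * norm (z - y)" by (rule mult_right_mono) simp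
        then show ?thesis using increment_le[OF s(1)[of n] t y zb] by (simp add: mult_ac)
      qed
      have b: "norm (g (s n) z - g (s n) y - blinfun_apply (J n) (z - y)) \<le> \<epsilon> / 3 * norm (z - y)"
        using d(2) z by simp
      have c: "norm (blinfun_apply (J n) (z - y) - blinfun_apply K (z - y)) \<le> \<epsilon> / 3 * norm (z - y)"
      proof -
        have "norm (blinfun_apply (J n - K) (z - y)) \<le> norm (J n - K) * norm (z - y)" by (rule norm_blinfun)
        also have "\<dots> \<le> \<epsilon> / 3 * norm (z - y)" using n(2) by (intro mult_right_mono) (auto simp: dist_norm)
        finally show ?thesis by (simp add: blinfun.diff_left)
      qed
      have "g t z - g t y - blinfun_apply K (z - y) = ((g t z - g t y) - (g (s n) z - g (s n) y)) +
          (g (s n) z - g (s n) y - blinfun_apply (J n) (z - y)) + (blinfun_apply (J n) (z - y) - blinfun_apply K (z - y))"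
        by simp
      also have "norm \<dots> \<le> \<epsilon> / 3 * norm (z - y) + \<epsilon> / 3 * norm (z - y) + \<epsilon> / 3 * norm (z - y)"
        by (intro norm_triangle_le add_mono a b c)
      finally show "norm (g t z - g t y - blinfun_apply K (z - y)) \<le> \<epsilon> * norm (z - y)" by simp
    qed (use d d' in auto)
  qed
  then show ?thesis unfolding differentiable_def by blast
qed

text \<open>Joint differentiability, which Rademacher's theorem provides almost everywhere, implies
differentiability in the second argument.\<close>

lemma negligible_nondifferentiable:
  "negligible {p \<in> ball t0 e \<times> ball y0 e. \<not> (g (fst p) differentiable (at (snd p)) \<and> G (fst p) differentiable (at (snd p)))}"
proof -
  have slice: "f (fst p) differentiable (at (snd p))"
    if "(\<lambda>p. f (fst p) (snd p)) differentiable (at p)" for f :: "real \<Rightarrow> 'b \<Rightarrow> 'e" and p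
  proof -
    have "(\<lambda>z. (fst p, z)) differentiable (at (snd p))"
      unfolding differentiable_def by (rule exI, rule has_derivative_Pair[OF has_derivative_const has_derivative_ident])
    from differentiable_chain_at[OF this, of "\<lambda>p. f (fst p) (snd p)"] that show ?thesis by (simp add: o_def)
  qed
  have o: "open (ball t0 e \<times> ball y0 e)" by (intro open_Times open_ball)
  have "negligible ({p \<in> ball t0 e \<times> ball y0 e. \<not> (\<lambda>p. g (fst p) (snd p)) differentiable (at p)} \<union>
      {p \<in> ball t0 e \<times> ball y0 e. \<not> (\<lambda>p. G (fst p) (snd p)) differentiable (at p)})"
    by (intro negligible_Un rademacher_open[OF o lip_g] rademacher_open[OF o lip_G])
  then show ?thesis by (rule negligible_subset) (use slice in blast)
qed

lemma quotient_limit: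
  fixes f :: "real \<Rightarrow> 'b \<Rightarrow> 'e"
  assumes "f t differentiable (at y)" and c: "c > 0"
  shows "(\<lambda>n. ((f t (y + (c * inverse (real (Suc n))) *\<^sub>R h) - f t y) \<bullet> k) / (c * inverse (real (Suc n)))) \<longlonglongrightarrow> blinfun_apply (partial2 f t y) h \<bullet> k"
proof -
  let ?\<tau> = "\<lambda>n. c * inverse (real (Suc n))"
  have D: "(f t has_derivative blinfun_apply (partial2 f t y)) (at y)" by (rule has_derivative_partial2[of f t y, OF assms(1)])
  define p where "p \<tau> = y + \<tau> *\<^sub>R h" for \<tau> :: real
  have p0: "p 0 = y" by (simp add: p_def)
  have "(p has_derivative (\<lambda>\<tau>. \<tau> *\<^sub>R h)) (at 0)" unfolding p_def by (auto intro!: derivative_eq_intros)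
  from diff_chain_at[OF this] D p0 have "((f t \<circ> p) has_derivative (blinfun_apply (partial2 f t y) \<circ> (\<lambda>\<tau>. \<tau> *\<^sub>R h))) (at 0)" by simp
  from has_derivative_inner_left[OF this, of k]
  have "((\<lambda>\<tau>. f t (p \<tau>) \<bullet> k) has_real_derivative (blinfun_apply (partial2 f t y) h \<bullet> k)) (at 0)"
    by (simp add: has_field_derivative_def o_def blinfun.scaleR_right mult_commute_abs)
  then have "((\<lambda>\<tau>. (f t (p \<tau>) \<bullet> k - f t y \<bullet> k) / \<tau>) \<longlongrightarrow> blinfun_apply (partial2 f t y) h \<bullet> k) (at 0)"
    by (simp add: DERIV_def p0)
  moreover have "filterlim ?\<tau> (at 0) sequentially"
    unfolding filterlim_at using tendsto_mult[OF tendsto_const[of c] LIMSEQ_inverse_real_of_nat] c by auto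
  ultimately have "(\<lambda>n. (f t (p (?\<tau> n)) \<bullet> k - f t y \<bullet> k) / ?\<tau> n) \<longlonglongrightarrow> blinfun_apply (partial2 f t y) h \<bullet> k"
    by (rule filterlim_compose)
  then show ?thesis by (simp add: p_def inner_diff_left)
qed

text \<open>For each entry of the Jacobian, the quotients of \<open>g\<close> with increment \<open>\<tau> n\<close> in the initial value have
the quotients of \<open>G\<close> as time derivatives; the latter are bounded by \<open>L\<close> and converge wherever \<open>G t\<close> is
differentiable.\<close>

lemma jacobian_derivative_ae:
  assumes y: "y \<in> ball y0 e" and ab: "{a..b} \<subseteq> ball t0 e"
    and dg: "\<And>t. t \<in> {a..b} \<Longrightarrow> g t differentiable (at y)"
    and dG: "negligible {t \<in> {a..b}. \<not> G t differentiable (at y)}"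
  shows "negligible {t \<in> {a<..<b}. \<not> ((\<lambda>s. partial2 g s y) has_vector_derivative partial2 G t y) (at t)}"
proof -
  have comp: "negligible {t \<in> {a<..<b}. \<not> ((\<lambda>s. blinfun_apply (partial2 g s y) h \<bullet> k) has_real_derivative
      (blinfun_apply (partial2 G t y) h \<bullet> k)) (at t)}" if h: "h \<in> Basis" and k: "k \<in> Basis" for h k
  proof -
    obtain c where c: "c > 0" "ball y c \<subseteq> ball y0 e" using y open_contains_ball[of "ball y0 e"] by blast
    define \<tau> where "\<tau> n = c / 2 * inverse (real (Suc n))" for n
    have \<tau>: "\<tau> n > 0" "\<tau> n < c" for n
    proof -
      show "\<tau> n > 0" using c by (simp add: \<tau>_def)
      have "\<tau> n \<le> c / 2 * 1" unfolding \<tau>_def using c by (intro mult_left_mono) (auto simp: field_simps)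
      then show "\<tau> n < c" using c by simp
    qed
    have yh: "y + \<tau> n *\<^sub>R h \<in> ball y0 e" for n
      using c(2) \<tau>[of n] norm_Basis[OF h] by (auto simp: subset_eq dist_norm)
    show ?thesis
    proof (rule ae_derivative_of_pointwise_limit[where Q = "\<lambda>n t. ((g t (y + \<tau> n *\<^sub>R h) - g t y) \<bullet> k) / \<tau> n"
          and q = "\<lambda>n t. ((G t (y + \<tau> n *\<^sub>R h) - G t y) \<bullet> k) / \<tau> n" and B = L])
      fix n t assume t: "t \<in> {a..b}"
      then have t': "t \<in> ball t0 e" using ab by blast
      have "((\<lambda>t. (g t (y + \<tau> n *\<^sub>R h) - g t y) \<bullet> k) has_vector_derivative (G t (y + \<tau> n *\<^sub>R h) - G t y) \<bullet> k) (at t)"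
        by (intro bounded_linear.has_vector_derivative[OF bounded_linear_inner_left] has_vector_derivative_diff evolve t' yh y)
      then show "((\<lambda>t. ((g t (y + \<tau> n *\<^sub>R h) - g t y) \<bullet> k) / \<tau> n) has_real_derivative ((G t (y + \<tau> n *\<^sub>R h) - G t y) \<bullet> k) / \<tau> n) (at t)"
        by (intro DERIV_cdivide) (simp add: has_real_derivative_iff_has_vector_derivative)
      have "\<bar>(G t (y + \<tau> n *\<^sub>R h) - G t y) \<bullet> k\<bar> \<le> norm (G t (y + \<tau> n *\<^sub>R h) - G t y)" using k by (rule Basis_le_norm)
      also have "\<dots> \<le> L * norm ((y + \<tau> n *\<^sub>R h) - y)" by (rule G_lipschitz[OF t' yh y])
      also have "\<dots> = L * \<tau> n" using \<tau>[of n] norm_Basis[OF h] by simp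
      finally show "\<bar>((G t (y + \<tau> n *\<^sub>R h) - G t y) \<bullet> k) / \<tau> n\<bar> \<le> L" using \<tau>[of n] by (simp add: field_simps)
    next
      fix n
      have cG: "continuous_on {a..b} (\<lambda>t. G t z)" if "z \<in> ball y0 e" for z
        by (rule continuous_on_compose2[OF lipschitz_on_continuous_on[OF lip_G], of _ "\<lambda>t. (t, z)", simplified])
          (use ab that in \<open>auto intro!: continuous_intros\<close>)
      show "continuous_on {a..b} (\<lambda>t. ((G t (y + \<tau> n *\<^sub>R h) - G t y) \<bullet> k) / \<tau> n)"
        using \<tau>[of n] by (intro continuous_intros cG yh y) auto
    next
      fix t assume "t \<in> {a..b}"
      then show "(\<lambda>n. ((g t (y + \<tau> n *\<^sub>R h) - g t y) \<bullet> k) / \<tau> n) \<longlonglongrightarrow> blinfun_apply (partial2 g t y) h \<bullet> k"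
        unfolding \<tau>_def using c by (intro quotient_limit dg) auto
    next
      have "{t \<in> {a..b}. \<not> (\<lambda>n. ((G t (y + \<tau> n *\<^sub>R h) - G t y) \<bullet> k) / \<tau> n) \<longlonglongrightarrow> blinfun_apply (partial2 G t y) h \<bullet> k}
          \<subseteq> {t \<in> {a..b}. \<not> G t differentiable (at y)}"
        unfolding \<tau>_def using quotient_limit[of G _ y "c / 2" h k] c by auto
      then show "negligible {t \<in> {a..b}. \<not> (\<lambda>n. ((G t (y + \<tau> n *\<^sub>R h) - G t y) \<bullet> k) / \<tau> n) \<longlonglongrightarrow> blinfun_apply (partial2 G t y) h \<bullet> k}"
        using dG negligible_subset by blast
    qed
  qed
  have "negligible (\<Union>(h, k)\<in>Basis \<times> Basis. {t \<in> {a<..<b}. \<not> ((\<lambda>s. blinfun_apply (partial2 g s y) h \<bullet> k) has_real_derivative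
      (blinfun_apply (partial2 G t y) h \<bullet> k)) (at t)})"
    by (intro negligible_Union) (use comp in \<open>auto intro!: finite_imageI\<close>)
  then show ?thesis
    by (rule negligible_subset) (use blinfun_has_vector_derivative_componentwise[of "\<lambda>s. partial2 g s y"] in blast)
qed

lemma partial1_eq: "t \<in> ball t0 e \<Longrightarrow> y \<in> ball y0 e \<Longrightarrow> partial1 g t y = G t y"
  unfolding partial1_def by (rule vector_derivative_at[OF evolve])

lemma partial1_differentiable_iff:
  assumes t: "t \<in> ball t0 e" and y: "y \<in> ball y0 e"
  shows "partial1 g t differentiable (at y) \<longleftrightarrow> G t differentiable (at y)"
  using differentiable_transform_open[OF _ open_ball y, of "partial1 g t" "G t"]
    differentiable_transform_open[OF _ open_ball y, of "G t" "partial1 g t"] partial1_eq[OF t] by metis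

lemma partial2_partial1:
  assumes t: "t \<in> ball t0 e" and y: "y \<in> ball y0 e" and d: "G t differentiable (at y)"
  shows "partial2 (partial1 g) t y = partial2 G t y"
proof (rule partial2_eqI)
  show "(partial1 g t has_derivative blinfun_apply (partial2 G t y)) (at y)"
    by (rule has_derivative_transform_within_open[OF has_derivative_partial2[of G t y, OF d] open_ball y])
      (rule partial1_eq[OF t, symmetric])
qed

lemma mixed_atI:
  assumes t: "t \<in> ball t0 e" and y: "y \<in> ball y0 e" and d: "G t differentiable (at y)"
    and dg: "\<forall>\<^sub>F s in nhds t. g s differentiable (at y)"
    and J: "((\<lambda>s. partial2 g s y) has_vector_derivative partial2 G t y) (at t)"
  shows "mixed_at g t y"
  unfolding mixed_at_def has_partial12_def has_partial21_def
proof (intro conjI dg)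
  show "(\<lambda>s. partial2 g s y) differentiable (at t)"
    using J unfolding has_vector_derivative_def differentiable_def by blast
  show "\<forall>\<^sub>F z in nhds y. (\<lambda>s. g s z) differentiable (at t)"
    using eventually_in_ball[OF y]
    by (rule eventually_mono) (use evolve[OF t] in \<open>auto simp: has_vector_derivative_def differentiable_def\<close>)
  show "partial1 g t differentiable (at y)" using d partial1_differentiable_iff[OF t y] by simp
  show "partial1 (partial2 g) t y = partial2 (partial1 g) t y"
    unfolding partial2_partial1[OF t y d] partial1_def by (rule vector_derivative_at[OF J])
qed

lemma partial12_bound:
  assumes t: "t \<in> ball t0 e" and y: "y \<in> ball y0 e" and p: "has_partial12 g t y"
  shows "norm (partial1 (partial2 g) t y) \<le> L"
proof -
  have d: "\<forall>\<^sub>F s in nhds t. g s differentiable (at y)" and J: "(\<lambda>s. partial2 g s y) differentiable (at t)"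
    using p by (auto simp: has_partial12_def)
  have "((\<lambda>s. partial2 g s y) has_derivative (\<lambda>h. h *\<^sub>R partial1 (partial2 g) t y)) (at t)"
    using J unfolding partial1_def by (simp add: vector_derivative_works has_vector_derivative_def)
  moreover have "\<forall>\<^sub>F s in nhds t. norm (partial2 g s y - partial2 g t y) \<le> L * norm (s - t)"
    using d eventually_in_ball_time[OF t]
  proof eventually_elim
    case (elim s)
    then show ?case
      using jacobian_lipschitz[OF elim(2) t y elim(1) eventually_nhds_x_imp_x[OF d]] by (simp add: dist_norm)
  qed
  ultimately have "norm (1 *\<^sub>R partial1 (partial2 g) t y) \<le> L * norm (1 :: real)"
    by (rule derivative_norm_le)
  then show ?thesis by simp
qed

lemma partial21_bound:
  assumes t: "t \<in> ball t0 e" and y: "y \<in> ball y0 e" and p: "has_partial21 g t y"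
  shows "norm (partial2 (partial1 g) t y) \<le> L"
proof (rule norm_blinfun_bound[OF L_nonneg])
  fix h
  have "partial1 g t differentiable (at y)" using p by (simp add: has_partial21_def)
  then have d: "G t differentiable (at y)" using partial1_differentiable_iff[OF t y] by simp
  show "norm (blinfun_apply (partial2 (partial1 g) t y) h) \<le> L * norm h"
    unfolding partial2_partial1[OF t y d]
  proof (rule derivative_norm_le[OF has_derivative_partial2[of G t y, OF d]])
    show "\<forall>\<^sub>F z in nhds y. norm (G t z - G t y) \<le> L * norm (z - y)"
      using eventually_in_ball[OF y] by (rule eventually_mono) (rule G_lipschitz[OF t _ y])
  qed
qed

end

text \<open>The change of parametrization \<open>\<tau>\<close> is independent of time, so both mixed differentials are composed with
its differential.\<close>

lemma mixed_at_compose: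
  fixes f :: "real \<Rightarrow> 'b::real_normed_vector \<Rightarrow> 'c::real_normed_vector"
    and k :: "real \<Rightarrow> 'd::real_normed_vector \<Rightarrow> 'c"
  assumes m: "mixed_at f t (\<tau> y)" and \<tau>: "\<tau> differentiable (at y)"
    and eq: "\<forall>\<^sub>F z in nhds y. \<forall>s. k s z = f s (\<tau> z)"
  shows "mixed_at k t y"
proof -
  obtain T where T: "(\<tau> has_derivative blinfun_apply T) (at y)"
    using \<tau> unfolding differentiable_def by (metis bounded_linear_Blinfun_apply has_derivative_bounded_linear)
  have comp: "((\<lambda>z. a (\<tau> z)) has_derivative blinfun_apply (D o\<^sub>L T)) (at y)"
    if "(a has_derivative blinfun_apply D) (at (\<tau> y))" for a :: "'b \<Rightarrow> 'c" and D
    using diff_chain_at[OF T that] by (simp add: o_def blinfun_compose.rep_eq)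
  have tr: "(b has_derivative D) (at y)" if "(a has_derivative D) (at y)" "\<forall>\<^sub>F z in nhds y. b z = a z" for a b :: "'d \<Rightarrow> 'c" and D
    using has_derivative_transform_eventually[OF that(1), of b] that(2) eventually_nhds_x_imp_x[OF that(2)]
    by (simp add: eventually_at_filter eq_commute eventually_mono)
  have kd: "k s differentiable (at y)" and k2: "partial2 k s y = partial2 f s (\<tau> y) o\<^sub>L T"
    if "f s differentiable (at (\<tau> y))" for s
  proof -
    have "(k s has_derivative blinfun_apply (partial2 f s (\<tau> y) o\<^sub>L T)) (at y)"
      by (rule tr[OF comp[OF has_derivative_partial2[where f = f and t = s and y = "\<tau> y", OF that]]])
        (use eq in \<open>auto elim: eventually_mono\<close>)
    then show "k s differentiable (at y)" "partial2 k s y = partial2 f s (\<tau> y) o\<^sub>L T"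
      using partial2_eqI[of k s "partial2 f s (\<tau> y) o\<^sub>L T" y] unfolding differentiable_def by blast+
  qed
  have fd: "\<forall>\<^sub>F s in nhds t. f s differentiable (at (\<tau> y))" and fJ: "(\<lambda>s. partial2 f s (\<tau> y)) differentiable (at t)"
    and fz: "\<forall>\<^sub>F z in nhds (\<tau> y). (\<lambda>s. f s z) differentiable (at t)" and f1: "partial1 f t differentiable (at (\<tau> y))"
    and fe: "partial1 (partial2 f) t (\<tau> y) = partial2 (partial1 f) t (\<tau> y)"
    using m unfolding mixed_at_def has_partial12_def has_partial21_def by blast+
  have "((\<lambda>s. partial2 f s (\<tau> y)) has_vector_derivative partial1 (partial2 f) t (\<tau> y)) (at t)"
    using fJ unfolding partial1_def by (simp add: vector_derivative_works)
  from bounded_linear.has_vector_derivative[OF bounded_bilinear.bounded_linear_left[OF bounded_bilinear_blinfun_compose, of T] this]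
  have "((\<lambda>s. partial2 f s (\<tau> y) o\<^sub>L T) has_vector_derivative partial1 (partial2 f) t (\<tau> y) o\<^sub>L T) (at t)" .
  moreover have ev: "\<forall>\<^sub>F s in nhds t. partial2 f s (\<tau> y) o\<^sub>L T = partial2 k s y"
    using fd by (rule eventually_mono) (simp add: k2)
  ultimately have kJ: "((\<lambda>s. partial2 k s y) has_vector_derivative partial1 (partial2 f) t (\<tau> y) o\<^sub>L T) (at t)"
    unfolding has_vector_derivative_def
    using has_derivative_transform_eventually[of "\<lambda>s. partial2 f s (\<tau> y) o\<^sub>L T" _ t UNIV "\<lambda>s. partial2 k s y"]
    by (simp add: eventually_nhds_conv_at)
  have \<tau>c: "filterlim \<tau> (nhds (\<tau> y)) (nhds y)"
    using differentiable_imp_continuous_within[OF \<tau>] by (simp add: continuous_within tendsto_at_iff_tendsto_nhds)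
  have p1: "\<forall>\<^sub>F z in nhds y. partial1 k t z = partial1 f t (\<tau> z)"
    using eq by (rule eventually_mono) (simp add: partial1_def)
  have "(partial1 k t has_derivative blinfun_apply (partial2 (partial1 f) t (\<tau> y) o\<^sub>L T)) (at y)"
    by (rule tr[OF comp[OF has_derivative_partial2[where f = "partial1 f" and t = t and y = "\<tau> y", OF f1]]]) (rule p1)
  then have k1: "partial1 k t differentiable (at y)" "partial2 (partial1 k) t y = partial2 (partial1 f) t (\<tau> y) o\<^sub>L T"
    using partial2_eqI[of "partial1 k" t "partial2 (partial1 f) t (\<tau> y) o\<^sub>L T" y] unfolding differentiable_def by blast+
  have "partial1 (partial2 k) t y = partial1 (partial2 f) t (\<tau> y) o\<^sub>L T"
    unfolding partial1_def[of "partial2 k"] by (rule vector_derivative_at[OF kJ])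
  moreover have "\<forall>\<^sub>F z in nhds y. (\<lambda>s. k s z) differentiable (at t)"
    using eventually_compose_filterlim[OF fz \<tau>c] eq by eventually_elim simp
  moreover have "(\<lambda>s. partial2 k s y) differentiable (at t)"
    using kJ unfolding has_vector_derivative_def differentiable_def by blast
  moreover have "\<forall>\<^sub>F s in nhds t. k s differentiable (at y)" using fd by (rule eventually_mono) (rule kd)
  ultimately show ?thesis using k1 fe unfolding mixed_at_def has_partial12_def has_partial21_def by simp
qed

section \<open>The charts of the tangent bundle\<close>

lemma lipschitz_if_derivative_lipschitz:
  fixes f :: "'a::real_normed_vector \<Rightarrow> 'b::real_normed_vector"
  assumes d: "\<And>y. y \<in> ball x r \<Longrightarrow> (f has_derivative blinfun_apply (f' y)) (at y)"
    and lip: "L-lipschitz_on (ball x r) f'" and "r > 0"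
  shows "y \<in> ball x r \<Longrightarrow> norm (f' y) \<le> norm (f' x) + L * r"
    and "(norm (f' x) + L * r)-lipschitz_on (ball x r) f"
proof -
  have L: "L \<ge> 0" by (rule lipschitz_on_nonneg[OF lip])
  show *: "norm (f' y) \<le> norm (f' x) + L * r" if y: "y \<in> ball x r" for y
  proof -
    have "norm (f' y) \<le> norm (f' x) + norm (f' y - f' x)" by (metis add.commute diff_add_cancel norm_triangle_ineq)
    moreover have "norm (f' y - f' x) \<le> L * dist y x"
      using lipschitz_onD[OF lip y, of x] \<open>r > 0\<close> by (simp add: dist_norm)
    moreover have "L * dist y x \<le> L * r" using y L by (intro mult_left_mono) (auto simp: dist_commute)
    ultimately show ?thesis by linarith
  qed
  show "(norm (f' x) + L * r)-lipschitz_on (ball x r) f"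
  proof (rule bounded_derivative_imp_lipschitz)
    show "(f has_derivative blinfun_apply (f' y)) (at y within ball x r)" if "y \<in> ball x r" for y
      by (rule has_derivative_at_withinI[OF d[OF that]])
    show "onorm (blinfun_apply (f' y)) \<le> norm (f' x) + L * r" if "y \<in> ball x r" for y
      using *[OF that] by (simp add: norm_blinfun.rep_eq)
    show "0 \<le> norm (f' x) + L * r" using L \<open>r > 0\<close> by simp
  qed simp
qed

lemma C21_onE:
  assumes "C21_on S f" "open S"
  obtains f' f'' where "\<And>x. x \<in> S \<Longrightarrow> (f has_derivative blinfun_apply (f' x)) (at x)"
    "\<And>x. x \<in> S \<Longrightarrow> (f' has_derivative blinfun_apply (f'' x)) (at x)" "locally_lipschitz_on S f''"
proof -
  obtain f' where f': "\<forall>x\<in>S. (f has_derivative blinfun_apply (f' x)) (at x within S)" "C11_on S f'"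
    using assms(1) unfolding C21_on_def by blast
  obtain f'' where f'': "\<forall>x\<in>S. (f' has_derivative blinfun_apply (f'' x)) (at x within S)" "locally_lipschitz_on S f''"
    using f'(2) unfolding C11_on_def by blast
  show ?thesis
    by (rule that[of f' f'']) (use f' f'' at_within_open[OF _ assms(2)] in auto)
qed

locale spray_manifold =
  fixes M :: "'p topology" and A :: "('p, 'a::euclidean_space) chart set"
    and H :: "('p, 'a) chart \<Rightarrow> 'a \<Rightarrow> 'a \<Rightarrow> 'a"
  assumes manifold: "C21_manifold M A" and spray: "lipschitz_spray A H"
begin

abbreviation TM :: "('p, 'a) tvec set" where "TM \<equiv> tangent_bundle A"
abbreviation TT :: "('p, 'a) tvec topology" where "TT \<equiv> tangent_topology A"
abbreviation tdm :: "('p, 'a) chart \<Rightarrow> ('p, 'a) tvec set" where "tdm c \<equiv> fst (tchart A c)"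
abbreviation tco :: "('p, 'a) chart \<Rightarrow> ('p, 'a) tvec \<Rightarrow> 'a \<times> 'a" where "tco c \<equiv> snd (tchart A c)"
abbreviation D\<tau> :: "('p, 'a) chart \<Rightarrow> ('p, 'a) chart \<Rightarrow> 'a \<Rightarrow> 'a \<Rightarrow> 'a" where
  "D\<tau> c d x \<equiv> frechet_derivative (transition c d) (at x)"

lemma chart: "c \<in> A \<Longrightarrow> is_chart M c"
  using manifold by (simp add: C21_manifold_def)

lemma cover_M: "(\<Union>c\<in>A. fst c) = topspace M"
  using manifold by (simp add: C21_manifold_def)

lemma chart_overlap_open: "c \<in> A \<Longrightarrow> d \<in> A \<Longrightarrow> open (overlap c d)"
  using overlap_open chart by blast

lemma in_overlap: "p \<in> fst c \<Longrightarrow> p \<in> fst d \<Longrightarrow> snd c p \<in> overlap c d"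
  by (auto simp: overlap_def)

lemma transition_C21:
  assumes "c \<in> A" "d \<in> A"
  obtains f' f'' where "\<And>x. x \<in> overlap c d \<Longrightarrow> (transition c d has_derivative blinfun_apply (f' x)) (at x)"
    "\<And>x. x \<in> overlap c d \<Longrightarrow> (f' has_derivative blinfun_apply (f'' x)) (at x)"
    "locally_lipschitz_on (overlap c d) f''"
    "\<And>x. x \<in> overlap c d \<Longrightarrow> D\<tau> c d x = blinfun_apply (f' x)"
proof -
  have "C21_on (overlap c d) (transition c d)" using manifold assms by (simp add: C21_manifold_def)
  then obtain f' f'' where "\<And>x. x \<in> overlap c d \<Longrightarrow> (transition c d has_derivative blinfun_apply (f' x)) (at x)"
    "\<And>x. x \<in> overlap c d \<Longrightarrow> (f' has_derivative blinfun_apply (f'' x)) (at x)"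
    "locally_lipschitz_on (overlap c d) f''"
    by (rule C21_onE[OF _ chart_overlap_open[OF assms]]) blast
  then show ?thesis using that frechet_derivative_at by metis
qed

lemma transition_derivative:
  assumes "c \<in> A" "d \<in> A" "x \<in> overlap c d"
  shows "(transition c d has_derivative D\<tau> c d x) (at x)"
  using transition_C21[OF assms(1,2)] assms(3) by metis

lemma transition_apply:
  fixes d :: "('p, 'a) chart"
  shows "c \<in> A \<Longrightarrow> p \<in> fst c \<Longrightarrow> transition c d (snd c p) = snd d p"
  using is_chartD(4)[OF chart] by (simp add: transition_def)

lemma cocycle:
  assumes cde: "c \<in> A" "d \<in> A" "k \<in> A" and p: "p \<in> fst c" "p \<in> fst d" "p \<in> fst k"
  shows "D\<tau> c k (snd c p) \<xi> = D\<tau> d k (snd d p) (D\<tau> c d (snd c p) \<xi>)"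
proof -
  have 1: "(transition c d has_derivative D\<tau> c d (snd c p)) (at (snd c p))"
    by (rule transition_derivative[OF cde(1,2) in_overlap[OF p(1,2)]])
  have 2: "(transition d k has_derivative D\<tau> d k (snd d p)) (at (transition c d (snd c p)))"
    using transition_derivative[OF cde(2,3) in_overlap[OF p(2,3)]] transition_apply[OF cde(1) p(1)] by simp
  have 3: "((transition d k \<circ> transition c d) has_derivative (D\<tau> d k (snd d p) \<circ> D\<tau> c d (snd c p))) (at (snd c p))"
    by (rule diff_chain_at[OF 1 2])
  have "(transition c k has_derivative (D\<tau> d k (snd d p) \<circ> D\<tau> c d (snd c p))) (at (snd c p))"
  proof (rule has_derivative_transform_within_open[OF 3 chart_overlap_open[OF cde(1,2)] in_overlap[OF p(1,2)]])
    fix x assume "x \<in> overlap c d"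
    then obtain q where q: "q \<in> fst c" "q \<in> fst d" "x = snd c q" by (auto simp: overlap_def)
    then show "(transition d k \<circ> transition c d) x = transition c k x"
      using transition_apply cde by simp
  qed
  from frechet_derivative_at[OF this] show ?thesis by (metis comp_apply)
qed

lemma D\<tau>_id:
  assumes "c \<in> A" "p \<in> fst c" shows "D\<tau> c c (snd c p) \<xi> = \<xi>"
proof -
  have "(transition c c has_derivative (\<lambda>h. h)) (at (snd c p))"
  proof (rule has_derivative_transform_within_open[OF has_derivative_ident chart_overlap_open[OF assms(1,1)] in_overlap[OF assms(2,2)]])
    fix x assume "x \<in> overlap c c"
    then obtain q where "q \<in> fst c" "x = snd c q" unfolding overlap_def by blast
    then show "x = transition c c x" using transition_apply[OF assms(1), of q c] by simp
  qed
  from frechet_derivative_at[OF this] show ?thesis by metis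
qed

definition tvec_at :: "('p, 'a) chart \<Rightarrow> 'p \<Rightarrow> 'a \<Rightarrow> ('p, 'a) tvec" where
  "tvec_at c p \<xi> = (p, \<lambda>d. if d \<in> A \<and> p \<in> fst d then D\<tau> c d (snd c p) \<xi> else 0)"

lemma TM_iff: "w \<in> TM \<longleftrightarrow> fst w \<in> (\<Union>c\<in>A. fst c) \<and> (\<forall>c. \<not> (c \<in> A \<and> fst w \<in> fst c) \<longrightarrow> snd w c = 0) \<and>
    (\<forall>c\<in>A. \<forall>d\<in>A. fst w \<in> fst c \<inter> fst d \<longrightarrow> snd w d = D\<tau> c d (snd c (fst w)) (snd w c))"
  by (simp add: tangent_bundle_def split_beta)

lemma tvec_at_TM:
  assumes c: "c \<in> A" "p \<in> fst c"
  shows "tvec_at c p \<xi> \<in> TM" "snd (tvec_at c p \<xi>) c = \<xi>" "fst (tvec_at c p \<xi>) = p"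
proof -
  show "fst (tvec_at c p \<xi>) = p" "snd (tvec_at c p \<xi>) c = \<xi>"
    using c D\<tau>_id[OF c] by (simp_all add: tvec_at_def)
  show "tvec_at c p \<xi> \<in> TM"
    unfolding TM_iff
  proof (intro conjI ballI allI impI)
    show "fst (tvec_at c p \<xi>) \<in> (\<Union>c\<in>A. fst c)" using c by (auto simp: tvec_at_def)
    show "snd (tvec_at c p \<xi>) d = 0" if "\<not> (d \<in> A \<and> fst (tvec_at c p \<xi>) \<in> fst d)" for d
      using that by (auto simp: tvec_at_def)
    fix d k assume d: "d \<in> A" "k \<in> A" "fst (tvec_at c p \<xi>) \<in> fst d \<inter> fst k"
    then have "p \<in> fst d" "p \<in> fst k" by (auto simp: tvec_at_def)
    then show "snd (tvec_at c p \<xi>) k = D\<tau> d k (snd d (fst (tvec_at c p \<xi>))) (snd (tvec_at c p \<xi>) d)"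
      using d cocycle[OF c(1) d(1,2) c(2)] by (simp add: tvec_at_def)
  qed
qed

lemma TMD:
  assumes "w \<in> TM"
  shows "fst w \<in> (\<Union>c\<in>A. fst c)" "\<not> (c \<in> A \<and> fst w \<in> fst c) \<Longrightarrow> snd w c = 0"
    "c \<in> A \<Longrightarrow> d \<in> A \<Longrightarrow> fst w \<in> fst c \<Longrightarrow> fst w \<in> fst d \<Longrightarrow> snd w d = D\<tau> c d (snd c (fst w)) (snd w c)"
  using assms unfolding TM_iff by blast+

lemma TM_eq_tvec_at:
  assumes w: "w \<in> TM" and c: "c \<in> A" "fst w \<in> fst c"
  shows "w = tvec_at c (fst w) (snd w c)"
proof (rule prod_eqI)
  show "snd w = snd (tvec_at c (fst w) (snd w c))"
  proof
    fix d
    show "snd w d = snd (tvec_at c (fst w) (snd w c)) d"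
      using TMD(2)[OF w, of d] TMD(3)[OF w c(1) _ c(2), of d] by (simp add: tvec_at_def)
  qed
qed (simp add: tvec_at_def)

lemma tdm_iff: "w \<in> tdm c \<longleftrightarrow> w \<in> TM \<and> fst w \<in> fst c"
  by (simp add: tchart_def)

lemma tco_apply: "tco c w = (snd c (fst w), snd w c)"
  by (simp add: tchart_def split_beta)

lemma tco_image: "c \<in> A \<Longrightarrow> tco c ` tdm c = snd c ` fst c \<times> UNIV"
proof
  assume c: "c \<in> A"
  show "tco c ` tdm c \<subseteq> snd c ` fst c \<times> UNIV" by (auto simp: tdm_iff tco_apply)
  show "snd c ` fst c \<times> UNIV \<subseteq> tco c ` tdm c"
  proof
    fix z assume "z \<in> snd c ` fst c \<times> (UNIV :: 'a set)"
    then obtain p \<xi> where p: "p \<in> fst c" "z = (snd c p, \<xi>)" by auto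
    then have "tvec_at c p \<xi> \<in> tdm c" "tco c (tvec_at c p \<xi>) = z"
      using tvec_at_TM[OF c p(1)] by (auto simp: tdm_iff tco_apply)
    then show "z \<in> tco c ` tdm c" by blast
  qed
qed

lemma tco_inj: "c \<in> A \<Longrightarrow> inj_on (tco c) (tdm c)"
proof (rule inj_onI)
  fix w w' assume c: "c \<in> A" and w: "w \<in> tdm c" "w' \<in> tdm c" "tco c w = tco c w'"
  then have "fst w = fst w'" "snd w c = snd w' c"
    using is_chartD(3)[OF chart[OF c]] by (auto simp: tdm_iff tco_apply inj_on_eq_iff)
  then show "w = w'" using TM_eq_tvec_at[of w c] TM_eq_tvec_at[of w' c] w c by (simp add: tdm_iff)
qed

lemma tco_inv: "c \<in> A \<Longrightarrow> w \<in> tdm c \<Longrightarrow> chart_inv (tchart A c) (tco c w) = w"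
  using tco_inj by simp

lemma toverlap: "c \<in> A \<Longrightarrow> d \<in> A \<Longrightarrow> overlap (tchart A c) (tchart A d) = overlap c d \<times> UNIV"
proof
  assume c: "c \<in> A" and d: "d \<in> A"
  show "overlap (tchart A c) (tchart A d) \<subseteq> overlap c d \<times> UNIV"
    by (auto simp: overlap_def tdm_iff tco_apply)
  show "overlap c d \<times> UNIV \<subseteq> overlap (tchart A c) (tchart A d)"
  proof
    fix z assume "z \<in> overlap c d \<times> (UNIV :: 'a set)"
    then obtain p \<xi> where p: "p \<in> fst c" "p \<in> fst d" "z = (snd c p, \<xi>)" by (auto simp: overlap_def)
    then have "tvec_at c p \<xi> \<in> tdm c \<inter> tdm d" "tco c (tvec_at c p \<xi>) = z"
      using tvec_at_TM[OF c p(1)] by (auto simp: tdm_iff tco_apply)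
    then show "z \<in> overlap (tchart A c) (tchart A d)" unfolding overlap_def by blast
  qed
qed

lemma ttransition:
  assumes c: "c \<in> A" and d: "d \<in> A" and x: "x \<in> overlap c d"
  shows "transition (tchart A c) (tchart A d) (x, v) = (transition c d x, D\<tau> c d x v)"
proof -
  obtain p where p: "p \<in> fst c" "p \<in> fst d" "x = snd c p" using x by (auto simp: overlap_def)
  let ?w = "tvec_at c p v"
  have w: "?w \<in> tdm c" "tco c ?w = (x, v)" using tvec_at_TM[OF c p(1)] p by (auto simp: tdm_iff tco_apply)
  have "transition (tchart A c) (tchart A d) (x, v) = tco d ?w"
    using tco_inv[OF c w(1)] w(2) by (simp add: transition_def)
  then show ?thesis
    using p d transition_apply[OF c p(1), of d] by (simp add: tco_apply tvec_at_def)
qed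

text \<open>The second derivative of the transition map enters through the fibre component. The result is exactly
the inhomogeneous transformation law of a spray.\<close>

lemma ttransition_derivative:
  assumes c: "c \<in> A" and d: "d \<in> A" and x: "x \<in> overlap c d"
  shows "\<exists>D. (transition (tchart A c) (tchart A d) has_derivative D) (at (x, v)) \<and>
    D (v, \<eta>) = (D\<tau> c d x v, second_derivative (transition c d) x v v + D\<tau> c d x \<eta>)"
proof -
  obtain f' f'' where f: "\<And>x. x \<in> overlap c d \<Longrightarrow> (transition c d has_derivative blinfun_apply (f' x)) (at x)"
    "\<And>x. x \<in> overlap c d \<Longrightarrow> (f' has_derivative blinfun_apply (f'' x)) (at x)"
    "\<And>x. x \<in> overlap c d \<Longrightarrow> D\<tau> c d x = blinfun_apply (f' x)"
    using transition_C21[OF c d] by metis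
  have o: "open (overlap c d)" by (rule chart_overlap_open[OF c d])
  have 1: "((\<lambda>z. transition c d (fst z)) has_derivative (\<lambda>h. f' x (fst h))) (at (x, v))"
    using diff_chain_at[OF has_derivative_fst[OF has_derivative_ident], of "transition c d" "blinfun_apply (f' x)" "(x, v)"] f(1)[OF x]
    by (simp add: o_def)
  have 2: "((\<lambda>z. f' (fst z)) has_derivative (\<lambda>h. f'' x (fst h))) (at (x, v))"
    using diff_chain_at[OF has_derivative_fst[OF has_derivative_ident], of f' "blinfun_apply (f'' x)" "(x, v)"] f(2)[OF x]
    by (simp add: o_def)
  have 3: "((\<lambda>z. blinfun_apply (f' (fst z)) (snd z)) has_derivative (\<lambda>h. f' x (snd h) + f'' x (fst h) v)) (at (x, v))"
    using bounded_bilinear.FDERIV[OF bounded_bilinear_blinfun_apply 2 has_derivative_snd[OF has_derivative_ident]] by simp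
  let ?D = "\<lambda>h. (f' x (fst h), f' x (snd h) + f'' x (fst h) v)"
  have "(transition (tchart A c) (tchart A d) has_derivative ?D) (at (x, v))"
  proof (rule has_derivative_transform_within_open[OF has_derivative_Pair[OF 1 3] open_Times[OF o open_UNIV]])
    fix z assume "z \<in> overlap c d \<times> (UNIV :: 'a set)"
    then show "(transition c d (fst z), blinfun_apply (f' (fst z)) (snd z)) = transition (tchart A c) (tchart A d) z"
      using ttransition[OF c d, of "fst z" "snd z"] f(3) by auto
  qed (use x in simp)
  moreover have "second_derivative (transition c d) x v v = f'' x v v"
  proof -
    have "((\<lambda>y. blinfun_apply (f' y) v) has_derivative (\<lambda>h. f'' x h v)) (at x)"
      using bounded_bilinear.FDERIV[OF bounded_bilinear_blinfun_apply f(2)[OF x] has_derivative_const[of v]]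
      by simp
    then have "((\<lambda>y. D\<tau> c d y v) has_derivative (\<lambda>h. f'' x h v)) (at x)"
      by (rule has_derivative_transform_within_open[OF _ o x]) (simp add: f(3))
    from frechet_derivative_at[OF this] show ?thesis by (metis second_derivative_def)
  qed
  ultimately show ?thesis using f(3)[OF x] by (intro exI[of _ ?D]) (simp add: add.commute)
qed

text \<open>In the fibre the transition map is \<open>(x, v) \<mapsto> D\<tau>(x) v\<close>, bilinear in \<open>D\<tau>(x)\<close> and \<open>v\<close> and hence Lipschitz
where both are bounded.\<close>

lemma ttransition_lipschitz:
  assumes c: "c \<in> A" and d: "d \<in> A"
  shows "locally_lipschitz_on (overlap (tchart A c) (tchart A d)) (transition (tchart A c) (tchart A d))"
  unfolding locally_lipschitz_on_def toverlap[OF c d]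
proof
  fix z assume "z \<in> overlap c d \<times> (UNIV :: 'a set)"
  then obtain x v where z: "z = (x, v)" "x \<in> overlap c d" by auto
  obtain f' f'' where f: "\<And>x. x \<in> overlap c d \<Longrightarrow> (transition c d has_derivative blinfun_apply (f' x)) (at x)"
    "\<And>x. x \<in> overlap c d \<Longrightarrow> (f' has_derivative blinfun_apply (f'' x)) (at x)"
    "locally_lipschitz_on (overlap c d) f''"
    "\<And>x. x \<in> overlap c d \<Longrightarrow> D\<tau> c d x = blinfun_apply (f' x)"
    using transition_C21[OF c d] by metis
  obtain r L where r: "r > 0" "ball x r \<subseteq> overlap c d" "L-lipschitz_on (ball x r) f''"
    using locally_lipschitz_on_openE[OF f(3) chart_overlap_open[OF c d] z(2)] by metis
  note l1 = lipschitz_if_derivative_lipschitz[OF f(2)[OF subsetD[OF r(2)]] r(3,1)]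
  define K1 where "K1 = norm (f'' x) + L * r"
  have lf': "K1-lipschitz_on (ball x r) f'" unfolding K1_def by (rule l1(2))
  note l2 = lipschitz_if_derivative_lipschitz[OF f(1)[OF subsetD[OF r(2)]] lf' r(1)]
  define K0 where "K0 = norm (f' x) + K1 * r"
  have K: "K1 \<ge> 0" "K0 \<ge> 0" using lipschitz_on_nonneg[OF lf'] lipschitz_on_nonneg[OF l2(2)] by (auto simp: K0_def)
  have "(K0 + (K0 + K1 * (norm v + r)))-lipschitz_on ((overlap c d \<times> UNIV) \<inter> ball z r) (transition (tchart A c) (tchart A d))"
  proof (rule lipschitz_onI)
    fix a b assume a: "a \<in> (overlap c d \<times> UNIV) \<inter> ball z r" and b: "b \<in> (overlap c d \<times> UNIV) \<inter> ball z r"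
    have nb: "fst q \<in> ball x r" "dist v (snd q) < r" "fst q \<in> overlap c d" if "q \<in> (overlap c d \<times> UNIV) \<inter> ball z r" for q
      using that dist_fst_le[of z q] dist_snd_le[of z q] z(1) by (auto simp: mem_Times_iff)
    have tq: "transition (tchart A c) (tchart A d) q = (transition c d (fst q), f' (fst q) (snd q))"
      if "q \<in> (overlap c d \<times> UNIV) \<inter> ball z r" for q
      using ttransition[OF c d nb(3)[OF that], of "snd q"] f(4)[OF nb(3)[OF that]] by simp
    have 1: "dist (transition c d (fst a)) (transition c d (fst b)) \<le> K0 * dist a b"
    proof -
      have "dist (transition c d (fst a)) (transition c d (fst b)) \<le> K0 * dist (fst a) (fst b)"
        unfolding K0_def by (rule lipschitz_onD[OF l2(2) nb(1)[OF a] nb(1)[OF b]])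
      also have "\<dots> \<le> K0 * dist a b" by (intro mult_left_mono dist_fst_le K)
      finally show ?thesis .
    qed
    have 2: "dist (f' (fst a) (snd a)) (f' (fst b) (snd b)) \<le> (K0 + K1 * (norm v + r)) * dist a b"
    proof -
      have "f' (fst a) (snd a) - f' (fst b) (snd b) = f' (fst a) (snd a - snd b) + (f' (fst a) - f' (fst b)) (snd b)"
        by (simp add: blinfun.diff_left blinfun.diff_right)
      also have "norm \<dots> \<le> norm (f' (fst a)) * norm (snd a - snd b) + norm (f' (fst a) - f' (fst b)) * norm (snd b)"
        by (intro norm_triangle_mono norm_blinfun)
      also have "\<dots> \<le> K0 * dist a b + (K1 * dist a b) * (norm v + r)"
      proof (intro add_mono mult_mono)
        show "norm (f' (fst a)) \<le> K0" unfolding K0_def by (rule lipschitz_if_derivative_lipschitz(1)[OF f(1)[OF subsetD[OF r(2)]] lf' r(1) nb(1)[OF a]])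
        show "norm (snd a - snd b) \<le> dist a b" using dist_snd_le[of a b] by (simp add: dist_norm)
        have "dist (f' (fst a)) (f' (fst b)) \<le> K1 * dist (fst a) (fst b)" by (rule lipschitz_onD[OF lf' nb(1)[OF a] nb(1)[OF b]])
        also have "\<dots> \<le> K1 * dist a b" by (intro mult_left_mono dist_fst_le K)
        finally show "norm (f' (fst a) - f' (fst b)) \<le> K1 * dist a b" by (simp add: dist_norm)
        have "norm (snd b) \<le> norm v + norm (snd b - v)" by (metis add.commute diff_add_cancel norm_triangle_ineq)
        then show "norm (snd b) \<le> norm v + r" using nb(2)[OF b] by (simp add: dist_norm norm_minus_commute)
      qed (use K in auto)
      finally show ?thesis by (simp add: dist_norm algebra_simps)
    qed
    have "dist (transition (tchart A c) (tchart A d) a) (transition (tchart A c) (tchart A d) b)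
        \<le> dist (transition c d (fst a)) (transition c d (fst b)) + dist (f' (fst a) (snd a)) (f' (fst b) (snd b))"
      unfolding tq[OF a] tq[OF b] dist_Pair_Pair by (rule sqrt_sum_squares_le_sum) auto
    also have "\<dots> \<le> K0 * dist a b + (K0 + K1 * (norm v + r)) * dist a b" by (rule add_mono[OF 1 2])
    finally show "dist (transition (tchart A c) (tchart A d) a) (transition (tchart A c) (tchart A d) b)
        \<le> (K0 + (K0 + K1 * (norm v + r))) * dist a b" by (simp add: algebra_simps)
  qed (use K r in auto)
  then show "\<exists>e>0. \<exists>L. L-lipschitz_on ((overlap c d \<times> UNIV) \<inter> ball z e) (transition (tchart A c) (tchart A d))"
    using r(1) by blast
qed

lemma topspace_TT: "topspace TT = TM"
proof -
  have "topspace TT = \<Union>{{w \<in> tdm c. tco c w \<in> Q} | c Q. c \<in> A \<and> open Q}"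
    by (simp add: tangent_topology_def)
  also have "\<dots> = TM"
  proof
    show "\<Union>{{w \<in> tdm c. tco c w \<in> Q} | c Q. c \<in> A \<and> open Q} \<subseteq> TM" by (auto simp: tdm_iff)
    show "TM \<subseteq> \<Union>{{w \<in> tdm c. tco c w \<in> Q} | c Q. c \<in> A \<and> open Q}"
    proof
      fix w assume w: "w \<in> TM"
      then obtain c where c: "c \<in> A" "fst w \<in> fst c" using TMD(1) by blast
      have "w \<in> {w \<in> tdm c. tco c w \<in> UNIV}" using w c by (simp add: tdm_iff)
      then show "w \<in> \<Union>{{w \<in> tdm c. tco c w \<in> Q} | c Q. c \<in> A \<and> open Q}" using c(1) open_UNIV by blast
    qed
  qed
  finally show ?thesis .
qed

lemma subtopology_TM: "subtopology TT TM = TT"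
  unfolding topspace_TT[symmetric] by (rule subtopology_topspace)

lemma TT_basic_open: "c \<in> A \<Longrightarrow> open Q \<Longrightarrow> openin TT {w \<in> tdm c. tco c w \<in> Q}"
  unfolding tangent_topology_def by (intro topology_generated_by_Basis) blast

lemma tdm_open: "c \<in> A \<Longrightarrow> openin TT (tdm c)"
  using TT_basic_open[of c UNIV] by simp

text \<open>By induction over the generation of the topology; for a generator that comes from another chart, the
claim is the continuity of the transition map.\<close>

lemma tco_open_image:
  assumes c: "c \<in> A" and V: "openin TT V"
  shows "open (tco c ` (tdm c \<inter> V))"
proof -
  have "generate_topology_on {{w \<in> tdm c. tco c w \<in> Q} | c Q. c \<in> A \<and> open Q} V"
    using V by (simp add: tangent_topology_def openin_topology_generated_by_iff)
  then show ?thesis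
  proof induction
    case Empty
    then show ?case by simp
  next
    case (Int a b)
    have "tco c ` (tdm c \<inter> (a \<inter> b)) = tco c ` (tdm c \<inter> a) \<inter> tco c ` (tdm c \<inter> b)"
      using tco_inj[OF c] by (auto simp: inj_on_eq_iff)
    then show ?case using Int by (simp add: open_Int)
  next
    case (UN K)
    have "tco c ` (tdm c \<inter> \<Union>K) = (\<Union>k\<in>K. tco c ` (tdm c \<inter> k))" by blast
    then show ?case using UN by auto
  next
    case (Basis s)
    then obtain d Q where d: "d \<in> A" "open Q" "s = {w \<in> tdm d. tco d w \<in> Q}" by blast
    let ?T = "transition (tchart A c) (tchart A d)" and ?O = "overlap (tchart A c) (tchart A d)"
    have o: "open ?O" unfolding toverlap[OF c d(1)] by (intro open_Times chart_overlap_open c d open_UNIV)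
    have "continuous_on ?O ?T" by (rule locally_lipschitz_imp_continuous_on[OF ttransition_lipschitz[OF c d(1)]])
    then have "open (?T -` Q \<inter> ?O)" using d(2) o continuous_on_open_vimage by blast
    moreover have "tco c ` (tdm c \<inter> s) = ?T -` Q \<inter> ?O"
      unfolding d(3) overlap_def transition_def using tco_inv[OF c] by auto
    ultimately show ?case by simp
  qed
qed

lemma tchart_is_chart:
  assumes c: "c \<in> A" shows "is_chart TT (tchart A c)"
  unfolding is_chart_def
proof (intro conjI)
  show "openin TT (tdm c)" by (rule tdm_open[OF c])
  show oi: "open (tco c ` tdm c)"
    unfolding tco_image[OF c] using is_chartD(2)[OF chart[OF c]] by (intro open_Times open_UNIV)
  have ts: "topspace (subtopology TT (tdm c)) = tdm c" using openin_subset[OF tdm_open[OF c]] by auto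
  show "homeomorphic_map (subtopology TT (tdm c)) (top_of_set (tco c ` tdm c)) (tco c)"
  proof (rule bijective_open_imp_homeomorphic_map)
    show "continuous_map (subtopology TT (tdm c)) (top_of_set (tco c ` tdm c)) (tco c)"
      unfolding continuous_map_def ts
    proof (intro conjI allI impI)
      fix U assume "openin (top_of_set (tco c ` tdm c)) U"
      then have "open U" using oi openin_open_trans by blast
      then have "openin TT {w \<in> tdm c. tco c w \<in> U}" by (rule TT_basic_open[OF c])
      then show "openin (subtopology TT (tdm c)) {w \<in> tdm c. tco c w \<in> U}"
        using openin_open_subtopology[OF tdm_open[OF c]] by auto
    qed auto
    show "open_map (subtopology TT (tdm c)) (top_of_set (tco c ` tdm c)) (tco c)"
      unfolding open_map_def
    proof (intro allI impI)
      fix U assume "openin (subtopology TT (tdm c)) U"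
      then have U: "openin TT U" "U \<subseteq> tdm c" using openin_open_subtopology[OF tdm_open[OF c]] by auto
      then have "open (tco c ` U)" using tco_open_image[OF c U(1)] by (simp add: inf.absorb2)
      then show "openin (top_of_set (tco c ` tdm c)) (tco c ` U)" using U(2) by (auto intro!: open_subset)
    qed
    show "tco c ` topspace (subtopology TT (tdm c)) = topspace (top_of_set (tco c ` tdm c))" unfolding ts by simp
    show "inj_on (tco c) (topspace (subtopology TT (tdm c)))" unfolding ts by (rule tco_inj[OF c])
  qed
qed

lemma base_open:
  assumes "openin M U" shows "openin TT {w \<in> TM. fst w \<in> U}"
proof -
  have "{w \<in> TM. fst w \<in> U} = (\<Union>c\<in>A. {w \<in> tdm c. tco c w \<in> snd c ` (fst c \<inter> U) \<times> UNIV})"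
  proof
    show "{w \<in> TM. fst w \<in> U} \<subseteq> (\<Union>c\<in>A. {w \<in> tdm c. tco c w \<in> snd c ` (fst c \<inter> U) \<times> UNIV})"
      using TMD(1) by (fastforce simp: tdm_iff tco_apply)
    show "(\<Union>c\<in>A. {w \<in> tdm c. tco c w \<in> snd c ` (fst c \<inter> U) \<times> UNIV}) \<subseteq> {w \<in> TM. fst w \<in> U}"
    proof
      fix w assume "w \<in> (\<Union>c\<in>A. {w \<in> tdm c. tco c w \<in> snd c ` (fst c \<inter> U) \<times> UNIV})"
      then obtain c where c: "c \<in> A" and w: "w \<in> tdm c" "tco c w \<in> snd c ` (fst c \<inter> U) \<times> UNIV"
        by (elim UN_E CollectE conjE)
      then obtain q where "q \<in> fst c" "q \<in> U" "snd c (fst w) = snd c q"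
        unfolding tco_apply by (elim SigmaE2 imageE IntE)
      then have "fst w = q" using is_chartD(3)[OF chart[OF c]] w(1) by (auto simp: tdm_iff inj_on_eq_iff)
      then show "w \<in> {w \<in> TM. fst w \<in> U}" using w(1) \<open>q \<in> U\<close> by (simp add: tdm_iff)
    qed
  qed
  moreover have "openin TT {w \<in> tdm c. tco c w \<in> snd c ` (fst c \<inter> U) \<times> UNIV}" if "c \<in> A" for c
    using that chart_open_image[OF chart assms] by (intro TT_basic_open open_Times open_UNIV) auto
  ultimately show ?thesis by auto
qed

lemma Hausdorff_TT: "Hausdorff_space TT"
  unfolding Hausdorff_space_def topspace_TT
proof (intro allI impI)
  fix w w' assume "w \<in> TM \<and> w' \<in> TM \<and> w \<noteq> w'"
  then have w: "w \<in> TM" "w' \<in> TM" "w \<noteq> w'" by auto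
  show "\<exists>U V. openin TT U \<and> openin TT V \<and> w \<in> U \<and> w' \<in> V \<and> disjnt U V"
  proof (cases "fst w = fst w'")
    case False
    have HM: "Hausdorff_space M" using manifold by (simp add: C21_manifold_def)
    have "fst w \<in> topspace M" "fst w' \<in> topspace M" using TMD(1) w cover_M by auto
    then obtain U V where UV: "openin M U" "openin M V" "fst w \<in> U" "fst w' \<in> V" "disjnt U V"
      using False HM[unfolded Hausdorff_space_def, rule_format, of "fst w" "fst w'"] by blast
    show ?thesis
    proof (intro exI conjI)
      show "openin TT {w \<in> TM. fst w \<in> U}" "openin TT {w \<in> TM. fst w \<in> V}" using base_open UV by auto
      show "disjnt {w \<in> TM. fst w \<in> U} {w \<in> TM. fst w \<in> V}" using UV(5) by (auto simp: disjnt_iff)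
    qed (use w UV in auto)
  next
    case True
    obtain c where c: "c \<in> A" "fst w \<in> fst c" using TMD(1)[OF w(1)] by blast
    have wc: "w \<in> tdm c" "w' \<in> tdm c" using c w True by (auto simp: tdm_iff)
    then have ne: "tco c w \<noteq> tco c w'" using w(3) tco_inj[OF c(1)] by (auto simp: inj_on_eq_iff)
    obtain P Q where PQ: "open P" "open Q" "tco c w \<in> P" "tco c w' \<in> Q" "P \<inter> Q = {}"
      using hausdorff[OF ne] by metis
    show ?thesis
    proof (intro exI conjI)
      show "openin TT {w \<in> tdm c. tco c w \<in> P}" "openin TT {w \<in> tdm c. tco c w \<in> Q}" using TT_basic_open c PQ by auto
      show "disjnt {w \<in> tdm c. tco c w \<in> P} {w \<in> tdm c. tco c w \<in> Q}" using PQ(5) by (auto simp: disjnt_iff)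
    qed (use wc PQ in auto)
  qed
qed

section \<open>Geodesics as integral curves of the spray\<close>

definition spray_field :: "('p, 'a) chart \<Rightarrow> 'a \<times> 'a \<Rightarrow> 'a \<times> 'a" where
  "spray_field c z = (snd z, H c (fst z) (snd z))"

lemma sprayD:
  assumes "c \<in> A"
  shows "locally_lipschitz_on ((snd c ` fst c) \<times> UNIV) (\<lambda>(x, v). H c x v)"
    "x \<in> snd c ` fst c \<Longrightarrow> s > 0 \<Longrightarrow> H c x (s *\<^sub>R v) = s\<^sup>2 *\<^sub>R H c x v"
    "d \<in> A \<Longrightarrow> x \<in> overlap c d \<Longrightarrow> H d (transition c d x) (D\<tau> c d x v) =
          second_derivative (transition c d) x v v + D\<tau> c d x (H c x v)"
  using spray assms unfolding lipschitz_spray_def by blast+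

lemma spray_field_lipschitz:
  assumes c: "c \<in> A"
  shows "locally_lipschitz_on (tco c ` tdm c) (spray_field c)"
  unfolding locally_lipschitz_on_def tco_image[OF c]
proof
  fix z assume "z \<in> snd c ` fst c \<times> (UNIV :: 'a set)"
  then obtain e L where e: "e > 0" "L-lipschitz_on ((snd c ` fst c) \<times> UNIV \<inter> ball z e) (\<lambda>(x, v). H c x v)"
    using locally_lipschitz_onE[OF sprayD(1)[OF c]] by metis
  have "(\<lambda>(x, v). H c x v) = (\<lambda>z. H c (fst z) (snd z))" by (simp add: split_beta')
  then have "(sqrt (1\<^sup>2 + L\<^sup>2))-lipschitz_on ((snd c ` fst c) \<times> UNIV \<inter> ball z e) (spray_field c)"
    using lipschitz_on_Pair[OF lipschitz_on_snd e(2)] by (simp add: spray_field_def[abs_def])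
  then show "\<exists>e>0. \<exists>L. L-lipschitz_on ((snd c ` fst c) \<times> UNIV \<inter> ball z e) (spray_field c)" using e(1) by blast
qed

sublocale T: charted_vector_field "tangent_topology A" A "tchart A" spray_field
proof
  show "Hausdorff_space TT" by (rule Hausdorff_TT)
  show "is_chart TT (tchart A c)" if "c \<in> A" for c using that by (rule tchart_is_chart)
  show "(\<Union>c\<in>A. tdm c) = topspace TT" unfolding topspace_TT using TMD(1) by (fastforce simp: tdm_iff)
  show "locally_lipschitz_on (tco c ` tdm c) (spray_field c)" if "c \<in> A" for c using that by (rule spray_field_lipschitz)
  show "locally_lipschitz_on (overlap (tchart A c) (tchart A d)) (transition (tchart A c) (tchart A d))"
    if "c \<in> A" "d \<in> A" for c d using that by (rule ttransition_lipschitz)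
  show "\<exists>D. (transition (tchart A c) (tchart A d) has_derivative D) (at z) \<and>
      D (spray_field c z) = spray_field d (transition (tchart A c) (tchart A d) z)"
    if c: "c \<in> A" and d: "d \<in> A" and z: "z \<in> overlap (tchart A c) (tchart A d)" for c d z
  proof -
    obtain x v where xv: "z = (x, v)" "x \<in> overlap c d" using z unfolding toverlap[OF c d] by auto
    show ?thesis
      using ttransition_derivative[OF c d xv(2), of v "H c x v"] sprayD(3)[OF c d xv(2), of v] ttransition[OF c d xv(2)]
      by (simp add: xv(1) spray_field_def)
  qed
qed

lemma ttransition_differentiable:
  assumes "c \<in> A" "d \<in> A" "w \<in> tdm c" "w \<in> tdm d"
  shows "transition (tchart A c) (tchart A d) differentiable (at (tco c w))"
proof -
  have "tco c w \<in> overlap (tchart A c) (tchart A d)" using assms by (auto simp: overlap_def)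
  then show ?thesis using T.field_transforms[OF assms(1,2)] unfolding differentiable_def by blast
qed

lemma velocity_cong:
  assumes "open J" "t \<in> J" "\<And>s. s \<in> J \<Longrightarrow> \<gamma> s = \<gamma>' s"
  shows "velocity A \<gamma> t = velocity A \<gamma>' t"
proof -
  have "vector_derivative (\<lambda>s. snd c (\<gamma> s)) (at t) = vector_derivative (\<lambda>s. snd c (\<gamma>' s)) (at t)" for c :: "('p, 'a) chart"
  proof (rule vector_derivative_cong_eq)
    show "\<forall>\<^sub>F s in nhds t. s \<in> UNIV \<longrightarrow> snd c (\<gamma> s) = snd c (\<gamma>' s)"
      using eventually_nhds_in_open[OF assms(1,2)] by (rule eventually_mono) (use assms(3) in auto)
  qed (use assms in auto)
  then show ?thesis using assms(3)[OF assms(2)] by (auto simp: velocity_def fun_eq_iff)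
qed

text \<open>Together with the lemma after it: velocity curves of geodesics and integral curves of the spray field
on the tangent bundle are the same thing.\<close>

lemma spray_solution_icurve:
  assumes g: "spray_solution M A H J \<gamma>"
  shows "T.icurve J (velocity A \<gamma>)"
proof -
  have J: "open J" "is_interval J" and cont: "continuous_map (top_of_set J) M \<gamma>"
    and d1: "\<And>t c. t \<in> J \<Longrightarrow> c \<in> A \<Longrightarrow> \<gamma> t \<in> fst c \<Longrightarrow> ((\<lambda>s. snd c (\<gamma> s)) has_vector_derivative snd (velocity A \<gamma> t) c) (at t)"
    and d2: "\<And>t c. t \<in> J \<Longrightarrow> c \<in> A \<Longrightarrow> \<gamma> t \<in> fst c \<Longrightarrow> ((\<lambda>s. snd (velocity A \<gamma> s) c) has_vector_derivative
           H c (snd c (\<gamma> t)) (snd (velocity A \<gamma> t) c)) (at t)"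
    using g unfolding spray_solution_def by blast+
  have fv: "fst (velocity A \<gamma> t) = \<gamma> t" for t by (simp add: velocity_def)
  have near: "\<exists>e>0. ball t e \<subseteq> J \<and> (\<forall>s\<in>ball t e. \<gamma> s \<in> U)" if "t \<in> J" "openin M U" "\<gamma> t \<in> U" for t U
    using cont that unfolding continuous_curve_iff[OF J(1)] by blast
  have TMv: "velocity A \<gamma> t \<in> TM" if t: "t \<in> J" for t
  proof -
    have "\<gamma> t \<in> topspace M" using cont t unfolding continuous_curve_iff[OF J(1)] by blast
    then have "\<gamma> t \<in> (\<Union>c\<in>A. fst c)" using cover_M by simp
    moreover have "snd (velocity A \<gamma> t) d = D\<tau> c d (snd c (\<gamma> t)) (snd (velocity A \<gamma> t) c)"
      if c: "c \<in> A" "\<gamma> t \<in> fst c" and d: "d \<in> A" "\<gamma> t \<in> fst d" for c d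
    proof -
      have D: "(transition c d has_derivative D\<tau> c d (snd c (\<gamma> t))) (at (snd c (\<gamma> t)))"
        by (rule transition_derivative[OF c(1) d(1) in_overlap[OF c(2) d(2)]])
      have "((transition c d \<circ> (\<lambda>s. snd c (\<gamma> s))) has_derivative (D\<tau> c d (snd c (\<gamma> t)) \<circ> (\<lambda>h. h *\<^sub>R snd (velocity A \<gamma> t) c))) (at t)"
        using diff_chain_at[OF d1[OF t c, unfolded has_vector_derivative_def] D] .
      then have "((transition c d \<circ> (\<lambda>s. snd c (\<gamma> s))) has_vector_derivative D\<tau> c d (snd c (\<gamma> t)) (snd (velocity A \<gamma> t) c)) (at t)"
        using linear_scale[OF has_derivative_linear[OF D]] by (simp add: has_vector_derivative_def o_def)
      moreover obtain e where "e > 0" "\<And>s. s \<in> ball t e \<Longrightarrow> \<gamma> s \<in> fst c"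
        using near[OF t is_chartD(1)[OF chart[OF c(1)]] c(2)] by blast
      moreover have "t \<in> ball t e" using \<open>e > 0\<close> by simp
      ultimately have "((\<lambda>s. snd d (\<gamma> s)) has_vector_derivative D\<tau> c d (snd c (\<gamma> t)) (snd (velocity A \<gamma> t) c)) (at t)"
        by (rule_tac has_vector_derivative_transform_within_open[OF _ open_ball])
          (assumption+, simp add: transition_apply[OF c(1), of _ d])
      then show ?thesis using d1[OF t d] vector_derivative_unique_at by blast
    qed
    moreover have "snd (velocity A \<gamma> t) c = 0" if "\<not> (c \<in> A \<and> \<gamma> t \<in> fst c)" for c
      using that by (auto simp: velocity_def)
    ultimately show ?thesis unfolding TM_iff fv by blast
  qed
  have z: "((\<lambda>s. tco c (velocity A \<gamma> s)) has_vector_derivative spray_field c (tco c (velocity A \<gamma> t))) (at t)"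
    if "t \<in> J" "c \<in> A" "\<gamma> t \<in> fst c" for t c
    using has_vector_derivative_Pair[OF d1[OF that] d2[OF that]]
    by (simp add: tco_apply spray_field_def fv)
  show ?thesis
    unfolding T.icurve_def continuous_curve_iff[OF J(1)] topspace_TT
  proof (intro conjI ballI allI impI J)
    fix t assume t: "t \<in> J"
    show "velocity A \<gamma> t \<in> TM" by (rule TMv[OF t])
    show "((\<lambda>s. tco c (velocity A \<gamma> s)) has_vector_derivative spray_field c (tco c (velocity A \<gamma> t))) (at t)"
      if "c \<in> A" "velocity A \<gamma> t \<in> tdm c" for c
      using z[OF t that(1)] that(2) by (simp add: tdm_iff fv)
    show "\<exists>e>0. ball t e \<subseteq> J \<and> (\<forall>s\<in>ball t e. velocity A \<gamma> s \<in> V)" if V: "openin TT V \<and> velocity A \<gamma> t \<in> V" for V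
    proof -
      obtain c where c: "c \<in> A" "\<gamma> t \<in> fst c" using TMD(1)[OF TMv[OF t]] by (auto simp: fv)
      have tc: "velocity A \<gamma> t \<in> tdm c" using TMv[OF t] c by (simp add: tdm_iff fv)
      obtain d where d: "d > 0" "\<And>y. y \<in> ball (tco c (velocity A \<gamma> t)) d \<Longrightarrow> chart_inv (tchart A c) y \<in> V"
        using chart_inv_nhd[OF tchart_is_chart[OF c(1)] conjunct1[OF V] imageI[OF tc]] tco_inv[OF c(1) tc] V by metis
      have "continuous (at t) (\<lambda>s. tco c (velocity A \<gamma> s))"
        using z[OF t c] has_vector_derivative_continuous by blast
      then obtain e where e: "e > 0" "\<And>s. dist s t < e \<Longrightarrow> dist (tco c (velocity A \<gamma> s)) (tco c (velocity A \<gamma> t)) < d"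
        using d(1) unfolding continuous_at_eps_delta by blast
      obtain e' where e': "e' > 0" "ball t e' \<subseteq> J" "\<And>s. s \<in> ball t e' \<Longrightarrow> \<gamma> s \<in> fst c"
        using near[OF t is_chartD(1)[OF chart[OF c(1)]] c(2)] by blast
      have "velocity A \<gamma> s \<in> V" if s: "s \<in> ball t (min e e')" for s
      proof -
        have "velocity A \<gamma> s \<in> tdm c" using TMv e' s by (auto simp: tdm_iff fv)
        then have "velocity A \<gamma> s = chart_inv (tchart A c) (tco c (velocity A \<gamma> s))" using tco_inv[OF c(1)] by simp
        moreover have "tco c (velocity A \<gamma> s) \<in> ball (tco c (velocity A \<gamma> t)) d" using e(2)[of s] s by (simp add: dist_commute)
        ultimately show ?thesis using d(2) by metis
      qed
      then show ?thesis using e(1) e'(1,2) by (intro exI[of _ "min e e'"]) auto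
    qed
  qed
qed

lemma icurve_spray_solution:
  assumes u: "T.icurve J u"
  shows "spray_solution M A H J (\<lambda>t. fst (u t))" "t \<in> J \<Longrightarrow> velocity A (\<lambda>t. fst (u t)) t = u t"
proof -
  note J = T.icurveD(1,2)[OF u]
  have TMu: "u t \<in> TM" if "t \<in> J" for t using T.icurveD(3)[OF u that] by (simp add: topspace_TT)
  have dd: "((\<lambda>s. snd c (fst (u s))) has_vector_derivative snd (u t) c) (at t)"
      "((\<lambda>s. snd (u s) c) has_vector_derivative H c (snd c (fst (u t))) (snd (u t) c)) (at t)"
    if t: "t \<in> J" and c: "c \<in> A" "fst (u t) \<in> fst c" for t c
  proof -
    have z: "((\<lambda>s. tco c (u s)) has_vector_derivative spray_field c (tco c (u t))) (at t)"
      using T.icurveD(4)[OF u t c(1)] TMu[OF t] c(2) by (simp add: tdm_iff)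
    show "((\<lambda>s. snd c (fst (u s))) has_vector_derivative snd (u t) c) (at t)"
      using bounded_linear.has_vector_derivative[OF bounded_linear_fst z] by (simp add: tco_apply spray_field_def)
    show "((\<lambda>s. snd (u s) c) has_vector_derivative H c (snd c (fst (u t))) (snd (u t) c)) (at t)"
      using bounded_linear.has_vector_derivative[OF bounded_linear_snd z] by (simp add: tco_apply spray_field_def)
  qed
  show vel: "velocity A (\<lambda>t. fst (u t)) t = u t" if t: "t \<in> J" for t
  proof (rule prod_eqI)
    show "snd (velocity A (\<lambda>t. fst (u t)) t) = snd (u t)"
    proof
      fix c
      show "snd (velocity A (\<lambda>t. fst (u t)) t) c = snd (u t) c"
        using vector_derivative_at[OF dd(1)[OF t]] TMD(2)[OF TMu[OF t]] by (auto simp: velocity_def)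
    qed
  qed (simp add: velocity_def)
  show "spray_solution M A H J (\<lambda>t. fst (u t))"
    unfolding spray_solution_def continuous_curve_iff[OF J(1)]
  proof (intro conjI ballI allI impI J)
    fix t assume t: "t \<in> J"
    show "fst (u t) \<in> topspace M" using TMD(1)[OF TMu[OF t]] cover_M by simp
    show "\<exists>e>0. ball t e \<subseteq> J \<and> (\<forall>s\<in>ball t e. fst (u s) \<in> V)" if "openin M V \<and> fst (u t) \<in> V" for V
      using T.icurveD(5)[OF u t base_open[of V]] TMu[OF t] that by auto
    fix c assume c: "c \<in> A" "fst (u t) \<in> fst c"
    show "((\<lambda>s. snd c (fst (u s))) has_vector_derivative snd (velocity A (\<lambda>t. fst (u t)) t) c) (at t)"
      using dd(1)[OF t c] vel[OF t] by simp
    have "((\<lambda>s. snd (velocity A (\<lambda>t. fst (u t)) s) c) has_vector_derivative H c (snd c (fst (u t))) (snd (u t) c)) (at t)"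
      by (rule has_vector_derivative_transform_within_open[OF dd(2)[OF t c] J(1) t]) (simp add: vel)
    then show "((\<lambda>s. snd (velocity A (\<lambda>t. fst (u t)) s) c) has_vector_derivative
        H c (snd c (fst (u t))) (snd (velocity A (\<lambda>t. fst (u t)) t) c)) (at t)"
      using vel[OF t] by simp
  qed
qed

lemma geodesic_dom_eq: "geodesic_dom M A H v = T.dom v"
proof
  show "geodesic_dom M A H v \<subseteq> T.dom v"
    unfolding geodesic_dom_def T.dom_def solution_from_def using spray_solution_icurve by blast
  show "T.dom v \<subseteq> geodesic_dom M A H v"
    unfolding geodesic_dom_def T.dom_def solution_from_def using icurve_spray_solution by blast
qed

lemma geodesic_eq: "t \<in> T.dom v \<Longrightarrow> geodesic M A H v t = fst (T.Fl t v)"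
  unfolding geodesic_def
proof (rule the_equality)
  assume "t \<in> T.dom v"
  then obtain J u where u: "T.icurve J u" "0 \<in> J" "u 0 = v" "t \<in> J" by (rule T.domE)
  show "\<exists>J \<gamma>. solution_from M A H v J \<gamma> \<and> t \<in> J \<and> \<gamma> t = fst (T.Fl t v)"
    using icurve_spray_solution[OF u(1)] u T.Fl_eqI(2)[OF u] unfolding solution_from_def
    by (intro exI[of _ J] exI[of _ "\<lambda>t. fst (u t)"]) auto
next
  fix p assume "\<exists>J \<gamma>. solution_from M A H v J \<gamma> \<and> t \<in> J \<and> \<gamma> t = p"
  then obtain J \<gamma> where g: "spray_solution M A H J \<gamma>" "0 \<in> J" "velocity A \<gamma> 0 = v" "t \<in> J" "\<gamma> t = p"
    unfolding solution_from_def by blast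
  then show "p = fst (T.Fl t v)"
    using T.Fl_eqI(2)[OF spray_solution_icurve[OF g(1)] g(2,3,4)] by (simp add: velocity_def)
qed

lemma flow_eq: "t \<in> T.dom v \<Longrightarrow> flow M A H t v = T.Fl t v"
  unfolding flow_def
  using velocity_cong[OF T.icurveD(1)[OF T.icurve_Fl], of t v "geodesic M A H v" "\<lambda>t. fst (T.Fl t v)"]
    geodesic_eq icurve_spray_solution(2)[OF T.icurve_Fl, of t v] by simp

lemma tscale_TM:
  assumes w: "w \<in> TM" shows "tscale s w \<in> TM"
proof -
  have lin: "linear (D\<tau> c d (snd c (fst w)))" if "c \<in> A" "d \<in> A" "fst w \<in> fst c" "fst w \<in> fst d" for c d
    using has_derivative_linear[OF transition_derivative[OF that(1,2) in_overlap[OF that(3,4)]]] .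
  have sc: "s *\<^sub>R snd w d = D\<tau> c d (snd c (fst w)) (s *\<^sub>R snd w c)"
    if "c \<in> A" "d \<in> A" "fst w \<in> fst c" "fst w \<in> fst d" for c d
    unfolding TMD(3)[OF w that] by (rule linear_scale[OF lin[OF that], symmetric])
  show ?thesis
    unfolding TM_iff
  proof (intro conjI ballI allI impI)
    show "fst (tscale s w) \<in> (\<Union>c\<in>A. fst c)" using TMD(1)[OF w] by (simp add: tscale_def)
    show "snd (tscale s w) c = 0" if "\<not> (c \<in> A \<and> fst (tscale s w) \<in> fst c)" for c
      using that TMD(2)[OF w, of c] by (simp add: tscale_def)
    show "snd (tscale s w) d = D\<tau> c d (snd c (fst (tscale s w))) (snd (tscale s w) c)"
      if "c \<in> A" "d \<in> A" "fst (tscale s w) \<in> fst c \<inter> fst d" for c d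
      using sc[OF that(1,2)] that(3) by (simp add: tscale_def)
  qed
qed

lemma tscale_tdm: "w \<in> tdm c \<Longrightarrow> tscale s w \<in> tdm c"
  and tscale_tco: "tco c (tscale s w) = (fst (tco c w), s *\<^sub>R snd (tco c w))"
  using tscale_TM by (auto simp: tdm_iff tco_apply) (simp_all add: tscale_def)

text \<open>Homogeneity is assumed for positive factors; at \<open>v = 0\<close> the factor \<open>2\<close> gives \<open>H(x, 0) = 4 H(x, 0)\<close>.\<close>

lemma spray_zero: "c \<in> A \<Longrightarrow> x \<in> snd c ` fst c \<Longrightarrow> H c x 0 = 0"
proof -
  assume "c \<in> A" "x \<in> snd c ` fst c"
  then have "H c x 0 = 4 *\<^sub>R H c x 0" using sprayD(2)[of c x 2 0] by simp
  then have "(4 - 1) *\<^sub>R H c x 0 = 0" unfolding scaleR_left_diff_distrib by simp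
  then show ?thesis by simp
qed

text \<open>If \<open>(x, v)\<close> solves the system, so does \<open>(x(s t), s v(s t))\<close>: the second component has derivative
\<open>s^2 H(x, v) = H(x, s v)\<close>.\<close>

lemma icurve_tscale:
  assumes u: "T.icurve J u" and s: "s > 0"
  shows "T.icurve ((\<lambda>t. s * t) -` J) (\<lambda>t. tscale s (u (s * t)))"
proof (rule T.icurve_if_locally)
  show o: "open ((\<lambda>t. s * t) -` J)" using T.icurveD(1)[OF u] by (intro open_vimage continuous_intros)
  show "is_interval ((\<lambda>t. s * t) -` J)"
    unfolding is_interval_1
  proof (intro ballI allI impI)
    fix b c x assume "b \<in> (\<lambda>t. s * t) -` J" "c \<in> (\<lambda>t. s * t) -` J" "b \<le> x \<and> x \<le> c"
    then show "x \<in> (\<lambda>t. s * t) -` J"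
      using mem_is_interval_1_I[OF T.icurveD(2)[OF u], of "s * b" "s * c" "s * x"] s by simp
  qed
  fix t assume t: "t \<in> (\<lambda>t. s * t) -` J"
  then have st: "s * t \<in> J" by simp
  obtain c where c: "c \<in> A" "u (s * t) \<in> tdm c" using T.chart_around[OF T.icurveD(3)[OF u st]] by blast
  obtain e where e: "e > 0" "ball (s * t) e \<subseteq> J" "\<And>r. r \<in> ball (s * t) e \<Longrightarrow> u r \<in> tdm c"
    using T.icurveD(5)[OF u st tdm_open[OF c(1)] c(2)] by blast
  have in_b: "s * r \<in> ball (s * t) e" if "r \<in> ball t (e / s)" for r
  proof -
    have "\<bar>s * t - s * r\<bar> = s * \<bar>t - r\<bar>" using s by (simp add: abs_mult right_diff_distrib[symmetric])
    then show ?thesis using that s by (simp add: dist_real_def field_simps)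
  qed
  define z where "z r = tco c (tscale s (u (s * r)))" for r
  have "T.icurve (ball t (e / s)) (\<lambda>r. chart_inv (tchart A c) (z r))"
  proof (rule T.icurve_of_chart[OF c(1) open_ball is_interval_ball_real])
    fix r assume r: "r \<in> ball t (e / s)"
    note sr = in_b[OF r]
    have uc: "u (s * r) \<in> tdm c" by (rule e(3)[OF sr])
    show "z r \<in> tco c ` tdm c" unfolding z_def using tscale_tdm[OF uc] by blast
    have d: "((\<lambda>r. s * r) has_vector_derivative s) (at r)"
      by (auto simp flip: has_real_derivative_iff_has_vector_derivative intro!: derivative_eq_intros)
    have "s * r \<in> J" using sr e(2) by blast
    from vector_diff_chain_at[OF d T.icurveD(4)[OF u this c(1) uc]]
    have w: "((\<lambda>r. tco c (u (s * r))) has_vector_derivative s *\<^sub>R spray_field c (tco c (u (s * r)))) (at r)"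
      by (simp add: o_def)
    have "((\<lambda>r. (fst (tco c (u (s * r))), s *\<^sub>R snd (tco c (u (s * r))))) has_vector_derivative
        (fst (s *\<^sub>R spray_field c (tco c (u (s * r)))), s *\<^sub>R snd (s *\<^sub>R spray_field c (tco c (u (s * r)))))) (at r)"
      by (intro has_vector_derivative_Pair bounded_linear.has_vector_derivative[OF bounded_linear_fst]
          bounded_linear.has_vector_derivative[OF bounded_linear_scaleR_right] bounded_linear.has_vector_derivative[OF bounded_linear_snd] w)
    moreover have "fst (tco c (u (s * r))) \<in> snd c ` fst c" using uc by (auto simp: tdm_iff tco_apply)
    ultimately show "(z has_vector_derivative spray_field c (z r)) (at r)"
      using sprayD(2)[OF c(1) _ s] unfolding z_def tscale_tco by (simp add: spray_field_def power2_eq_square)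
  qed
  moreover have "ball t (e / s) \<subseteq> (\<lambda>t. s * t) -` J" using in_b e(2) by blast
  moreover have "tscale s (u (s * r)) = chart_inv (tchart A c) (z r)" if "r \<in> ball t (e / s)" for r
    unfolding z_def using tco_inv[OF c(1) tscale_tdm[OF e(3)[OF in_b[OF that]]]] by simp
  ultimately show "\<exists>e>0. \<exists>J' w. T.icurve J' w \<and> ball t e \<subseteq> J' \<and> (\<forall>r\<in>ball t e. tscale s (u (s * r)) = w r)"
    using e(1) s by (intro exI[of _ "e / s"] conjI exI[of _ "ball t (e / s)"] exI[of _ "\<lambda>r. chart_inv (tchart A c) (z r)"]) auto
qed

lemma icurve_zero:
  assumes v: "v \<in> TM"
  shows "T.icurve UNIV (\<lambda>t. tscale 0 v)"
proof -
  obtain c where c: "c \<in> A" "fst v \<in> fst c" using TMD(1)[OF v] by blast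
  then have vc: "tscale 0 v \<in> tdm c" using v tscale_tdm[of v c 0] by (simp add: tdm_iff)
  have "T.icurve UNIV (\<lambda>t. chart_inv (tchart A c) (tco c (tscale 0 v)))"
  proof (rule T.icurve_of_chart[OF c(1) open_UNIV is_interval_univ])
    show "tco c (tscale 0 v) \<in> tco c ` tdm c" using vc by blast
    have "spray_field c (tco c (tscale 0 v)) = 0"
      using spray_zero[OF c(1)] c(2) by (simp add: spray_field_def tco_apply tscale_def zero_prod_def)
    then show "((\<lambda>t. tco c (tscale 0 v)) has_vector_derivative spray_field c (tco c (tscale 0 v))) (at t)" for t
      by (simp add: has_vector_derivative_const)
  qed
  then show ?thesis using tco_inv[OF c(1) vc] by simp
qed

lemma tscale_flow:
  assumes v: "v \<in> TM" and s: "s \<ge> 0" and t: "s * t \<in> T.dom v"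
  shows "t \<in> T.dom (tscale s v)" "T.Fl t (tscale s v) = tscale s (T.Fl (s * t) v)"
proof -
  have v0: "0 \<in> T.dom v" "T.Fl 0 v = v" using T.zero_in_dom T.Fl_0 v by (auto simp: topspace_TT)
  have "t \<in> T.dom (tscale s v) \<and> T.Fl t (tscale s v) = tscale s (T.Fl (s * t) v)"
  proof (cases "s = 0")
    case True
    then show ?thesis using T.Fl_eqI[OF icurve_zero[OF v], of "tscale 0 v" t] v0 by simp
  next
    case False
    then have "s > 0" using s by simp
    from T.Fl_eqI[OF icurve_tscale[OF T.icurve_Fl this], of v "tscale s v" t] v0 t
    show ?thesis by simp
  qed
  then show "t \<in> T.dom (tscale s v)" "T.Fl t (tscale s v) = tscale s (T.Fl (s * t) v)" by auto
qed

section \<open>Domain and regularity of the geodesic flow\<close>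

lemma flow_dom_iff: "(t, v) \<in> flow_dom M A H \<longleftrightarrow> 0 \<le> t \<and> v \<in> TM \<and> t \<in> T.dom v"
  by (simp add: flow_dom_def geodesic_dom_eq)

lemma dom_interval: "v \<in> TM \<Longrightarrow> t \<in> T.dom v \<Longrightarrow> 0 \<le> s \<Longrightarrow> s \<le> t \<Longrightarrow> s \<in> T.dom v"
  using mem_is_interval_1_I[OF T.icurveD(2)[OF T.icurve_Fl, of v], of 0 t s] T.zero_in_dom topspace_TT by auto

lemma exp_dom_iff: "v \<in> exp_dom M A H \<longleftrightarrow> v \<in> TM \<and> 1 \<in> T.dom v"
  using dom_interval[of v 1] by (auto simp: exp_dom_def geodesic_dom_eq)

lemma exp_dom_times: "v \<in> exp_dom M A H \<Longrightarrow> t \<in> {0..1} \<Longrightarrow> t \<in> T.dom v"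
  using dom_interval[of v 1 t] by (auto simp: exp_dom_iff)

lemma chart_at:
  assumes "w \<in> TM" obtains c where "c \<in> A" "w \<in> tdm c"
  using T.chart_around assms unfolding topspace_TT by blast

lemma tchart_param: "c \<in> A \<Longrightarrow> T.lipschitz_param (tchart A c)"
  unfolding T.lipschitz_param_def
  using tchart_is_chart ttransition_lipschitz by (metis order_refl subtopology_topspace)

lemma flow_rep_eq: "t \<in> T.dom (chart_inv b y) \<Longrightarrow> flow_rep M A H b c t y = tco c (T.Fl t (chart_inv b y))"
  by (simp add: flow_rep_def flow_eq)

lemma evolution_box_exists:
  assumes b: "T.lipschitz_param b" "v \<in> fst b" and t: "t \<in> T.dom v" and c: "c \<in> A" "T.Fl t v \<in> tdm c"
  shows "\<exists>e L. T.flow_box b c t (snd b v) e L \<and>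
    evolution_box (flow_rep M A H b c) (\<lambda>t y. spray_field c (flow_rep M A H b c t y)) t (snd b v) e L"
proof -
  obtain e0 L0 where "T.flow_box b c t (snd b v) e0 L0" using T.flow_box_exists[OF b t c] by blast
  from T.flow_box_with_field[OF this c(1)] obtain e L where
    f: "T.flow_box b c t (snd b v) e L"
    and g: "L-lipschitz_on (ball t e \<times> ball (snd b v) e) (\<lambda>p. spray_field c (tco c (T.Fl (fst p) (chart_inv b (snd p)))))"
    by blast
  have eq: "flow_rep M A H b c s y = tco c (T.Fl s (chart_inv b y))" if "s \<in> ball t e" "y \<in> ball (snd b v) e" for s y
    by (rule flow_rep_eq[OF T.flow_boxD(3)[OF f that]])
  have "evolution_box (flow_rep M A H b c) (\<lambda>t y. spray_field c (flow_rep M A H b c t y)) t (snd b v) e L"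
  proof
    show "e > 0" by (rule T.flow_boxD(1)[OF f])
    show "L-lipschitz_on (ball t e \<times> ball (snd b v) e) (\<lambda>p. flow_rep M A H b c (fst p) (snd p))"
      by (rule lipschitz_on_transform[OF T.flow_boxD(5)[OF f]]) (use eq in auto)
    show "L-lipschitz_on (ball t e \<times> ball (snd b v) e) (\<lambda>p. spray_field c (flow_rep M A H b c (fst p) (snd p)))"
      by (rule lipschitz_on_transform[OF g]) (use eq in auto)
    fix s y assume s: "s \<in> ball t e" and y: "y \<in> ball (snd b v) e"
    show "((\<lambda>s. flow_rep M A H b c s y) has_vector_derivative spray_field c (flow_rep M A H b c s y)) (at s)"
      unfolding eq[OF s y]
      by (rule has_vector_derivative_transform_within_open[OF T.flow_box_derivative[OF f c(1) s y] open_ball s])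
        (simp add: eq[OF _ y])
  qed
  then show ?thesis using f by blast
qed

lemma param_nhd:
  assumes b: "is_chart (subtopology TT N) b" and v: "v \<in> fst b" and "e > 0"
  obtains V where "openin TT V" "v \<in> V" "\<And>w. w \<in> V \<Longrightarrow> w \<in> N \<Longrightarrow> w \<in> fst b \<and> snd b w \<in> ball (snd b v) e"
proof -
  have "openin (subtopology TT N) {w \<in> fst b. snd b w \<in> ball (snd b v) e}"
    by (rule chart_openin_preimage[OF b open_ball])
  then obtain V where V: "openin TT V" "{w \<in> fst b. snd b w \<in> ball (snd b v) e} = V \<inter> N"
    by (auto simp: openin_subtopology)
  have "v \<in> {w \<in> fst b. snd b w \<in> ball (snd b v) e}" using v \<open>e > 0\<close> by simp
  then show ?thesis using that[OF V(1)] V(2) by blast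
qed

text \<open>Openness of the flow domain and continuity of the flow in both variables are read off from this form,
in which no charts occur.\<close>

lemma flow_nhd:
  assumes v: "v \<in> TM" and t: "t \<in> T.dom v" and V: "openin TT V" "T.Fl t v \<in> V"
  shows "\<exists>e>0. \<exists>U. openin TT U \<and> v \<in> U \<and> (\<forall>s\<in>ball t e. \<forall>w\<in>U. w \<in> TM \<and> s \<in> T.dom w \<and> T.Fl s w \<in> V)"
proof -
  obtain d where d: "d \<in> A" "v \<in> tdm d" using chart_at[OF v] .
  have FT: "T.Fl t v \<in> TM" using T.Fl_in_space[OF t] by (simp add: topspace_TT)
  obtain c where c: "c \<in> A" "T.Fl t v \<in> tdm c" using chart_at[OF FT] .
  obtain e L where f: "T.flow_box (tchart A d) c t (tco d v) e L"
    using T.flow_box_exists[OF tchart_param[OF d(1)] d(2) t c] by blast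
  have e: "e > 0" by (rule T.flow_boxD(1)[OF f])
  obtain \<rho> where \<rho>: "\<rho> > 0" "\<And>z. z \<in> ball (tco c (T.Fl t v)) \<rho> \<Longrightarrow> chart_inv (tchart A c) z \<in> V"
    using chart_inv_nhd[OF tchart_is_chart[OF c(1)] V(1) imageI[OF c(2)]] tco_inv[OF c] V(2) by metis
  let ?g = "\<lambda>p. tco c (T.Fl (fst p) (chart_inv (tchart A d) (snd p)))"
  obtain e' where e': "e' > 0" "e' \<le> e" "\<And>p. p \<in> ball t e' \<times> ball (tco d v) e' \<Longrightarrow> ?g p \<in> ball (?g (t, tco d v)) \<rho>"
    using lipschitz_box_shrink[OF T.flow_boxD(5)[OF f] e \<rho>(1)] by blast
  let ?U = "{w \<in> tdm d. tco d w \<in> ball (tco d v) e'}"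
  have "w \<in> TM \<and> s \<in> T.dom w \<and> T.Fl s w \<in> V" if s: "s \<in> ball t e'" and w: "w \<in> ?U" for s w
  proof -
    have iw: "chart_inv (tchart A d) (tco d w) = w" using tco_inv[OF d(1)] w by auto
    have sb: "s \<in> ball t e" and wb: "tco d w \<in> ball (tco d v) e" using s w e'(2) by auto
    have "T.Fl s w \<in> tdm c" using T.flow_boxD(4)[OF f sb wb] iw by simp
    moreover have "tco c (T.Fl s w) \<in> ball (tco c (T.Fl t v)) \<rho>"
      using e'(3)[of "(s, tco d w)"] s w iw tco_inv[OF d] by simp
    ultimately have "T.Fl s w \<in> V" using \<rho>(2) tco_inv[OF c(1)] by metis
    then show ?thesis using T.flow_boxD(3)[OF f sb wb] iw w by (auto simp: tdm_iff)
  qed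
  moreover have "openin TT ?U" by (rule TT_basic_open[OF d(1) open_ball])
  ultimately show ?thesis using e'(1) d(2) by (intro exI[of _ e'] conjI exI[of _ ?U]) auto
qed

lemma flow_dom_open: "openin (prod_topology (top_of_set {0..}) (subtopology TT N)) (flow_dom M A H \<inter> UNIV \<times> N)"
  unfolding openin_prod_topology_alt
proof (intro allI impI)
  fix t v assume "(t, v) \<in> flow_dom M A H \<inter> UNIV \<times> N"
  then have tv: "0 \<le> t" "v \<in> TM" "t \<in> T.dom v" "v \<in> N" by (auto simp: flow_dom_iff)
  obtain e U where U: "e > 0" "openin TT U" "v \<in> U" "\<And>s w. s \<in> ball t e \<Longrightarrow> w \<in> U \<Longrightarrow> w \<in> TM \<and> s \<in> T.dom w"
    using flow_nhd[OF tv(2,3) openin_topspace T.Fl_in_space[OF tv(3)]] by blast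
  show "\<exists>U V. openin (top_of_set {0..}) U \<and> openin (subtopology TT N) V \<and> t \<in> U \<and> v \<in> V \<and> U \<times> V \<subseteq> flow_dom M A H \<inter> UNIV \<times> N"
  proof (intro exI conjI)
    show "openin (top_of_set {0..}) ({0..} \<inter> ball t e)" by (simp add: openin_open_Int)
    show "openin (subtopology TT N) (N \<inter> U)" by (rule openin_subtopology_Int2[OF U(2)])
    show "({0..} \<inter> ball t e) \<times> (N \<inter> U) \<subseteq> flow_dom M A H \<inter> UNIV \<times> N" using U(4) by (auto simp: flow_dom_iff)
  qed (use tv U in auto)
qed

lemma exp_dom_open: "openin TT (exp_dom M A H)"
  unfolding openin_subopen[of TT "exp_dom M A H"]
proof
  fix v assume "v \<in> exp_dom M A H"
  then have v: "v \<in> TM" "1 \<in> T.dom v" by (auto simp: exp_dom_iff)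
  obtain e U where U: "e > 0" "openin TT U" "v \<in> U" "\<And>s w. s \<in> ball 1 e \<Longrightarrow> w \<in> U \<Longrightarrow> w \<in> TM \<and> s \<in> T.dom w"
    using flow_nhd[OF v openin_topspace T.Fl_in_space[OF v(2)]] by blast
  have "U \<subseteq> exp_dom M A H"
  proof
    fix w assume "w \<in> U"
    then show "w \<in> exp_dom M A H" using U(4)[of 1 w] U(1) by (simp add: exp_dom_iff)
  qed
  then show "\<exists>U. openin TT U \<and> v \<in> U \<and> U \<subseteq> exp_dom M A H" using U by blast
qed

lemma flow_dom_scale:
  assumes "(t, v) \<in> flow_dom M A H" "s \<in> {0..1}"
  shows "(s * t, v) \<in> flow_dom M A H" "(t, tscale s v) \<in> flow_dom M A H"
proof -
  have tv: "0 \<le> t" "v \<in> TM" "t \<in> T.dom v" using assms by (auto simp: flow_dom_iff)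
  have st: "s * t \<in> T.dom v"
    using dom_interval[OF tv(2,3), of "s * t"] assms(2) tv(1) by (auto simp: mult_left_le_one_le)
  show "(s * t, v) \<in> flow_dom M A H" using st tv assms(2) by (simp add: flow_dom_iff)
  show "(t, tscale s v) \<in> flow_dom M A H"
    using tscale_flow(1)[OF tv(2) _ st] tv tscale_TM assms(2) by (simp add: flow_dom_iff)
qed

lemma exp_dom_flow_dom: "{0..1} \<times> exp_dom M A H \<subseteq> flow_dom M A H"
  using exp_dom_times by (auto simp: flow_dom_iff exp_dom_iff)

lemma exp_dom_scale:
  assumes "v \<in> exp_dom M A H" "s \<in> {0..1}" shows "tscale s v \<in> exp_dom M A H"
  using flow_dom_scale(2)[of 1 v s] assms by (auto simp: flow_dom_iff exp_dom_iff)

text \<open>The time derivative of the flow in a chart is the spray field along the curve, a locally Lipschitz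
function of time.\<close>

lemma flow_curves: "N \<subseteq> TM \<Longrightarrow> flow_curves_C11 M A H N"
  unfolding flow_curves_C11_def
proof (intro ballI conjI)
  fix v assume "N \<subseteq> TM" "v \<in> N"
  then have v: "v \<in> TM" by blast
  note ic = T.icurve_Fl[of v]
  have "continuous_map (top_of_set (T.dom v)) TT (\<lambda>t. T.Fl t v)" using ic by (simp add: T.icurve_def)
  then have "continuous_map (top_of_set {t. (t, v) \<in> flow_dom M A H}) TT (\<lambda>t. T.Fl t v)"
    by (rule continuous_map_from_subtopology_mono) (auto simp: flow_dom_iff)
  then show "continuous_map (top_of_set {t. (t, v) \<in> flow_dom M A H}) TT (\<lambda>t. flow M A H t v)"
    by (rule continuous_map_eq) (auto simp: flow_dom_iff flow_eq)
  fix c assume c: "c \<in> A"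
  let ?S = "{t. (t, v) \<in> flow_dom M A H \<and> flow M A H t v \<in> tdm c}"
  have S: "t \<in> T.dom v \<and> T.Fl t v \<in> tdm c" if "t \<in> ?S" for t using that by (auto simp: flow_dom_iff flow_eq)
  obtain d where d: "d \<in> A" "v \<in> tdm d" using chart_at[OF v] .
  show "C11_on ?S (\<lambda>t. tco c (flow M A H t v))"
    unfolding C11_on_def
  proof (intro exI[of _ "\<lambda>t. blinfun_scaleR_left (spray_field c (tco c (T.Fl t v)))"] conjI ballI)
    fix t assume "t \<in> ?S"
    then have t: "t \<in> T.dom v" "T.Fl t v \<in> tdm c" using S by auto
    have "((\<lambda>s. tco c (flow M A H s v)) has_vector_derivative spray_field c (tco c (T.Fl t v))) (at t)"
      by (rule has_vector_derivative_transform_within_open[OF T.icurveD(4)[OF ic t(1) c t(2)] T.icurveD(1)[OF ic] t(1)])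
        (simp add: flow_eq)
    then show "((\<lambda>s. tco c (flow M A H s v)) has_derivative blinfun_apply (blinfun_scaleR_left (spray_field c (tco c (T.Fl t v))))) (at t within ?S)"
      by (auto simp: has_vector_derivative_def intro: has_derivative_at_withinI)
  next
    show "locally_lipschitz_on ?S (\<lambda>t. blinfun_scaleR_left (spray_field c (tco c (T.Fl t v))))"
      unfolding locally_lipschitz_on_def
    proof
      fix t assume "t \<in> ?S"
      then have t: "t \<in> T.dom v" "T.Fl t v \<in> tdm c" using S by auto
      obtain e L where f: "T.flow_box (tchart A d) c t (tco d v) e L"
        and E: "evolution_box (flow_rep M A H (tchart A d) c) (\<lambda>t y. spray_field c (flow_rep M A H (tchart A d) c t y)) t (tco d v) e L"
        using evolution_box_exists[OF tchart_param[OF d(1)] d(2) t(1) c t(2)] by blast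
      have e: "e > 0" by (rule T.flow_boxD(1)[OF f])
      have rep: "flow_rep M A H (tchart A d) c s (tco d v) = tco c (T.Fl s v)" if "s \<in> ball t e" for s
        using flow_rep_eq[OF T.flow_boxD(3)[OF f that, of "tco d v"]] e tco_inv[OF d] by simp
      have "L-lipschitz_on (ball t e) (\<lambda>t. blinfun_scaleR_left (spray_field c (tco c (T.Fl t v))))"
      proof (rule lipschitz_onI)
        fix r s assume rs: "r \<in> ball t e" "s \<in> ball t e"
        let ?G = "\<lambda>t. spray_field c (tco c (T.Fl t v))"
        have "dist (?G r) (?G s) \<le> L * dist r s"
          using lipschitz_onD[OF evolution_box.lip_G[OF E], of "(r, tco d v)" "(s, tco d v)"] rs e rep
          by (simp add: dist_Pair_Pair)
        moreover have "norm (blinfun_scaleR_left (?G r) - blinfun_scaleR_left (?G s)) \<le> norm (?G r - ?G s)"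
          by (rule norm_blinfun_bound) (auto simp: blinfun.diff_left scaleR_right_diff_distrib[symmetric])
        ultimately show "dist (blinfun_scaleR_left (?G r)) (blinfun_scaleR_left (?G s)) \<le> L * dist r s"
          by (simp add: dist_norm)
      qed (rule evolution_box.L_nonneg[OF E])
      then show "\<exists>e>0. \<exists>L. L-lipschitz_on (?S \<inter> ball t e) (\<lambda>t. blinfun_scaleR_left (spray_field c (tco c (T.Fl t v))))"
        using e lipschitz_on_subset[OF _ Int_lower2] by blast
    qed
  qed
qed

lemma flow_continuous:
  "continuous_map (subtopology (prod_topology (top_of_set {0..}) TT) (flow_dom M A H \<inter> UNIV \<times> N)) TT (\<lambda>(t, v). flow M A H t v)"
proof -
  let ?P = "prod_topology (top_of_set {0..}) TT"
  have ts: "topspace (subtopology ?P (flow_dom M A H)) = flow_dom M A H"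
    by (auto simp: flow_dom_iff topspace_TT)
  have "continuous_map (subtopology ?P (flow_dom M A H)) TT (\<lambda>(t, v). flow M A H t v)"
    unfolding continuous_map_def ts
  proof (intro conjI allI impI)
    show "(\<lambda>(t, v). flow M A H t v) \<in> flow_dom M A H \<rightarrow> topspace TT"
      using T.Fl_in_space by (auto simp: flow_dom_iff flow_eq)
    fix V assume V: "openin TT V"
    show "openin (subtopology ?P (flow_dom M A H)) {p \<in> flow_dom M A H. (case p of (t, v) \<Rightarrow> flow M A H t v) \<in> V}"
      unfolding openin_subopen[of _ "{p \<in> flow_dom M A H. (case p of (t, v) \<Rightarrow> flow M A H t v) \<in> V}"]
    proof
      fix p assume pV: "p \<in> {p \<in> flow_dom M A H. (case p of (t, v) \<Rightarrow> flow M A H t v) \<in> V}"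
      obtain t v where p1: "p = (t, v)" by (cases p)
      have p: "p = (t, v)" "(t, v) \<in> flow_dom M A H" "flow M A H t v \<in> V" using pV p1 by auto
      then have tv: "0 \<le> t" "v \<in> TM" "t \<in> T.dom v" "T.Fl t v \<in> V" by (auto simp: flow_dom_iff flow_eq)
      obtain e U where U: "e > 0" "openin TT U" "v \<in> U" "\<And>s w. s \<in> ball t e \<Longrightarrow> w \<in> U \<Longrightarrow> s \<in> T.dom w \<and> T.Fl s w \<in> V"
        using flow_nhd[OF tv(2,3) V tv(4)] by blast
      show "\<exists>T. openin (subtopology ?P (flow_dom M A H)) T \<and> p \<in> T \<and>
          T \<subseteq> {p \<in> flow_dom M A H. (case p of (t, v) \<Rightarrow> flow M A H t v) \<in> V}"
      proof (intro exI conjI)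
        have "openin ?P (({0..} \<inter> ball t e) \<times> U)"
          using U(2) by (simp add: openin_prod_Times_iff openin_open_Int)
        then show "openin (subtopology ?P (flow_dom M A H)) (flow_dom M A H \<inter> (({0..} \<inter> ball t e) \<times> U))"
          by (rule openin_subtopology_Int2)
        show "p \<in> flow_dom M A H \<inter> (({0..} \<inter> ball t e) \<times> U)" using p tv U by auto
        show "flow_dom M A H \<inter> (({0..} \<inter> ball t e) \<times> U) \<subseteq> {p \<in> flow_dom M A H. (case p of (t, v) \<Rightarrow> flow M A H t v) \<in> V}"
          using U(4) by (auto simp: flow_eq)
      qed
    qed
  qed
  then show ?thesis by (rule continuous_map_from_subtopology_mono) auto
qed

lemma flow_rep_locally_lipschitz:
  assumes b: "T.lipschitz_param b" and c: "c \<in> A"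
  shows "locally_lipschitz_on (flow_rep_dom M A H b c) (\<lambda>(t, y). flow_rep M A H b c t y)"
  unfolding locally_lipschitz_on_def
proof
  fix p assume "p \<in> flow_rep_dom M A H b c"
  then obtain t y where p: "p = (t, y)" "y \<in> snd b ` fst b" "(t, chart_inv b y) \<in> flow_dom M A H"
      "flow M A H t (chart_inv b y) \<in> tdm c" by (auto simp: flow_rep_dom_def)
  then have t: "t \<in> T.dom (chart_inv b y)" "T.Fl t (chart_inv b y) \<in> tdm c" by (auto simp: flow_dom_iff flow_eq)
  have v: "chart_inv b y \<in> fst b" "snd b (chart_inv b y) = y" using T.param_chartD(5,6)[OF b p(2)] by auto
  obtain e L where "evolution_box (flow_rep M A H b c) (\<lambda>t y. spray_field c (flow_rep M A H b c t y)) t y e L"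
    using evolution_box_exists[OF b v(1) t(1) c t(2)] v(2) by auto
  then interpret evolution_box "flow_rep M A H b c" "\<lambda>t y. spray_field c (flow_rep M A H b c t y)" t y e L .
  have "ball p e \<subseteq> ball t e \<times> ball y e"
  proof
    fix q assume "q \<in> ball p e"
    then show "q \<in> ball t e \<times> ball y e"
      using dist_fst_le[of p q] dist_snd_le[of p q] p(1) by (auto simp: mem_Times_iff)
  qed
  then have "L-lipschitz_on (flow_rep_dom M A H b c \<inter> ball p e) (\<lambda>p. flow_rep M A H b c (fst p) (snd p))"
    using lipschitz_on_subset[OF lip_g] by blast
  then show "\<exists>e>0. \<exists>L. L-lipschitz_on (flow_rep_dom M A H b c \<inter> ball p e) (\<lambda>(t, y). flow_rep M A H b c t y)"
    using e by (auto simp: split_beta')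
qed

lemma tangent_bundle_submanifold: "lipschitz_submanifold A TM (tchart A ` A)"
proof -
  have "(\<Union>b\<in>tchart A ` A. fst b) = TM"
  proof
    show "(\<Union>b\<in>tchart A ` A. fst b) \<subseteq> TM" by (auto simp: tdm_iff)
    show "TM \<subseteq> (\<Union>b\<in>tchart A ` A. fst b)"
    proof
      fix w assume "w \<in> TM"
      then obtain c where "c \<in> A" "w \<in> tdm c" by (rule chart_at)
      then show "w \<in> (\<Union>b\<in>tchart A ` A. fst b)" by blast
    qed
  qed
  then show ?thesis
    unfolding lipschitz_submanifold_def subtopology_TM using tchart_is_chart ttransition_lipschitz by blast
qed

end

section \<open>Initial vectors with a differentiable flow\<close>

locale spray_submanifold = spray_manifold M A H
  for M :: "'p topology" and A :: "('p, 'a::euclidean_space) chart set" and H +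
  fixes N :: "('p, 'a) tvec set" and B :: "(('p, 'a) tvec, 'b::euclidean_space) chart set"
    and C :: "('p, 'a) chart set"
  assumes submanifold: "lipschitz_submanifold A N B" and C: "C \<subseteq> A" "countable C"
begin

lemma submanifoldD: "N \<subseteq> TM" "b \<in> B \<Longrightarrow> is_chart (subtopology TT N) b" "(\<Union>b\<in>B. fst b) = N"
    "b \<in> B \<Longrightarrow> c \<in> A \<Longrightarrow> locally_lipschitz_on (overlap b (tchart A c)) (transition b (tchart A c))"
    "b \<in> B \<Longrightarrow> c \<in> A \<Longrightarrow> locally_lipschitz_on (overlap (tchart A c) b) (transition (tchart A c) b)"
  using submanifold unfolding lipschitz_submanifold_def by blast+

lemma param: "b \<in> B \<Longrightarrow> T.lipschitz_param b"
  unfolding T.lipschitz_param_def topspace_TT using submanifoldD(1,2,4) by blast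

lemma flow_locally_lipschitz_N: "flow_locally_lipschitz M A H N B"
  unfolding flow_locally_lipschitz_def using flow_continuous flow_rep_locally_lipschitz param by blast

abbreviation rep :: "(('p, 'a) tvec, 'c::euclidean_space) chart \<Rightarrow> ('p, 'a) chart \<Rightarrow> real \<Rightarrow> 'c \<Rightarrow> 'a \<times> 'a" where
  "rep \<equiv> flow_rep M A H"

text \<open>The two conditions on \<open>v\<close> from which everything else follows: differentiability of the flow at every
time, and differentiability of its time derivative at almost every time. The second one depends on
the target chart, because \<open>\<partial>\<^sub>1\<phi>\<close> takes values in the second tangent bundle, and is therefore required only for the
countably many charts in \<open>C\<close>.\<close>

definition good :: "(('p, 'a) tvec, 'c::euclidean_space) chart \<Rightarrow> ('p, 'a) tvec \<Rightarrow> bool" where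
  "good b v \<longleftrightarrow> (\<forall>t\<in>{0..1}. \<forall>c\<in>A. T.Fl t v \<in> tdm c \<longrightarrow> rep b c t differentiable (at (snd b v))) \<and>
     (\<forall>c\<in>C. negligible {t \<in> {0<..<1}. T.Fl t v \<in> tdm c \<and> \<not> partial1 (rep b c) t differentiable (at (snd b v))})"

definition \<Omega>' :: "('p, 'a) tvec set" where
  "\<Omega>' = {v \<in> exp_dom M A H \<inter> N. \<forall>b\<in>B. v \<in> fst b \<longrightarrow> good b v}"

lemma \<Omega>'D: "v \<in> \<Omega>' \<Longrightarrow> v \<in> exp_dom M A H" "v \<in> \<Omega>' \<Longrightarrow> v \<in> N" "v \<in> \<Omega>' \<Longrightarrow> b \<in> B \<Longrightarrow> v \<in> fst b \<Longrightarrow> good b v"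
  by (auto simp: \<Omega>'_def)

lemma \<Omega>'_differentiable: "flow_differentiable_on M A H B \<Omega>'"
  unfolding flow_differentiable_on_def
proof (intro ballI impI)
  fix v t b c assume v: "v \<in> \<Omega>'" and t: "t \<in> {0..1}" and b: "b \<in> B" and c: "c \<in> A"
    and vb: "v \<in> fst b \<and> flow M A H t v \<in> tdm c"
  have "t \<in> T.dom v" by (rule exp_dom_times[OF \<Omega>'D(1)[OF v] t])
  then show "rep b c t differentiable (at (snd b v))"
    using \<Omega>'D(3)[OF v b] vb t c by (auto simp: good_def flow_eq)
qed

lemma \<Omega>'_box:
  assumes v: "v \<in> \<Omega>'" and t: "t \<in> {0..1}" and b: "b \<in> B" and c: "c \<in> A" and vb: "v \<in> fst b \<and> flow M A H t v \<in> tdm c"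
  obtains V e L where "openin TT V" "v \<in> V"
    "evolution_box (rep b c) (\<lambda>t y. spray_field c (rep b c t y)) t (snd b v) e L"
    "\<And>w. w \<in> V \<inter> \<Omega>' \<inter> fst b \<Longrightarrow> snd b w \<in> ball (snd b v) e"
    "\<And>w s. w \<in> V \<inter> \<Omega>' \<inter> fst b \<Longrightarrow> s \<in> {0..1} \<inter> ball t e \<Longrightarrow> rep b c s differentiable (at (snd b w))"
proof -
  have tv: "t \<in> T.dom v" by (rule exp_dom_times[OF \<Omega>'D(1)[OF v] t])
  then have Fc: "T.Fl t v \<in> tdm c" using vb by (simp add: flow_eq)
  obtain e L where f: "T.flow_box b c t (snd b v) e L"
    and E: "evolution_box (rep b c) (\<lambda>t y. spray_field c (rep b c t y)) t (snd b v) e L"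
    using evolution_box_exists[OF param[OF b] _ tv c Fc] vb by blast
  obtain V where V: "openin TT V" "v \<in> V" "\<And>w. w \<in> V \<Longrightarrow> w \<in> N \<Longrightarrow> w \<in> fst b \<and> snd b w \<in> ball (snd b v) e"
    using param_nhd[OF submanifoldD(2)[OF b] conjunct1[OF vb] T.flow_boxD(1)[OF f]] by blast
  have wb: "snd b w \<in> ball (snd b v) e" if "w \<in> V \<inter> \<Omega>' \<inter> fst b" for w
    using V(3)[of w] \<Omega>'D(2)[of w] that by blast
  show ?thesis
  proof (rule that[OF V(1,2) E wb])
    fix w s assume w: "w \<in> V \<inter> \<Omega>' \<inter> fst b" and s: "s \<in> {0..1} \<inter> ball t e"
    have "T.Fl s (chart_inv b (snd b w)) \<in> tdm c" using T.flow_boxD(4)[OF f _ wb[OF w]] s by blast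
    then have "T.Fl s w \<in> tdm c" using T.param_chartD(4)[OF param[OF b]] w by simp
    then show "rep b c s differentiable (at (snd b w))"
      using \<Omega>'D(3)[of w b] b c w s by (auto simp: good_def)
  qed
qed

lemma \<Omega>'_jacobian: "jacobian_locally_lipschitz M A H B \<Omega>'"
  unfolding jacobian_locally_lipschitz_def
proof (intro ballI impI)
  fix v t b c assume a: "v \<in> \<Omega>'" "t \<in> {0..1::real}" "b \<in> B" "c \<in> A" "v \<in> fst b \<and> flow M A H t v \<in> tdm c"
  obtain V e L where V: "openin TT V" "v \<in> V"
    "evolution_box (rep b c) (\<lambda>t y. spray_field c (rep b c t y)) t (snd b v) e L"
    "\<And>w. w \<in> V \<inter> \<Omega>' \<inter> fst b \<Longrightarrow> snd b w \<in> ball (snd b v) e"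
    "\<And>w s. w \<in> V \<inter> \<Omega>' \<inter> fst b \<Longrightarrow> s \<in> {0..1} \<inter> ball t e \<Longrightarrow> rep b c s differentiable (at (snd b w))"
    using \<Omega>'_box[OF a] by metis
  interpret evolution_box "rep b c" "\<lambda>t y. spray_field c (rep b c t y)" t "snd b v" e L by (rule V(3))
  show "\<exists>V e L. openin TT V \<and> v \<in> V \<and> 0 < e \<and>
           (\<forall>w \<in> V \<inter> \<Omega>' \<inter> fst b. L-lipschitz_on ({0..1} \<inter> ball t e) (\<lambda>s. partial2 (rep b c) s (snd b w)))"
  proof (intro exI conjI ballI)
    fix w assume w: "w \<in> V \<inter> \<Omega>' \<inter> fst b"
    show "L-lipschitz_on ({0..1} \<inter> ball t e) (\<lambda>s. partial2 (rep b c) s (snd b w))"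
      by (rule lipschitz_onI[OF _ L_nonneg]) (use jacobian_lipschitz V(4)[OF w] V(5)[OF w] in blast)
  qed (use V e in auto)
qed

lemma \<Omega>'_bounded: "mixed_partials_locally_bounded M A H B \<Omega>'"
  unfolding mixed_partials_locally_bounded_def
proof (intro ballI impI)
  fix v t b c assume a: "v \<in> \<Omega>'" "t \<in> {0..1::real}" "b \<in> B" "c \<in> A" "v \<in> fst b \<and> flow M A H t v \<in> tdm c"
  obtain V e L where V: "openin TT V" "v \<in> V"
    "evolution_box (rep b c) (\<lambda>t y. spray_field c (rep b c t y)) t (snd b v) e L"
    "\<And>w. w \<in> V \<inter> \<Omega>' \<inter> fst b \<Longrightarrow> snd b w \<in> ball (snd b v) e"
    using \<Omega>'_box[OF a] by metis
  interpret evolution_box "rep b c" "\<lambda>t y. spray_field c (rep b c t y)" t "snd b v" e L by (rule V(3))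
  show "\<exists>V e K. openin TT V \<and> v \<in> V \<and> 0 < e \<and>
           (\<forall>w \<in> V \<inter> \<Omega>' \<inter> fst b. \<forall>s \<in> {0..1} \<inter> ball t e.
              (has_partial12 (rep b c) s (snd b w) \<longrightarrow> norm (partial1 (partial2 (rep b c)) s (snd b w)) \<le> K) \<and>
              (has_partial21 (rep b c) s (snd b w) \<longrightarrow> norm (partial2 (partial1 (rep b c)) s (snd b w)) \<le> K))"
    by (rule exI[of _ V], rule exI[of _ e], rule exI[of _ L])
      (use V(1,2) e partial12_bound[OF _ V(4)] partial21_bound[OF _ V(4)] in blast)
qed

text \<open>Locally in time the flow is an evolution box, where the exchange of the differentials holds off a null
set of times. The end points of the unit interval are discarded because neighbourhoods of them contain
times outside of it.\<close>

lemma mixed_negligible: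
  assumes v: "v \<in> \<Omega>'" and b: "b \<in> B" "v \<in> fst b" and c: "c \<in> C"
  shows "negligible {t \<in> {0..1}. T.Fl t v \<in> tdm c \<and> \<not> mixed_at (rep b c) t (snd b v)}"
proof -
  have cA: "c \<in> A" using c C by blast
  have g: "good b v" by (rule \<Omega>'D(3)[OF v b])
  let ?Z = "{t \<in> {0<..<1}. T.Fl t v \<in> tdm c \<and> \<not> mixed_at (rep b c) t (snd b v)}"
  have "negligible ?Z"
    unfolding locally_negligible_alt[of ?Z]
  proof
    fix t assume t: "t \<in> ?Z"
    then have t01: "t \<in> {0..1}" by auto
    have td: "t \<in> T.dom v" by (rule exp_dom_times[OF \<Omega>'D(1)[OF v] t01])
    obtain e L where f: "T.flow_box b c t (snd b v) e L"
      and E: "evolution_box (rep b c) (\<lambda>t y. spray_field c (rep b c t y)) t (snd b v) e L"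
      using evolution_box_exists[OF param[OF b(1)] b(2) td cA] t by blast
    interpret evolution_box "rep b c" "\<lambda>t y. spray_field c (rep b c t y)" t "snd b v" e L by (rule E)
    \<comment> \<open>A closed interval of times around \<open>t\<close> inside both the flow box and the open unit interval.\<close>
    define d where "d = Min {e, t, 1 - t} / 2"
    have d: "d > 0" "d < e" "d < t" "d < 1 - t" using e t by (auto simp: d_def min_def)
    have sub: "{t - d..t + d} \<subseteq> ball t e" "{t - d..t + d} \<subseteq> {0<..<1}" using d by (auto simp: dist_real_def)
    have y: "snd b v \<in> ball (snd b v) e" using e by simp
    have Fs: "T.Fl s v \<in> tdm c" if "s \<in> ball t e" for s
      using T.flow_boxD(4)[OF f that y] T.param_chartD(4)[OF param[OF b(1)] b(2)] by simp
    have dg: "rep b c s differentiable (at (snd b v))" if "s \<in> {t - d..t + d}" for s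
    proof -
      have "s \<in> ball t e" "s \<in> {0<..<1}" using sub that by blast+
      then have "T.Fl s v \<in> tdm c" "s \<in> {0..1}" using Fs by auto
      then show ?thesis using g cA unfolding good_def by blast
    qed
    have "negligible {s \<in> {0<..<1}. T.Fl s v \<in> tdm c \<and> \<not> partial1 (rep b c) s differentiable (at (snd b v))}"
      using g c by (auto simp: good_def)
    then have dG: "negligible {s \<in> {t - d..t + d}. \<not> (\<lambda>y. spray_field c (rep b c s y)) differentiable (at (snd b v))}"
      by (rule negligible_subset) (use sub Fs partial1_differentiable_iff[OF _ y] in blast)
    have "negligible {s \<in> {t - d<..<t + d}. \<not> ((\<lambda>r. partial2 (rep b c) r (snd b v)) has_vector_derivative
        partial2 (\<lambda>s y. spray_field c (rep b c s y)) s (snd b v)) (at s)}"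
      by (rule jacobian_derivative_ae[OF y sub(1) dg dG])
    from negligible_Un[OF this dG]
    have "negligible (?Z \<inter> {t - d<..<t + d})"
    proof (rule negligible_subset)
      show "?Z \<inter> {t - d<..<t + d} \<subseteq> {s \<in> {t - d<..<t + d}. \<not> ((\<lambda>r. partial2 (rep b c) r (snd b v)) has_vector_derivative
        partial2 (\<lambda>s y. spray_field c (rep b c s y)) s (snd b v)) (at s)} \<union>
        {s \<in> {t - d..t + d}. \<not> (\<lambda>y. spray_field c (rep b c s y)) differentiable (at (snd b v))}"
      proof
        fix s assume s: "s \<in> ?Z \<inter> {t - d<..<t + d}"
        have "\<forall>\<^sub>F r in nhds s. r \<in> {t - d<..<t + d}" by (rule eventually_nhds_in_open) (use s in auto)
        then have "\<forall>\<^sub>F r in nhds s. rep b c r differentiable (at (snd b v))"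
          by (rule eventually_mono) (use dg in auto)
        then show "s \<in> {s \<in> {t - d<..<t + d}. \<not> ((\<lambda>r. partial2 (rep b c) r (snd b v)) has_vector_derivative
            partial2 (\<lambda>s y. spray_field c (rep b c s y)) s (snd b v)) (at s)} \<union>
            {s \<in> {t - d..t + d}. \<not> (\<lambda>y. spray_field c (rep b c s y)) differentiable (at (snd b v))}"
        proof -
          have "s \<in> ball t e" using s sub(1) by (meson IntD2 greaterThanLessThan_subseteq_atLeastAtMost_iff order_refl subsetD)
          then show ?thesis using mixed_atI[OF _ y, of s] s \<open>\<forall>\<^sub>F r in nhds s. rep b c r differentiable (at (snd b v))\<close> by auto
        qed
      qed
    qed
    moreover have "openin (top_of_set ?Z) (?Z \<inter> {t - d<..<t + d})" by (simp add: openin_open_Int)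
    ultimately show "\<exists>U. openin (top_of_set ?Z) U \<and> t \<in> U \<and> negligible U"
      using t d by (intro exI[of _ "?Z \<inter> {t - d<..<t + d}"]) auto
  qed
  then have "negligible (?Z \<union> {0, 1})" by (intro negligible_Un) auto
  then show ?thesis by (rule negligible_subset) auto
qed

lemma ae_on_unit_interval:
  assumes "negligible Z" "\<And>t. t \<in> {0..1} \<Longrightarrow> t \<notin> Z \<Longrightarrow> P t"
  shows "AE t in lebesgue_on {0..1::real}. P t"
proof -
  have "AE t in lebesgue. t \<notin> Z" using assms(1) by (intro AE_not_in) (simp add: negligible_iff_null_sets)
  then have "AE t in lebesgue. t \<in> {0..1} \<longrightarrow> P t" by eventually_elim (use assms(2) in auto)
  then show ?thesis by (subst AE_restrict_space_iff) auto
qed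

text \<open>Holds for the tangent bundle with the induced atlas. It replaces countability of the atlas: being good
is then independent of the chart in which the initial vector is expressed.\<close>

definition differentiable_atlas :: bool where
  "differentiable_atlas \<longleftrightarrow> (\<forall>b\<in>B. \<forall>d\<in>B. \<forall>v. v \<in> fst b \<inter> fst d \<longrightarrow> transition b d differentiable (at (snd b v)))"

lemma rep_change_initial:
  assumes o: "open (overlap b d)" and inj: "inj_on (snd b) (fst b)" "inj_on (snd d) (fst d)" and v: "v \<in> fst b" "v \<in> fst d"
  shows "\<forall>\<^sub>F z in nhds (snd b v). \<forall>s. rep b c s z = rep d c s (transition b d z)"
    and "transition b d (snd b v) = snd d v"
proof -
  have "\<forall>\<^sub>F z in nhds (snd b v). z \<in> overlap b d" by (rule eventually_nhds_in_open[OF o]) (use v in \<open>auto simp: overlap_def\<close>)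
  then show "\<forall>\<^sub>F z in nhds (snd b v). \<forall>s. rep b c s z = rep d c s (transition b d z)"
  proof (rule eventually_mono)
    fix z assume "z \<in> overlap b d"
    then obtain w where w: "w \<in> fst b" "w \<in> fst d" "z = snd b w" by (auto simp: overlap_def)
    then show "\<forall>s. rep b c s z = rep d c s (transition b d z)"
      using inj by (simp add: flow_rep_def transition_def)
  qed
  show "transition b d (snd b v) = snd d v" using inj v by (simp add: transition_def)
qed

lemma overlap_open_B: "b \<in> B \<Longrightarrow> d \<in> B \<Longrightarrow> open (overlap b d)"
  using overlap_open submanifoldD(2) by blast

text \<open>The exceptional set of times has to serve all charts \<open>b\<close> at once. Either there are countably many of
them, or a single one decides for all others by the chain rule.\<close>

lemma \<Omega>'_mixed:
  assumes "countable B \<or> differentiable_atlas"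
  shows "mixed_partials_coincide M A H C B \<Omega>'"
  unfolding mixed_partials_coincide_def
proof
  fix v assume v: "v \<in> \<Omega>'"
  let ?Z = "\<lambda>b c. {t \<in> {0..1}. T.Fl t v \<in> tdm c \<and> \<not> mixed_at (rep b c) t (snd b v)}"
  have Fl: "flow M A H t v = T.Fl t v" if "t \<in> {0..1}" for t
    by (rule flow_eq[OF exp_dom_times[OF \<Omega>'D(1)[OF v] that]])
  have "AE t in lebesgue_on {0..1}. \<forall>b\<in>B. \<forall>c\<in>C. v \<in> fst b \<and> flow M A H t v \<in> tdm c \<longrightarrow> mixed_at (rep b c) t (snd b v)"
    using assms
  proof
    assume cB: "countable B"
    show ?thesis
    proof (rule ae_on_unit_interval)
      show "negligible (\<Union>((\<lambda>(b, c). ?Z b c) ` ({b \<in> B. v \<in> fst b} \<times> C)))"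
        by (intro negligible_countable_Union countable_image countable_SIGMA countable_subset[OF _ cB] C(2))
          (use mixed_negligible[OF v] in auto)
    qed (use Fl in auto)
  next
    assume sm: differentiable_atlas
    obtain d where d: "d \<in> B" "v \<in> fst d" using \<Omega>'D(2)[OF v] submanifoldD(3) by blast
    show ?thesis
    proof (rule ae_on_unit_interval)
      show "negligible (\<Union>c\<in>C. ?Z d c)"
        by (intro negligible_countable_Union countable_image C(2)) (use mixed_negligible[OF v d] in auto)
      fix t assume t: "t \<in> {0..1::real}" "t \<notin> (\<Union>c\<in>C. ?Z d c)"
      show "\<forall>b\<in>B. \<forall>c\<in>C. v \<in> fst b \<and> flow M A H t v \<in> tdm c \<longrightarrow> mixed_at (rep b c) t (snd b v)"
      proof (intro ballI impI)
        fix b c assume b: "b \<in> B" and c: "c \<in> C" and vb: "v \<in> fst b \<and> flow M A H t v \<in> tdm c"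
        have m: "mixed_at (rep d c) t (snd d v)" using t c vb Fl[OF t(1)] by auto
        note ch = rep_change_initial[OF overlap_open_B[OF b d(1)] T.param_chartD(1)[OF param[OF b]] T.param_chartD(1)[OF param[OF d(1)]] conjunct1[OF vb] d(2)]
        show "mixed_at (rep b c) t (snd b v)"
        proof (rule mixed_at_compose)
          show "mixed_at (rep d c) t (transition b d (snd b v))" using m ch(2) by simp
          show "transition b d differentiable (at (snd b v))" using sm b d vb unfolding differentiable_atlas_def by blast
          show "\<forall>\<^sub>F z in nhds (snd b v). \<forall>s. rep b c s z = rep d c s (transition b d z)" by (rule ch(1))
        qed
      qed
    qed
  qed
  then show "AE t in lebesgue_on {0..1}. \<forall>b\<in>B. \<forall>c\<in>C. v \<in> fst b \<and> flow M A H t v \<in> tdm c \<longrightarrow>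
      has_partial12 (rep b c) t (snd b v) \<and> has_partial21 (rep b c) t (snd b v) \<and>
      partial1 (partial2 (rep b c)) t (snd b v) = partial2 (partial1 (rep b c)) t (snd b v)"
    by (simp only: mixed_at_def)
qed

end

section \<open>Almost every initial vector is good\<close>

lemma differentiable_transform_eventually:
  assumes "f differentiable (at y)" "\<forall>\<^sub>F z in nhds y. g z = f z"
  shows "g differentiable (at y)"
proof -
  obtain S where "open S" "y \<in> S" "\<And>z. z \<in> S \<Longrightarrow> g z = f z"
    using assms(2) unfolding eventually_nhds by blast
  then show ?thesis using differentiable_transform_open[OF assms(1), of S g] by simp
qed

lemma differentiable_comp_eventually:
  assumes "f differentiable (at (\<tau> y))" "\<tau> differentiable (at y)" "\<forall>\<^sub>F z in nhds y. g z = f (\<tau> z)"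
  shows "g differentiable (at y)"
  using differentiable_transform_eventually[OF _ assms(3)] differentiable_chain_at[OF assms(2,1)] by (simp add: o_def)

context spray_submanifold
begin

lemma differentiable_change_initial:
  assumes o: "open (overlap b d)" and inj: "inj_on (snd b) (fst b)" "inj_on (snd d) (fst d)" and v: "v \<in> fst b" "v \<in> fst d"
    and \<tau>: "transition b d differentiable (at (snd b v))"
  shows "rep d c t differentiable (at (snd d v)) \<Longrightarrow> rep b c t differentiable (at (snd b v))"
    "partial1 (rep d c) t differentiable (at (snd d v)) \<Longrightarrow> partial1 (rep b c) t differentiable (at (snd b v))"
proof -
  note ch = rep_change_initial[OF o inj v]
  show "rep b c t differentiable (at (snd b v))" if "rep d c t differentiable (at (snd d v))"
    by (rule differentiable_comp_eventually[OF _ \<tau>, of "rep d c t"]) (use that ch(1)[of c] ch(2) in \<open>auto elim: eventually_mono\<close>)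
  show "partial1 (rep b c) t differentiable (at (snd b v))" if "partial1 (rep d c) t differentiable (at (snd d v))"
  proof (rule differentiable_comp_eventually[OF _ \<tau>])
    show "partial1 (rep d c) t differentiable (at (transition b d (snd b v)))" using that ch(2) by simp
    show "\<forall>\<^sub>F z in nhds (snd b v). partial1 (rep b c) t z = partial1 (rep d c) t (transition b d z)"
      using ch(1)[of c] by (rule eventually_mono) (simp add: partial1_def)
  qed
qed

lemma good_change_initial:
  assumes "open (overlap b d)" "inj_on (snd b) (fst b)" "inj_on (snd d) (fst d)" "v \<in> fst b" "v \<in> fst d"
    "transition b d differentiable (at (snd b v))" and g: "good d v"
  shows "good b v"
  unfolding good_def
proof (intro conjI ballI impI)
  note ch = differentiable_change_initial[OF assms(1-6)]
  show "rep b c t differentiable (at (snd b v))" if "t \<in> {0..1}" "c \<in> A" "T.Fl t v \<in> tdm c" for t c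
    using g that ch(1) unfolding good_def by blast
  fix c assume "c \<in> C"
  then have "negligible {t \<in> {0<..<1}. T.Fl t v \<in> tdm c \<and> \<not> partial1 (rep d c) t differentiable (at (snd d v))}"
    using g unfolding good_def by blast
  then show "negligible {t \<in> {0<..<1}. T.Fl t v \<in> tdm c \<and> \<not> partial1 (rep b c) t differentiable (at (snd b v))}"
    by (rule negligible_subset) (use ch(2) in blast)
qed

text \<open>Transition maps of the tangent bundle are differentiable, so a time that is exceptional for one target
chart is exceptional for all of them.\<close>

lemma differentiable_change_target:
  assumes f: "T.flow_box b c t0 y0 e L" and t: "t \<in> ball t0 e" and y: "y \<in> ball y0 e"
    and c: "c \<in> A" and d: "d \<in> A" "T.Fl t (chart_inv b y) \<in> tdm d"
    and D: "rep b c t differentiable (at y)"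
  shows "rep b d t differentiable (at y)"
proof -
  let ?T = "transition (tchart A c) (tchart A d)"
  have Fc: "T.Fl t (chart_inv b z) \<in> tdm c" "rep b c t z = tco c (T.Fl t (chart_inv b z))"
      "rep b d t z = tco d (T.Fl t (chart_inv b z))" if "z \<in> ball y0 e" for z
    using T.flow_boxD(4)[OF f t that] flow_rep_eq[OF T.flow_boxD(3)[OF f t that]] by auto
  have "tco c (T.Fl t (chart_inv b y)) \<in> overlap (tchart A c) (tchart A d)"
    using Fc(1)[OF y] d(2) by (auto simp: overlap_def)
  then have "?T differentiable (at (rep b c t y))"
    using T.field_transforms[OF c d(1)] Fc(2)[OF y] unfolding differentiable_def by metis
  from differentiable_chain_at[OF D this] have "(\<lambda>z. ?T (rep b c t z)) differentiable (at y)" by (simp add: o_def)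
  then show ?thesis
    by (rule differentiable_transform_open[OF _ open_ball y])
      (use Fc tco_inv[OF c] in \<open>simp add: transition_def\<close>)
qed

text \<open>Pairs of a time and the coordinates of an initial vector. Quantifying over all target charts is
harmless by \<open>differentiable_change_target\<close>, whereas \<open>bad_times_partial1\<close> has to be kept separate for each
target chart.\<close>

definition bad_times :: "(('p, 'a) tvec, 'b) chart \<Rightarrow> (real \<times> 'b) set" where
  "bad_times b = {(t, y). t \<in> {0<..<1} \<and> y \<in> snd b ` fst b \<and> t \<in> T.dom (chart_inv b y) \<and>
     (\<exists>c\<in>A. T.Fl t (chart_inv b y) \<in> tdm c \<and> \<not> rep b c t differentiable (at y))}"

definition bad_times_partial1 :: "(('p, 'a) tvec, 'b) chart \<Rightarrow> ('p, 'a) chart \<Rightarrow> (real \<times> 'b) set" where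
  "bad_times_partial1 b c = {(t, y). t \<in> {0<..<1} \<and> y \<in> snd b ` fst b \<and> t \<in> T.dom (chart_inv b y) \<and>
     T.Fl t (chart_inv b y) \<in> tdm c \<and> \<not> partial1 (rep b c) t differentiable (at y)}"

lemma negligible_if_on_boxes:
  assumes "\<And>t y. (t, y) \<in> Z \<Longrightarrow> \<exists>e>0. negligible (Z \<inter> ball t e \<times> ball y e)"
  shows "negligible (Z :: (real \<times> 'b) set)"
  unfolding locally_negligible_alt[of Z]
proof
  fix p assume p: "p \<in> Z"
  then obtain e where e: "e > 0" "negligible (Z \<inter> ball (fst p) e \<times> ball (snd p) e)"
    using assms[of "fst p" "snd p"] by auto
  have "openin (top_of_set Z) (Z \<inter> ball (fst p) e \<times> ball (snd p) e)"
    by (intro openin_open_Int open_Times open_ball)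
  then show "\<exists>U. openin (top_of_set Z) U \<and> p \<in> U \<and> negligible U"
    using p e by (intro exI[of _ "Z \<inter> ball (fst p) e \<times> ball (snd p) e"]) (auto simp: mem_Times_iff)
qed

text \<open>On each flow box this is Rademacher's theorem for the flow and the field along it, jointly in time and
initial value.\<close>

lemma negligible_bad_times:
  assumes b: "b \<in> B"
  shows "negligible (bad_times b)" "c \<in> A \<Longrightarrow> negligible (bad_times_partial1 b c)"
proof -
  note pb = param[OF b]
  have box: "\<exists>e L. T.flow_box b c t y e L \<and> evolution_box (rep b c) (\<lambda>t y. spray_field c (rep b c t y)) t y e L"
    if "y \<in> snd b ` fst b" "t \<in> T.dom (chart_inv b y)" "c \<in> A" "T.Fl t (chart_inv b y) \<in> tdm c" for t y c
    using evolution_box_exists[OF pb T.param_chartD(5)[OF pb that(1)] that(2-4)] T.param_chartD(6)[OF pb that(1)] by simp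
  show "negligible (bad_times b)"
  proof (rule negligible_if_on_boxes)
    fix t y assume "(t, y) \<in> bad_times b"
    then obtain c where c: "c \<in> A" "T.Fl t (chart_inv b y) \<in> tdm c" and ty: "y \<in> snd b ` fst b" "t \<in> T.dom (chart_inv b y)"
      unfolding bad_times_def by blast
    obtain e L where f: "T.flow_box b c t y e L" and E: "evolution_box (rep b c) (\<lambda>t y. spray_field c (rep b c t y)) t y e L"
      using box[OF ty c] by blast
    have "negligible (bad_times b \<inter> ball t e \<times> ball y e)"
    proof (rule negligible_subset[OF evolution_box.negligible_nondifferentiable[OF E]], rule subsetI)
      fix p assume p: "p \<in> bad_times b \<inter> ball t e \<times> ball y e"
      then obtain d where d: "d \<in> A" "T.Fl (fst p) (chart_inv b (snd p)) \<in> tdm d" "\<not> rep b d (fst p) differentiable (at (snd p))"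
        unfolding bad_times_def by auto
      have pb: "fst p \<in> ball t e" "snd p \<in> ball y e" using p by auto
      have "\<not> rep b c (fst p) differentiable (at (snd p))"
        using differentiable_change_target[OF f pb c(1) d(1,2)] d(3) by blast
      then show "p \<in> {p \<in> ball t e \<times> ball y e. \<not> (rep b c (fst p) differentiable (at (snd p)) \<and>
          (\<lambda>y. spray_field c (rep b c (fst p) y)) differentiable (at (snd p)))}" using p by blast
    qed
    then show "\<exists>e>0. negligible (bad_times b \<inter> ball t e \<times> ball y e)" using T.flow_boxD(1)[OF f] by blast
  qed
  show "negligible (bad_times_partial1 b c)" if c: "c \<in> A"
  proof (rule negligible_if_on_boxes)
    fix t y assume "(t, y) \<in> bad_times_partial1 b c"
    then have ty: "y \<in> snd b ` fst b" "t \<in> T.dom (chart_inv b y)" "T.Fl t (chart_inv b y) \<in> tdm c"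
      unfolding bad_times_partial1_def by auto
    obtain e L where f: "T.flow_box b c t y e L" and E: "evolution_box (rep b c) (\<lambda>t y. spray_field c (rep b c t y)) t y e L"
      using box[OF ty(1,2) c ty(3)] by blast
    have "negligible (bad_times_partial1 b c \<inter> ball t e \<times> ball y e)"
    proof (rule negligible_subset[OF evolution_box.negligible_nondifferentiable[OF E]], rule subsetI)
      fix p assume p: "p \<in> bad_times_partial1 b c \<inter> ball t e \<times> ball y e"
      then have "\<not> partial1 (rep b c) (fst p) differentiable (at (snd p))" unfolding bad_times_partial1_def by auto
      moreover have "fst p \<in> ball t e" "snd p \<in> ball y e" using p by auto
      ultimately have "\<not> (\<lambda>y. spray_field c (rep b c (fst p) y)) differentiable (at (snd p))"
        using evolution_box.partial1_differentiable_iff[OF E] by blast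
      then show "p \<in> {p \<in> ball t e \<times> ball y e. \<not> (rep b c (fst p) differentiable (at (snd p)) \<and>
          (\<lambda>y. spray_field c (rep b c (fst p) y)) differentiable (at (snd p)))}" using p by blast
    qed
    then show "\<exists>e>0. negligible (bad_times_partial1 b c \<inter> ball t e \<times> ball y e)" using T.flow_boxD(1)[OF f] by blast
  qed
qed

text \<open>Differentiability at almost all times is differentiability at a dense set of times, and the latter
propagates to all times.\<close>

lemma good_if_slices:
  assumes b: "b \<in> B" and v: "v \<in> fst b" "v \<in> exp_dom M A H"
    and s: "negligible {t. (t, snd b v) \<in> bad_times b}" "\<And>c. c \<in> C \<Longrightarrow> negligible {t. (t, snd b v) \<in> bad_times_partial1 b c}"
  shows "good b v"
  unfolding good_def
proof (intro conjI ballI impI)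
  note pb = param[OF b]
  have iv: "chart_inv b (snd b v) = v" by (rule T.param_chartD(4)[OF pb v(1)])
  show "negligible {t \<in> {0<..<1}. T.Fl t v \<in> tdm c \<and> \<not> partial1 (rep b c) t differentiable (at (snd b v))}" if "c \<in> C" for c
    by (rule negligible_subset[OF s(2)[OF that]]) (use exp_dom_times[OF v(2)] v(1) iv in \<open>auto simp: bad_times_partial1_def\<close>)
  fix t c assume t: "t \<in> {0..1::real}" and c: "c \<in> A" and F: "T.Fl t v \<in> tdm c"
  obtain e L where f: "T.flow_box b c t (snd b v) e L"
    and E: "evolution_box (rep b c) (\<lambda>t y. spray_field c (rep b c t y)) t (snd b v) e L"
    using evolution_box_exists[OF pb v(1) exp_dom_times[OF v(2) t] c F] by blast
  have e: "e > 0" by (rule T.flow_boxD(1)[OF f])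
  show "rep b c t differentiable (at (snd b v))"
  proof (rule evolution_box.differentiable_if_dense[OF E])
    show "t \<in> ball t e" "snd b v \<in> ball (snd b v) e" using e by auto
    fix d :: real assume d: "d > 0"
    let ?O = "ball t (min d e) \<inter> {0<..<1}"
    have "?O \<noteq> {}"
    proof -
      define \<delta> where "\<delta> = min (min d e) 1 / 2"
      have \<delta>: "0 < \<delta>" "\<delta> < d" "\<delta> < e" "\<delta> \<le> 1 / 2" using d e by (auto simp: \<delta>_def min_def)
      show ?thesis
      proof (cases "t \<le> 1 / 2")
        case True
        then have "t + \<delta> / 2 \<in> ?O" using \<delta> t by (auto simp: dist_real_def)
        then show ?thesis by blast
      next
        case False
        then have "t - \<delta> / 2 \<in> ?O" using \<delta> t by (auto simp: dist_real_def)
        then show ?thesis by blast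
      qed
    qed
    moreover have "open ?O" by auto
    ultimately have "\<not> negligible ?O" by (simp add: open_not_negligible)
    then obtain r where r: "r \<in> ?O" "(r, snd b v) \<notin> bad_times b"
      using negligible_subset[OF s(1), of ?O] by blast
    have rb: "r \<in> ball t e" "\<bar>r - t\<bar> < d" "r \<in> {0<..<1}" using r(1) by (auto simp: dist_real_def abs_minus_commute)
    have "T.Fl r v \<in> tdm c" using T.flow_boxD(4)[OF f rb(1), of "snd b v"] e iv by simp
    moreover have "r \<in> T.dom v" by (rule exp_dom_times[OF v(2)]) (use rb in auto)
    ultimately have "rep b c r differentiable (at (snd b v))"
      using r(2) rb(3) v(1) c iv unfolding bad_times_def by auto
    then show "\<exists>s\<in>ball t e. \<bar>s - t\<bar> < d \<and> rep b c s differentiable (at (snd b v))" using rb by blast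
  qed
qed

lemma negligible_not_good:
  assumes b: "b \<in> B"
  shows "negligible (snd b ` {v \<in> fst b. v \<in> exp_dom M A H \<and> \<not> good b v})"
proof -
  have "negligible ({y. \<not> negligible {t. (t, y) \<in> bad_times b}} \<union> \<Union>((\<lambda>c. {y. \<not> negligible {t. (t, y) \<in> bad_times_partial1 b c}}) ` C))"
    using C negligible_bad_times[OF b]
    by (intro negligible_Un negligible_countable_Union countable_image) (auto intro!: negligible_prod_slices)
  then show ?thesis
    by (rule negligible_subset) (use good_if_slices[OF b] in blast)
qed

text \<open>Locally, the transition between two charts of the submanifold factors through a chart of the tangent
bundle, hence is Lipschitz and preserves null sets.\<close>

lemma negligible_change_chart:
  assumes b: "b \<in> B" and d: "d \<in> B" and S: "S \<subseteq> fst d" and n: "negligible (snd d ` S)"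
  shows "negligible (snd b ` (S \<inter> fst b))"
proof -
  let ?T = "transition d b"
  let ?S = "snd d ` (S \<inter> fst b)"
  have Td: "?T (snd d w) = snd b w" if "w \<in> fst d" for w
    using T.param_chartD(4)[OF param[OF d] that] by (simp add: transition_def)
  have "negligible (?T ` ?S)"
  proof (rule negligible_locally_Lipschitz_image)
    show "negligible ?S" by (rule negligible_subset[OF n]) auto
    fix y assume "y \<in> ?S"
    then obtain w where w: "w \<in> fst d" "w \<in> fst b" "y = snd d w" using S by blast
    have "w \<in> TM" using submanifoldD(1,3) b w(2) by blast
    then obtain c where c: "c \<in> A" "w \<in> tdm c" using chart_at by blast
    have y: "y \<in> overlap d (tchart A c)" using w c by (auto simp: overlap_def)
    obtain r1 L1 where r1: "r1 > 0" "ball y r1 \<subseteq> overlap d (tchart A c)" "L1-lipschitz_on (ball y r1) (transition d (tchart A c))"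
      using locally_lipschitz_on_openE[OF submanifoldD(4)[OF d c(1)] T.overlap_open_param[OF param[OF d] c(1)] y] .
    have z: "transition d (tchart A c) y = tco c w" using T.param_chartD(4)[OF param[OF d] w(1)] w(3) by (simp add: transition_def)
    have "tco c w \<in> overlap (tchart A c) b" using w c by (auto simp: overlap_def)
    then obtain r2 L2 where r2: "r2 > 0" "L2-lipschitz_on (overlap (tchart A c) b \<inter> ball (tco c w) r2) (transition (tchart A c) b)"
      using locally_lipschitz_onE[OF submanifoldD(5)[OF b c(1)]] by blast
    have "continuous_on (ball y r1) (transition d (tchart A c))" by (rule lipschitz_on_continuous_on[OF r1(3)])
    then have "open (transition d (tchart A c) -` ball (tco c w) r2 \<inter> ball y r1)"
      using continuous_on_open_vimage[OF open_ball] open_ball by blast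
    let ?O = "transition d (tchart A c) -` ball (tco c w) r2 \<inter> ball y r1"
    show "\<exists>T K. open T \<and> y \<in> T \<and> (\<forall>x\<in>?S \<inter> T. norm (?T x - ?T y) \<le> K * norm (x - y))"
    proof (intro exI conjI ballI)
      show "open ?O" by fact
      show "y \<in> ?O" using r1 r2 z by simp
      fix x assume x: "x \<in> ?S \<inter> ?O"
      then obtain u where u: "u \<in> fst d" "u \<in> fst b" "x = snd d u" using S by blast
      have xo: "x \<in> overlap d (tchart A c)" using x r1 by blast
      obtain q where "snd d u = snd d q" "q \<in> fst d \<inter> tdm c"
        using xo[unfolded u(3) overlap_def] by (elim imageE)
      then have "q \<in> fst d" "q \<in> tdm c" "snd d u = snd d q" by auto
      then have uc: "u \<in> tdm c" using u(1) T.param_chartD(1)[OF param[OF d]] by (metis inj_on_eq_iff)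
      have zx: "transition d (tchart A c) x = tco c u" using T.param_chartD(4)[OF param[OF d] u(1)] u(3) by (simp add: transition_def)
      have fac: "transition (tchart A c) b (tco c q) = snd b q" if "q \<in> tdm c" for q
        using tco_inv[OF c(1) that] by (simp add: transition_def)
      have in': "tco c u \<in> overlap (tchart A c) b \<inter> ball (tco c w) r2" "tco c w \<in> overlap (tchart A c) b \<inter> ball (tco c w) r2"
        using x u uc w c r2 zx by (auto simp: overlap_def)
      have "dist (snd b u) (snd b w) \<le> L2 * dist (tco c u) (tco c w)"
        using lipschitz_onD[OF r2(2) in'] fac uc c by simp
      also have "dist (tco c u) (tco c w) \<le> L1 * dist x y"
        using lipschitz_onD[OF r1(3), of x y] x r1 zx z by simp
      finally have "dist (snd b u) (snd b w) \<le> L2 * (L1 * dist x y)"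
        using lipschitz_on_nonneg[OF r2(2)] by (simp add: mult_left_mono)
      then show "norm (?T x - ?T y) \<le> (L2 * L1) * norm (x - y)"
        using Td u w by (simp add: dist_norm mult.assoc)
    qed
  qed simp
  moreover have "?T ` ?S = snd b ` (S \<inter> fst b)"
    unfolding image_image by (intro image_cong refl) (use Td S in auto)
  ultimately show ?thesis by simp
qed

lemma \<Omega>'_conull:
  assumes "countable B \<or> differentiable_atlas"
  shows "chart_null B (exp_dom M A H \<inter> N - \<Omega>')"
  unfolding chart_null_def negligible_iff_null_sets[symmetric]
proof
  fix b assume b: "b \<in> B"
  let ?bad = "\<lambda>d. {v \<in> fst d. v \<in> exp_dom M A H \<and> \<not> good d v}"
  show "negligible (snd b ` ((exp_dom M A H \<inter> N - \<Omega>') \<inter> fst b))"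
    using assms
  proof
    assume cB: "countable B"
    have "negligible (\<Union>d\<in>B. snd b ` (?bad d \<inter> fst b))"
      using negligible_change_chart[OF b _ _ negligible_not_good]
      by (intro negligible_countable_Union countable_image cB) auto
    then show ?thesis by (rule negligible_subset) (auto simp: \<Omega>'_def)
  next
    assume sm: differentiable_atlas
    have "good d v" if g: "good b v" and v: "v \<in> fst b" and d: "d \<in> B" "v \<in> fst d" for v d
      by (rule good_change_initial[OF overlap_open_B[OF d(1) b] T.param_chartD(1)[OF param[OF d(1)]] T.param_chartD(1)[OF param[OF b]] d(2) v _ g])
        (use sm b d v in \<open>unfold differentiable_atlas_def, blast\<close>)
    then have "(exp_dom M A H \<inter> N - \<Omega>') \<inter> fst b \<subseteq> ?bad b"
      by (auto simp: \<Omega>'_def)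
    then show ?thesis by (intro negligible_subset[OF negligible_not_good[OF b]] image_mono)
  qed
qed

end

section \<open>The flow near zero vectors\<close>

lemma has_derivative_quadratic:
  fixes f :: "'a::real_normed_vector \<Rightarrow> 'b::real_normed_vector"
  assumes D: "bounded_linear D" and r: "r > 0"
    and q: "\<And>z. z \<in> ball a r \<Longrightarrow> norm (f z - f a - D (z - a)) \<le> K * (norm (z - a))\<^sup>2"
  shows "(f has_derivative D) (at a)"
  unfolding has_derivative_at_alt
proof (intro conjI D allI impI)
  fix e :: real assume "e > 0"
  define d where "d = min r (e / (\<bar>K\<bar> + 1))"
  have d: "d > 0" using r \<open>e > 0\<close> by (simp add: d_def)
  show "\<exists>d>0. \<forall>y. norm (y - a) < d \<longrightarrow> norm (f y - f a - D (y - a)) \<le> e * norm (y - a)"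
  proof (intro exI[of _ d] conjI d allI impI)
    fix y assume y: "norm (y - a) < d"
    then have yb: "y \<in> ball a r" by (simp add: d_def dist_norm norm_minus_commute)
    have "K * (norm (y - a))\<^sup>2 \<le> (\<bar>K\<bar> + 1) * (norm (y - a))\<^sup>2" by (rule mult_right_mono) auto
    also have "\<dots> = ((\<bar>K\<bar> + 1) * norm (y - a)) * norm (y - a)" by (simp add: power2_eq_square)
    also have "\<dots> \<le> e * norm (y - a)"
    proof (rule mult_right_mono)
      have "norm (y - a) \<le> e / (\<bar>K\<bar> + 1)" using y by (simp add: d_def)
      then show "(\<bar>K\<bar> + 1) * norm (y - a) \<le> e" by (simp add: field_simps)
    qed simp
    finally show "norm (f y - f a - D (y - a)) \<le> e * norm (y - a)" using q[OF yb] by linarith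
  qed
qed

text \<open>The lower bound forces the derivative of \<open>f\<close> at \<open>\<eta> y1\<close> to be injective. A linear left inverse of it,
applied to the first-order expansion of \<open>f \<circ> \<eta>\<close>, gives the one of \<open>\<eta>\<close>; the upper bound turns the remainder of
\<open>f\<close> into one in terms of \<open>y - y1\<close>.\<close>

lemma differentiable_if_composite:
  fixes f :: "'b::euclidean_space \<Rightarrow> 'c::euclidean_space" and \<eta> :: "'a::real_normed_vector \<Rightarrow> 'b"
  assumes f: "f differentiable (at (\<eta> y1))"
    and low: "\<forall>\<^sub>F z in nhds (\<eta> y1). norm (z - \<eta> y1) \<le> c * norm (f z - f (\<eta> y1))"
    and up: "\<forall>\<^sub>F y in nhds y1. norm (\<eta> y - \<eta> y1) \<le> k * norm (y - y1)"
    and comp: "(\<lambda>y. f (\<eta> y)) differentiable (at y1)"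
  shows "\<eta> differentiable (at y1)"
proof -
  let ?a = "\<eta> y1"
  obtain D where D: "(f has_derivative D) (at ?a)" using f unfolding differentiable_def by blast
  obtain E where E: "((\<lambda>y. f (\<eta> y)) has_derivative E) (at y1)" using comp unfolding differentiable_def by blast
  have linD: "linear D" by (rule has_derivative_linear[OF D])
  have "inj D"
    unfolding linear_injective_0[OF linD]
  proof (intro allI impI, rule ccontr)
    fix h assume h: "D h = 0" "h \<noteq> 0"
    have c0: "\<bar>c\<bar> + 1 > 0" by simp
    have "1 / (2 * (\<bar>c\<bar> + 1)) > 0" using c0 by (simp add: field_simps)
    then obtain d where d: "d > 0" "\<And>z. norm (z - ?a) < d \<Longrightarrow> norm (f z - f ?a - D (z - ?a)) \<le> 1 / (2 * (\<bar>c\<bar> + 1)) * norm (z - ?a)"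
      using D unfolding has_derivative_at_alt by blast
    obtain r where r: "r > 0" "\<And>z. dist z ?a < r \<Longrightarrow> norm (z - ?a) \<le> c * norm (f z - f ?a)"
      using low unfolding eventually_nhds_metric by blast
    define \<tau> where "\<tau> = min d r / (2 * norm h)"
    have \<tau>: "\<tau> > 0" "\<tau> * norm h < d" "\<tau> * norm h < r" using h d r by (auto simp: \<tau>_def)
    let ?z = "?a + \<tau> *\<^sub>R h"
    have n: "norm (?z - ?a) = \<tau> * norm h" using \<tau> by simp
    have "D (?z - ?a) = 0" using linear_scale[OF linD] h by simp
    then have 1: "norm (f ?z - f ?a) \<le> 1 / (2 * (\<bar>c\<bar> + 1)) * (\<tau> * norm h)" using d(2)[of ?z] n \<tau> by simp
    have "\<tau> * norm h \<le> c * norm (f ?z - f ?a)" using r(2)[of ?z] n \<tau> by (simp add: dist_norm)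
    also have "\<dots> \<le> (\<bar>c\<bar> + 1) * norm (f ?z - f ?a)" by (rule mult_right_mono) auto
    also have "\<dots> \<le> (\<bar>c\<bar> + 1) * (1 / (2 * (\<bar>c\<bar> + 1)) * (\<tau> * norm h))" using 1 by (rule mult_left_mono) simp
    also have "\<dots> = (\<tau> * norm h) / 2" using c0 by (simp add: field_simps)
    finally show False using \<tau>(1) h(2) by (simp add: mult_le_0_iff)
  qed
  then obtain P where P: "linear P" "P \<circ> D = id" using linear_injective_left_inverse[OF linD] by blast
  have PD: "P (D x) = x" for x using P(2) by (metis comp_apply id_apply)
  have blP: "bounded_linear P" using P(1) by (simp add: linear_linear)
  obtain p where p: "p > 0" "\<And>x. norm (P x) \<le> p * norm x"
    using bounded_linear.pos_bounded[OF blP] by (auto simp: mult.commute)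
  have blE: "bounded_linear E" by (rule has_derivative_bounded_linear[OF E])
  have "(\<eta> has_derivative (\<lambda>h. P (E h))) (at y1)"
    unfolding has_derivative_at_alt
  proof (intro conjI allI impI)
    show "bounded_linear (\<lambda>h. P (E h))" using bounded_linear_compose[OF blP blE] .
    fix e :: real assume "e > 0"
    obtain r where r: "r > 0" "\<And>y. dist y y1 < r \<Longrightarrow> norm (\<eta> y - ?a) \<le> k * norm (y - y1)"
      using up unfolding eventually_nhds_metric by blast
    define e1 where "e1 = e / (2 * p)"
    define e2 where "e2 = e1 / (\<bar>k\<bar> + 1)"
    have e: "e1 > 0" "e2 > 0" using \<open>e > 0\<close> p by (auto simp: e1_def e2_def)
    obtain d1 where d1: "d1 > 0" "\<And>y. norm (y - y1) < d1 \<Longrightarrow> norm (f (\<eta> y) - f ?a - E (y - y1)) \<le> e1 * norm (y - y1)"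
      using E e(1) unfolding has_derivative_at_alt by blast
    obtain d2 where d2: "d2 > 0" "\<And>z. norm (z - ?a) < d2 \<Longrightarrow> norm (f z - f ?a - D (z - ?a)) \<le> e2 * norm (z - ?a)"
      using D e(2) unfolding has_derivative_at_alt by blast
    define d where "d = min (min r d1) (d2 / (\<bar>k\<bar> + 1))"
    have d: "d > 0" using r d1 d2 by (simp add: d_def)
    show "\<exists>d>0. \<forall>y. norm (y - y1) < d \<longrightarrow> norm (\<eta> y - ?a - P (E (y - y1))) \<le> e * norm (y - y1)"
    proof (intro exI[of _ d] conjI d allI impI)
      fix y assume y: "norm (y - y1) < d"
      have yk: "norm (\<eta> y - ?a) \<le> (\<bar>k\<bar> + 1) * norm (y - y1)"
      proof -
        have "norm (\<eta> y - ?a) \<le> k * norm (y - y1)" using r(2)[of y] y by (simp add: d_def dist_norm)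
        also have "\<dots> \<le> (\<bar>k\<bar> + 1) * norm (y - y1)" by (rule mult_right_mono) auto
        finally show ?thesis .
      qed
      have "norm (y - y1) < d2 / (\<bar>k\<bar> + 1)" using y by (simp add: d_def)
      then have "(\<bar>k\<bar> + 1) * norm (y - y1) < d2" by (simp add: field_simps)
      then have "norm (f (\<eta> y) - f ?a - D (\<eta> y - ?a)) \<le> e2 * norm (\<eta> y - ?a)" using d2(2) yk by simp
      also have "\<dots> \<le> e2 * ((\<bar>k\<bar> + 1) * norm (y - y1))" using yk e(2) by (intro mult_left_mono) auto
      also have "\<dots> = e1 * norm (y - y1)" using abs_ge_zero[of k] by (auto simp: e2_def)
      finally have a: "norm (f (\<eta> y) - f ?a - D (\<eta> y - ?a)) \<le> e1 * norm (y - y1)" .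
      have b: "norm (f (\<eta> y) - f ?a - E (y - y1)) \<le> e1 * norm (y - y1)" using d1(2) y by (simp add: d_def)
      have "\<eta> y - ?a - P (E (y - y1)) = P (D (\<eta> y - ?a) - E (y - y1))"
        using linear_diff[OF P(1)] PD by simp
      also have "norm \<dots> \<le> p * norm (D (\<eta> y - ?a) - E (y - y1))" by (rule p(2))
      also have "\<dots> \<le> p * (e1 * norm (y - y1) + e1 * norm (y - y1))"
      proof (rule mult_left_mono)
        have "D (\<eta> y - ?a) - E (y - y1) = (f (\<eta> y) - f ?a - E (y - y1)) - (f (\<eta> y) - f ?a - D (\<eta> y - ?a))" by simp
        then show "norm (D (\<eta> y - ?a) - E (y - y1)) \<le> e1 * norm (y - y1) + e1 * norm (y - y1)"
          using norm_triangle_ineq4[of "f (\<eta> y) - f ?a - E (y - y1)" "f (\<eta> y) - f ?a - D (\<eta> y - ?a)"] a b by simp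
      qed (use p in simp)
      also have "\<dots> = e * norm (y - y1)" using p(1) by (simp add: e1_def field_simps)
      finally show "norm (\<eta> y - ?a - P (E (y - y1))) \<le> e * norm (y - y1)" .
    qed
  qed
  then show ?thesis unfolding differentiable_def by blast
qed

lemma norm_snd_component: "norm (snd p) \<le> norm p" for p :: "'a::real_normed_vector \<times> 'b::real_normed_vector"
  using norm_snd_le[of "snd p" "fst p"] by simp

context spray_manifold
begin

text \<open>A short vector \<open>(x, v)\<close> is \<open>s\<close> times a vector \<open>(x, u)\<close> of fixed length with \<open>s\<close> proportional to \<open>|v|\<close>, and by
scaling its flow up to time \<open>1\<close> is the flow of \<open>(x, u)\<close> up to the short time \<open>s\<close>. During that time the
velocity of \<open>(x, u)\<close> changes by \<open>O(s)\<close>, hence that of \<open>(x, v)\<close> by \<open>O(s^2) = O(|v|^2)\<close>. In particular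
the flow of short vectors exists up to time \<open>1\<close> and stays in the chart.\<close>

lemma zero_vector_expansion:
  assumes w: "w \<in> TM" "snd w = (\<lambda>_. 0)" and c: "c \<in> A" "w \<in> tdm c"
  shows "\<exists>r>0. \<exists>K. \<forall>z\<in>ball (tco c w) r. \<forall>t\<in>{0..1}.
    t \<in> T.dom (chart_inv (tchart A c) z) \<and> T.Fl t (chart_inv (tchart A c) z) \<in> tdm c \<and>
    norm (tco c (T.Fl t (chart_inv (tchart A c) z)) - (fst z + t *\<^sub>R snd z, snd z)) \<le> K * (norm (snd z))\<^sup>2 \<and>
    norm (spray_field c (tco c (T.Fl t (chart_inv (tchart A c) z))) - (snd z, 0)) \<le> K * (norm (snd z))\<^sup>2"
proof -
  let ?inv = "chart_inv (tchart A c)"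
  let ?z0 = "tco c w"
  note pc = tchart_param[OF c(1)]
  have w0: "0 \<in> T.dom w" "T.Fl 0 w = w" using T.zero_in_dom T.Fl_0 w(1) by (auto simp: topspace_TT)
  obtain e L where f: "T.flow_box (tchart A c) c 0 ?z0 e L"
    and E: "evolution_box (flow_rep M A H (tchart A c) c) (\<lambda>t y. spray_field c (flow_rep M A H (tchart A c) c t y)) 0 ?z0 e L"
    using evolution_box_exists[OF pc c(2) w0(1) c(1)] w0(2) c(2) by auto
  let ?g = "flow_rep M A H (tchart A c) c"
  interpret evolution_box ?g "\<lambda>t y. spray_field c (?g t y)" 0 ?z0 e L by (rule E)
  have snd0: "snd ?z0 = 0" using w(2) by (simp add: tco_apply)
  have x0: "fst ?z0 \<in> snd c ` fst c" using c(2) by (auto simp: tdm_iff tco_apply)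
  have img: "z \<in> tco c ` tdm c" if "z \<in> ball ?z0 e" for z
    using T.flow_boxD(2)[OF f] that by blast
  have inv: "?inv z \<in> tdm c" "tco c (?inv z) = z" if "z \<in> tco c ` tdm c" for z
    using T.param_chartD(5,6)[OF pc that] by auto
  have g: "?g t z = tco c (T.Fl t (?inv z))" if "t \<in> ball 0 e" "z \<in> ball ?z0 e" for t z
    by (rule flow_rep_eq[OF T.flow_boxD(3)[OF f that]])
  have g0: "?g 0 z = z" if "z \<in> ball ?z0 e" for z
    using g[OF _ that, of 0] e inv[OF img[OF that]] T.Fl_0[of "?inv z"] by (auto simp: topspace_TT tdm_iff)
  have gt: "norm (?g t z - z) \<le> L * \<bar>t\<bar>" if t: "t \<in> ball 0 e" and z: "z \<in> ball ?z0 e" for t z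
    using lipschitz_onD[OF lip_g, of "(t, z)" "(0, z)"] t z e g0[OF z] by (simp add: dist_Pair_Pair dist_norm)
  have G0: "spray_field c (?g 0 ?z0) = 0"
    using g0[of ?z0] e spray_zero[OF c(1) x0] snd0 by (simp add: spray_field_def zero_prod_def)
  have Gb: "norm (spray_field c (?g t z)) \<le> L * (2 * e)" if t: "t \<in> ball 0 e" and z: "z \<in> ball ?z0 e" for t z
  proof -
    have "dist (spray_field c (?g t z)) (spray_field c (?g 0 ?z0)) \<le> L * dist (t, z) (0, ?z0)"
      using lipschitz_onD[OF lip_G, of "(t, z)" "(0, ?z0)"] t z e by simp
    also have "dist (t, z) (0, ?z0) \<le> dist t 0 + dist z ?z0"
      unfolding dist_Pair_Pair by (rule sqrt_sum_squares_le_sum) auto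
    also have "\<dots> \<le> 2 * e" using t z by (simp add: dist_commute)
    finally show ?thesis using G0 L_nonneg by (simp add: mult_left_mono)
  qed
  \<comment> \<open>For \<open>|z - z0| < r\<close> the factor \<open>s\<close> below is less than \<open>e\<close>, and the enlarged vector \<open>z'\<close> still lies in the
    flow box.\<close>
  define r where "r = min (e / 4) (e\<^sup>2 / 4)"
  have r: "r > 0" "r \<le> e / 4" "r \<le> e\<^sup>2 / 4" using e by (auto simp: r_def)
  define K where "K = (2 * L + L * (2 * e)) * (4 / e\<^sup>2)"
  have K0: "K \<ge> 0" using L_nonneg e by (simp add: K_def)
  have main: "t \<in> T.dom (?inv z) \<and> T.Fl t (?inv z) \<in> tdm c \<and>
    norm (tco c (T.Fl t (?inv z)) - (fst z + t *\<^sub>R snd z, snd z)) \<le> K * (norm (snd z))\<^sup>2 \<and>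
    norm (spray_field c (tco c (T.Fl t (?inv z))) - (snd z, 0)) \<le> K * (norm (snd z))\<^sup>2"
    if z: "z \<in> ball ?z0 r" and t: "t \<in> {0..1}" for z t
  proof -
    have ze: "z \<in> ball ?z0 e" using z r e by auto
    note iz = inv[OF img[OF ze]]
    have izTM: "?inv z \<in> TM" using iz(1) by (simp add: tdm_iff)
    define n where "n = norm (snd z)"
    have nr: "n < r" using z dist_snd_le[of ?z0 z] snd0 by (simp add: n_def dist_norm)
    \<comment> \<open>Dividing the fibre component by \<open>s\<close> gives a vector of length \<open>e / 2\<close>; for a zero vector \<open>s\<close> and \<open>u'\<close> are \<open>0\<close>.\<close>
    define s where "s = 2 * n / e"
    have s: "s \<ge> 0" "s < e" "s = 0 \<longleftrightarrow> snd z = 0"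
    proof -
      show "s \<ge> 0" using e by (simp add: s_def n_def)
      have "2 * n < e\<^sup>2" using nr r by simp
      then show "s < e" using e by (simp add: s_def power2_eq_square field_simps)
      show "s = 0 \<longleftrightarrow> snd z = 0" using e by (simp add: s_def n_def)
    qed
    define u' where "u' = (if snd z = 0 then 0 else snd z /\<^sub>R s)"
    define z' where "z' = (fst z, u')"
    have su: "s *\<^sub>R u' = snd z" using s(3) by (simp add: u'_def)
    have nu: "norm u' \<le> e / 2"
    proof (cases "snd z = 0")
      case False
      then have "norm u' = n / s" using s by (simp add: u'_def n_def divide_inverse_commute)
      also have "\<dots> = e / 2" using False e by (simp add: s_def n_def)
      finally show ?thesis by simp
    qed (use e in \<open>simp add: u'_def\<close>)
    have z'e: "z' \<in> ball ?z0 e"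
    proof -
      have "dist ?z0 z' \<le> dist (fst ?z0) (fst z') + dist (snd ?z0) (snd z')"
        using sqrt_sum_squares_le_sum[OF zero_le_dist zero_le_dist] by (simp add: dist_prod_def)
      also have "\<dots> \<le> r + e / 2"
        using z dist_fst_le[of ?z0 z] nu snd0 by (intro add_mono) (auto simp: z'_def dist_norm)
      also have "\<dots> < e" using r e by simp
      finally show ?thesis by simp
    qed
    note iz' = inv[OF img[OF z'e]]
    have iz'TM: "?inv z' \<in> TM" using iz'(1) by (simp add: tdm_iff)
    have "tco c (tscale s (?inv z')) = z"
      using iz'(2) su by (simp add: tscale_tco z'_def prod_eq_iff)
    then have scale: "tscale s (?inv z') = ?inv z"
      using tco_inv[OF c(1) tscale_tdm[OF iz'(1)], of s] by simp
    let ?\<tau> = "s * t"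
    have \<tau>: "0 \<le> ?\<tau>" "?\<tau> \<le> s" "?\<tau> \<in> ball 0 e"
    proof -
      show "0 \<le> ?\<tau>" "?\<tau> \<le> s" using s(1) t by (auto simp: mult_left_le)
      then show "?\<tau> \<in> ball 0 e" using s(2) by simp
    qed
    have dm: "?\<tau> \<in> T.dom (?inv z')" by (rule T.flow_boxD(3)[OF f \<tau>(3) z'e])
    note fl = tscale_flow[OF iz'TM s(1) dm, unfolded scale]
    define X where "X = fst (?g ?\<tau> z')"
    define V where "V = snd (?g ?\<tau> z')"
    have F\<tau>: "T.Fl ?\<tau> (?inv z') \<in> tdm c" by (rule T.flow_boxD(4)[OF f \<tau>(3) z'e])
    have gX: "tco c (T.Fl ?\<tau> (?inv z')) = (X, V)" using g[OF \<tau>(3) z'e] by (simp add: X_def V_def)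
    have fc: "T.Fl t (?inv z) \<in> tdm c" unfolding fl(2) by (rule tscale_tdm[OF F\<tau>])
    have val: "tco c (T.Fl t (?inv z)) = (X, s *\<^sub>R V)" unfolding fl(2) tscale_tco gX by simp
    have Vu: "norm (snd (?g \<sigma> z') - u') \<le> L * \<bar>\<sigma>\<bar>" if "\<sigma> \<in> ball 0 e" for \<sigma>
    proof -
      have "norm (snd (?g \<sigma> z' - z')) \<le> norm (?g \<sigma> z' - z')" by (rule norm_snd_component)
      then show ?thesis using gt[OF that z'e] by (simp add: z'_def)
    qed
    \<comment> \<open>The position deviates from uniform motion by the integral over \<open>[0, s t]\<close> of a velocity change of at most \<open>L s\<close>.\<close>
    have Xb: "norm (X - (fst z + ?\<tau> *\<^sub>R u')) \<le> L * s * s"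
    proof -
      let ?h = "\<lambda>\<sigma>. fst (?g \<sigma> z') - \<sigma> *\<^sub>R u'"
      have "norm (?h ?\<tau> - ?h 0) \<le> (L * s) * \<bar>?\<tau> - 0\<bar>"
      proof (rule vector_derivative_bound)
        show "convex {0..?\<tau>}" by simp
        fix \<sigma> assume \<sigma>: "\<sigma> \<in> {0..?\<tau>}"
        then have \<sigma>e: "\<sigma> \<in> ball 0 e" using \<tau> s by auto
        have "((\<lambda>\<sigma>. fst (?g \<sigma> z')) has_vector_derivative fst (spray_field c (?g \<sigma> z'))) (at \<sigma>)"
          by (rule bounded_linear.has_vector_derivative[OF bounded_linear_fst evolve[OF \<sigma>e z'e]])
        moreover have "((\<lambda>\<sigma>. \<sigma> *\<^sub>R u') has_vector_derivative u') (at \<sigma>)"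
          by (auto simp: has_vector_derivative_def intro!: derivative_eq_intros)
        ultimately have "(?h has_vector_derivative fst (spray_field c (?g \<sigma> z')) - u') (at \<sigma>)"
          by (rule has_vector_derivative_diff)
        then show "(?h has_vector_derivative snd (?g \<sigma> z') - u') (at \<sigma> within {0..?\<tau>})"
          by (simp add: spray_field_def has_vector_derivative_at_within)
        have "L * \<bar>\<sigma>\<bar> \<le> L * s" using \<sigma> \<tau>(2) L_nonneg by (intro mult_left_mono) auto
        then show "norm (snd (?g \<sigma> z') - u') \<le> L * s" using Vu[OF \<sigma>e] by linarith
      qed (use \<tau> in auto)
      also have "\<dots> \<le> L * s * s" using \<tau> s L_nonneg by (intro mult_left_mono) auto
      finally show ?thesis using g0[OF z'e] by (simp add: X_def z'_def algebra_simps)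
    qed
    have sV: "norm (s *\<^sub>R V - snd z) \<le> L * s * s"
    proof -
      have "s *\<^sub>R V - snd z = s *\<^sub>R (V - u')" using su by (simp add: scaleR_right_diff_distrib)
      then have "norm (s *\<^sub>R V - snd z) = s * norm (V - u')" using s by simp
      also have "\<dots> \<le> s * (L * \<bar>?\<tau>\<bar>)" unfolding V_def by (intro mult_left_mono Vu \<tau> s)
      also have "\<dots> \<le> s * (L * s)" using \<tau> s L_nonneg by (intro mult_left_mono) auto
      finally show ?thesis by (simp add: mult_ac)
    qed
    have tu: "?\<tau> *\<^sub>R u' = t *\<^sub>R snd z" using su by (metis mult.commute scaleR_scaleR)
    have ss: "s * s = 4 / e\<^sup>2 * (norm (snd z))\<^sup>2" by (simp add: s_def n_def power2_eq_square)
    have Kge: "(L + L) * (s * s) \<le> K * (norm (snd z))\<^sup>2" "(L + L * (2 * e)) * (s * s) \<le> K * (norm (snd z))\<^sup>2"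
    proof -
      have KK: "K * (norm (snd z))\<^sup>2 = (2 * L + L * (2 * e)) * (s * s)"
        unfolding K_def ss by (simp only: mult.assoc)
      have "(L + L) * (s * s) \<le> (2 * L + L * (2 * e)) * (s * s)" using L_nonneg e by (intro mult_right_mono) auto
      then show "(L + L) * (s * s) \<le> K * (norm (snd z))\<^sup>2" by (simp only: KK)
      have "(L + L * (2 * e)) * (s * s) \<le> (2 * L + L * (2 * e)) * (s * s)" using L_nonneg e by (intro mult_right_mono) auto
      then show "(L + L * (2 * e)) * (s * s) \<le> K * (norm (snd z))\<^sup>2" by (simp only: KK)
    qed
    have npair: "norm (p, q) \<le> norm p + norm q" for p q :: 'a
      unfolding norm_Pair by (rule sqrt_sum_squares_le_sum) auto
    have A: "norm (tco c (T.Fl t (?inv z)) - (fst z + t *\<^sub>R snd z, snd z)) \<le> K * (norm (snd z))\<^sup>2"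
    proof -
      have "norm (tco c (T.Fl t (?inv z)) - (fst z + t *\<^sub>R snd z, snd z)) \<le> norm (X - (fst z + t *\<^sub>R snd z)) + norm (s *\<^sub>R V - snd z)"
        unfolding val by (simp add: npair)
      also have "\<dots> \<le> L * s * s + L * s * s" using Xb sV tu by (intro add_mono) auto
      also have "\<dots> = (L + L) * (s * s)" by (simp add: algebra_simps)
      finally show ?thesis using Kge(1) by linarith
    qed
    have B: "norm (spray_field c (tco c (T.Fl t (?inv z))) - (snd z, 0)) \<le> K * (norm (snd z))\<^sup>2"
    proof -
      have Xc: "X \<in> snd c ` fst c" using F\<tau> gX by (auto simp: tdm_iff tco_apply)
      have HV: "norm (H c X V) \<le> L * (2 * e)"
        using norm_snd_component[of "spray_field c (?g ?\<tau> z')"] Gb[OF \<tau>(3) z'e] by (simp add: spray_field_def X_def V_def)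
      have Hs: "H c X (s *\<^sub>R V) = s\<^sup>2 *\<^sub>R H c X V"
      proof (cases "s = 0")
        case True
        then show ?thesis using spray_zero[OF c(1) Xc] by simp
      next
        case False
        then show ?thesis using sprayD(2)[OF c(1) Xc] s(1) by simp
      qed
      have "norm (spray_field c (tco c (T.Fl t (?inv z))) - (snd z, 0)) \<le> norm (s *\<^sub>R V - snd z) + norm (s\<^sup>2 *\<^sub>R H c X V)"
        unfolding val spray_field_def using npair[of "s *\<^sub>R V - snd z" "s\<^sup>2 *\<^sub>R H c X V"] by (simp add: Hs)
      also have "norm (s\<^sup>2 *\<^sub>R H c X V) \<le> s\<^sup>2 * (L * (2 * e))" using HV by (simp add: mult_left_mono)
      also have "norm (s *\<^sub>R V - snd z) + s\<^sup>2 * (L * (2 * e)) \<le> L * s * s + s\<^sup>2 * (L * (2 * e))" using sV by simp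
      also have "\<dots> = (L + L * (2 * e)) * (s * s)" by (simp add: algebra_simps power2_eq_square)
      finally show ?thesis using Kge(2) by linarith
    qed
    show ?thesis using fl(1) fc A B by blast
  qed
  show ?thesis using r(1) main by blast
qed

lemma open_tscale_vimage:
  assumes c: "c \<in> A" and V: "openin TT V"
  shows "openin TT {w \<in> tdm c. tscale s w \<in> V}"
proof -
  let ?S = "\<lambda>z :: 'a \<times> 'a. (fst z, s *\<^sub>R snd z)"
  have "open (?S -` (tco c ` (tdm c \<inter> V)))"
    by (intro open_vimage tco_open_image[OF c V] continuous_intros)
  from TT_basic_open[OF c this]
  have "openin TT {w \<in> tdm c. tco c w \<in> ?S -` (tco c ` (tdm c \<inter> V))}" .
  moreover have "{w \<in> tdm c. tco c w \<in> ?S -` (tco c ` (tdm c \<inter> V))} = {w \<in> tdm c. tscale s w \<in> V}"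
  proof -
    have "?S (tco c w) \<in> tco c ` (tdm c \<inter> V) \<longleftrightarrow> tscale s w \<in> V" if w: "w \<in> tdm c" for w
    proof
      assume "?S (tco c w) \<in> tco c ` (tdm c \<inter> V)"
      then obtain q where q: "q \<in> tdm c" "q \<in> V" "tco c (tscale s w) = tco c q"
        unfolding tscale_tco by blast
      then have "tscale s w = q" using tco_inj[OF c] tscale_tdm[OF w] by (auto simp: inj_on_eq_iff)
      then show "tscale s w \<in> V" using q by simp
    next
      assume "tscale s w \<in> V"
      then show "?S (tco c w) \<in> tco c ` (tdm c \<inter> V)" using tscale_tdm[OF w, of s] tscale_tco[of c s w]
        by (metis IntI image_eqI)
    qed
    then show ?thesis by auto
  qed
  ultimately show ?thesis by simp
qed

lemma tscale_inverse: "s \<noteq> 0 \<Longrightarrow> tscale (1 / s) (tscale s w) = w"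
  by (simp add: tscale_def)

end

context spray_submanifold
begin

text \<open>Both the flow and the spray field along it are affine up to a quadratic error near a zero vector, so
they are differentiable there at every time.\<close>

lemma good_zero_vector:
  assumes w: "w \<in> TM" "snd w = (\<lambda>_. 0)" and d: "d \<in> A" "w \<in> tdm d"
  shows "good (tchart A d) w"
proof -
  have Flw: "T.Fl t w = w" for t
  proof -
    \<comment> \<open>A zero vector is the scaling of itself by \<open>0\<close>, so its geodesic is constant.\<close>
    have "tscale 0 w = w" using w(2) by (simp add: tscale_def prod_eq_iff)
    then show ?thesis using tscale_flow(2)[OF w(1), of 0 t] T.zero_in_dom[of w] T.Fl_0[of w] w(1) topspace_TT by simp
  qed
  have diff: "rep (tchart A c) c t differentiable (at (tco c w)) \<and> partial1 (rep (tchart A c) c) t differentiable (at (tco c w))"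
    if c: "c \<in> A" "w \<in> tdm c" and t: "t \<in> {0..1}" for c t
  proof -
    let ?inv = "chart_inv (tchart A c)"
    obtain r K where r: "r > 0" and rK: "\<And>z t. z \<in> ball (tco c w) r \<Longrightarrow> t \<in> {0..1} \<Longrightarrow>
      t \<in> T.dom (?inv z) \<and> T.Fl t (?inv z) \<in> tdm c \<and>
      norm (tco c (T.Fl t (?inv z)) - (fst z + t *\<^sub>R snd z, snd z)) \<le> K * (norm (snd z))\<^sup>2 \<and>
      norm (spray_field c (tco c (T.Fl t (?inv z))) - (snd z, 0)) \<le> K * (norm (snd z))\<^sup>2"
      using zero_vector_expansion[OF w c] by blast
    have w0: "snd (tco c w) = 0" using w(2) by (simp add: tco_apply)
    have repz: "rep (tchart A c) c t z = tco c (T.Fl t (?inv z))" if "z \<in> ball (tco c w) r" for z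
      by (rule flow_rep_eq) (use rK[OF that t] in blast)
    have p1: "partial1 (rep (tchart A c) c) t z = spray_field c (tco c (T.Fl t (?inv z)))" if "z \<in> ball (tco c w) r" for z
    proof -
      have d: "t \<in> T.dom (?inv z)" "T.Fl t (?inv z) \<in> tdm c" using rK[OF that t] by auto
      have "((\<lambda>s. rep (tchart A c) c s z) has_vector_derivative spray_field c (tco c (T.Fl t (?inv z)))) (at t)"
        by (rule has_vector_derivative_transform_within_open[OF T.icurveD(4)[OF T.icurve_Fl d(1) c(1) d(2)] T.icurveD(1)[OF T.icurve_Fl] d(1)])
          (simp add: flow_rep_eq)
      then show ?thesis unfolding partial1_def by (rule vector_derivative_at)
    qed
    have sn: "K * (norm (snd z))\<^sup>2 \<le> \<bar>K\<bar> * (norm (z - tco c w))\<^sup>2" for z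
    proof -
      have "norm (snd z) \<le> norm (z - tco c w)" using norm_snd_component[of "z - tco c w"] w0 by simp
      then have "(norm (snd z))\<^sup>2 \<le> (norm (z - tco c w))\<^sup>2" by (rule power_mono) simp
      then have "\<bar>K\<bar> * (norm (snd z))\<^sup>2 \<le> \<bar>K\<bar> * (norm (z - tco c w))\<^sup>2" by (rule mult_left_mono) simp
      moreover have "K * (norm (snd z))\<^sup>2 \<le> \<bar>K\<bar> * (norm (snd z))\<^sup>2" by (rule mult_right_mono) auto
      ultimately show ?thesis by linarith
    qed
    have wb: "tco c w \<in> ball (tco c w) r" using r by simp
    have iw: "?inv (tco c w) = w" using tco_inv[OF c] .
    have "(rep (tchart A c) c t has_derivative (\<lambda>h. (fst h + t *\<^sub>R snd h, snd h))) (at (tco c w))"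
    proof (rule has_derivative_quadratic[OF _ r])
      show "bounded_linear (\<lambda>h :: 'a \<times> 'a. (fst h + t *\<^sub>R snd h, snd h))" by (intro bounded_linear_intros)
      fix z assume z: "z \<in> ball (tco c w) r"
      have "rep (tchart A c) c t (tco c w) = (fst (tco c w), 0)" using repz[OF wb] iw Flw w0 by (simp add: prod_eq_iff)
      then have "rep (tchart A c) c t z - rep (tchart A c) c t (tco c w) - (fst (z - tco c w) + t *\<^sub>R snd (z - tco c w), snd (z - tco c w))
          = tco c (T.Fl t (?inv z)) - (fst z + t *\<^sub>R snd z, snd z)"
        using repz[OF z] w0 by (simp add: prod_eq_iff)
      then show "norm (rep (tchart A c) c t z - rep (tchart A c) c t (tco c w) - (fst (z - tco c w) + t *\<^sub>R snd (z - tco c w), snd (z - tco c w)))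
          \<le> \<bar>K\<bar> * (norm (z - tco c w))\<^sup>2"
        using rK[OF z t] sn[of z] by (simp del: fst_diff snd_diff)
    qed
    moreover have "(partial1 (rep (tchart A c) c) t has_derivative (\<lambda>h. (snd h, 0))) (at (tco c w))"
    proof (rule has_derivative_quadratic[OF _ r])
      show "bounded_linear (\<lambda>h :: 'a \<times> 'a. (snd h, 0 :: 'a))" by (intro bounded_linear_intros)
      fix z assume z: "z \<in> ball (tco c w) r"
      have "fst (tco c w) \<in> snd c ` fst c" using c(2) by (auto simp: tdm_iff tco_apply)
      then have "partial1 (rep (tchart A c) c) t (tco c w) = 0"
        using p1[OF wb] iw Flw w0 spray_zero[OF c(1)] by (simp add: spray_field_def zero_prod_def)
      then have "partial1 (rep (tchart A c) c) t z - partial1 (rep (tchart A c) c) t (tco c w) - (snd (z - tco c w), 0)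
          = spray_field c (tco c (T.Fl t (?inv z))) - (snd z, 0)"
        using p1[OF z] w0 by simp
      then show "norm (partial1 (rep (tchart A c) c) t z - partial1 (rep (tchart A c) c) t (tco c w) - (snd (z - tco c w), 0))
          \<le> \<bar>K\<bar> * (norm (z - tco c w))\<^sup>2"
        using rK[OF z t] sn[of z] by simp
    qed
    ultimately show ?thesis unfolding differentiable_def by blast
  qed
  have trans: "rep (tchart A d) c t differentiable (at (tco d w)) \<and> partial1 (rep (tchart A d) c) t differentiable (at (tco d w))"
    if c: "c \<in> A" "w \<in> tdm c" and t: "t \<in> {0..1}" for c t
  proof -
    have o: "open (overlap (tchart A d) (tchart A c))" by (rule overlap_open[OF tchart_is_chart[OF d(1)] tchart_is_chart[OF c(1)]])
    have "transition (tchart A d) (tchart A c) differentiable (at (tco d w))"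
      by (rule ttransition_differentiable[OF d(1) c(1) d(2) c(2)])
    from differentiable_change_initial[OF o tco_inj[OF d(1)] tco_inj[OF c(1)] d(2) c(2) this] diff[OF c t]
    show ?thesis by blast
  qed
  show ?thesis
    unfolding good_def
  proof (intro conjI ballI impI)
    show "rep (tchart A d) c t differentiable (at (tco d w))" if "t \<in> {0..1}" "c \<in> A" "T.Fl t w \<in> tdm c" for t c
      using trans that Flw by simp
    fix c assume "c \<in> C"
    then have "{t \<in> {0<..<1}. T.Fl t w \<in> tdm c \<and> \<not> partial1 (rep (tchart A d) c) t differentiable (at (tco d w))} = {}"
      using trans[of c] Flw C by auto
    then show "negligible {t \<in> {0<..<1}. T.Fl t w \<in> tdm c \<and> \<not> partial1 (rep (tchart A d) c) t differentiable (at (tco d w))}"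
      by (simp only: negligible_empty)
  qed
qed

section \<open>Scaling in a star-shaped submanifold\<close>

text \<open>In the charts \<open>d\<close> around \<open>v\<close> and \<open>b\<close> around \<open>s v\<close> the scaling is a continuous injective map \<open>\<psi>\<close> between open sets of the
same Euclidean space, so its image is open and its inverse \<open>\<eta>\<close> is defined near the coordinates of \<open>s v\<close>.
Through a chart \<open>c\<close> of the tangent bundle, \<open>\<eta>\<close> factors into Lipschitz maps, and its composition with the
inclusion of the submanifold is the linear inverse scaling after the inclusion at \<open>s v\<close>, which is differentiable.
As the inclusion at \<open>v\<close> is differentiable with a lower bound, \<open>\<eta>\<close> is differentiable.\<close>

lemma inverse_scaling:
  assumes st: "star_shaped N" and s: "0 < s" "s \<le> 1"
    and d: "d \<in> B" "v \<in> fst d" and b: "b \<in> B" "tscale s v \<in> fst b"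
    and c: "c \<in> A" "v \<in> tdm c"
    and dd: "transition d (tchart A c) differentiable (at (snd d v))"
    and db: "transition b (tchart A c) differentiable (at (snd b (tscale s v)))"
  obtains \<eta> where "\<eta> (snd b (tscale s v)) = snd d v" "\<eta> differentiable (at (snd b (tscale s v)))"
    "\<forall>\<^sub>F y in nhds (snd b (tscale s v)). \<eta> y \<in> snd d ` fst d \<and> chart_inv b y = tscale s (chart_inv d (\<eta> y))"
proof -
  let ?y1 = "snd b (tscale s v)"
  let ?I = "transition d (tchart A c)" and ?J = "transition b (tchart A c)"
  let ?R = "transition (tchart A c) b" and ?Q = "transition (tchart A c) d"
  let ?S = "\<lambda>a (z :: 'a \<times> 'a). (fst z, a *\<^sub>R snd z)"
  note pb = param[OF b(1)] and pd = param[OF d(1)]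
  have s0: "s \<noteq> 0" using s by simp
  have vN: "v \<in> N" using d submanifoldD(3) by blast
  obtain V where V: "openin TT V" "fst b = V \<inter> N"
    using is_chartD(1)[OF submanifoldD(2)[OF b(1)]] by (auto simp: openin_subtopology)
  let ?W = "{w \<in> tdm c. tscale s w \<in> V}"
  have W: "openin TT ?W" by (rule open_tscale_vimage[OF c(1) V(1)])
  define P where "P = snd d ` (fst d \<inter> (N \<inter> ?W))"
  have oP: "open P" unfolding P_def
    by (rule chart_open_image[OF submanifoldD(2)[OF d(1)]]) (rule openin_subtopology_Int2[OF W])
  have Pw: "\<exists>w. w \<in> fst d \<and> w \<in> tdm c \<and> tscale s w \<in> fst b \<and> y = snd d w \<and> chart_inv d y = w" if "y \<in> P" for y
  proof -
    obtain w where w: "w \<in> fst d" "w \<in> N" "w \<in> ?W" "y = snd d w" using \<open>y \<in> P\<close> unfolding P_def by blast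
    have "tscale s w \<in> N" using st w(2) s unfolding star_shaped_def by auto
    then show ?thesis using w V(2) T.param_chartD(4)[OF pd w(1)] by blast
  qed
  have vP: "snd d v \<in> P"
    unfolding P_def using d c vN b(2) V(2) by blast
  define \<psi> where "\<psi> y = snd b (tscale s (chart_inv d y))" for y
  have \<psi>v: "\<psi> (snd d v) = ?y1" using T.param_chartD(4)[OF pd d(2)] by (simp add: \<psi>_def)
  have \<psi>eq: "\<psi> y = ?R (?S s (?I y))" and \<psi>dom: "y \<in> overlap d (tchart A c)" "?S s (?I y) \<in> overlap (tchart A c) b"
    if y: "y \<in> P" for y
  proof -
    obtain w where w: "w \<in> fst d" "w \<in> tdm c" "tscale s w \<in> fst b" "y = snd d w" "chart_inv d y = w" using Pw[OF y] by blast
    have I: "?I y = tco c w" using w by (simp add: transition_def)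
    have SI: "?S s (?I y) = tco c (tscale s w)" unfolding I tscale_tco ..
    show "y \<in> overlap d (tchart A c)" using w by (auto simp: overlap_def)
    show "?S s (?I y) \<in> overlap (tchart A c) b" unfolding SI using w tscale_tdm[OF w(2)] by (auto simp: overlap_def)
    show "\<psi> y = ?R (?S s (?I y))" unfolding SI using tco_inv[OF c(1) tscale_tdm[OF w(2)]] w by (simp add: \<psi>_def transition_def)
  qed
  have cI: "continuous_on P ?I"
    by (rule continuous_on_subset[OF locally_lipschitz_imp_continuous_on[OF submanifoldD(4)[OF d(1) c(1)]]]) (use \<psi>dom in blast)
  have "continuous_on P (\<lambda>y. ?R (?S s (?I y)))"
    by (rule continuous_on_compose2[OF locally_lipschitz_imp_continuous_on[OF submanifoldD(5)[OF b(1) c(1)]]])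
      (use \<psi>dom in \<open>auto intro!: continuous_intros cI\<close>)
  then have c\<psi>: "continuous_on P \<psi>" using \<psi>eq by (simp cong: continuous_on_cong)
  have inj\<psi>: "inj_on \<psi> P"
  proof (rule inj_onI)
    fix y y' assume y: "y \<in> P" "y' \<in> P" "\<psi> y = \<psi> y'"
    obtain w where w: "tscale s w \<in> fst b" "y = snd d w" "chart_inv d y = w" using Pw[OF y(1)] by blast
    obtain w' where w': "tscale s w' \<in> fst b" "y' = snd d w'" "chart_inv d y' = w'" using Pw[OF y(2)] by blast
    have "tscale s w = tscale s w'" using y(3) w w' T.param_chartD(1)[OF pb] by (simp add: \<psi>_def inj_on_eq_iff)
    then have "w = w'" using tscale_inverse[OF s0] by metis
    then show "y = y'" using w w' by simp
  qed
  \<comment> \<open>Both charts belong to \<open>N\<close>, so domain and codomain of \<open>\<psi>\<close> have the same dimension.\<close>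
  have o\<psi>: "open (\<psi> ` P)" by (rule invariance_of_domain[OF c\<psi> oP inj\<psi>])
  define \<eta> where "\<eta> y = snd d (tscale (1 / s) (chart_inv b y))" for y
  have \<eta>\<psi>: "\<eta> (\<psi> y) = y" "chart_inv b (\<psi> y) = tscale s (chart_inv d y)" if y: "y \<in> P" for y
  proof -
    obtain w where w: "w \<in> fst d" "tscale s w \<in> fst b" "y = snd d w" "chart_inv d y = w" using Pw[OF y] by blast
    show i: "chart_inv b (\<psi> y) = tscale s (chart_inv d y)" using T.param_chartD(4)[OF pb w(2)] w by (simp add: \<psi>_def)
    show "\<eta> (\<psi> y) = y" unfolding \<eta>_def i using w tscale_inverse[OF s0, of w] by simp
  qed
  have y1: "?y1 \<in> \<psi> ` P" using \<psi>v vP by (metis image_eqI)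
  have \<eta>1: "\<eta> ?y1 = snd d v" using \<eta>\<psi>(1)[OF vP] \<psi>v by simp
  have evP: "\<forall>\<^sub>F y in nhds ?y1. y \<in> \<psi> ` P" by (rule eventually_nhds_in_open[OF o\<psi> y1])
  have fac: "?I (\<eta> y) = ?S (1 / s) (?J y)" "\<eta> y = ?Q (?S (1 / s) (?J y))" "y \<in> overlap b (tchart A c)"
      "?S (1 / s) (?J y) \<in> overlap (tchart A c) d"
    if yP: "y \<in> \<psi> ` P" for y
  proof -
    obtain x where x: "x \<in> P" "y = \<psi> x" using yP by blast
    obtain w where w: "w \<in> fst d" "w \<in> tdm c" "tscale s w \<in> fst b" "x = snd d w" "chart_inv d x = w" using Pw[OF x(1)] by blast
    have \<eta>y: "\<eta> y = snd d w" using \<eta>\<psi>(1)[OF x(1)] x w by simp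
    have iy: "chart_inv b y = tscale s w" using \<eta>\<psi>(2)[OF x(1)] x w by simp
    have J: "?J y = ?S s (tco c w)" using iy by (simp add: transition_def tscale_tco)
    have SJ: "?S (1 / s) (?J y) = tco c w" unfolding J using s0 by simp
    show "?I (\<eta> y) = ?S (1 / s) (?J y)" unfolding SJ \<eta>y using T.param_chartD(4)[OF pd w(1)] by (simp add: transition_def)
    show "\<eta> y = ?Q (?S (1 / s) (?J y))" unfolding SJ \<eta>y using tco_inv[OF c(1) w(2)] by (simp add: transition_def)
    have "y = snd b (tscale s w)" using x w by (simp add: \<psi>_def)
    then show "y \<in> overlap b (tchart A c)" using w tscale_tdm[OF w(2)] by (auto simp: overlap_def)
    show "?S (1 / s) (?J y) \<in> overlap (tchart A c) d" unfolding SJ using w by (auto simp: overlap_def)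
  qed
  show ?thesis
  proof (rule that[of \<eta>])
    show "\<eta> ?y1 = snd d v" by (rule \<eta>1)
    show "\<forall>\<^sub>F y in nhds ?y1. \<eta> y \<in> snd d ` fst d \<and> chart_inv b y = tscale s (chart_inv d (\<eta> y))"
      using evP
    proof (rule eventually_mono)
      fix y assume "y \<in> \<psi> ` P"
      then obtain x where x: "x \<in> P" "y = \<psi> x" by blast
      then show "\<eta> y \<in> snd d ` fst d \<and> chart_inv b y = tscale s (chart_inv d (\<eta> y))"
        using \<eta>\<psi>[OF x(1)] Pw[OF x(1)] by auto
    qed
    have vo: "tco c v \<in> overlap (tchart A c) d" using d c by (auto simp: overlap_def)
    \<comment> \<open>The inverse \<open>?Q\<close> of the inclusion is Lipschitz near \<open>v\<close>; this is the lower bound for the inclusion \<open>?I\<close> and,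
      after composition with \<open>?J\<close>, the upper bound for \<open>\<eta>\<close>.\<close>
    obtain r L where r: "r > 0" "L-lipschitz_on (overlap (tchart A c) d \<inter> ball (tco c v) r) ?Q"
      using locally_lipschitz_onE[OF submanifoldD(5)[OF d(1) c(1)] vo] by blast
    have Iv: "?I (snd d v) = tco c v" using T.param_chartD(4)[OF pd d(2)] by (simp add: transition_def)
    have y1o: "?y1 \<in> overlap b (tchart A c)" by (rule fac(3)[OF y1])
    obtain r1 L1 where r1: "r1 > 0" "ball ?y1 r1 \<subseteq> overlap b (tchart A c)" "L1-lipschitz_on (ball ?y1 r1) ?J"
      using locally_lipschitz_on_openE[OF submanifoldD(4)[OF b(1) c(1)] T.overlap_open_param[OF pb c(1)] y1o] .
    show "\<eta> differentiable (at ?y1)"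
    proof (rule differentiable_if_composite[where f = ?I and c = L and k = "L * ((1 + 1 / s) * L1)"])
      show "?I differentiable (at (\<eta> ?y1))" using dd \<eta>1 by simp
      have ev: "\<forall>\<^sub>F y in nhds ?y1. ?I (\<eta> y) = ?S (1 / s) (?J y)"
        using evP by (rule eventually_mono) (rule fac(1))
      have "(\<lambda>y. ?S (1 / s) (?J y)) differentiable (at ?y1)"
      proof -
        have "bounded_linear (?S (1 / s))" by (intro bounded_linear_intros)
        then have "?S (1 / s) differentiable (at (?J ?y1))" using bounded_linear_imp_has_derivative differentiable_def by blast
        from differentiable_chain_at[OF db this] show ?thesis by (simp add: o_def)
      qed
      then show "(\<lambda>y. ?I (\<eta> y)) differentiable (at ?y1)" by (rule differentiable_transform_eventually[OF _ ev])
      have oP2: "open (?I -` ball (tco c v) r \<inter> P)" using continuous_on_open_vimage[OF oP] cI open_ball by blast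
      have in2: "snd d v \<in> ?I -` ball (tco c v) r \<inter> P" using Iv vP r by simp
      show "\<forall>\<^sub>F z in nhds (\<eta> ?y1). norm (z - \<eta> ?y1) \<le> L * norm (?I z - ?I (\<eta> ?y1))"
        unfolding \<eta>1 Iv using eventually_nhds_in_open[OF oP2 in2]
      proof (rule eventually_mono)
        fix z assume z: "z \<in> ?I -` ball (tco c v) r \<inter> P"
        obtain w where w: "w \<in> fst d" "w \<in> tdm c" "z = snd d w" "chart_inv d z = w" using Pw[of z] z by blast
        have Iz: "?I z = tco c w" using w by (simp add: transition_def)
        have Qw: "?Q (tco c q) = snd d q" if "q \<in> tdm c" for q using tco_inv[OF c(1) that] by (simp add: transition_def)
        have "dist (?Q (tco c w)) (?Q (tco c v)) \<le> L * dist (tco c w) (tco c v)"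
          by (rule lipschitz_onD[OF r(2)]) (use w z Iz vo r in \<open>auto simp: overlap_def\<close>)
        then show "norm (z - snd d v) \<le> L * norm (?I z - tco c v)"
          unfolding Qw[OF w(2)] Qw[OF c(2)] Iz by (simp add: dist_norm w(3)[symmetric])
      qed
      have SJ1: "?S (1 / s) (?J ?y1) = tco c v" using fac(1)[OF y1] \<eta>1 Iv by simp
      have cSJ: "continuous_on (ball ?y1 r1) (\<lambda>y. ?S (1 / s) (?J y))"
        using lipschitz_on_continuous_on[OF r1(3)] by (intro continuous_intros)
      have oU: "open ((\<lambda>y. ?S (1 / s) (?J y)) -` ball (tco c v) r \<inter> ball ?y1 r1)" (is "open ?U")
        using continuous_on_open_vimage[OF open_ball] cSJ open_ball by blast
      have y1U: "?y1 \<in> ?U" using SJ1 r r1 by simp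
      show "\<forall>\<^sub>F y in nhds ?y1. norm (\<eta> y - \<eta> ?y1) \<le> (L * ((1 + 1 / s) * L1)) * norm (y - ?y1)"
        using evP eventually_nhds_in_open[OF oU y1U]
      proof eventually_elim
        case (elim y)
        have "dist (\<eta> y) (\<eta> ?y1) \<le> L * dist (?S (1 / s) (?J y)) (?S (1 / s) (?J ?y1))"
          unfolding fac(2)[OF elim(1)] fac(2)[OF y1]
          by (rule lipschitz_onD[OF r(2)]) (use fac(4)[OF elim(1)] fac(4)[OF y1] elim(2) SJ1 r in auto)
        also have "dist (?S (1 / s) (?J y)) (?S (1 / s) (?J ?y1)) \<le> (1 + 1 / s) * dist (?J y) (?J ?y1)"
        proof -
          have "dist (?S (1 / s) (?J y)) (?S (1 / s) (?J ?y1)) \<le> dist (fst (?J y)) (fst (?J ?y1)) + dist ((1 / s) *\<^sub>R snd (?J y)) ((1 / s) *\<^sub>R snd (?J ?y1))"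
            unfolding dist_Pair_Pair by (rule sqrt_sum_squares_le_sum) auto
          also have "\<dots> = dist (fst (?J y)) (fst (?J ?y1)) + 1 / s * dist (snd (?J y)) (snd (?J ?y1))"
            using s by (simp add: dist_norm scaleR_right_diff_distrib[symmetric])
          also have "\<dots> \<le> dist (?J y) (?J ?y1) + 1 / s * dist (?J y) (?J ?y1)"
            using s by (intro add_mono mult_left_mono dist_fst_le dist_snd_le) auto
          finally show ?thesis by (simp add: algebra_simps)
        qed
        also have "dist (?J y) (?J ?y1) \<le> L1 * dist y ?y1"
          by (rule lipschitz_onD[OF r1(3)]) (use elim(2) r1 in auto)
        finally have "dist (\<eta> y) (\<eta> ?y1) \<le> L * ((1 + 1 / s) * (L1 * dist y ?y1))"
          using lipschitz_on_nonneg[OF r(2)] s by (simp add: mult_left_mono)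
        then show ?case by (simp add: dist_norm mult_ac)
      qed
    qed
  qed
qed

text \<open>The chart representation of the flow at \<open>s v\<close> is that at \<open>v\<close>, at the time \<open>s t\<close>, composed with the
inverse scaling \<open>\<eta>\<close> on the side of the initial vectors and with the fibrewise scaling on the side of the
values.\<close>

lemma good_scaled:
  assumes st: "star_shaped N" and s: "0 < s" "s \<le> 1"
    and v: "v \<in> exp_dom M A H" and d: "d \<in> B" "v \<in> fst d" "good d v"
    and b: "b \<in> B" "tscale s v \<in> fst b" and incl: "inclusion_differentiable_at A B (tscale s v)"
  shows "good b (tscale s v)"
proof -
  let ?y1 = "snd b (tscale s v)"
  let ?S = "\<lambda>z :: 'a \<times> 'a. (fst z, s *\<^sub>R snd z)"
  have vTM: "v \<in> TM" using v by (simp add: exp_dom_iff)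
  obtain c0 where c0: "c0 \<in> A" "v \<in> tdm c0" using chart_at[OF vTM] .
  have v0: "T.Fl 0 v = v" using T.Fl_0 vTM by (simp add: topspace_TT)
  note pd = param[OF d(1)] and pb = param[OF b(1)]
  \<comment> \<open>The flow at time \<open>0\<close> is the inclusion, so at a good vector the inclusion is differentiable.\<close>
  have dd: "transition d (tchart A c0) differentiable (at (snd d v))"
  proof -
    have "rep d c0 0 differentiable (at (snd d v))" using d(3) c0 v0 unfolding good_def by auto
    moreover have "\<forall>\<^sub>F z in nhds (snd d v). z \<in> snd d ` fst d"
      by (rule eventually_nhds_in_open[OF T.param_chartD(2)[OF pd]]) (use d in blast)
    then have "\<forall>\<^sub>F z in nhds (snd d v). transition d (tchart A c0) z = rep d c0 0 z"
    proof (rule eventually_mono)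
      fix z assume "z \<in> snd d ` fst d"
      then have "chart_inv d z \<in> topspace TT" using T.param_chartD(3,5)[OF pd] by blast
      then show "transition d (tchart A c0) z = rep d c0 0 z"
        using flow_rep_eq[OF T.zero_in_dom, of d z c0] T.Fl_0[of "chart_inv d z"] by (simp add: transition_def)
    qed
    ultimately show ?thesis by (rule differentiable_transform_eventually)
  qed
  have db: "transition b (tchart A c0) differentiable (at ?y1)"
    using incl b c0 tscale_tdm[OF c0(2)] unfolding inclusion_differentiable_at_def by blast
  obtain \<eta> where \<eta>1: "\<eta> ?y1 = snd d v" and \<eta>d: "\<eta> differentiable (at ?y1)"
    and \<eta>e: "\<forall>\<^sub>F y in nhds ?y1. \<eta> y \<in> snd d ` fst d \<and> chart_inv b y = tscale s (chart_inv d (\<eta> y))"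
    using inverse_scaling[OF st s d(1,2) b c0 dd db] by blast
  have \<eta>c: "filterlim \<eta> (nhds (snd d v)) (nhds ?y1)"
    using differentiable_imp_continuous_within[OF \<eta>d]
    by (simp only: continuous_within tendsto_at_iff_tendsto_nhds \<eta>1[symmetric])
  have bS: "bounded_linear ?S" by (intro bounded_linear_intros)
  have Sd: "?S differentiable (at z)" for z using bounded_linear_imp_has_derivative[OF bS] differentiable_def by blast
  have key: "(\<forall>\<^sub>F y in nhds ?y1. rep b c t y = ?S (rep d c (s * t) (\<eta> y))) \<and>
      (\<forall>\<^sub>F y in nhds ?y1. partial1 (rep b c) t y = s *\<^sub>R ?S (partial1 (rep d c) (s * t) (\<eta> y))) \<and> T.Fl (s * t) v \<in> tdm c"
    if t: "t \<in> {0..1}" and c: "c \<in> A" and F: "T.Fl t (tscale s v) \<in> tdm c" for t c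
  proof -
    have st01: "s * t \<in> {0..1}" using s t by (auto simp: mult_le_one)
    have std: "s * t \<in> T.dom v" by (rule exp_dom_times[OF v st01])
    have "T.Fl t (tscale s v) = tscale s (T.Fl (s * t) v)" by (rule tscale_flow(2)[OF vTM _ std]) (use s in simp)
    then have FTs: "tscale s (T.Fl (s * t) v) \<in> tdm c" using F by simp
    have "T.Fl (s * t) v \<in> TM" using T.Fl_in_space[OF std] by (simp add: topspace_TT)
    then have Fst: "T.Fl (s * t) v \<in> tdm c" using FTs by (simp add: tdm_iff tscale_def)
    obtain e L where f: "T.flow_box d c (s * t) (snd d v) e L"
      and E: "evolution_box (rep d c) (\<lambda>t y. spray_field c (rep d c t y)) (s * t) (snd d v) e L"
      using evolution_box_exists[OF pd d(2) std c Fst] by blast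
    interpret evolution_box "rep d c" "\<lambda>t y. spray_field c (rep d c t y)" "s * t" "snd d v" e L by (rule E)
    have ball: "\<forall>\<^sub>F y in nhds ?y1. \<eta> y \<in> ball (snd d v) e"
      by (rule eventually_compose_filterlim[OF _ \<eta>c], rule eventually_in_ball) (use e in simp)
    have sb: "s * r \<in> ball (s * t) e" if "r \<in> ball t (e / s)" for r
    proof -
      have "\<bar>s * t - s * r\<bar> = s * \<bar>t - r\<bar>" using s by (simp add: abs_mult right_diff_distrib[symmetric])
      then show ?thesis using that s by (simp add: dist_real_def field_simps)
    qed
    have eq: "rep b c r y = ?S (rep d c (s * r) (\<eta> y))"
      if y: "\<eta> y \<in> snd d ` fst d \<and> chart_inv b y = tscale s (chart_inv d (\<eta> y))" "\<eta> y \<in> ball (snd d v) e"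
        and r: "r \<in> ball t (e / s)" for r y
    proof -
      have sr: "s * r \<in> T.dom (chart_inv d (\<eta> y))" by (rule T.flow_boxD(3)[OF f sb[OF r] y(2)])
      have wTM: "chart_inv d (\<eta> y) \<in> TM" using T.param_chartD(3,5)[OF pd] y(1) topspace_TT by blast
      have fl: "r \<in> T.dom (chart_inv b y)" "T.Fl r (chart_inv b y) = tscale s (T.Fl (s * r) (chart_inv d (\<eta> y)))"
        using tscale_flow[OF wTM _ sr] s y(1) by auto
      show ?thesis using flow_rep_eq[OF fl(1), of c] flow_rep_eq[OF sr, of c] fl(2) by (simp add: tscale_tco)
    qed
    have tb: "t \<in> ball t (e / s)" using e s by simp
    have 1: "\<forall>\<^sub>F y in nhds ?y1. rep b c t y = ?S (rep d c (s * t) (\<eta> y))"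
      using \<eta>e ball by eventually_elim (rule eq[OF _ _ tb])
    have 2: "\<forall>\<^sub>F y in nhds ?y1. partial1 (rep b c) t y = s *\<^sub>R ?S (partial1 (rep d c) (s * t) (\<eta> y))"
      using \<eta>e ball
    proof eventually_elim
      case (elim y)
      have st: "s * t \<in> ball (s * t) e" using e by simp
      have "((\<lambda>r. s * r) has_vector_derivative s) (at t)"
        by (auto simp flip: has_real_derivative_iff_has_vector_derivative intro!: derivative_eq_intros)
      from vector_diff_chain_at[OF this evolve[OF st elim(2)]]
      have "((\<lambda>r. rep d c (s * r) (\<eta> y)) has_vector_derivative s *\<^sub>R partial1 (rep d c) (s * t) (\<eta> y)) (at t)"
        by (simp add: o_def partial1_eq[OF st elim(2)])
      from bounded_linear.has_vector_derivative[OF bS this]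
      have "((\<lambda>r. ?S (rep d c (s * r) (\<eta> y))) has_vector_derivative ?S (s *\<^sub>R partial1 (rep d c) (s * t) (\<eta> y))) (at t)" .
      then have "((\<lambda>r. rep b c r y) has_vector_derivative ?S (s *\<^sub>R partial1 (rep d c) (s * t) (\<eta> y))) (at t)"
        by (rule has_vector_derivative_transform_within_open[OF _ open_ball tb]) (simp add: eq[OF elim])
      then have "partial1 (rep b c) t y = ?S (s *\<^sub>R partial1 (rep d c) (s * t) (\<eta> y))"
        unfolding partial1_def[of "rep b c"] by (rule vector_derivative_at)
      then show ?case by simp
    qed
    show ?thesis using 1 2 Fst by blast
  qed
  show ?thesis
    unfolding good_def
  proof (intro conjI ballI impI)
    fix t c assume t: "t \<in> {0..1::real}" and c: "c \<in> A" and F: "T.Fl t (tscale s v) \<in> tdm c"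
    have st01: "s * t \<in> {0..1}" using s t by (auto simp: mult_le_one)
    note k = key[OF t c F]
    have D: "rep d c (s * t) differentiable (at (\<eta> ?y1))" using d(3) st01 c k \<eta>1 unfolding good_def by auto
    have "(\<lambda>y. ?S (rep d c (s * t) (\<eta> y))) differentiable (at ?y1)"
      using differentiable_chain_at[OF differentiable_chain_at[OF \<eta>d D] Sd] by (simp add: o_def)
    then show "rep b c t differentiable (at ?y1)" by (rule differentiable_transform_eventually) (use k in blast)
  next
    fix c assume c: "c \<in> C"
    then have cA: "c \<in> A" using C by blast
    let ?Z = "{t \<in> {0<..<1}. T.Fl t v \<in> tdm c \<and> \<not> partial1 (rep d c) t differentiable (at (snd d v))}"
    have "negligible ?Z" using d(3) c unfolding good_def by blast
    then have n: "negligible ((\<lambda>x. (1 / s) *\<^sub>R x) ` ?Z)"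
      by (intro negligible_locally_Lipschitz_image[where f = "\<lambda>x. (1 / s) *\<^sub>R x"])
        (auto intro!: exI[of _ UNIV] exI[of _ "1 / s"] simp: right_diff_distrib[symmetric] diff_divide_distrib[symmetric] abs_mult s less_imp_le)
    show "negligible {t \<in> {0<..<1}. T.Fl t (tscale s v) \<in> tdm c \<and> \<not> partial1 (rep b c) t differentiable (at ?y1)}"
    proof (rule negligible_subset[OF n], rule subsetI)
      fix t assume "t \<in> {t \<in> {0<..<1}. T.Fl t (tscale s v) \<in> tdm c \<and> \<not> partial1 (rep b c) t differentiable (at ?y1)}"
      then have t: "0 < t" "t < 1" and F: "T.Fl t (tscale s v) \<in> tdm c" and nd: "\<not> partial1 (rep b c) t differentiable (at ?y1)" by auto
      have k: "(\<forall>\<^sub>F y in nhds ?y1. partial1 (rep b c) t y = s *\<^sub>R ?S (partial1 (rep d c) (s * t) (\<eta> y)))" "T.Fl (s * t) v \<in> tdm c"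
        using key[OF _ cA F] t by auto
      have "\<not> partial1 (rep d c) (s * t) differentiable (at (snd d v))"
      proof
        assume D: "partial1 (rep d c) (s * t) differentiable (at (snd d v))"
        have "(\<lambda>z. s *\<^sub>R ?S z) differentiable (at z)" for z
          using bounded_linear_imp_has_derivative[OF bounded_linear_const_scaleR[OF bS]] differentiable_def by blast
        from differentiable_chain_at[OF differentiable_chain_at[OF \<eta>d, of "partial1 (rep d c) (s * t)"] this] D \<eta>1
        have "(\<lambda>y. s *\<^sub>R ?S (partial1 (rep d c) (s * t) (\<eta> y))) differentiable (at ?y1)" by (simp add: o_def)
        then have "partial1 (rep b c) t differentiable (at ?y1)" by (rule differentiable_transform_eventually) (rule k(1))
        then show False using nd by blast
      qed
      moreover have "s * t < 1" using s t by (smt (verit) mult_le_cancel_right2)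
      ultimately have "s * t \<in> ?Z" using t s k(2) by simp
      then show "t \<in> (\<lambda>x. (1 / s) *\<^sub>R x) ` ?Z" using s by (intro image_eqI[of _ _ "s * t"]) auto
    qed
  qed
qed

lemma \<Omega>'_star:
  assumes st: "star_shaped N" and v: "v \<in> \<Omega>'" and s: "s \<in> {0..1}"
    and incl: "inclusion_differentiable_at A B (tscale s v)"
  shows "tscale s v \<in> \<Omega>'"
  unfolding \<Omega>'_def
proof (intro CollectI conjI ballI impI IntI)
  show "tscale s v \<in> exp_dom M A H" by (rule exp_dom_scale[OF \<Omega>'D(1)[OF v] s])
  show "tscale s v \<in> N" using st \<Omega>'D(2)[OF v] s unfolding star_shaped_def by blast
  fix b assume b: "b \<in> B" "tscale s v \<in> fst b"
  show "good b (tscale s v)"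
  proof (cases "s = 0")
    case False
    obtain d where d: "d \<in> B" "v \<in> fst d" using \<Omega>'D(2)[OF v] submanifoldD(3) by blast
    show ?thesis
      by (rule good_scaled[OF st _ _ \<Omega>'D(1)[OF v] d \<Omega>'D(3)[OF v d] b incl]) (use s False in auto)
  next
    case True
    have vTM: "v \<in> TM" using \<Omega>'D(1)[OF v] by (simp add: exp_dom_iff)
    let ?w = "tscale s v"
    have w1: "?w \<in> TM" by (rule tscale_TM[OF vTM])
    have w2: "snd ?w = (\<lambda>_. 0)" using True by (simp add: tscale_def)
    note w = w1 w2
    obtain c where c: "c \<in> A" "?w \<in> tdm c" using chart_at[OF w(1)] .
    show ?thesis
    proof (rule good_change_initial[OF T.overlap_open_param[OF param[OF b(1)] c(1)] T.param_chartD(1)[OF param[OF b(1)]]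
          tco_inj[OF c(1)] b(2) c(2) _ good_zero_vector[OF w c]])
      show "transition b (tchart A c) differentiable (at (snd b ?w))"
        using incl b c unfolding inclusion_differentiable_at_def by blast
    qed
  qed
qed

end

section \<open>Regularity of the geodesic flow\<close>

theorem theorem1:
  fixes M :: "'p topology"
    and A :: "('p, 'a::euclidean_space) chart set"
    and H :: "('p, 'a) chart \<Rightarrow> 'a \<Rightarrow> 'a \<Rightarrow> 'a"
    and C :: "('p, 'a) chart set"
  assumes "C21_manifold M A"
    and "lipschitz_spray A H"
    and "C \<subseteq> A" "countable C"
  shows
    "(openin (prod_topology (top_of_set {0..}) (tangent_topology A)) (flow_dom M A H) \<and>
      {0..1} \<times> exp_dom M A H \<subseteq> flow_dom M A H \<and>
      (\<forall>s\<in>{0..1}. \<forall>(t, v)\<in>flow_dom M A H.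
         (s * t, v) \<in> flow_dom M A H \<and> (t, tscale s v) \<in> flow_dom M A H) \<and>
      openin (tangent_topology A) (exp_dom M A H) \<and>
      star_shaped (exp_dom M A H)) \<and>
     (flow_curves_C11 M A H (tangent_bundle A) \<and>
      flow_locally_lipschitz M A H (tangent_bundle A) (tchart A ` A) \<and>
      (\<exists>\<Omega>'. \<Omega>' \<subseteq> exp_dom M A H \<and> star_shaped \<Omega>' \<and>
         chart_null (tchart A ` A) (exp_dom M A H - \<Omega>') \<and>
         flow_differentiable_on M A H (tchart A ` A) \<Omega>' \<and>
         jacobian_locally_lipschitz M A H (tchart A ` A) \<Omega>' \<and>
         mixed_partials_coincide M A H C (tchart A ` A) \<Omega>' \<and>
         mixed_partials_locally_bounded M A H (tchart A ` A) \<Omega>')) \<and>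
     (\<forall>N (B :: (('p, 'a) tvec, 'b::euclidean_space) chart set).
        lipschitz_submanifold A N B \<and> countable B \<longrightarrow>
          (openin (prod_topology (top_of_set {0..}) (subtopology (tangent_topology A) N))
             (flow_dom M A H \<inter> UNIV \<times> N) \<and>
           {0..1} \<times> (exp_dom M A H \<inter> N) \<subseteq> flow_dom M A H \<inter> UNIV \<times> N \<and>
           (\<forall>s\<in>{0..1}. \<forall>(t, v)\<in>flow_dom M A H \<inter> UNIV \<times> N.
              (s * t, v) \<in> flow_dom M A H \<inter> UNIV \<times> N \<and>
              (tscale s v \<in> N \<longrightarrow> (t, tscale s v) \<in> flow_dom M A H \<inter> UNIV \<times> N)) \<and>
           openin (subtopology (tangent_topology A) N) (exp_dom M A H \<inter> N) \<and>
           (\<forall>s\<in>{0..1}. \<forall>v\<in>exp_dom M A H \<inter> N.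
              tscale s v \<in> N \<longrightarrow> tscale s v \<in> exp_dom M A H \<inter> N)) \<and>
          (flow_curves_C11 M A H N \<and>
           flow_locally_lipschitz M A H N B \<and>
           (\<exists>\<Omega>'. \<Omega>' \<subseteq> exp_dom M A H \<inter> N \<and>
              chart_null B (exp_dom M A H \<inter> N - \<Omega>') \<and>
              (star_shaped N \<longrightarrow>
                 (\<forall>v\<in>\<Omega>'. \<forall>s\<in>{0..1}. inclusion_differentiable_at A B (tscale s v) \<longrightarrow>
                    tscale s v \<in> \<Omega>')) \<and>
              flow_differentiable_on M A H B \<Omega>' \<and>
              jacobian_locally_lipschitz M A H B \<Omega>' \<and>
              mixed_partials_coincide M A H C B \<Omega>' \<and>
              mixed_partials_locally_bounded M A H B \<Omega>')))"
proof -
  interpret spray_manifold M A H using assms(1,2) by unfold_locales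
  interpret full: spray_submanifold M A H TM "tchart A ` A" C
    using assms(3,4) tangent_bundle_submanifold by unfold_locales
  have smooth: "full.differentiable_atlas"
    unfolding full.differentiable_atlas_def using ttransition_differentiable by blast
  have dTM: "flow_dom M A H \<inter> UNIV \<times> TM = flow_dom M A H" by (auto simp: flow_dom_iff)
  have eTM: "exp_dom M A H \<inter> TM = exp_dom M A H" by (auto simp: exp_dom_iff)
  have starTM: "star_shaped TM" using tscale_TM by (simp add: star_shaped_def)
  have inclTM: "inclusion_differentiable_at A (tchart A ` A) w" for w
    unfolding inclusion_differentiable_at_def using ttransition_differentiable by blast
  show ?thesis
  proof (intro conjI allI impI)
    show "openin (prod_topology (top_of_set {0..}) TT) (flow_dom M A H)"
      using flow_dom_open[of TM] unfolding subtopology_TM dTM .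
    show "{0..1} \<times> exp_dom M A H \<subseteq> flow_dom M A H" by (rule exp_dom_flow_dom)
    show "\<forall>s\<in>{0..1}. \<forall>(t, v)\<in>flow_dom M A H. (s * t, v) \<in> flow_dom M A H \<and> (t, tscale s v) \<in> flow_dom M A H"
      using flow_dom_scale by blast
    show "openin TT (exp_dom M A H)" by (rule exp_dom_open)
    show "star_shaped (exp_dom M A H)" unfolding star_shaped_def using exp_dom_scale by blast
    show "flow_curves_C11 M A H TM" by (rule flow_curves) simp
    show "flow_locally_lipschitz M A H TM (tchart A ` A)" by (rule full.flow_locally_lipschitz_N)
    show "\<exists>\<Omega>'. \<Omega>' \<subseteq> exp_dom M A H \<and> star_shaped \<Omega>' \<and>
         chart_null (tchart A ` A) (exp_dom M A H - \<Omega>') \<and>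
         flow_differentiable_on M A H (tchart A ` A) \<Omega>' \<and>
         jacobian_locally_lipschitz M A H (tchart A ` A) \<Omega>' \<and>
         mixed_partials_coincide M A H C (tchart A ` A) \<Omega>' \<and>
         mixed_partials_locally_bounded M A H (tchart A ` A) \<Omega>'"
    proof (intro exI[of _ full.\<Omega>'] conjI)
      show "full.\<Omega>' \<subseteq> exp_dom M A H" using full.\<Omega>'D(1) by blast
      show "star_shaped full.\<Omega>'" unfolding star_shaped_def using full.\<Omega>'_star[OF starTM _ _ inclTM] by blast
      show "chart_null (tchart A ` A) (exp_dom M A H - full.\<Omega>')"
        using full.\<Omega>'_conull smooth unfolding eTM by blast
      show "mixed_partials_coincide M A H C (tchart A ` A) full.\<Omega>'" using full.\<Omega>'_mixed smooth by blast
    qed (rule full.\<Omega>'_differentiable full.\<Omega>'_jacobian full.\<Omega>'_bounded)+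
  next
    fix N and B :: "(('p, 'a) tvec, 'b) chart set"
    assume NB: "lipschitz_submanifold A N B \<and> countable B"
    interpret sub: spray_submanifold M A H N B C
      using assms(3,4) NB by unfold_locales blast+
    show "openin (prod_topology (top_of_set {0..}) (subtopology TT N)) (flow_dom M A H \<inter> UNIV \<times> N)"
      by (rule flow_dom_open)
    show "{0..1} \<times> (exp_dom M A H \<inter> N) \<subseteq> flow_dom M A H \<inter> UNIV \<times> N" using exp_dom_flow_dom by blast
    show "\<forall>s\<in>{0..1}. \<forall>(t, v)\<in>flow_dom M A H \<inter> UNIV \<times> N.
        (s * t, v) \<in> flow_dom M A H \<inter> UNIV \<times> N \<and>
        (tscale s v \<in> N \<longrightarrow> (t, tscale s v) \<in> flow_dom M A H \<inter> UNIV \<times> N)"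
      using flow_dom_scale by blast
    show "openin (subtopology TT N) (exp_dom M A H \<inter> N)"
      using openin_subtopology_Int2[OF exp_dom_open, of N] by (simp add: Int_commute)
    show "\<forall>s\<in>{0..1}. \<forall>v\<in>exp_dom M A H \<inter> N. tscale s v \<in> N \<longrightarrow> tscale s v \<in> exp_dom M A H \<inter> N"
      using exp_dom_scale by blast
    show "flow_curves_C11 M A H N" by (rule flow_curves[OF sub.submanifoldD(1)])
    show "flow_locally_lipschitz M A H N B" by (rule sub.flow_locally_lipschitz_N)
    show "\<exists>\<Omega>'. \<Omega>' \<subseteq> exp_dom M A H \<inter> N \<and> chart_null B (exp_dom M A H \<inter> N - \<Omega>') \<and>
        (star_shaped N \<longrightarrow> (\<forall>v\<in>\<Omega>'. \<forall>s\<in>{0..1}. inclusion_differentiable_at A B (tscale s v) \<longrightarrow> tscale s v \<in> \<Omega>')) \<and>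
        flow_differentiable_on M A H B \<Omega>' \<and> jacobian_locally_lipschitz M A H B \<Omega>' \<and>
        mixed_partials_coincide M A H C B \<Omega>' \<and> mixed_partials_locally_bounded M A H B \<Omega>'"
    proof (intro exI[of _ sub.\<Omega>'] conjI impI ballI)
      show "sub.\<Omega>' \<subseteq> exp_dom M A H \<inter> N" using sub.\<Omega>'D(1,2) by blast
      show "chart_null B (exp_dom M A H \<inter> N - sub.\<Omega>')" using sub.\<Omega>'_conull NB by blast
      show "mixed_partials_coincide M A H C B sub.\<Omega>'" using sub.\<Omega>'_mixed NB by blast
    qed (assumption | rule sub.\<Omega>'_star sub.\<Omega>'_differentiable sub.\<Omega>'_jacobian sub.\<Omega>'_bounded)+
  qed
qed

end
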